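(* Consider a BMS channel with capacity $C \in (0,1)$ and let $N=2^m$. For every $\mathrm{RM}(r,m)$ code whose rate satisfies $R(r,m) < C$, the bit-error rate under bit-MAP decoding satisfies $$\mathrm{BER}(X_i \mid \mathbf{Y}) \le \frac{\tfrac12\rho(m)}{C-R(r,m)}\quad\text{for all } i\in[N],$$ where $\rho(m) = (6\ln(m)+34)/(5\sqrt{m})$. In particular, for every $R\in[0,C)$ there exists a sequence of RM codes with increasing blocklength and rate converging to $R$ such that the BER under bit-MAP decoding converges to zero. Conversely, if $R(r,m) > C$ then $$\mathrm{BER}(X_i\mid \mathbf{Y}) \ge \mathrm{BER}(X_i\mid Y_i) - (1-C)\sqrt{\frac{\ln(2)\,\rho(m)}{2\,\psi(1-C)\,\Psi(R(r,m)-C)}}\quad\text{for all } i\in[N],$$ where $\Psi(u)=\int_0^u\psi(v)\,dv$. In particular, for every $R\in(C,1]$ and every sequence of RM codes with increasing blocklength and rate converging to $R$, the BER under bit-MAP decoding converges to the bit-error rate associated with a single use of the channel.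
   Context: A BMS channel has input $\{\pm1\}$, output in $\overline{\mathbb{R}}$, transition density with $w(y\mid+1)=w(-y\mid-1)$, used memorylessly; its capacity is $I(X;Y)$ for uniform input. $\mathrm{RM}(r,m)$ ($0\le r\le m$) is the binary code of length $N=2^m$ whose codewords are the evaluations of all $\mathbb{F}_2$-multilinear polynomials in $m$ variables of degree $\le r$ at all points $\mathbf{v}\in\mathbb{F}_2^m$, ordered by $\tau(\mathbf{v})=\sum_j v_j2^j$; its rate is $R(r,m)=2^{-m}\sum_{i=0}^r\binom mi$. $\mathbf{X}\in\{\pm1\}^N$ is the BPSK image $(-1)^{\mathbf{u}}$ of a uniformly random codeword $\mathbf{u}$, and $\mathbf{Y}$ is its output through $N$ independent uses of the channel. For $X\in\{\pm1\}$ and an observation $Y$, $\mathrm{BER}(X\mid Y)=\Pr(X\neq\phi(Y))$ with $\phi(y)=\arg\max_x\Pr(X=x\mid Y=y)$. $h_b(x)=-x\log_2x-(1-x)\log_2(1-x)$, $h_b^{-1}:[0,1]\to[0,1/2]$ is its inverse on $[0,1/2]$, and $\psi(u)=1-(1-2h_b^{-1}(u))^2$. $[N]=\{0,\dots,N-1\}$. *)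

theory Defs
  imports "HOL-Probability.Probability"
begin

definition bms_channel :: "ereal measure \<Rightarrow> (real \<Rightarrow> ereal \<Rightarrow> real) \<Rightarrow> bool" where
  "bms_channel \<mu> W \<longleftrightarrow>
     sets \<mu> = sets borel \<and> sigma_finite_measure \<mu> \<and> distr \<mu> borel uminus = \<mu> \<and>
     (\<forall>x\<in>{1, -1}. W x \<in> borel_measurable borel \<and> (\<forall>y. 0 \<le> W x y) \<and>
        integrable \<mu> (W x) \<and> (\<integral>y. W x y \<partial>\<mu>) = 1) \<and>
     (\<forall>y. W 1 y = W (-1) (-y))"

text \<open>Capacity = I(X;Y) for uniform input X on {+1,-1} (log base 2, 0 log 0 = 0).\<close>
definition capacity :: "ereal measure \<Rightarrow> (real \<Rightarrow> ereal \<Rightarrow> real) \<Rightarrow> real" where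
  "capacity \<mu> W = (\<Sum>x\<in>{1, -1::real}. (1/2) *
      (\<integral>y. W x y * log 2 (W x y / ((W 1 y + W (-1) y) / 2)) \<partial>\<mu>))"

text \<open>RM(r,m): codeword u is a bit vector indexed by [N] (False outside [N]); index i is the
  point v with v_j = bit j of i (i = tau(v)). A multilinear polynomial of degree <= r is
  given by its set A of monomials (sets S of variables, card S <= r) with coefficient 1.\<close>
definition rm_code :: "nat \<Rightarrow> nat \<Rightarrow> (nat \<Rightarrow> bool) set" where
  "rm_code r m = {u. \<exists>A. A \<subseteq> {S. S \<subseteq> {..<m} \<and> card S \<le> r} \<and>
      (\<forall>i. u i = (i < 2 ^ m \<and> odd (card {S\<in>A. \<forall>j\<in>S. bit i j})))}"

definition rm_rate :: "nat \<Rightarrow> nat \<Rightarrow> real" where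
  "rm_rate r m = (\<Sum>i\<le>r. real (m choose i)) / 2 ^ m"

definition bpsk :: "bool \<Rightarrow> real" where
  "bpsk b = (if b then -1 else 1)"

text \<open>Generic bit-MAP error: p x y is the joint density of (codeword x, observation y)
  w.r.t. M; g x in {+1,-1} is the bit to be estimated. The MAP decision maximises
  Pr(g X = b | Y = y), equivalently the joint density; ties broken towards +1.\<close>
definition map_decision :: "'x set \<Rightarrow> ('x \<Rightarrow> 'y \<Rightarrow> real) \<Rightarrow> ('x \<Rightarrow> real) \<Rightarrow> 'y \<Rightarrow> real" where
  "map_decision S p g y =
     (if (\<Sum>x\<in>{x\<in>S. g x = 1}. p x y) \<ge> (\<Sum>x\<in>{x\<in>S. g x = -1}. p x y) then 1 else -1)"

definition bit_map_ber :: "'y measure \<Rightarrow> 'x set \<Rightarrow> ('x \<Rightarrow> 'y \<Rightarrow> real) \<Rightarrow> ('x \<Rightarrow> real) \<Rightarrow> real" where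
  "bit_map_ber M S p g = (\<integral>y. (\<Sum>x\<in>{x\<in>S. g x \<noteq> map_decision S p g y}. p x y) \<partial>M)"

definition ber_code :: "ereal measure \<Rightarrow> (real \<Rightarrow> ereal \<Rightarrow> real) \<Rightarrow> nat \<Rightarrow> nat \<Rightarrow> nat \<Rightarrow> real" where
  "ber_code \<mu> W r m i = bit_map_ber (PiM {..<2 ^ m} (\<lambda>_. \<mu>)) (rm_code r m)
      (\<lambda>u y. (\<Prod>j<2 ^ m. W (bpsk (u j)) (y j)) / real (card (rm_code r m)))
      (\<lambda>u. bpsk (u i))"

definition ber_code_single :: "ereal measure \<Rightarrow> (real \<Rightarrow> ereal \<Rightarrow> real) \<Rightarrow> nat \<Rightarrow> nat \<Rightarrow> nat \<Rightarrow> real" where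
  "ber_code_single \<mu> W r m i = bit_map_ber \<mu> (rm_code r m)
      (\<lambda>u y. W (bpsk (u i)) y / real (card (rm_code r m)))
      (\<lambda>u. bpsk (u i))"

definition ber_channel :: "ereal measure \<Rightarrow> (real \<Rightarrow> ereal \<Rightarrow> real) \<Rightarrow> real" where
  "ber_channel \<mu> W = bit_map_ber \<mu> {1, -1} (\<lambda>x y. W x y / 2) id"

definition hb :: "real \<Rightarrow> real" where
  "hb x = - x * log 2 x - (1 - x) * log 2 (1 - x)"

definition hb_inv :: "real \<Rightarrow> real" where
  "hb_inv u = (THE x. 0 \<le> x \<and> x \<le> 1/2 \<and> hb x = u)"

definition psi :: "real \<Rightarrow> real" where
  "psi u = 1 - (1 - 2 * hb_inv u) ^ 2"

definition Psi :: "real \<Rightarrow> real" where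
  "Psi u = integral {0..u} psi"

definition rho :: "nat \<Rightarrow> real" where
  "rho m = (6 * ln (real m) + 34) / (5 * sqrt (real m))"

end

theory Submission
  imports Defs
begin

text \<open>
  Let \<open>p\<close> be one minus the extrinsic MMSE of a bit of \<open>RM(r, m)\<close> and \<open>p'\<close> that of \<open>RM(r, m+1)\<close>, over the same channel.
  Inside \<open>RM(r, m+1)\<close> there are two copies of \<open>RM(r, m)\<close> through the bit whose common part is half of each.
  By the symmetry group and an Efron--Stein argument, that common part explains at most half of the variance of
  the extrinsic estimate, so the average of the two estimates gives \<open>p (1 - p) / 4 \<le> p' - p\<close>.

  Interpolate the channel linearly from erasure to the given channel (or from the given channel to the noiseless one).
  The derivative of the entropy per bit is an extrinsic information functional, which is an even power series
  in the extrinsic estimate with coefficients of one sign; hence its gap between \<open>m\<close> and \<open>m+1\<close> dominates a constant times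
  \<open>p' - p\<close>. Nesting bounds the integrated gap by the rate difference \<open>R(r, m) - R(r, m+1) = binom(m, r) / 2\<^bsup>m+1\<^esup>\<close>,
  which is of order \<open>m\<^bsup>-1/2\<^esup>\<close>. So \<open>p (1 - p)\<close> is small on average along the path, and as \<open>p\<close> is monotone along it,
  it jumps from near \<open>0\<close> to near \<open>1\<close>; the entropy balance puts the jump where the capacity equals the rate.
\<close>

section \<open>Bounded measurable functions on product spaces\<close>

text \<open>The quantity \<open>p\<close> is the right yardstick because two moments agree: once the
  all-zero codeword is assumed to be sent, the extrinsic estimate has mean and mean square both
  equal to \<open>p\<close>, hence variance \<open>p * (1 - p)\<close>. The mean square of the
  difference of the two estimates is twice the variance that the common coordinates leave
  unexplained, so it is at least \<open>p * (1 - p)\<close>; the best multiple of their sum then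
  gains \<open>p * (1 - p) / 4\<close>. Passing from the quadratic gain to information keeps only
  the leading coefficient 1 / (2 ln 2) of the power series. This is legitimate because every even
  moment grows with the code, so no term of the difference is negative. No integral over the path is
  formed. In each direction one combination of the normalised divergences of the two codes has
  nonnegative derivative, and its endpoint values are controlled by nesting and by the elementary
  bounds on the divergence. The factors 4 and 2 ln 2 make up 8 ln 2; times a rate difference of at
  most 1 / (2 sqrt m) this stays below 4 / sqrt m, which lies below \<open>rho m\<close>.\<close>

definition bmeas :: "'a measure \<Rightarrow> ('a \<Rightarrow> real) \<Rightarrow> bool" where
  "bmeas M F \<longleftrightarrow> F \<in> borel_measurable M \<and> (\<exists>B. \<forall>x\<in>space M. \<bar>F x\<bar> \<le> B)"

text \<open>Only the measurable space \<open>S\<close> is fixed, so one statement of measurability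
  and boundedness over \<open>S\<close> serves every law placed on it; along an interpolation the
  law changes but the side conditions do not.\<close>

definition law :: "'a measure \<Rightarrow> 'a measure \<Rightarrow> bool" where
  "law S M \<longleftrightarrow> prob_space M \<and> sets M = sets S"

lemma bmeasI: "F \<in> borel_measurable M \<Longrightarrow> (\<And>x. x \<in> space M \<Longrightarrow> \<bar>F x\<bar> \<le> B) \<Longrightarrow> bmeas M F"
  unfolding bmeas_def by blast

lemma bmeas_measurable: "bmeas M F \<Longrightarrow> F \<in> borel_measurable M"
  unfolding bmeas_def by blast

lemma bmeas_bound:
  assumes "bmeas M F" obtains B where "0 \<le> B" "\<And>x. x \<in> space M \<Longrightarrow> \<bar>F x\<bar> \<le> B"
proof -
  obtain B where B: "\<forall>x\<in>space M. \<bar>F x\<bar> \<le> B" using assms unfolding bmeas_def by blast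
  have "\<And>x. x \<in> space M \<Longrightarrow> \<bar>F x\<bar> \<le> max B 0" using B by fastforce
  then show ?thesis using that[of "max B 0"] by simp
qed

lemma bmeas_const: "bmeas M (\<lambda>x. c)"
  by (rule bmeasI[where B="\<bar>c\<bar>"]) auto

lemma bmeas_add:
  assumes "bmeas M F" "bmeas M G" shows "bmeas M (\<lambda>x. F x + G x)"
proof -
  obtain A where A: "\<And>x. x \<in> space M \<Longrightarrow> \<bar>F x\<bar> \<le> A" using bmeas_bound[OF assms(1)] by blast
  obtain B where B: "\<And>x. x \<in> space M \<Longrightarrow> \<bar>G x\<bar> \<le> B" using bmeas_bound[OF assms(2)] by blast
  show ?thesis
    using assms[THEN bmeas_measurable] A B
    by (intro bmeasI[where B="A+B"] borel_measurable_add) (auto intro: order_trans[OF abs_triangle_ineq add_mono])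
qed

lemma bmeas_mult:
  assumes "bmeas M F" "bmeas M G" shows "bmeas M (\<lambda>x. F x * G x)"
proof -
  obtain A where A: "0 \<le> A" "\<And>x. x \<in> space M \<Longrightarrow> \<bar>F x\<bar> \<le> A" using bmeas_bound[OF assms(1)] by blast
  obtain B where B: "0 \<le> B" "\<And>x. x \<in> space M \<Longrightarrow> \<bar>G x\<bar> \<le> B" using bmeas_bound[OF assms(2)] by blast
  show ?thesis
    using assms[THEN bmeas_measurable] A B
    by (intro bmeasI[where B="A*B"] borel_measurable_times) (auto simp: abs_mult intro: mult_mono)
qed

lemma bmeas_uminus: "bmeas M F \<Longrightarrow> bmeas M (\<lambda>x. - F x)"
  using bmeas_mult[OF bmeas_const[of M "-1"], of F] by simp

lemma bmeas_diff: "bmeas M F \<Longrightarrow> bmeas M G \<Longrightarrow> bmeas M (\<lambda>x. F x - G x)"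
  using bmeas_add[OF _ bmeas_uminus, of M F G] by simp

lemma bmeas_cmult: "bmeas M F \<Longrightarrow> bmeas M (\<lambda>x. c * F x)"
  using bmeas_mult[OF bmeas_const[of M c], of F] by simp

lemma bmeas_abs: "bmeas M F \<Longrightarrow> bmeas M (\<lambda>x. \<bar>F x\<bar>)"
  unfolding bmeas_def by auto

lemma bmeas_power: "bmeas M F \<Longrightarrow> bmeas M (\<lambda>x. F x ^ n)"
  by (induction n) (auto intro: bmeas_const bmeas_mult)

lemma bmeas_sum: "(\<And>i. i \<in> A \<Longrightarrow> bmeas M (F i)) \<Longrightarrow> bmeas M (\<lambda>x. \<Sum>i\<in>A. F i x)"
  by (induction A rule: infinite_finite_induct) (auto intro: bmeas_const bmeas_add)

lemma bmeas_prod: "(\<And>i. i \<in> A \<Longrightarrow> bmeas M (F i)) \<Longrightarrow> bmeas M (\<lambda>x. \<Prod>i\<in>A. F i x)"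
  by (induction A rule: infinite_finite_induct) (auto intro: bmeas_const bmeas_mult)

lemma bmeas_compose:
  assumes "g \<in> measurable M N" "bmeas N F" shows "bmeas M (\<lambda>x. F (g x))"
proof -
  obtain B where "\<And>x. x \<in> space N \<Longrightarrow> \<bar>F x\<bar> \<le> B" using bmeas_bound[OF assms(2)] by blast
  then show ?thesis
    using measurable_compose[OF assms(1) bmeas_measurable[OF assms(2)]] measurable_space[OF assms(1)]
    by (intro bmeasI[where B=B]) auto
qed

lemma bmeas_cong_sets: "sets M = sets N \<Longrightarrow> bmeas M F \<longleftrightarrow> bmeas N F"
  unfolding bmeas_def using measurable_cong_sets[of M N "borel :: real measure" borel] sets_eq_imp_space_eq[of M N] by simp

lemma bmeas_cong: "(\<And>x. x \<in> space M \<Longrightarrow> F x = G x) \<Longrightarrow> bmeas M F \<longleftrightarrow> bmeas M G"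
  unfolding bmeas_def using measurable_cong[of M F G borel] by auto

lemmas bmeas_intros = bmeas_const bmeas_add bmeas_mult bmeas_uminus bmeas_diff bmeas_abs bmeas_power bmeas_sum bmeas_prod

section \<open>Integration against laws on a fixed measurable space\<close>

lemma law_prob: "law S M \<Longrightarrow> prob_space M"
  and law_sets: "law S M \<Longrightarrow> sets M = sets S"
  and law_space: "law S M \<Longrightarrow> space M = space S"
  unfolding law_def by (auto dest: sets_eq_imp_space_eq)

lemma law_measure: "law S M \<Longrightarrow> measure M (space M) = 1"
  using prob_space.prob_space[OF law_prob] .

lemma law_PiM: "law S M \<Longrightarrow> law (PiM J (\<lambda>_. S)) (PiM J (\<lambda>_. M))"
  unfolding law_def by (auto intro!: prob_space_PiM sets_PiM_cong)

lemma law_bmeas: "law S M \<Longrightarrow> bmeas S F \<Longrightarrow> bmeas M F"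
  using bmeas_cong_sets law_sets by blast

lemma law_integrable:
  assumes "law S M" "bmeas S F" shows "integrable M F"
proof -
  interpret prob_space M using assms(1) by (rule law_prob)
  obtain B where "\<And>x. x \<in> space M \<Longrightarrow> \<bar>F x\<bar> \<le> B"
    using bmeas_bound[OF law_bmeas[OF assms]] by blast
  then show ?thesis
    using bmeas_measurable[OF law_bmeas[OF assms]]
    by (intro integrable_const_bound[of _ B]) auto
qed

lemma law_integral_abs_le:
  assumes "law S M" "bmeas S F" "\<And>x. x \<in> space S \<Longrightarrow> \<bar>F x\<bar> \<le> B"
  shows "\<bar>\<integral>x. F x \<partial>M\<bar> \<le> B"
proof -
  interpret prob_space M using assms(1) by (rule law_prob)
  have "\<bar>\<integral>x. F x \<partial>M\<bar> \<le> (\<integral>x. \<bar>F x\<bar> \<partial>M)" by (rule integral_abs_bound)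
  also have "\<dots> \<le> (\<integral>x. B \<partial>M)"
    using assms law_space[OF assms(1)]
    by (intro integral_mono law_integrable[OF assms(1)] bmeas_intros) auto
  finally show ?thesis by (simp add: prob_space)
qed

lemma law_integral_mono:
  assumes "law S M" "bmeas S F" "bmeas S G" "\<And>x. x \<in> space S \<Longrightarrow> F x \<le> G x"
  shows "(\<integral>x. F x \<partial>M) \<le> (\<integral>x. G x \<partial>M)"
  using assms law_space[OF assms(1)] by (intro integral_mono law_integrable[OF assms(1)]) auto

lemma law_integral_cong:
  assumes "law S M" "\<And>x. x \<in> space S \<Longrightarrow> F x = G x"
  shows "(\<integral>x. F x \<partial>M) = (\<integral>x. G x \<partial>M)"
  using assms law_space[OF assms(1)] by (intro Bochner_Integration.integral_cong) auto

lemma law_integral_add: "law S M \<Longrightarrow> bmeas S F \<Longrightarrow> bmeas S G \<Longrightarrow>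
    (\<integral>x. F x + G x \<partial>M) = (\<integral>x. F x \<partial>M) + (\<integral>x. G x \<partial>M)"
  by (intro Bochner_Integration.integral_add law_integrable)

lemma law_integral_diff: "law S M \<Longrightarrow> bmeas S F \<Longrightarrow> bmeas S G \<Longrightarrow>
    (\<integral>x. F x - G x \<partial>M) = (\<integral>x. F x \<partial>M) - (\<integral>x. G x \<partial>M)"
  by (intro Bochner_Integration.integral_diff law_integrable)

lemma law_integral_nonneg:
  fixes F :: "_ \<Rightarrow> real"
  assumes "law S M" "\<And>x. x \<in> space S \<Longrightarrow> 0 \<le> F x" shows "0 \<le> (\<integral>x. F x \<partial>M)"
  using assms law_space[OF assms(1)] by (intro Bochner_Integration.integral_nonneg) auto

text \<open>Nonnegativity of the variance.\<close>

lemma law_square_mean_le: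
  assumes M: "law S M" and F: "bmeas S F"
  shows "(\<integral>x. F x \<partial>M)^2 \<le> (\<integral>x. F x ^ 2 \<partial>M)"
proof -
  let ?c = "\<integral>x. F x \<partial>M"
  have "0 \<le> (\<integral>x. (F x - ?c)^2 \<partial>M)" by (rule law_integral_nonneg[OF M]) simp
  also have "\<dots> = (\<integral>x. (F x ^ 2 - 2 * ?c * F x) + ?c^2 \<partial>M)"
    by (rule law_integral_cong[OF M]) (simp add: power2_eq_square algebra_simps)
  also have "\<dots> = (\<integral>x. F x ^ 2 - 2 * ?c * F x \<partial>M) + ?c^2"
    by (subst law_integral_add[OF M]) (auto intro!: bmeas_intros F simp: law_measure[OF M])
  also have "\<dots> = (\<integral>x. F x ^ 2 \<partial>M) - 2 * ?c * ?c + ?c^2"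
    by (subst law_integral_diff[OF M]) (auto intro!: bmeas_intros F simp: law_measure[OF M])
  finally show ?thesis by (simp add: power2_eq_square)
qed

section \<open>Coordinatewise integration over product spaces\<close>

lemma measurable_upd2:
  "(\<lambda>(l, x). l(k := x)) \<in> measurable (PiM J (\<lambda>_. S) \<Otimes>\<^sub>M S) (PiM (insert k J) (\<lambda>_. S))"
  using measurable_add_dim[of k J "\<lambda>_. S"] by simp

lemma measurable_upd:
  assumes "x \<in> space S"
  shows "(\<lambda>l. l(k := x)) \<in> measurable (PiM J (\<lambda>_. S)) (PiM (insert k J) (\<lambda>_. S))"
proof -
  have "(\<lambda>l. (l, x)) \<in> measurable (PiM J (\<lambda>_. S)) (PiM J (\<lambda>_. S) \<Otimes>\<^sub>M S)"
    using assms by simp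
  from measurable_compose[OF this measurable_upd2] show ?thesis by simp
qed

lemma measurable_upd1:
  assumes "l \<in> space (PiM J (\<lambda>_. S))"
  shows "(\<lambda>x. l(k := x)) \<in> measurable S (PiM (insert k J) (\<lambda>_. S))"
proof -
  have "(\<lambda>x. (l, x)) \<in> measurable S (PiM J (\<lambda>_. S) \<Otimes>\<^sub>M S)"
    using assms by simp
  from measurable_compose[OF this measurable_upd2] show ?thesis by simp
qed

lemma bmeas_slice:
  assumes "bmeas (PiM (insert k J) (\<lambda>_. S)) F" "l \<in> space (PiM J (\<lambda>_. S))"
  shows "bmeas S (\<lambda>x. F (l(k := x)))"
  using bmeas_compose[OF measurable_upd1[OF assms(2)] assms(1)] .

lemma bmeas_upd:
  assumes "bmeas (PiM (insert k J) (\<lambda>_. S)) F" "x \<in> space S"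
  shows "bmeas (PiM J (\<lambda>_. S)) (\<lambda>l. F (l(k := x)))"
  using bmeas_compose[OF measurable_upd[OF assms(2)] assms(1)] .

lemma bmeas_partial_integral2:
  assumes M: "law S M" and F: "bmeas (N \<Otimes>\<^sub>M S) F"
  shows "bmeas N (\<lambda>l. \<integral>x. F (l, x) \<partial>M)"
proof -
  interpret prob_space M using M by (rule law_prob)
  have "bmeas (N \<Otimes>\<^sub>M M) F"
    using F bmeas_cong_sets[OF sets_pair_measure_cong[OF refl law_sets[OF M]]] by blast
  then have m: "(\<lambda>l. \<integral>x. F (l, x) \<partial>M) \<in> borel_measurable N"
    by (intro borel_measurable_lebesgue_integral) (simp add: bmeas_def case_prod_beta')
  obtain B where B: "\<And>z. z \<in> space (N \<Otimes>\<^sub>M S) \<Longrightarrow> \<bar>F z\<bar> \<le> B"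
    using bmeas_bound[OF F] by blast
  show ?thesis
  proof (rule bmeasI[OF m])
    fix l assume l: "l \<in> space N"
    have "bmeas S (\<lambda>x. F (l, x))"
      using l by (intro bmeas_compose[OF _ F]) simp
    then show "\<bar>\<integral>x. F (l, x) \<partial>M\<bar> \<le> B"
      using B l by (intro law_integral_abs_le[OF M]) (auto simp: space_pair_measure)
  qed
qed

lemma bmeas_partial_integral:
  assumes M: "law S M" and F: "bmeas (PiM (insert k J) (\<lambda>_. S)) F"
  shows "bmeas (PiM J (\<lambda>_. S)) (\<lambda>l. \<integral>x. F (l(k := x)) \<partial>M)"
  using bmeas_partial_integral2[OF M bmeas_compose[OF measurable_upd2 F]] by simp

lemma integral_PiM_insert:
  assumes M: "law S M" and J: "finite J" "k \<notin> J" and F: "bmeas (PiM (insert k J) (\<lambda>_. S)) F"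
  shows "(\<integral>l. F l \<partial>PiM (insert k J) (\<lambda>_. M)) = (\<integral>l. (\<integral>x. F (l(k := x)) \<partial>M) \<partial>PiM J (\<lambda>_. M))"
proof -
  interpret product_sigma_finite "\<lambda>_. M"
    using M by (simp add: product_sigma_finite_def law_prob prob_space_imp_sigma_finite)
  show ?thesis
    by (rule product_integral_insert[OF J law_integrable[OF law_PiM[OF M] F]])
qed

text \<open>Once coordinate \<open>k\<close> is split off, the inner integral does not depend on the
  value it overwrites, so an independent redraw of one coordinate leaves the product law
  unchanged.\<close>

lemma integral_resample:
  assumes M: "law S M" and J: "finite J" "k \<in> J" and F: "bmeas (PiM J (\<lambda>_. S)) F"
  shows "(\<integral>l. F l \<partial>PiM J (\<lambda>_. M)) = (\<integral>l. (\<integral>x. F (l(k := x)) \<partial>M) \<partial>PiM J (\<lambda>_. M))"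
proof -
  have ins: "insert k (J - {k}) = J" "insert k J = J" using J by auto
  note I = integral_PiM_insert[OF M, of "J - {k}" k, unfolded ins]
  have "(\<integral>l. F l \<partial>PiM J (\<lambda>_. M)) = (\<integral>l. (\<integral>x. F (l(k := x)) \<partial>M) \<partial>PiM (J - {k}) (\<lambda>_. M))"
    using J F by (intro I) auto
  also have "\<dots> = (\<integral>l. (\<integral>y. (\<integral>x. F (l(k := y, k := x)) \<partial>M) \<partial>M) \<partial>PiM (J - {k}) (\<lambda>_. M))"
    by (simp add: law_measure[OF M])
  also have "\<dots> = (\<integral>l. (\<integral>x. F (l(k := x)) \<partial>M) \<partial>PiM J (\<lambda>_. M))"
    using J F bmeas_partial_integral[OF M, of k J F, unfolded ins] by (intro I[symmetric]) auto
  finally show ?thesis .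
qed

text \<open>Fubini for two distinct coordinates with possibly different laws, in the form needed
  when one coordinate is varied and another is averaged under an endpoint law.\<close>

lemma integral_resample_swap:
  assumes M: "law S M" "law S M'" and F: "bmeas (PiM (insert i (insert k J)) (\<lambda>_. S)) F"
    and l: "l \<in> space (PiM J (\<lambda>_. S))" and ik: "i \<noteq> k"
  shows "(\<integral>x. (\<integral>y. F (l(k := x, i := y)) \<partial>M) \<partial>M') = (\<integral>y. (\<integral>x. F (l(i := y, k := x)) \<partial>M') \<partial>M)"
proof -
  interpret A: prob_space M using M(1) by (rule law_prob)
  interpret B: prob_space M' using M(2) by (rule law_prob)
  interpret pair_sigma_finite M' M by unfold_locales
  have "(\<lambda>z. l(k := fst z)) \<in> measurable (S \<Otimes>\<^sub>M S) (PiM (insert k J) (\<lambda>_. S))"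
    using measurable_compose[OF measurable_fst measurable_upd1[OF l]] .
  then have "(\<lambda>z. (l(k := fst z), snd z)) \<in> measurable (S \<Otimes>\<^sub>M S) (PiM (insert k J) (\<lambda>_. S) \<Otimes>\<^sub>M S)"
    by measurable
  from measurable_compose[OF this measurable_upd2]
  have "bmeas (S \<Otimes>\<^sub>M S) (\<lambda>z. F (l(k := fst z, i := snd z)))"
    by (intro bmeas_compose[OF _ F]) simp
  moreover have pl: "law (S \<Otimes>\<^sub>M S) (M' \<Otimes>\<^sub>M M)"
    using M unfolding law_def by (auto intro!: prob_space_pair sets_pair_measure_cong)
  ultimately have "integrable (M' \<Otimes>\<^sub>M M) (\<lambda>(x, y). F (l(k := x, i := y)))"
    using law_integrable[OF pl] by (simp add: case_prod_beta')
  from Fubini_integral[OF this] show ?thesis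
    using ik by (simp add: fun_upd_twist)
qed

lemma law_pair: "law S M \<Longrightarrow> law T N \<Longrightarrow> law (S \<Otimes>\<^sub>M T) (M \<Otimes>\<^sub>M N)"
  unfolding law_def by (auto intro!: prob_space_pair sets_pair_measure_cong)

lemma integral_pair:
  assumes M: "law S M" "law T N" and F: "bmeas (S \<Otimes>\<^sub>M T) F"
  shows "(\<integral>z. F z \<partial>(M \<Otimes>\<^sub>M N)) = (\<integral>x. (\<integral>y. F (x, y) \<partial>N) \<partial>M)"
proof -
  interpret A: prob_space M using M(1) by (rule law_prob)
  interpret B: prob_space N using M(2) by (rule law_prob)
  interpret pair_sigma_finite M N by unfold_locales
  show ?thesis
    using integral_fst'[OF law_integrable[OF law_pair[OF M] F]] by simp
qed

text \<open>Product measures are only ever transported through this lemma: coordinate \<open>j\<close> of the target is the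
  image under \<open>g j\<close> of the source measure reweighted by \<open>s\<close>.\<close>

lemma integral_PiM_transfer:
  fixes s :: "'a \<Rightarrow> real" and g :: "'i \<Rightarrow> 'a \<Rightarrow> 'b"
  assumes \<mu>: "sigma_finite_measure \<mu>" and s: "integrable \<mu> s" "\<And>x. 0 \<le> s x"
    and g: "\<And>j. j \<in> J \<Longrightarrow> g j \<in> measurable \<mu> S" and M: "law S M"
    and tr: "\<And>j f. j \<in> J \<Longrightarrow> bmeas S f \<Longrightarrow> (\<integral>x. f x \<partial>M) = (\<integral>x. s x * f (g j x) \<partial>\<mu>)"
    and J: "finite J" and F: "bmeas (PiM J (\<lambda>_. S)) F"
  shows "(\<integral>l. F l \<partial>PiM J (\<lambda>_. M)) = (\<integral>y. (\<Prod>j\<in>J. s (y j)) * F (\<lambda>j\<in>J. g j (y j)) \<partial>PiM J (\<lambda>_. \<mu>))"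
  using J g tr F
proof (induction J arbitrary: F rule: finite_induct)
  case empty
  show ?case by (simp add: PiM_empty lebesgue_integral_count_space_finite)
next
  case (insert i J)
  interpret B: product_sigma_finite "\<lambda>_. \<mu>"
    using \<mu> by (simp add: product_sigma_finite_def)
  let ?F' = "\<lambda>l. \<integral>x. F (l(i := x)) \<partial>M"
  let ?I = "insert i J"
  have gm: "(\<lambda>y. \<lambda>j\<in>K. g j (y j)) \<in> measurable (PiM K (\<lambda>_. \<mu>)) (PiM K (\<lambda>_. S))" if "K \<subseteq> ?I" for K
    using that insert.prems(1) by (intro measurable_restrict measurable_compose[OF measurable_component_singleton]) auto
  obtain B where B: "0 \<le> B" "\<And>l. l \<in> space (PiM ?I (\<lambda>_. S)) \<Longrightarrow> \<bar>F l\<bar> \<le> B"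
    using bmeas_bound[OF insert.prems(3)] by blast
  have ips: "integrable (PiM ?I (\<lambda>_. \<mu>)) (\<lambda>y. \<Prod>j\<in>?I. s (y j))"
    using insert.hyps s by (intro B.product_integrable_prod) auto
  \<comment> \<open>The base measure is only sigma-finite, so boundedness of \<open>F\<close> is not
    enough; the product of the integrable weights is the dominating function.\<close>
  have int: "integrable (PiM ?I (\<lambda>_. \<mu>)) (\<lambda>y. (\<Prod>j\<in>?I. s (y j)) * F (\<lambda>j\<in>?I. g j (y j)))"
  proof (rule Bochner_Integration.integrable_bound[OF integrable_mult_right[OF ips, of B]])
    show "(\<lambda>y. (\<Prod>j\<in>?I. s (y j)) * F (\<lambda>j\<in>?I. g j (y j))) \<in> borel_measurable (PiM ?I (\<lambda>_. \<mu>))"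
      by (rule borel_measurable_times[OF borel_measurable_integrable[OF ips]
            bmeas_measurable[OF bmeas_compose[OF gm[OF subset_refl] insert.prems(3)]]])
    show "AE y in PiM ?I (\<lambda>_. \<mu>). norm ((\<Prod>j\<in>?I. s (y j)) * F (\<lambda>j\<in>?I. g j (y j)))
        \<le> norm (B * (\<Prod>j\<in>?I. s (y j)))"
    proof (rule AE_I2)
      fix y assume "y \<in> space (PiM ?I (\<lambda>_. \<mu>))"
      then have "\<bar>F (\<lambda>j\<in>?I. g j (y j))\<bar> \<le> B"
        by (intro B(2) measurable_space[OF gm[OF subset_refl]])
      then have "\<bar>\<Prod>j\<in>?I. s (y j)\<bar> * \<bar>F (\<lambda>j\<in>?I. g j (y j))\<bar> \<le> \<bar>\<Prod>j\<in>?I. s (y j)\<bar> * \<bar>B\<bar>"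
        using B(1) by (intro mult_left_mono) auto
      then show "norm ((\<Prod>j\<in>?I. s (y j)) * F (\<lambda>j\<in>?I. g j (y j))) \<le> norm (B * (\<Prod>j\<in>?I. s (y j)))"
        by (simp only: real_norm_def abs_mult mult.commute[of B] mult.commute[of "\<bar>B\<bar>"])
    qed
  qed
  have bF': "bmeas (PiM J (\<lambda>_. S)) ?F'"
    using insert.prems(3) by (rule bmeas_partial_integral[OF M])
  have "(\<integral>l. F l \<partial>PiM ?I (\<lambda>_. M)) = (\<integral>l. ?F' l \<partial>PiM J (\<lambda>_. M))"
    using insert by (intro integral_PiM_insert[OF M]) auto
  also have "\<dots> = (\<integral>y. (\<Prod>j\<in>J. s (y j)) * ?F' (\<lambda>j\<in>J. g j (y j)) \<partial>PiM J (\<lambda>_. \<mu>))"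
    by (rule insert.IH[OF _ _ bF']) (use insert.prems in auto)
  also have "\<dots> = (\<integral>y. (\<integral>x. (\<Prod>j\<in>?I. s ((y(i := x)) j)) * F (\<lambda>j\<in>?I. g j ((y(i := x)) j)) \<partial>\<mu>) \<partial>PiM J (\<lambda>_. \<mu>))"
  proof (intro Bochner_Integration.integral_cong refl)
    fix y assume y: "y \<in> space (PiM J (\<lambda>_. \<mu>))"
    then have sp: "(\<lambda>j\<in>J. g j (y j)) \<in> space (PiM J (\<lambda>_. S))"
      by (intro measurable_space[OF gm]) auto
    have F'eq: "?F' (\<lambda>j\<in>J. g j (y j)) = (\<integral>x. s x * F ((\<lambda>j\<in>J. g j (y j))(i := g i x)) \<partial>\<mu>)"
      using insert.prems(2)[of i "\<lambda>x. F ((\<lambda>j\<in>J. g j (y j))(i := x))"] bmeas_slice[OF insert.prems(3) sp] by simp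
    have "(\<lambda>j\<in>J. g j (y j))(i := g i x) = (\<lambda>j\<in>?I. g j ((y(i := x)) j))" for x
      by (auto simp: fun_eq_iff)
    moreover have "(\<Prod>j\<in>?I. s ((y(i := x)) j)) = s x * (\<Prod>j\<in>J. s (y j))" for x
    proof -
      have "(\<Prod>j\<in>J. s ((y(i := x)) j)) = (\<Prod>j\<in>J. s (y j))"
        using insert.hyps by (intro prod.cong) auto
      then show ?thesis using insert.hyps by simp
    qed
    ultimately have "(\<integral>x. (\<Prod>j\<in>?I. s ((y(i := x)) j)) * F (\<lambda>j\<in>?I. g j ((y(i := x)) j)) \<partial>\<mu>) =
        (\<integral>x. (\<Prod>j\<in>J. s (y j)) * (s x * F ((\<lambda>j\<in>J. g j (y j))(i := g i x))) \<partial>\<mu>)"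
      by (simp only: mult_ac)
    also have "\<dots> = (\<Prod>j\<in>J. s (y j)) * (\<integral>x. s x * F ((\<lambda>j\<in>J. g j (y j))(i := g i x)) \<partial>\<mu>)"
      by (rule integral_mult_right_zero)
    finally show "(\<Prod>j\<in>J. s (y j)) * ?F' (\<lambda>j\<in>J. g j (y j)) =
        (\<integral>x. (\<Prod>j\<in>?I. s ((y(i := x)) j)) * F (\<lambda>j\<in>?I. g j ((y(i := x)) j)) \<partial>\<mu>)"
      using F'eq by simp
  qed
  also have "\<dots> = (\<integral>y. (\<Prod>j\<in>?I. s (y j)) * F (\<lambda>j\<in>?I. g j (y j)) \<partial>PiM ?I (\<lambda>_. \<mu>))"
    using B.product_integral_insert[OF insert.hyps int] by simp
  finally show ?case .
qed

lemma integral_PiM_reindex: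
  assumes M: "law S M" and inj: "inj_on \<sigma> J" "\<sigma> \<in> J \<rightarrow> K"
    and F: "bmeas (PiM J (\<lambda>_. S)) F"
  shows "(\<integral>l. F (\<lambda>j\<in>J. l (\<sigma> j)) \<partial>PiM K (\<lambda>_. M)) = (\<integral>l. F l \<partial>PiM J (\<lambda>_. M))"
proof -
  have d: "distr (PiM K (\<lambda>_. M)) (PiM J (\<lambda>_. M)) (\<lambda>\<omega>. \<lambda>n\<in>J. \<omega> (\<sigma> n)) = PiM J (\<lambda>_. M)"
    using distr_PiM_reindex[of K "\<lambda>_. M" \<sigma> J] inj law_prob[OF M] by simp
  have "(\<lambda>\<omega>. \<lambda>n\<in>J. \<omega> (\<sigma> n)) \<in> measurable (PiM K (\<lambda>_. M)) (PiM J (\<lambda>_. M))"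
    using inj by (intro measurable_restrict measurable_component_singleton) auto
  then have "(\<integral>l. F l \<partial>distr (PiM K (\<lambda>_. M)) (PiM J (\<lambda>_. M)) (\<lambda>\<omega>. \<lambda>n\<in>J. \<omega> (\<sigma> n))) = (\<integral>l. F (\<lambda>j\<in>J. l (\<sigma> j)) \<partial>PiM K (\<lambda>_. M))"
    using bmeas_measurable[OF law_bmeas[OF law_PiM[OF M] F]] by (intro integral_distr)
  then show ?thesis unfolding d by simp
qed

text \<open>The product rule for product laws, a Russo-type formula: differentiating the factor of
  one coordinate replaces its law by the signed difference of the two endpoint laws. The inner
  integrals overwrite coordinate \<open>i\<close>, so the outer integral may still run over all of
  \<open>J\<close>.\<close>

lemma integral_mixture_derivative:
  assumes M0: "law S M0" and M1: "law S M1"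
    and Mt: "\<And>t. t \<in> {0..1} \<Longrightarrow> law S (Mt t)"
    and mix: "\<And>t f. t \<in> {0..1} \<Longrightarrow> bmeas S f \<Longrightarrow>
        (\<integral>x. f x \<partial>Mt t) = (1 - t) * (\<integral>x. f x \<partial>M0) + t * (\<integral>x. f x \<partial>M1)"
    and J: "finite J" and F: "bmeas (PiM J (\<lambda>_. S)) F" and t: "t \<in> {0..1}"
  shows "((\<lambda>t. \<integral>l. F l \<partial>PiM J (\<lambda>_. Mt t)) has_real_derivative
      (\<Sum>i\<in>J. \<integral>l. (\<integral>x. F (l(i := x)) \<partial>M1) - (\<integral>x. F (l(i := x)) \<partial>M0) \<partial>PiM J (\<lambda>_. Mt t))) (at t within {0..1})"
  using J F
proof (induction J arbitrary: F rule: finite_induct)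
  case empty
  have "(\<integral>l. F l \<partial>PiM {} (\<lambda>_. Mt t)) = F (\<lambda>_. undefined)" for t
    by (simp add: PiM_empty lebesgue_integral_count_space_finite)
  then show ?case by simp
next
  case (insert i J)
  let ?I = "insert i J"
  note F = insert.prems
  let ?G0 = "\<lambda>l. \<integral>x. F (l(i := x)) \<partial>M0" and ?G1 = "\<lambda>l. \<integral>x. F (l(i := x)) \<partial>M1"
  let ?\<Phi> = "\<lambda>G t. \<integral>l. G l \<partial>PiM J (\<lambda>_. Mt t)"
  let ?d = "\<lambda>G k l. (\<integral>x. G (l(k := x)) \<partial>M1) - (\<integral>x. G (l(k := x)) \<partial>M0)"
  have bG: "bmeas (PiM J (\<lambda>_. S)) ?G0" "bmeas (PiM J (\<lambda>_. S)) ?G1"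
    by (rule bmeas_partial_integral[OF M0 F], rule bmeas_partial_integral[OF M1 F])
  \<comment> \<open>Makes explicit how the integral depends on \<open>t\<close> through coordinate
    \<open>i\<close>; the dependence through the other coordinates is left to the induction
    hypothesis.\<close>
  have split: "(\<integral>l. G l \<partial>PiM ?I (\<lambda>_. Mt t)) =
      (1 - t) * ?\<Phi> (\<lambda>l. \<integral>x. G (l(i := x)) \<partial>M0) t + t * ?\<Phi> (\<lambda>l. \<integral>x. G (l(i := x)) \<partial>M1) t"
    if t: "t \<in> {0..1}" and G: "bmeas (PiM ?I (\<lambda>_. S)) G" for t G
  proof -
    note L = law_PiM[OF Mt[OF t], of J]
    have "(\<integral>l. G l \<partial>PiM ?I (\<lambda>_. Mt t)) = ?\<Phi> (\<lambda>l. \<integral>x. G (l(i := x)) \<partial>Mt t) t"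
      using G insert.hyps by (intro integral_PiM_insert[OF Mt[OF t]]) auto
    also have "\<dots> = ?\<Phi> (\<lambda>l. (1 - t) * (\<integral>x. G (l(i := x)) \<partial>M0) + t * (\<integral>x. G (l(i := x)) \<partial>M1)) t"
      using mix[OF t bmeas_slice[OF G]] by (intro law_integral_cong[OF L]) auto
    also have "\<dots> = (1 - t) * ?\<Phi> (\<lambda>l. \<integral>x. G (l(i := x)) \<partial>M0) t + t * ?\<Phi> (\<lambda>l. \<integral>x. G (l(i := x)) \<partial>M1) t"
      using bmeas_partial_integral[OF _ G] M0 M1
      by (subst law_integral_add[OF L]) (auto intro!: bmeas_cmult)
    finally show ?thesis .
  qed
  note L = law_PiM[OF Mt[OF t], of J] and LI = law_PiM[OF Mt[OF t], of ?I]
  have ins: "insert k ?I = ?I" if "k \<in> ?I" for k using that by auto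
  have bd: "bmeas (PiM ?I (\<lambda>_. S)) (?d F k)" if "k \<in> ?I" for k
    using bmeas_partial_integral[OF M0, of k ?I F] bmeas_partial_integral[OF M1, of k ?I F] F ins[OF that]
    by (auto intro: bmeas_diff)
  have ti: "(\<integral>l. ?d F i l \<partial>PiM ?I (\<lambda>_. Mt t)) = ?\<Phi> ?G1 t - ?\<Phi> ?G0 t"
  proof -
    have "(\<integral>l. ?d F i l \<partial>PiM ?I (\<lambda>_. Mt t)) = ?\<Phi> (\<lambda>l. ?G1 l - ?G0 l) t"
      using insert.hyps bd[of i] integral_PiM_insert[OF Mt[OF t], of J i "?d F i"]
      by (simp add: law_measure[OF Mt[OF t]])
    then show ?thesis using bG by (simp add: law_integral_diff[OF L])
  qed
  \<comment> \<open>The difference at \<open>k\<close> commutes with averaging over \<open>i\<close>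
    by Fubini, so the terms of the induction hypothesis for the two endpoint averages recombine into
    one average over the enlarged index set.\<close>
  have tk: "(\<integral>l. ?d F k l \<partial>PiM ?I (\<lambda>_. Mt t)) = (1 - t) * ?\<Phi> (?d ?G0 k) t + t * ?\<Phi> (?d ?G1 k) t"
    if k: "k \<in> J" for k
  proof -
    have ki: "i \<noteq> k" using k insert.hyps by auto
    have kJ: "insert i (insert k J) = ?I" "insert k J = J" using k by auto
    have "(\<integral>x. ?d F k (l(i := x)) \<partial>M) = ?d (\<lambda>l. \<integral>x. F (l(i := x)) \<partial>M) k l"
      if M: "law S M" and l: "l \<in> space (PiM J (\<lambda>_. S))" for M l
    proof -
      have b: "bmeas S (\<lambda>x. \<integral>y. F (l(i := x, k := y)) \<partial>N)" if "law S N" for N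
        using bmeas_slice[OF bmeas_partial_integral[OF that, of k ?I F] l] F k by (simp add: insert_absorb)
      show ?thesis
        using integral_resample_swap[OF M M0, of i k J F l] integral_resample_swap[OF M M1, of i k J F l]
          F l ki b[OF M0] b[OF M1]
        by (simp add: kJ law_integral_diff[OF M])
    qed
    note dd = this
    have "(\<integral>l. ?d F k l \<partial>PiM ?I (\<lambda>_. Mt t)) =
        (1 - t) * ?\<Phi> (\<lambda>l. \<integral>x. ?d F k (l(i := x)) \<partial>M0) t + t * ?\<Phi> (\<lambda>l. \<integral>x. ?d F k (l(i := x)) \<partial>M1) t"
      using k by (intro split[OF t] bd) auto
    also have "?\<Phi> (\<lambda>l. \<integral>x. ?d F k (l(i := x)) \<partial>M0) t = ?\<Phi> (?d ?G0 k) t"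
      by (rule law_integral_cong[OF L dd[OF M0]])
    also have "?\<Phi> (\<lambda>l. \<integral>x. ?d F k (l(i := x)) \<partial>M1) t = ?\<Phi> (?d ?G1 k) t"
      by (rule law_integral_cong[OF L dd[OF M1]])
    finally show ?thesis .
  qed
  have "((\<lambda>t. (1 - t) * ?\<Phi> ?G0 t + t * ?\<Phi> ?G1 t) has_real_derivative
      ((0 - 1) * ?\<Phi> ?G0 t + (\<Sum>k\<in>J. ?\<Phi> (?d ?G0 k) t) * (1 - t)) +
      (1 * ?\<Phi> ?G1 t + (\<Sum>k\<in>J. ?\<Phi> (?d ?G1 k) t) * t)) (at t within {0..1})"
    by (intro DERIV_add DERIV_mult DERIV_diff DERIV_const DERIV_ident insert.IH bG)
  also have "((0 - 1) * ?\<Phi> ?G0 t + (\<Sum>k\<in>J. ?\<Phi> (?d ?G0 k) t) * (1 - t)) +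
      (1 * ?\<Phi> ?G1 t + (\<Sum>k\<in>J. ?\<Phi> (?d ?G1 k) t) * t) =
      (\<Sum>k\<in>?I. \<integral>l. ?d F k l \<partial>PiM ?I (\<lambda>_. Mt t))"
    using insert.hyps by (simp add: ti tk sum.distrib sum_distrib_left mult.commute)
  finally show ?case
    by (rule has_field_derivative_transform_within[OF _ zero_less_one t]) (rule split[OF _ F, symmetric])
qed

text \<open>The pairs \<open>w j\<close> are two independent samples per coordinate; coordinates outside \<open>C\<close> use the second one.\<close>

definition resamp :: "'i set \<Rightarrow> 'i set \<Rightarrow> ('i \<Rightarrow> 'a \<times> 'a) \<Rightarrow> 'i \<Rightarrow> 'a" where
  "resamp J C w = (\<lambda>j\<in>J. if j \<in> C then fst (w j) else snd (w j))"

text \<open>Twice the mean conditional variance of \<open>f\<close> given the coordinates in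
  \<open>C\<close>: the two arguments share these coordinates and are otherwise independent with the
  same law.\<close>

definition energy :: "'i set \<Rightarrow> 'a measure \<Rightarrow> 'i set \<Rightarrow> (('i \<Rightarrow> 'a) \<Rightarrow> real) \<Rightarrow> real" where
  "energy J M C f = (\<integral>w. (f (resamp J UNIV w) - f (resamp J C w))^2 \<partial>PiM J (\<lambda>_. M \<Otimes>\<^sub>M M))"

section \<open>Resampling energies and the Efron--Stein bound\<close>

lemma measurable_resamp:
  "resamp J C \<in> measurable (PiM J (\<lambda>_. S \<Otimes>\<^sub>M S)) (PiM J (\<lambda>_. S))"
proof -
  have "(\<lambda>w. if j \<in> C then fst (w j) else snd (w j)) \<in> measurable (PiM J (\<lambda>_. S \<Otimes>\<^sub>M S)) S" if "j \<in> J" for j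
  proof -
    have [measurable]: "(\<lambda>w. w j) \<in> measurable (PiM J (\<lambda>_. S \<Otimes>\<^sub>M S)) (S \<Otimes>\<^sub>M S)"
      using measurable_component_singleton[OF that, of "\<lambda>_. S \<Otimes>\<^sub>M S"] by simp
    show ?thesis by (cases "j \<in> C") simp_all
  qed
  then show ?thesis unfolding resamp_def by (intro measurable_restrict)
qed

lemma integral_pair_fst:
  assumes M: "law S M" and f: "bmeas S f"
  shows "(\<integral>z. f (fst z) \<partial>(M \<Otimes>\<^sub>M M)) = (\<integral>x. f x \<partial>M)"
  using integral_pair[OF M M bmeas_compose[OF measurable_fst f]] by (simp add: law_measure[OF M])

lemma integral_pair_snd:
  assumes M: "law S M" and f: "bmeas S f"
  shows "(\<integral>z. f (snd z) \<partial>(M \<Otimes>\<^sub>M M)) = (\<integral>x. f x \<partial>M)"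
  using integral_pair[OF M M bmeas_compose[OF measurable_snd f]] by (simp add: law_measure[OF M])

lemma integral_resamp:
  assumes M: "law S M" and J: "finite J" and F: "bmeas (PiM J (\<lambda>_. S)) F"
  shows "(\<integral>w. F (resamp J C w) \<partial>PiM J (\<lambda>_. M \<Otimes>\<^sub>M M)) = (\<integral>l. F l \<partial>PiM J (\<lambda>_. M))"
proof -
  note MM = law_pair[OF M M]
  define g :: "'b \<Rightarrow> 'a \<times> 'a \<Rightarrow> 'a" where "g j = (if j \<in> C then fst else snd)" for j
  have g: "g j \<in> measurable (M \<Otimes>\<^sub>M M) S" for j
    using measurable_cong_sets[OF law_sets[OF MM] refl, of S] by (cases "j \<in> C") (auto simp: g_def)
  have "(\<integral>l. F l \<partial>PiM J (\<lambda>_. M)) = (\<integral>y. (\<Prod>j\<in>J. 1) * F (\<lambda>j\<in>J. g j (y j)) \<partial>PiM J (\<lambda>_. M \<Otimes>\<^sub>M M))"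
  proof (rule integral_PiM_transfer[OF _ _ _ g M _ J F])
    show "sigma_finite_measure (M \<Otimes>\<^sub>M M)" by (rule prob_space_imp_sigma_finite[OF law_prob[OF MM]])
    show "integrable (M \<Otimes>\<^sub>M M) (\<lambda>x. 1::real)" by (rule law_integrable[OF MM bmeas_const])
    show "(\<integral>x. f x \<partial>M) = (\<integral>x. 1 * f (g j x) \<partial>(M \<Otimes>\<^sub>M M))" if "bmeas S f" for f j
      using integral_pair_fst[OF M that] integral_pair_snd[OF M that] by (cases "j \<in> C") (auto simp: g_def)
  qed auto
  also have "\<dots> = (\<integral>w. F (resamp J C w) \<partial>PiM J (\<lambda>_. M \<Otimes>\<^sub>M M))"
    by (rule Bochner_Integration.integral_cong[OF refl]) (auto simp: resamp_def g_def intro!: arg_cong[where f=F])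
  finally show ?thesis by simp
qed

text \<open>For a shared coordinate this is Jensen's inequality. For a resampled one the two samples
  are independent, so the cross term factors into the averages \<open>g\<close>, and the conditional
  variances \<open>h\<close> at the two arguments are what remains.\<close>

lemma energy_insert_ge:
  fixes f :: "('i \<Rightarrow> 'a) \<Rightarrow> real"
  assumes M: "law S M" and J: "finite J" "i \<notin> J" and f: "bmeas (PiM (insert i J) (\<lambda>_. S)) f"
  defines "g \<equiv> \<lambda>l. \<integral>x. f (l(i := x)) \<partial>M"
  shows "energy J M C g + (if i \<in> C then 0 else 2 * ((\<integral>l. f l ^ 2 \<partial>PiM (insert i J) (\<lambda>_. M)) - (\<integral>l. g l ^ 2 \<partial>PiM J (\<lambda>_. M))))
    \<le> energy (insert i J) M C f"
proof -
  note MM = law_pair[OF M M]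
  let ?I = "insert i J" and ?P = "PiM J (\<lambda>_. M \<Otimes>\<^sub>M M)"
  let ?SJ = "PiM J (\<lambda>_. S)" and ?SSJ = "PiM J (\<lambda>_. S \<Otimes>\<^sub>M S)"
  define h where "h l = (\<integral>x. f (l(i := x)) ^ 2 \<partial>M) - g l ^ 2" for l
  note LP = law_PiM[OF MM, of J]
  have bg: "bmeas ?SJ g" unfolding g_def by (rule bmeas_partial_integral[OF M f])
  have bf2: "bmeas ?SJ (\<lambda>l. \<integral>x. f (l(i := x)) ^ 2 \<partial>M)"
    by (rule bmeas_partial_integral[OF M bmeas_power[OF f]])
  have bh: "bmeas ?SJ h" unfolding h_def by (intro bmeas_intros bf2 bg)
  have inth: "(\<integral>w. h (resamp J D w) \<partial>?P) = (\<integral>l. f l ^ 2 \<partial>PiM ?I (\<lambda>_. M)) - (\<integral>l. g l ^ 2 \<partial>PiM J (\<lambda>_. M))" for D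
    unfolding integral_resamp[OF M J(1) bh] integral_PiM_insert[OF M J bmeas_power[OF f]] unfolding h_def
    by (rule law_integral_diff[OF law_PiM[OF M] bf2 bmeas_power[OF bg]])
  have res: "resamp ?I D (w(i := z)) = (resamp J D w)(i := if i \<in> D then fst z else snd z)" for D w z
    using J by (auto simp: resamp_def fun_eq_iff)
  have bR: "bmeas ?SSJ (\<lambda>w. F (resamp J D w))" if "bmeas ?SJ F" for F D
    by (rule bmeas_compose[OF measurable_resamp that])
  have bE: "bmeas (PiM ?I (\<lambda>_. S \<Otimes>\<^sub>M S)) (\<lambda>w. (f (resamp ?I UNIV w) - f (resamp ?I C w))^2)"
    by (intro bmeas_intros bmeas_compose[OF measurable_resamp f])
  let ?in = "\<lambda>w. \<integral>z. (f ((resamp J UNIV w)(i := fst z)) - f ((resamp J C w)(i := if i \<in> C then fst z else snd z)))^2 \<partial>(M \<Otimes>\<^sub>M M)"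
  have E: "energy ?I M C f = (\<integral>w. ?in w \<partial>?P)"
    unfolding energy_def integral_PiM_insert[OF MM J bE] res by simp
  have bin: "bmeas ?SSJ ?in"
    using bmeas_partial_integral[OF MM bE] unfolding res by simp
  have sp: "resamp J D w \<in> space ?SJ" if "w \<in> space ?SSJ" for D w
    by (rule measurable_space[OF measurable_resamp that])
  show ?thesis
  proof (cases "i \<in> C")
    case True
    have "(\<integral>w. (g (resamp J UNIV w) - g (resamp J C w))^2 \<partial>?P) \<le> (\<integral>w. ?in w \<partial>?P)"
    proof (rule law_integral_mono[OF LP _ bin])
      show "bmeas ?SSJ (\<lambda>w. (g (resamp J UNIV w) - g (resamp J C w))^2)"
        by (intro bmeas_intros bR bg)
      fix w assume w: "w \<in> space ?SSJ"
      let ?a = "resamp J UNIV w" and ?b = "resamp J C w"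
      note sl = bmeas_slice[OF f sp[OF w]]
      have "g ?a - g ?b = (\<integral>x. f (?a(i := x)) - f (?b(i := x)) \<partial>M)"
        unfolding g_def by (rule law_integral_diff[OF M sl sl, symmetric])
      also have "\<dots> ^ 2 \<le> (\<integral>x. (f (?a(i := x)) - f (?b(i := x)))^2 \<partial>M)"
        by (intro law_square_mean_le[OF M] bmeas_intros sl)
      also have "\<dots> = (\<integral>z. (f (?a(i := fst z)) - f (?b(i := fst z)))^2 \<partial>(M \<Otimes>\<^sub>M M))"
        by (rule integral_pair_fst[OF M, symmetric]) (intro bmeas_intros sl)
      finally show "(g ?a - g ?b)^2 \<le> ?in w" using True by simp
    qed
    then show ?thesis using True unfolding E unfolding energy_def by simp
  next
    case False
    have "?in w = (g (resamp J UNIV w) - g (resamp J C w))^2 + (h (resamp J UNIV w) + h (resamp J C w))"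
      if w: "w \<in> space ?SSJ" for w
    proof -
      let ?a = "resamp J UNIV w" and ?b = "resamp J C w"
      note sl = bmeas_slice[OF f sp[OF w]]
      note s1 = bmeas_compose[OF measurable_fst sl] and s2 = bmeas_compose[OF measurable_snd sl]
      have cross: "(\<integral>z. f (?a(i := fst z)) * f (?b(i := snd z)) \<partial>(M \<Otimes>\<^sub>M M)) = g ?a * g ?b"
        unfolding g_def by (subst integral_pair[OF M M]) (auto intro!: bmeas_intros s1 s2)
      have "?in w = (\<integral>z. (f (?a(i := fst z)) ^ 2 + f (?b(i := snd z)) ^ 2) - 2 * (f (?a(i := fst z)) * f (?b(i := snd z))) \<partial>(M \<Otimes>\<^sub>M M))"
        using False by (intro law_integral_cong[OF MM]) (simp add: power2_eq_square algebra_simps)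
      also have "\<dots> = (\<integral>z. f (?a(i := fst z)) ^ 2 + f (?b(i := snd z)) ^ 2 \<partial>(M \<Otimes>\<^sub>M M))
          - 2 * (\<integral>z. f (?a(i := fst z)) * f (?b(i := snd z)) \<partial>(M \<Otimes>\<^sub>M M))"
        by (subst law_integral_diff[OF MM]) (auto intro!: bmeas_intros s1 s2)
      also have "(\<integral>z. f (?a(i := fst z)) ^ 2 + f (?b(i := snd z)) ^ 2 \<partial>(M \<Otimes>\<^sub>M M))
          = (\<integral>z. f (?a(i := fst z)) ^ 2 \<partial>(M \<Otimes>\<^sub>M M)) + (\<integral>z. f (?b(i := snd z)) ^ 2 \<partial>(M \<Otimes>\<^sub>M M))"
        by (rule law_integral_add[OF MM]) (intro bmeas_intros s1 s2)+
      also have "(\<integral>z. f (?a(i := fst z)) ^ 2 \<partial>(M \<Otimes>\<^sub>M M)) = (\<integral>x. f (?a(i := x)) ^ 2 \<partial>M)"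
        by (rule integral_pair_fst[OF M]) (intro bmeas_intros sl)
      also have "(\<integral>z. f (?b(i := snd z)) ^ 2 \<partial>(M \<Otimes>\<^sub>M M)) = (\<integral>x. f (?b(i := x)) ^ 2 \<partial>M)"
        by (rule integral_pair_snd[OF M]) (intro bmeas_intros sl)
      finally show ?thesis unfolding cross h_def power2_diff by linarith
    qed
    then have "(\<integral>w. ?in w \<partial>?P) = (\<integral>w. (g (resamp J UNIV w) - g (resamp J C w))^2 + (h (resamp J UNIV w) + h (resamp J C w)) \<partial>?P)"
      by (rule law_integral_cong[OF LP])
    also have "\<dots> = energy J M C g + ((\<integral>w. h (resamp J UNIV w) \<partial>?P) + (\<integral>w. h (resamp J C w) \<partial>?P))"
      unfolding energy_def
      by (subst law_integral_add[OF LP], intro bmeas_intros bR bg, intro bmeas_intros bR bh,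
          subst law_integral_add[OF LP], intro bR bh, intro bR bh) simp
    finally show ?thesis using False unfolding E inth by simp
  qed
qed

text \<open>An Efron--Stein type bound; the induction averages out one coordinate at a time, which never increases
  the energy and, for a resampled coordinate, loses exactly twice the variance it carries.\<close>

lemma variance_le_energy:
  fixes f :: "('i \<Rightarrow> 'a) \<Rightarrow> real"
  assumes M: "law S M" and J: "finite J" and f: "bmeas (PiM J (\<lambda>_. S)) f" and H: "finite H"
    and half: "\<And>j. j \<in> J \<Longrightarrow> card H \<le> 2 * card {h \<in> H. j \<notin> C h}"
  shows "real (card H) * ((\<integral>l. f l ^ 2 \<partial>PiM J (\<lambda>_. M)) - (\<integral>l. f l \<partial>PiM J (\<lambda>_. M))^2) \<le> (\<Sum>h\<in>H. energy J M (C h) f)"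
  using J f half
proof (induction J arbitrary: f rule: finite_induct)
  case empty
  have "0 \<le> energy {} M (C h) f" for h
    unfolding energy_def by (intro Bochner_Integration.integral_nonneg) auto
  then show ?case by (simp add: PiM_empty lebesgue_integral_count_space_finite sum_nonneg)
next
  case (insert i J)
  let ?I = "insert i J"
  let ?g = "\<lambda>l. \<integral>x. f (l(i := x)) \<partial>M"
  note f = insert.prems(1)
  let ?vf = "(\<integral>l. f l ^ 2 \<partial>PiM ?I (\<lambda>_. M))" and ?vg = "(\<integral>l. ?g l ^ 2 \<partial>PiM J (\<lambda>_. M))"
  have bg: "bmeas (PiM J (\<lambda>_. S)) ?g" by (rule bmeas_partial_integral[OF M f])
  have fg: "(\<integral>l. f l \<partial>PiM ?I (\<lambda>_. M)) = (\<integral>l. ?g l \<partial>PiM J (\<lambda>_. M))"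
    by (rule integral_PiM_insert[OF M insert.hyps f])
  have "?vg \<le> (\<integral>l. (\<integral>x. f (l(i := x))^2 \<partial>M) \<partial>PiM J (\<lambda>_. M))"
    by (rule law_integral_mono[OF law_PiM[OF M] bmeas_power[OF bg] bmeas_partial_integral[OF M bmeas_power[OF f]]])
      (rule law_square_mean_le[OF M bmeas_slice[OF f]])
  then have v: "0 \<le> ?vf - ?vg"
    unfolding integral_PiM_insert[OF M insert.hyps bmeas_power[OF f]] by simp
  \<comment> \<open>Coordinate \<open>i\<close> is resampled by at least half of the sets, and each
    of them contributes the variance increment twice; together they pay for \<open>card H\<close>
    copies of it.\<close>
  have c: "real (card H) \<le> 2 * real (card {h \<in> H. i \<notin> C h})"
  proof -
    have "card H \<le> 2 * card {h \<in> H. i \<notin> C h}" by (rule insert.prems(2)) simp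
    then show ?thesis by linarith
  qed
  have "real (card H) * (?vf - (\<integral>l. f l \<partial>PiM ?I (\<lambda>_. M))^2) =
      real (card H) * (?vg - (\<integral>l. ?g l \<partial>PiM J (\<lambda>_. M))^2) + real (card H) * (?vf - ?vg)"
    unfolding fg by (simp add: algebra_simps)
  also have "\<dots> \<le> (\<Sum>h\<in>H. energy J M (C h) ?g) + (2 * real (card {h \<in> H. i \<notin> C h})) * (?vf - ?vg)"
    using insert.prems(2) by (intro add_mono insert.IH bg mult_right_mono c v) auto
  also have "\<dots> = (\<Sum>h\<in>H. energy J M (C h) ?g + (if i \<in> C h then 0 else 2 * (?vf - ?vg)))"
  proof -
    have "(\<Sum>h\<in>H. (if i \<in> C h then 0 else 2 * (?vf - ?vg))) = (\<Sum>h\<in>{h\<in>H. i \<notin> C h}. 2 * (?vf - ?vg))"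
      using H by (subst sum.inter_filter) (auto intro!: sum.cong)
    also have "\<dots> = 2 * real (card {h \<in> H. i \<notin> C h}) * (?vf - ?vg)" by simp
    finally show ?thesis unfolding sum.distrib by linarith
  qed
  also have "\<dots> \<le> (\<Sum>h\<in>H. energy ?I M (C h) f)"
    by (rule sum_mono) (rule energy_insert_ge[OF M insert.hyps f])
  finally show ?case .
qed

text \<open>Permuting the independent pairs preserves their law and, by invariance of
  \<open>f\<close>, has no effect but to move the shared set. Sets in one orbit of the symmetry
  group of \<open>f\<close> therefore have the same energy.\<close>

lemma energy_reindex:
  assumes M: "law S M" and J: "finite J" and f: "bmeas (PiM J (\<lambda>_. S)) f"
    and bij: "bij_betw \<sigma> J J" and inv: "\<And>l. l \<in> space (PiM J (\<lambda>_. S)) \<Longrightarrow> f (\<lambda>j\<in>J. l (\<sigma> j)) = f l"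
    and C: "\<And>j. j \<in> J \<Longrightarrow> \<sigma> j \<in> C' \<longleftrightarrow> j \<in> C"
  shows "energy J M C f = energy J M C' f"
proof -
  note MM = law_pair[OF M M]
  have b: "bmeas (PiM J (\<lambda>_. S \<Otimes>\<^sub>M S)) (\<lambda>w. (f (resamp J UNIV w) - f (resamp J C w))^2)"
    by (intro bmeas_intros bmeas_compose[OF measurable_resamp f])
  have inj: "inj_on \<sigma> J" "\<sigma> \<in> J \<rightarrow> J" using bij by (auto simp: bij_betw_def)
  have r: "f (resamp J C (\<lambda>j\<in>J. w (\<sigma> j))) = f (resamp J C' w)"
    if "w \<in> space (PiM J (\<lambda>_. S \<Otimes>\<^sub>M S))" and C: "\<And>j. j \<in> J \<Longrightarrow> \<sigma> j \<in> C' \<longleftrightarrow> j \<in> C" for w C C'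
  proof -
    have "resamp J C (\<lambda>j\<in>J. w (\<sigma> j)) = (\<lambda>j\<in>J. resamp J C' w (\<sigma> j))"
      using inj C by (auto simp: resamp_def fun_eq_iff)
    then show ?thesis using inv[OF measurable_space[OF measurable_resamp that(1)]] by simp
  qed
  have "energy J M C f = (\<integral>w. (f (resamp J UNIV (\<lambda>j\<in>J. w (\<sigma> j))) - f (resamp J C (\<lambda>j\<in>J. w (\<sigma> j))))^2 \<partial>PiM J (\<lambda>_. M \<Otimes>\<^sub>M M))"
    unfolding energy_def by (rule integral_PiM_reindex[OF MM inj b, symmetric])
  also have "\<dots> = energy J M C' f"
    unfolding energy_def by (rule law_integral_cong[OF law_PiM[OF MM]]) (simp add: r[of _ UNIV UNIV] r[of _ C' C] C)
  finally show ?thesis .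
qed

section \<open>Reed--Muller codes\<close>

definition rm_monomials :: "nat \<Rightarrow> nat \<Rightarrow> nat set set" where
  "rm_monomials r m = {S. S \<subseteq> {..<m} \<and> card S \<le> r}"

definition rm_eval :: "nat \<Rightarrow> nat set set \<Rightarrow> nat \<Rightarrow> bool" where
  "rm_eval m A i \<longleftrightarrow> i < 2 ^ m \<and> odd (card {S\<in>A. \<forall>j\<in>S. bit i j})"

definition bxor :: "(nat \<Rightarrow> bool) \<Rightarrow> (nat \<Rightarrow> bool) \<Rightarrow> nat \<Rightarrow> bool" where
  "bxor u v i \<longleftrightarrow> u i \<noteq> v i"

lemma finite_rm_monomials: "finite (rm_monomials r m)"
  unfolding rm_monomials_def by (rule finite_subset[of _ "Pow {..<m}"]) auto

lemma rm_code_eq: "rm_code r m = rm_eval m ` Pow (rm_monomials r m)"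
  unfolding rm_code_def rm_monomials_def rm_eval_def image_def by (auto simp: fun_eq_iff)

lemma finite_rm_code: "finite (rm_code r m)"
  unfolding rm_code_eq by (simp add: finite_rm_monomials)

lemma rm_codeI: "A \<subseteq> rm_monomials r m \<Longrightarrow> rm_eval m A \<in> rm_code r m"
  unfolding rm_code_eq by blast

lemma rm_code_support: "u \<in> rm_code r m \<Longrightarrow> u i \<Longrightarrow> i < 2 ^ m"
  unfolding rm_code_eq rm_eval_def by auto

lemma odd_card_sym_diff:
  assumes "finite A" "finite B"
  shows "odd (card (sym_diff A B)) \<longleftrightarrow> (odd (card A) \<noteq> odd (card B))"
proof -
  have "card X = card (X - Y) + card (X \<inter> Y)" if "finite X" for X Y :: "'a set"
    using card_Int_Diff[OF that, of Y] by simp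
  from this[of A B] this[of B A]
  have "card A = card (A - B) + card (A \<inter> B)" "card B = card (B - A) + card (A \<inter> B)"
    using assms by (simp_all add: Int_commute)
  moreover have "card (sym_diff A B) = card (A - B) + card (B - A)"
    using assms by (intro card_Un_disjoint) auto
  ultimately show ?thesis by presburger
qed

lemma rm_eval_sym_diff:
  assumes "finite A" "finite B"
  shows "rm_eval m (sym_diff A B) = bxor (rm_eval m A) (rm_eval m B)"
proof
  fix i :: nat
  let ?f = "\<lambda>A. {S\<in>A. \<forall>j\<in>S. bit i j}"
  have "?f (sym_diff A B) = sym_diff (?f A) (?f B)" by auto
  then show "rm_eval m (sym_diff A B) i = bxor (rm_eval m A) (rm_eval m B) i"
    using odd_card_sym_diff[of "?f A" "?f B"] assms by (auto simp: rm_eval_def bxor_def)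
qed

lemma rm_code_bxor:
  assumes "u \<in> rm_code r m" "v \<in> rm_code r m" shows "bxor u v \<in> rm_code r m"
proof -
  obtain A B where A: "A \<subseteq> rm_monomials r m" "u = rm_eval m A" and B: "B \<subseteq> rm_monomials r m" "v = rm_eval m B"
    using assms unfolding rm_code_eq by blast
  have "bxor u v = rm_eval m (sym_diff A B)"
    using rm_eval_sym_diff[of A B m] A B finite_subset[OF _ finite_rm_monomials] by auto
  moreover have "sym_diff A B \<subseteq> rm_monomials r m" using A B by auto
  ultimately show ?thesis by (simp add: rm_codeI)
qed

lemma rm_code_zero: "(\<lambda>_. False) \<in> rm_code r m"
proof -
  have "rm_eval m {} = (\<lambda>_. False)" by (auto simp: rm_eval_def fun_eq_iff)
  then show ?thesis using rm_codeI[of "{}" r m] by simp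
qed

lemma rm_eval_single: "rm_eval m {S} = (\<lambda>i. i < 2 ^ m \<and> (\<forall>j\<in>S. bit i j))"
proof
  fix i :: nat
  have "{T \<in> {S}. \<forall>j\<in>T. bit i j} = (if \<forall>j\<in>S. bit i j then {S} else {})" by auto
  then show "rm_eval m {S} i = (i < 2 ^ m \<and> (\<forall>j\<in>S. bit i j))" by (auto simp: rm_eval_def)
qed

lemma rm_code_one: "(\<lambda>i. i < 2 ^ m) \<in> rm_code r m"
  using rm_codeI[of "{{}}" r m] unfolding rm_eval_single by (simp add: rm_monomials_def)

text \<open>The code is the span of the evaluated monomials over the field with two elements, so
  closure properties need only be checked on monomials and under addition.\<close>

lemma rm_code_induct [consumes 1, case_names zero mono xor]:
  assumes u: "u \<in> rm_code r m"
    and z: "P (\<lambda>_. False)"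
    and mono: "\<And>S. S \<subseteq> {..<m} \<Longrightarrow> card S \<le> r \<Longrightarrow> P (\<lambda>i. i < 2 ^ m \<and> (\<forall>j\<in>S. bit i j))"
    and x: "\<And>u v. P u \<Longrightarrow> P v \<Longrightarrow> P (bxor u v)"
  shows "P u"
proof -
  obtain A where A: "A \<subseteq> rm_monomials r m" "u = rm_eval m A"
    using u unfolding rm_code_eq by blast
  have "finite A" using A finite_subset[OF _ finite_rm_monomials] by blast
  then have "P (rm_eval m A)" using A(1)
  proof (induction A rule: finite_induct)
    case empty
    then show ?case using z by (simp add: rm_eval_def[abs_def])
  next
    case (insert S A)
    have "insert S A = sym_diff {S} A" using insert.hyps by auto
    then have "rm_eval m (insert S A) = bxor (rm_eval m {S}) (rm_eval m A)"
      using rm_eval_sym_diff[of "{S}" A m] insert.hyps by simp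
    moreover have "P (rm_eval m {S})"
      unfolding rm_eval_single using insert.prems mono by (auto simp: rm_monomials_def)
    ultimately show ?case using x insert by simp
  qed
  then show ?thesis using A by simp
qed

section \<open>Degree of products and affine substitutions\<close>

lemma rm_code_mono: "r \<le> r' \<Longrightarrow> rm_code r m \<subseteq> rm_code r' m"
  unfolding rm_code_eq rm_monomials_def by (intro image_mono Pow_mono) auto

lemma rm_monomial_in_code:
  "S \<subseteq> {..<m} \<Longrightarrow> card S \<le> r \<Longrightarrow> (\<lambda>i. i < 2 ^ m \<and> (\<forall>j\<in>S. bit i j)) \<in> rm_code r m"
  using rm_codeI[of "{S}" r m] unfolding rm_eval_single by (simp add: rm_monomials_def)

text \<open>Pointwise conjunction is multiplication of polynomials. Degrees add, and a variable
  shared by two monomials is counted once because it is idempotent.\<close>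

lemma rm_code_conj:
  assumes "u \<in> rm_code a m" "v \<in> rm_code b m"
  shows "(\<lambda>i. u i \<and> v i) \<in> rm_code (a + b) m"
  using assms(1)
proof (induction rule: rm_code_induct)
  case zero
  then show ?case by (simp add: rm_code_zero)
next
  case (mono S)
  show ?case using assms(2)
  proof (induction rule: rm_code_induct)
    case zero
    then show ?case by (simp add: rm_code_zero)
  next
    case (mono T)
    have "card (S \<union> T) \<le> a + b" using card_Un_le[of S T] mono \<open>card S \<le> a\<close> by linarith
    then have "(\<lambda>i. i < 2 ^ m \<and> (\<forall>j\<in>S \<union> T. bit i j)) \<in> rm_code (a + b) m"
      using mono \<open>S \<subseteq> {..<m}\<close> by (intro rm_monomial_in_code) auto
    moreover have "(\<lambda>i::nat. i < 2 ^ m \<and> (\<forall>j\<in>S \<union> T. bit i j)) = (\<lambda>i. (i < 2 ^ m \<and> (\<forall>j\<in>S. bit i j)) \<and> i < 2 ^ m \<and> (\<forall>j\<in>T. bit i j))"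
      by (auto simp: fun_eq_iff)
    ultimately show ?case by simp
  next
    case (xor u v)
    have "(\<lambda>i. (i < 2 ^ m \<and> (\<forall>j\<in>S. bit i j)) \<and> bxor u v i) =
       bxor (\<lambda>i. (i < 2 ^ m \<and> (\<forall>j\<in>S. bit i j)) \<and> u i) (\<lambda>i. (i < 2 ^ m \<and> (\<forall>j\<in>S. bit i j)) \<and> v i)"
      by (auto simp: bxor_def fun_eq_iff)
    then show ?case using rm_code_bxor[OF xor] by simp
  qed
next
  case (xor u w)
  have "(\<lambda>i. bxor u w i \<and> v i) = bxor (\<lambda>i. u i \<and> v i) (\<lambda>i. w i \<and> v i)"
    by (auto simp: bxor_def fun_eq_iff)
  then show ?case using rm_code_bxor[OF xor] by simp
qed

text \<open>Substituting affine forms turns a monomial of degree d into a product of d affine forms,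
  so the degree does not grow. The condition on the range of \<sigma> reflects that codewords are
  False outside the index set.\<close>

lemma rm_code_subst:
  assumes u: "u \<in> rm_code r m"
    and dom: "\<And>i. \<sigma> i < 2 ^ m \<longleftrightarrow> i < 2 ^ m"
    and aff: "\<And>j. j < m \<Longrightarrow> (\<lambda>i. i < 2 ^ m \<and> bit (\<sigma> i) j) \<in> rm_code 1 m"
  shows "(\<lambda>i. u (\<sigma> i)) \<in> rm_code r m"
  using u
proof (induction rule: rm_code_induct)
  case zero
  then show ?case by (simp add: rm_code_zero)
next
  case (mono S)
  have "finite S" using mono finite_subset by blast
  then have "(\<lambda>i. i < 2 ^ m \<and> (\<forall>j\<in>S. bit (\<sigma> i) j)) \<in> rm_code (card S) m" using mono(1)
  proof (induction S rule: finite_induct)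
    case empty
    then show ?case by (simp add: rm_code_one)
  next
    case (insert k S)
    have "(\<lambda>i. i < 2 ^ m \<and> (\<forall>j\<in>insert k S. bit (\<sigma> i) j)) =
        (\<lambda>i. (i < 2 ^ m \<and> bit (\<sigma> i) k) \<and> (i < 2 ^ m \<and> (\<forall>j\<in>S. bit (\<sigma> i) j)))" by auto
    moreover have "(\<lambda>i. (i < 2 ^ m \<and> bit (\<sigma> i) k) \<and> (i < 2 ^ m \<and> (\<forall>j\<in>S. bit (\<sigma> i) j))) \<in> rm_code (1 + card S) m"
      using insert by (intro rm_code_conj aff) auto
    ultimately show ?case using insert by simp
  qed
  then show ?case using rm_code_mono[OF mono(2)] by (auto simp: dom)
next
  case (xor u v)
  have "(\<lambda>i. bxor u v (\<sigma> i)) = bxor (\<lambda>i. u (\<sigma> i)) (\<lambda>i. v (\<sigma> i))" by (auto simp: bxor_def)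
  then show ?case using rm_code_bxor[OF xor] by simp
qed

section \<open>Points as bit patterns and the dimension of the code\<close>

lemma less_pow2_iff_bit: "(i::nat) < 2 ^ m \<longleftrightarrow> (\<forall>j\<ge>m. \<not> bit i j)"
proof
  assume "i < 2 ^ m"
  then have "take_bit m i = i" by (simp add: take_bit_nat_eq_self)
  then show "\<forall>j\<ge>m. \<not> bit i j" by (metis bit_take_bit_iff not_less)
next
  assume "\<forall>j\<ge>m. \<not> bit i j"
  then have "take_bit m i = i" by (auto simp: bit_eq_iff bit_take_bit_iff not_le[symmetric])
  then show "i < 2 ^ m" by (metis take_bit_nat_less_exp)
qed

lemma ex_bits:
  assumes "S \<subseteq> {..<m}" shows "\<exists>i<2 ^ m. \<forall>j. bit (i::nat) j \<longleftrightarrow> j \<in> S"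
proof -
  have "finite S" using assms finite_subset by blast
  then have "\<exists>i::nat. \<forall>j. bit i j \<longleftrightarrow> j \<in> S"
  proof (induction S rule: finite_induct)
    case empty
    then show ?case by (intro exI[of _ 0]) simp
  next
    case (insert k S)
    then obtain i :: nat where "\<forall>j. bit i j \<longleftrightarrow> j \<in> S" by blast
    then show ?case by (intro exI[of _ "set_bit k i"]) (auto simp: bit_set_bit_iff)
  qed
  then show ?thesis using assms less_pow2_iff_bit by (metis lessThan_iff not_less subset_iff)
qed

text \<open>At the point whose set of ones is a monomial of least degree in \<open>A\<close>, that
  monomial is the only one of \<open>A\<close> that does not vanish. This linear independence of
  monomials yields the size of the code.\<close>

lemma rm_eval_nonzero:
  assumes A: "finite A" "A \<noteq> {}" "\<And>S. S \<in> A \<Longrightarrow> S \<subseteq> {..<m}"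
  shows "\<exists>i. rm_eval m A i"
proof -
  obtain S where S: "S \<in> A" "\<And>T. T \<in> A \<Longrightarrow> card S \<le> card T"
    using A by (metis arg_min_least arg_min_if_finite(1))
  obtain i :: nat where i: "i < 2 ^ m" "\<forall>j. bit i j \<longleftrightarrow> j \<in> S"
    using ex_bits A(3)[OF S(1)] by blast
  have "T = S" if "T \<in> A" "T \<subseteq> S" for T
  proof (rule card_subset_eq[OF _ that(2)])
    show "finite S" using A(3)[OF S(1)] finite_subset by blast
    then show "card T = card S" using card_mono[OF _ that(2)] S(2)[OF that(1)] by (simp add: le_antisym)
  qed
  then have "{T\<in>A. \<forall>j\<in>T. bit i j} = {S}" using i S by auto
  then show ?thesis using i unfolding rm_eval_def by (intro exI[of _ i]) auto
qed

lemma card_rm_monomials: "card (rm_monomials r m) = (\<Sum>i\<le>r. m choose i)"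
proof -
  have "rm_monomials r m = (\<Union>i\<le>r. {S. S \<subseteq> {..<m} \<and> card S = i})"
    by (auto simp: rm_monomials_def)
  also have "card \<dots> = (\<Sum>i\<le>r. card {S. S \<subseteq> {..<m} \<and> card S = i})"
    by (intro card_UN_disjoint) (auto intro: finite_subset[of _ "Pow {..<m}"])
  finally show ?thesis by (simp add: n_subsets)
qed

lemma card_rm_code: "card (rm_code r m) = 2 ^ (\<Sum>i\<le>r. m choose i)"
proof -
  have "inj_on (rm_eval m) (Pow (rm_monomials r m))"
  proof (rule inj_onI)
    fix A B assume AB: "A \<in> Pow (rm_monomials r m)" "B \<in> Pow (rm_monomials r m)" "rm_eval m A = rm_eval m B"
    then have fin: "finite A" "finite B" using finite_subset[OF _ finite_rm_monomials] by auto
    have "\<not> rm_eval m (sym_diff A B) i" for i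
      unfolding rm_eval_sym_diff[OF fin] AB(3) by (simp add: bxor_def)
    then have "sym_diff A B = {}"
      using rm_eval_nonzero[of "sym_diff A B" m] fin AB by (auto simp: rm_monomials_def)
    then show "A = B" by auto
  qed
  then show ?thesis
    unfolding rm_code_eq by (simp add: card_image card_Pow finite_rm_monomials card_rm_monomials)
qed

lemma log_card_rm_code: "log 2 (card (rm_code r m)) = 2 ^ m * rm_rate r m"
  unfolding card_rm_code rm_rate_def by (simp add: log_nat_power)

text \<open>The linear map that adds the parity of the coordinates in \<open>S\<close> to coordinate
  \<open>b\<close>. With \<open>b\<close> outside \<open>S\<close> it is an involution; it fixes the
  point 0, the position of the bit to be estimated.\<close>

definition transvect :: "nat \<Rightarrow> nat set \<Rightarrow> nat \<Rightarrow> nat" where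
  "transvect b S i = (if odd (card {j\<in>S. bit i j}) then flip_bit b i else i)"

section \<open>Symmetries of the code: transvections and translations\<close>

lemma bit_transvect:
  "bit (transvect b S i) j \<longleftrightarrow> (if j = b then bit i b \<noteq> odd (card {j\<in>S. bit i j}) else bit i j)"
  by (auto simp: transvect_def bit_flip_bit_iff)

lemma transvect_less: "b < m \<Longrightarrow> transvect b S i < 2 ^ m \<longleftrightarrow> i < 2 ^ m"
  unfolding less_pow2_iff_bit bit_transvect by auto

lemma transvect_invol: "b \<notin> S \<Longrightarrow> transvect b S (transvect b S i) = i"
proof -
  assume b: "b \<notin> S"
  have "{j\<in>S. bit (transvect b S i) j} = {j\<in>S. bit i j}" using b by (auto simp: bit_transvect)
  then have "bit (transvect b S (transvect b S i)) n = bit i n" for n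
    using bit_transvect[of b S i] bit_transvect[of b S "transvect b S i"] by auto
  then show ?thesis by (intro bit_eqI) auto
qed

lemma rm_code_parity:
  assumes "S \<subseteq> {..<m}" shows "(\<lambda>i. i < 2 ^ m \<and> odd (card {j\<in>S. bit i j})) \<in> rm_code 1 m"
proof -
  have "card {T\<in>(\<lambda>j. {j}) ` S. \<forall>j\<in>T. bit i j} = card {j\<in>S. bit i j}" for i :: nat
  proof -
    have "{T\<in>(\<lambda>j. {j}) ` S. \<forall>j\<in>T. bit i j} = (\<lambda>j. {j}) ` {j\<in>S. bit i j}" by auto
    then show ?thesis by (simp add: card_image)
  qed
  then have "rm_eval m ((\<lambda>j. {j}) ` S) = (\<lambda>i. i < 2 ^ m \<and> odd (card {j\<in>S. bit i j}))"
    by (simp add: rm_eval_def[abs_def])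
  moreover have "(\<lambda>j. {j}) ` S \<subseteq> rm_monomials 1 m" using assms by (auto simp: rm_monomials_def)
  ultimately show ?thesis using rm_codeI by metis
qed

lemma rm_code_bit: "j < m \<Longrightarrow> (\<lambda>i. i < 2 ^ m \<and> bit i j) \<in> rm_code 1 m"
  using rm_monomial_in_code[of "{j}" m 1] by simp

lemma rm_code_transvect:
  assumes "u \<in> rm_code r m" "b < m" "S \<subseteq> {..<m}"
  shows "(\<lambda>i. u (transvect b S i)) \<in> rm_code r m"
proof (rule rm_code_subst[OF assms(1) transvect_less[OF assms(2)]])
  fix j assume j: "j < m"
  show "(\<lambda>i. i < 2 ^ m \<and> bit (transvect b S i) j) \<in> rm_code 1 m"
  proof (cases "j = b")
    case True
    have "(\<lambda>i. i < 2 ^ m \<and> bit (transvect b S i) j) =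
        bxor (\<lambda>i. i < 2 ^ m \<and> bit i b) (\<lambda>i. i < 2 ^ m \<and> odd (card {j\<in>S. bit i j}))"
      using True by (auto simp: bit_transvect bxor_def fun_eq_iff)
    then show ?thesis using rm_code_bxor[OF rm_code_bit[OF assms(2)] rm_code_parity[OF assms(3)]] by simp
  next
    case False
    then show ?thesis using rm_code_bit[OF j] by (simp add: bit_transvect)
  qed
qed

lemma xor_less_iff: "a < 2 ^ m \<Longrightarrow> xor (i::nat) a < 2 ^ m \<longleftrightarrow> i < 2 ^ m"
  unfolding less_pow2_iff_bit bit_xor_iff by auto

lemma rm_code_translate:
  assumes "u \<in> rm_code r m" "a < 2 ^ m"
  shows "(\<lambda>i. u (xor i a)) \<in> rm_code r m"
proof (rule rm_code_subst[OF assms(1) xor_less_iff[OF assms(2)]])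
  fix j assume j: "j < m"
  have "(\<lambda>i. i < 2 ^ m \<and> bit (xor i a) j) =
      (if bit a j then bxor (\<lambda>i. i < 2 ^ m \<and> bit i j) (\<lambda>i. i < 2 ^ m) else (\<lambda>i. i < 2 ^ m \<and> bit i j))"
    by (auto simp: bxor_def bit_xor_iff fun_eq_iff)
  then show "(\<lambda>i. i < 2 ^ m \<and> bit (xor i a) j) \<in> rm_code 1 m"
    using rm_code_bxor[OF rm_code_bit[OF j] rm_code_one[of m 1]] rm_code_bit[OF j] by (cases "bit a j") simp_all
qed

text \<open>The hyperplanes \<open>\<langle>h + e\<^sub>b, v\<rangle> = 0\<close> with \<open>h\<close> ranging over the vectors supported off \<open>b\<close>
  are all images of a single one under transvections, and miss every nonzero point at least half of the time.\<close>

lemma half_of_hyperplanes_miss: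
  assumes j: "j < 2 ^ Suc b"
  shows "card (Pow {..<b}) \<le> 2 * card {h\<in>Pow {..<b}. \<not> (transvect b h j \<in> {1..<2 ^ b})}"
proof -
  let ?H = "Pow {..<b}"
  have lt: "transvect b h j < 2 ^ Suc b" for h
    using transvect_less[of b "Suc b" h j] j by auto
  have small: "transvect b h j < 2 ^ b \<longleftrightarrow> \<not> (bit j b \<noteq> odd (card {k\<in>h. bit j k}))" for h
  proof -
    have "transvect b h j < 2 ^ b \<longleftrightarrow> \<not> bit (transvect b h j) b"
    proof
      assume "transvect b h j < 2 ^ b"
      then show "\<not> bit (transvect b h j) b" unfolding less_pow2_iff_bit by blast
    next
      assume nb: "\<not> bit (transvect b h j) b"
      have "\<not> bit (transvect b h j) i" if "b \<le> i" for i
      proof (cases "i = b")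
        case False
        then have "Suc b \<le> i" using that by simp
        then show ?thesis using lt[of h] unfolding less_pow2_iff_bit by blast
      qed (use nb in simp)
      then show "transvect b h j < 2 ^ b" unfolding less_pow2_iff_bit by blast
    qed
    then show ?thesis by (simp add: bit_transvect)
  qed
  show ?thesis
  proof (cases "\<exists>k<b. bit j k")
    case False
    \<comment> \<open>Here \<open>j\<close> is 0 or \<open>2 ^ b\<close>, both fixed by all the
      maps. The point 0 is kept out of the target set, in accordance with an extrinsic estimate that
      ignores coordinate 0.\<close>
    have "\<not> (transvect b h j \<in> {1..<2 ^ b})" if h: "h \<in> ?H" for h
    proof
      assume a: "transvect b h j \<in> {1..<2 ^ b}"
      have e: "{k\<in>h. bit j k} = {}" using False h by auto
      then have "transvect b h j = j" unfolding transvect_def e by simp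
      then have "j < 2 ^ b" "j \<noteq> 0" using a by auto
      then have "\<forall>k. \<not> bit j k" using False unfolding less_pow2_iff_bit by (meson not_less)
      then have "j = 0" by (intro bit_eqI) simp
      then show False using \<open>j \<noteq> 0\<close> by simp
    qed
    then have "{h\<in>?H. \<not> (transvect b h j \<in> {1..<2 ^ b})} = ?H" by blast
    then show ?thesis by simp
  next
    case True
    then obtain k where k: "k < b" "bit j k" by blast
    define Q where "Q h \<longleftrightarrow> bit j b \<noteq> odd (card {k\<in>h. bit j k})" for h
    \<comment> \<open>Since \<open>j\<close> has bit \<open>k\<close>, toggling \<open>k\<close> in
      \<open>h\<close> flips the parity; the involution exchanges the cases in which the image of
      \<open>j\<close> lies in the lower half with those in which it does not.\<close>
    define f where "f h = sym_diff h {k}" for h :: "nat set"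
    let ?T = "{h\<in>?H. Q h}"
    have tog: "Q (f h) \<longleftrightarrow> \<not> Q h" if "h \<in> ?H" for h
    proof -
      have "{i\<in>f h. bit j i} = sym_diff {i\<in>h. bit j i} {k}" using k unfolding f_def by auto
      moreover have "finite {i\<in>h. bit j i}" using that finite_subset[of _ "{..<b}"] by auto
      ultimately have "odd (card {i\<in>f h. bit j i}) \<longleftrightarrow> \<not> odd (card {i\<in>h. bit j i})"
        using odd_card_sym_diff[of "{i\<in>h. bit j i}" "{k}"] by simp
      then show ?thesis unfolding Q_def by blast
    qed
    have inv: "f (f h) = h" for h unfolding f_def by auto
    have fH: "f h \<in> ?H" if "h \<in> ?H" for h using that k unfolding f_def by auto
    have "?H - ?T \<subseteq> f ` ?T"
    proof
      fix h assume h: "h \<in> ?H - ?T"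
      then have "f h \<in> ?T" using tog[of h] fH[of h] by blast
      then have "f (f h) \<in> f ` ?T" by (rule imageI)
      then show "h \<in> f ` ?T" by (simp only: inv)
    qed
    then have "card (?H - ?T) \<le> card (f ` ?T)" by (intro card_mono) auto
    also have "\<dots> \<le> card ?T" by (intro card_image_le) auto
    finally have "card (?H - ?T) \<le> card ?T" .
    moreover have "card ?H = card ?T + card (?H - ?T)"
    proof -
      have "?H \<inter> ?T = ?T" by blast
      then show ?thesis using card_Int_Diff[of ?H ?T] by simp
    qed
    moreover have "card ?T \<le> card {h\<in>?H. \<not> (transvect b h j \<in> {1..<2 ^ b})}"
    proof (rule card_mono)
      show "?T \<subseteq> {h\<in>?H. \<not> (transvect b h j \<in> {1..<2 ^ b})}"
        using small unfolding Q_def atLeastLessThan_iff by blast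
    qed simp
    ultimately show ?thesis by linarith
  qed
qed

lemma bxor_cancel: "bxor (bxor u v) v = u"
  by (auto simp: bxor_def fun_eq_iff)

lemma bxor_zero: "bxor (\<lambda>_. False) u = u"
  and bxor_self: "bxor u u = (\<lambda>_. False)"
  by (auto simp: bxor_def fun_eq_iff)

section \<open>Nesting in the number of variables\<close>

definition low :: "nat \<Rightarrow> (nat \<Rightarrow> bool) \<Rightarrow> nat \<Rightarrow> bool" where
  "low N u i \<longleftrightarrow> i < N \<and> u i"

lemma low_rm_eval: "low (2 ^ m) (rm_eval (Suc m) A) = rm_eval m {S\<in>A. S \<subseteq> {..<m}}" if "A \<subseteq> Pow {..<Suc m}"
proof
  fix i :: nat
  have "{S\<in>A. \<forall>j\<in>S. bit i j} = {S\<in>{S\<in>A. S \<subseteq> {..<m}}. \<forall>j\<in>S. bit i j}" if "i < 2 ^ m"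
  proof -
    have "\<not> bit i j" if "m \<le> j" for j using that \<open>i < 2 ^ m\<close> less_pow2_iff_bit by blast
    then have "j < m" if "bit i j" for j using that by (meson not_le)
    then show ?thesis by auto
  qed
  then show "low (2 ^ m) (rm_eval (Suc m) A) i = rm_eval m {S\<in>A. S \<subseteq> {..<m}} i"
    by (auto simp: low_def rm_eval_def)
qed

text \<open>Setting the last variable to 0 kills the monomials containing it and leaves the others
  as they are.\<close>

lemma low_rm_code: "low (2 ^ m) ` rm_code r (Suc m) = rm_code r m"
proof
  show "low (2 ^ m) ` rm_code r (Suc m) \<subseteq> rm_code r m"
  proof
    fix v assume "v \<in> low (2 ^ m) ` rm_code r (Suc m)"
    then obtain A where A: "A \<subseteq> rm_monomials r (Suc m)" "v = low (2 ^ m) (rm_eval (Suc m) A)"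
      unfolding rm_code_eq by blast
    have "A \<subseteq> Pow {..<Suc m}" using A(1) unfolding rm_monomials_def by blast
    then have "v = rm_eval m {S\<in>A. S \<subseteq> {..<m}}" using low_rm_eval A by simp
    moreover have "{S\<in>A. S \<subseteq> {..<m}} \<subseteq> rm_monomials r m" using A by (auto simp: rm_monomials_def)
    ultimately show "v \<in> rm_code r m" by (simp add: rm_codeI)
  qed
  show "rm_code r m \<subseteq> low (2 ^ m) ` rm_code r (Suc m)"
  proof
    fix v assume "v \<in> rm_code r m"
    then obtain A where A: "A \<subseteq> rm_monomials r m" "v = rm_eval m A" unfolding rm_code_eq by blast
    have 1: "A \<subseteq> Pow {..<Suc m}" using A(1) lessThan_subset_iff[of m "Suc m"] unfolding rm_monomials_def by fastforce
    have 2: "{S\<in>A. S \<subseteq> {..<m}} = A" using A by (auto simp: rm_monomials_def)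
    have "v = low (2 ^ m) (rm_eval (Suc m) A)" using low_rm_eval[OF 1] 2 A by simp
    moreover have "A \<subseteq> rm_monomials r (Suc m)" using A 1 by (auto simp: rm_monomials_def)
    ultimately show "v \<in> low (2 ^ m) ` rm_code r (Suc m)" using rm_codeI by blast
  qed
qed

text \<open>Restriction is linear and onto, so its fibres are cosets of the kernel \<open>K\<close>
  and equally large: a uniform codeword of the long code restricts to a uniform codeword of the
  short one.\<close>

lemma sum_low_rm_code:
  fixes G :: "(nat \<Rightarrow> bool) \<Rightarrow> real"
  shows "(\<Sum>u\<in>rm_code r (Suc m). G (low (2 ^ m) u)) / card (rm_code r (Suc m)) = (\<Sum>v\<in>rm_code r m. G v) / card (rm_code r m)"
proof -
  let ?C = "rm_code r (Suc m)" and ?\<rho> = "low (2 ^ m)"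
  define K where "K = {u\<in>?C. ?\<rho> u = (\<lambda>_. False)}"
  have hom: "?\<rho> (bxor u v) = bxor (?\<rho> u) (?\<rho> v)" for u v by (auto simp: low_def bxor_def fun_eq_iff)
  have fib: "card {u\<in>?C. ?\<rho> u = v} = card K" if v: "v \<in> rm_code r m" for v
  proof -
    have "v \<in> ?\<rho> ` ?C" using v by (simp only: low_rm_code)
    then obtain u0 where u0: "u0 \<in> ?C" "?\<rho> u0 = v" by (elim imageE) simp
    have "bij_betw (\<lambda>u. bxor u u0) K {u\<in>?C. ?\<rho> u = v}"
    proof (rule bij_betw_byWitness[where f'="\<lambda>u. bxor u u0"])
      show "(\<lambda>u. bxor u u0) ` K \<subseteq> {u\<in>?C. ?\<rho> u = v}"
        using u0 rm_code_bxor by (auto simp only: K_def hom bxor_zero)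
      show "(\<lambda>u. bxor u u0) ` {u\<in>?C. ?\<rho> u = v} \<subseteq> K"
        using u0 rm_code_bxor by (auto simp only: K_def hom bxor_self)
    qed (simp_all only: bxor_cancel Ball_def simp_thms)
    then show ?thesis by (simp add: bij_betw_same_card)
  qed
  have S: "(\<Sum>u\<in>?C. G (?\<rho> u)) = card K * (\<Sum>v\<in>rm_code r m. G v)" for G :: "(nat \<Rightarrow> bool) \<Rightarrow> real"
  proof -
    have "(\<Sum>u\<in>?C. G (?\<rho> u)) = (\<Sum>v\<in>rm_code r m. \<Sum>u\<in>{u\<in>?C. ?\<rho> u = v}. G (?\<rho> u))"
      by (rule sum.group[symmetric]) (simp_all add: finite_rm_code low_rm_code)
    also have "\<dots> = (\<Sum>v\<in>rm_code r m. card K * G v)"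
      using fib by (intro sum.cong refl) simp
    finally show ?thesis by (simp add: sum_distrib_left)
  qed
  have "(\<lambda>_. False) \<in> K" unfolding K_def using rm_code_zero by (simp add: low_def[abs_def])
  then have "card K \<noteq> 0" using finite_rm_code[of r "Suc m"] by (auto simp: K_def)
  moreover have "real (card ?C) = card K * card (rm_code r m)" using S[of "\<lambda>_. 1"] by simp
  ultimately show ?thesis unfolding S by simp
qed

text \<open>Summing Pascal's rule counts every binomial coefficient twice except the top one. The
  order \<open>r\<close> is kept while the number of variables grows, so the rate drops.\<close>

lemma rm_rate_diff: "rm_rate r m - rm_rate r (Suc m) = real (m choose r) / 2 ^ Suc m"
proof -
  have "(\<Sum>i\<le>r. real (Suc m choose i)) = 2 * (\<Sum>i\<le>r. real (m choose i)) - real (m choose r)"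
    by (induction r) auto
  then show ?thesis unfolding rm_rate_def by (simp add: field_simps)
qed

section \<open>Size of the rate step\<close>

lemma central_binomial_Suc: "(2 * Suc n choose Suc n) = 2 * (Suc (2 * n) choose Suc n)"
proof -
  have "(Suc (2 * n) choose Suc n) = (Suc (2 * n) choose n)"
    using binomial_symmetric[of "Suc n" "Suc (2 * n)"] by simp
  then show ?thesis
    using binomial_Suc_Suc[of "Suc (2 * n)" n] by (simp del: binomial_Suc_Suc)
qed

text \<open>The factor \<open>2 * n + 1\<close> makes the induction close, by (2n + 1)(2n + 3) <=
  (2n + 2)^2.\<close>

lemma central_binomial_sq_le: "(real (2 * n choose n))\<^sup>2 * real (2 * n + 1) \<le> (4 ^ n)\<^sup>2"
proof (induction n)
  case 0
  then show ?case by simp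
next
  case (Suc n)
  let ?a = "real (2 * n choose n)" and ?b = "real (2 * Suc n choose Suc n)"
  have "Suc n * (Suc (2 * n) choose Suc n) = Suc (2 * n) * (2 * n choose n)"
    using Suc_times_binomial_eq[of "2 * n" n] by (simp only: mult.commute)
  then have "real (Suc n * (Suc (2 * n) choose Suc n)) = real (Suc (2 * n) * (2 * n choose n))" by presburger
  then have "(real n + 1) * real (Suc (2 * n) choose Suc n) = (2 * real n + 1) * ?a"
    by (simp only: of_nat_mult of_nat_Suc of_nat_numeral add.commute)
  then have b: "(real n + 1) * ?b = 2 * (2 * real n + 1) * ?a"
    unfolding central_binomial_Suc of_nat_mult by (simp del: binomial_Suc_Suc add: algebra_simps)
  have "(real n + 1)\<^sup>2 * (?b\<^sup>2 * real (2 * Suc n + 1)) = ((real n + 1) * ?b)\<^sup>2 * (2 * real n + 3)"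
    by (simp add: power_mult_distrib)
  also have "\<dots> = (?a\<^sup>2 * (2 * real n + 1)) * (4 * ((2 * real n + 1) * (2 * real n + 3)))"
    unfolding b by (simp add: power2_eq_square algebra_simps)
  also have "\<dots> \<le> (4 ^ n)\<^sup>2 * (4 * (2 * real n + 2)\<^sup>2)"
    using Suc by (intro mult_mono) (auto simp: power2_eq_square algebra_simps)
  also have "\<dots> = (real n + 1)\<^sup>2 * (4 ^ Suc n)\<^sup>2"
    by (simp add: power2_eq_square algebra_simps)
  finally show ?case
    by (rule mult_left_le_imp_le) simp
qed

lemma binomial_le_sqrt:
  assumes m: "1 \<le> m" shows "real (m choose r) / 2 ^ m \<le> 1 / sqrt m"
proof -
  have even: "real (2 * n choose n) / 4 ^ n \<le> 1 / sqrt (2 * n + 1)" for n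
  proof -
    have "(real (2 * n choose n) * sqrt (2 * n + 1))\<^sup>2 \<le> (4 ^ n)\<^sup>2"
      using central_binomial_sq_le[of n] by (simp add: power_mult_distrib)
    then have "real (2 * n choose n) * sqrt (2 * n + 1) \<le> 4 ^ n"
      by (rule power2_le_imp_le) simp
    then show ?thesis by (simp add: field_simps)
  qed
  have "real (m choose r) / 2 ^ m \<le> real (m choose (m div 2)) / 2 ^ m"
    using binomial_maximum[of m r] by (intro divide_right_mono) auto
  also have "\<dots> \<le> 1 / sqrt m"
  proof (cases "even m")
    case True
    then obtain n where n: "m = 2 * n" by blast
    have "real (m choose (m div 2)) / 2 ^ m = real (2 * n choose n) / 4 ^ n"
      using n by (simp add: power_mult)
    also have "\<dots> \<le> 1 / sqrt (2 * n + 1)" by (rule even)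
    also have "\<dots> \<le> 1 / sqrt m" using n m by (intro divide_left_mono) auto
    finally show ?thesis .
  next
    case False
    then obtain n where n: "m = 2 * n + 1" using oddE by blast
    \<comment> \<open>A middle coefficient of odd order is half of the next central one, which
      reduces the odd case to the even case.\<close>
    have "(Suc (2 * n) choose Suc n) = (Suc (2 * n) choose n)"
      using binomial_symmetric[of "Suc n" "Suc (2 * n)"] by simp
    then have "(2 * Suc n choose Suc n) = 2 * (Suc (2 * n) choose n)" using central_binomial_Suc by simp
    then have "real (m choose (m div 2)) / 2 ^ m = real (2 * Suc n choose Suc n) / 4 ^ Suc n"
      using n by (simp add: power_mult del: binomial_Suc_Suc)
    also have "\<dots> \<le> 1 / sqrt (2 * Suc n + 1)" by (rule even)
    also have "\<dots> \<le> 1 / sqrt m" using n m by (intro divide_left_mono) auto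
    finally show ?thesis .
  qed
  finally show ?thesis .
qed

section \<open>The binary entropy function\<close>

text \<open>The capacity of the binary symmetric channel with bias \<open>z\<close>, i.e. \<open>kappa z = 1 - hb ((1 - z) / 2)\<close>;
  its expansion in even powers with positive coefficients drives all information inequalities below.\<close>

definition kappa :: "real \<Rightarrow> real" where
  "kappa z = ((1 + z) * log 2 (1 + z) + (1 - z) * log 2 (1 - z)) / 2"

text \<open>The coefficient of \<open>z ^ (2 * n + 2)\<close> in \<open>kappa z\<close>; it equals 1
  / (2n + 1) - 1 / (2n + 2) divided by ln 2, so the sum is the alternating harmonic series.\<close>

definition kcoeff :: "nat \<Rightarrow> real" where
  "kcoeff n = 1 / (real (2 * n + 2) * real (2 * n + 1) * ln 2)"

lemma kcoeff_pos: "0 < kcoeff n"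
  by (simp add: kcoeff_def)

lemma kappa_ln: "kappa z = ((1 + z) * ln (1 + z) + (1 - z) * ln (1 - z)) / (2 * ln 2)"
  by (simp add: kappa_def log_def field_simps)

lemma kcoeff_sums: "kcoeff sums 1"
proof -
  have "(\<lambda>n. sum (\<lambda>k. (-1) ^ k / real_of_nat (Suc k)) {n * 2..<n * 2 + 2}) sums ln 2"
    by (rule sums_group[OF alternating_harmonic_series_sums]) simp
  moreover have "sum (\<lambda>k. (-1) ^ k / real_of_nat (Suc k)) {n * 2..<n * 2 + 2} = ln 2 * kcoeff n" for n
  proof -
    have "{n * 2..<n * 2 + 2} = {n * 2, Suc (n * 2)}" by auto
    then show ?thesis by (simp add: kcoeff_def divide_simps) (simp add: algebra_simps)
  qed
  ultimately have "(\<lambda>n. ln 2 * kcoeff n) sums (ln 2 * 1)" by simp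
  then show ?thesis by (subst (asm) sums_mult_iff) auto
qed

text \<open>The numerator of \<open>kappa\<close> is ln (1 + z) + ln (1 - z) + z (ln (1 + z) - ln (1
  - z)). The first two terms combine to ln (1 - z^2), so only even powers occur. The endpoints are
  treated through \<open>kcoeff_sums\<close>, since there a logarithm is singular.\<close>

lemma kappa_sums_aux:
  assumes "\<bar>z\<bar> \<le> 1" shows "(\<lambda>n. kcoeff n * z ^ (2 * n + 2)) sums kappa z"
proof (cases "\<bar>z\<bar> = 1")
  case True
  then have "z = 1 \<or> z = -1" by auto
  then have "kappa z = 1" "z ^ (2 * n + 2) = 1" for n by (auto simp: kappa_def)
  then show ?thesis using kcoeff_sums by simp
next
  case False
  then have z: "\<bar>z\<bar> < 1" using assms by simp
  have lnp: "(\<lambda>n. (-1) ^ n * (1 / real (n + 1)) * y ^ Suc n) sums ln (1 + y)" if "\<bar>y\<bar> < 1" for y :: real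
  proof -
    have "ln (1 + y) = (\<Sum>n. (-1) ^ n * (1 / real (n + 1)) * (1 + y - 1) ^ Suc n)"
      using that by (intro ln_series) auto
    moreover have "summable (\<lambda>n. (-1) ^ n * (1 / real (n + 1)) * y ^ Suc n)"
    proof (rule summable_comparison_test'[of "\<lambda>n. \<bar>y\<bar> ^ Suc n" 0])
      show "summable (\<lambda>n. \<bar>y\<bar> ^ Suc n)" using that summable_geometric[of "\<bar>y\<bar>"] summable_Suc_iff by auto
      show "norm ((-1) ^ n * (1 / real (n + 1)) * y ^ Suc n) \<le> \<bar>y\<bar> ^ Suc n" for n
      proof -
        have "\<bar>y\<bar> ^ Suc n / (real n + 1) \<le> \<bar>y\<bar> ^ Suc n / 1" by (intro divide_left_mono) auto
        then show ?thesis by (simp add: abs_mult power_abs add.commute)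
      qed
    qed
    ultimately show ?thesis by (simp add: sums_iff)
  qed
  have "\<bar>- (z\<^sup>2)\<bar> < 1" using z by (simp add: power2_eq_square abs_mult_self_eq abs_square_less_1[unfolded power2_eq_square])
  from lnp[OF this] have "(\<lambda>n. - (1 / real (n + 1) * z ^ (2 * n + 2))) sums ln (1 - z\<^sup>2)"
  proof -
    have "(-1) ^ n * (1 / real (n + 1)) * (- (z\<^sup>2)) ^ Suc n = - (1 / real (n + 1) * z ^ (2 * n + 2))" for n
    proof -
      have "(- (z\<^sup>2)) ^ Suc n = - ((-1) ^ n * z ^ (2 * n + 2))"
        using power_minus[of "z\<^sup>2" n] by (simp add: power_mult power2_eq_square)
      then show ?thesis by (simp add: mult.assoc[symmetric] power_mult_distrib[symmetric])
    qed
    then show ?thesis using lnp[OF \<open>\<bar>- (z\<^sup>2)\<bar> < 1\<close>] by simp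
  qed
  moreover have "ln (1 - z\<^sup>2) = ln (1 + z) + ln (1 - z)"
  proof -
    have "1 - z\<^sup>2 = (1 + z) * (1 - z)" by (simp add: power2_eq_square algebra_simps)
    then show ?thesis using z by (simp add: ln_mult_pos)
  qed
  ultimately have 1: "(\<lambda>n. - (1 / real (n + 1) * z ^ (2 * n + 2))) sums (ln (1 + z) + ln (1 - z))" by simp
  have "(\<lambda>n. (-1) ^ n * (1 / real (n + 1)) * z ^ Suc n - (-1) ^ n * (1 / real (n + 1)) * (- z) ^ Suc n) sums (ln (1 + z) - ln (1 + - z))"
    using z by (intro sums_diff lnp) auto
  moreover have "(-1) ^ n * (1 / real (n + 1)) * z ^ Suc n - (-1) ^ n * (1 / real (n + 1)) * (- z) ^ Suc n =
      (if even n then 2 / real (n + 1) * z ^ Suc n else 0)" for n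
    by (auto simp: power_minus_odd)
  ultimately have "(\<lambda>n. if even n then 2 / real (n + 1) * z ^ Suc n else 0) sums (ln (1 + z) - ln (1 - z))" by simp
  then have "(\<lambda>n. (\<lambda>n. if even n then 2 / real (n + 1) * z ^ Suc n else 0) (2 * n)) sums (ln (1 + z) - ln (1 - z))"
    by (subst sums_mono_reindex) (auto simp: strict_mono_def elim!: evenE)
  then have "(\<lambda>n. 2 / real (2 * n + 1) * z ^ Suc (2 * n)) sums (ln (1 + z) - ln (1 - z))" by simp
  from sums_add[OF 1 sums_mult[OF this, of z]]
  have "(\<lambda>n. - (1 / real (n + 1) * z ^ (2 * n + 2)) + z * (2 / real (2 * n + 1) * z ^ Suc (2 * n))) sums
     (ln (1 + z) + ln (1 - z) + z * (ln (1 + z) - ln (1 - z)))" .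
  from sums_divide[OF this, of "2 * ln 2"]
  have "(\<lambda>n. (- (1 / real (n + 1) * z ^ (2 * n + 2)) + z * (2 / real (2 * n + 1) * z ^ Suc (2 * n))) / (2 * ln 2)) sums kappa z"
    unfolding kappa_ln by (simp add: algebra_simps)
  moreover have "(- (1 / real (n + 1) * z ^ (2 * n + 2)) + z * (2 / real (2 * n + 1) * z ^ Suc (2 * n))) / (2 * ln 2) = kcoeff n * z ^ (2 * n + 2)" for n
  proof -
    have "- (1 / real (n + 1) * z ^ (2 * n + 2)) + z * (2 / real (2 * n + 1) * z ^ Suc (2 * n)) =
        (2 / real (2 * n + 1) - 1 / real (n + 1)) * z ^ (2 * n + 2)" by (simp add: algebra_simps)
    also have "2 / real (2 * n + 1) - 1 / real (n + 1) = 2 * ln 2 * kcoeff n"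
      unfolding kcoeff_def by (simp add: divide_simps)
    finally show ?thesis by simp
  qed
  ultimately show ?thesis by simp
qed

lemma kappa_sums: "\<bar>z\<bar> \<le> 1 \<Longrightarrow> (\<lambda>n. kcoeff n * (z\<^sup>2) ^ Suc n) sums kappa z"
proof -
  have "z ^ (2 * n + 2) = (z\<^sup>2) ^ Suc n" for n
    by (simp add: power_mult power2_eq_square)
  then show "\<bar>z\<bar> \<le> 1 \<Longrightarrow> (\<lambda>n. kcoeff n * (z\<^sup>2) ^ Suc n) sums kappa z"
    using kappa_sums_aux[of z] by presburger
qed

lemma kappa_minus: "kappa (- z) = kappa z"
  by (simp add: kappa_def)

lemma kappa_0: "kappa 0 = 0" and kappa_1: "kappa 1 = 1"
  by (simp_all add: kappa_def)

lemma kappa_nonneg: "\<bar>z\<bar> \<le> 1 \<Longrightarrow> 0 \<le> kappa z"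
  by (rule sums_le[OF _ sums_zero kappa_sums]) (auto intro!: mult_nonneg_nonneg less_imp_le[OF kcoeff_pos])

text \<open>In each term of the series the power of \<open>f\<^sup>2\<close> is at most
  \<open>f\<^sup>2\<close> itself.\<close>

lemma kappa_mult_le:
  assumes "\<bar>x\<bar> \<le> 1" "\<bar>f\<bar> \<le> 1" shows "kappa (x * f) \<le> f\<^sup>2 * kappa x"
proof -
  have xf: "\<bar>x * f\<bar> \<le> 1" using assms by (simp add: abs_mult mult_le_one)
  have "kcoeff n * ((x * f)\<^sup>2) ^ Suc n \<le> f\<^sup>2 * (kcoeff n * (x\<^sup>2) ^ Suc n)" for n
  proof -
    have "(f\<^sup>2) ^ Suc n \<le> f\<^sup>2"
      using assms(2) power_decreasing[of 1 "Suc n" "f\<^sup>2"] by (simp add: abs_square_le_1)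
    then have "(x\<^sup>2) ^ Suc n * (f\<^sup>2) ^ Suc n \<le> (x\<^sup>2) ^ Suc n * f\<^sup>2" by (intro mult_left_mono) auto
    then have "((x * f)\<^sup>2) ^ Suc n \<le> f\<^sup>2 * (x\<^sup>2) ^ Suc n"
      by (simp only: power_mult_distrib mult.commute)
    then show ?thesis using kcoeff_pos[of n] by (simp add: mult.left_commute)
  qed
  then show ?thesis
    using sums_le[OF _ kappa_sums[OF xf] sums_mult[OF kappa_sums[OF assms(1)], of "f\<^sup>2"]] by blast
qed

lemma kappa_le_sq: "\<bar>z\<bar> \<le> 1 \<Longrightarrow> kappa z \<le> z\<^sup>2"
  using kappa_mult_le[of 1 z] by (simp add: kappa_1)

lemma kappa_le_1: "\<bar>z\<bar> \<le> 1 \<Longrightarrow> kappa z \<le> 1"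
  using kappa_le_sq[of z] by (meson abs_square_le_1 order_trans)

lemma kappa_diff_ge:
  assumes "\<bar>z\<bar> \<le> 1" "y\<^sup>2 \<le> z\<^sup>2" shows "kcoeff 0 * (z\<^sup>2 - y\<^sup>2) \<le> kappa z - kappa y"
proof -
  have y: "\<bar>y\<bar> \<le> 1" using assms by (meson abs_square_le_1 order_trans)
  have s: "(\<lambda>n. kcoeff n * (z\<^sup>2) ^ Suc n - kcoeff n * (y\<^sup>2) ^ Suc n) sums (kappa z - kappa y)"
    by (intro sums_diff kappa_sums assms y)
  have "0 \<le> kcoeff n * (z\<^sup>2) ^ Suc n - kcoeff n * (y\<^sup>2) ^ Suc n" for n
  proof -
    have "(y\<^sup>2) ^ Suc n \<le> (z\<^sup>2) ^ Suc n" using assms(2) by (rule power_mono) simp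
    then show ?thesis using kcoeff_pos[of n] by (simp only: right_diff_distrib[symmetric]) simp
  qed
  then have "(\<Sum>n<1. kcoeff n * (z\<^sup>2) ^ Suc n - kcoeff n * (y\<^sup>2) ^ Suc n) \<le> kappa z - kappa y"
    using sum_le_suminf[OF sums_summable[OF s], of "{..<1}"] sums_unique[OF s] by auto
  then show ?thesis by (simp add: power2_eq_square right_diff_distrib)
qed

lemma power_tangent:
  fixes y b :: real assumes "0 \<le> y" "0 \<le> b"
  shows "b ^ Suc n + real (Suc n) * b ^ n * (y - b) \<le> y ^ Suc n"
proof (induction n)
  case 0
  then show ?case by simp
next
  case (Suc n)
  have "y * (b ^ Suc n + real (Suc n) * b ^ n * (y - b)) \<le> y * y ^ Suc n"
    using Suc assms(1) by (rule mult_left_mono)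
  moreover have "y * (b ^ Suc n + real (Suc n) * b ^ n * (y - b)) =
      b ^ Suc (Suc n) + real (Suc (Suc n)) * b ^ Suc n * (y - b) + real (Suc n) * b ^ n * (y - b)\<^sup>2"
    by (simp add: power2_eq_square algebra_simps)
  moreover have "0 \<le> real (Suc n) * b ^ n * (y - b)\<^sup>2" using assms by simp
  ultimately show ?case by simp
qed

text \<open>As a function of \<open>z\<^sup>2\<close> the series is convex, each term lying above
  its tangent; the series of slopes converges because \<open>z0 < 1\<close>. Integrated against a
  law, the tangent serves as Jensen's inequality and spares a separate study of the curvature of the
  inverse function.\<close>

lemma kappa_tangent:
  assumes "0 < z0" "z0 < 1"
  obtains s where "0 < s" "\<And>z. \<bar>z\<bar> \<le> 1 \<Longrightarrow> kappa z0 + s * (z\<^sup>2 - z0\<^sup>2) \<le> kappa z"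
proof -
  let ?b = "z0\<^sup>2"
  let ?t = "\<lambda>n. kcoeff n * (real (Suc n) * ?b ^ n)"
  have b: "0 < ?b" "?b < 1" using assms by (auto simp: power_less_one_iff abs_square_less_1)
  have t: "?t n = ?b ^ n / (2 * real (2 * n + 1) * ln 2)" for n
    unfolding kcoeff_def by (simp add: divide_simps) (simp add: algebra_simps)
  have "summable ?t"
  proof (rule summable_comparison_test'[of "\<lambda>n. ?b ^ n / (2 * ln 2)" 0])
    show "summable (\<lambda>n. ?b ^ n / (2 * ln 2))" using b by (intro summable_divide summable_geometric) auto
    show "norm (?t n) \<le> ?b ^ n / (2 * ln 2)" for n
    proof -
      have "?b ^ n / (2 * real (2 * n + 1) * ln 2) \<le> ?b ^ n / (2 * ln 2)"
        using b by (intro divide_left_mono) auto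
      then show ?thesis unfolding t using b by simp
    qed
  qed
  then have st: "?t sums suminf ?t" by (rule summable_sums)
  have pos: "0 < ?t n" for n using b kcoeff_pos[of n] by simp
  show ?thesis
  proof
    show "0 < suminf ?t" using \<open>summable ?t\<close> pos by (rule suminf_pos)
    fix z :: real assume z: "\<bar>z\<bar> \<le> 1"
    have "kcoeff n * (z0\<^sup>2) ^ Suc n + ?t n * (z\<^sup>2 - ?b) \<le> kcoeff n * (z\<^sup>2) ^ Suc n" for n
    proof -
      have "kcoeff n * (?b ^ Suc n + real (Suc n) * ?b ^ n * (z\<^sup>2 - ?b)) \<le> kcoeff n * (z\<^sup>2) ^ Suc n"
        by (intro mult_left_mono power_tangent less_imp_le[OF kcoeff_pos]) auto
      then show ?thesis by (simp only: distrib_left mult.assoc)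
    qed
    then show "kappa z0 + suminf ?t * (z\<^sup>2 - z0\<^sup>2) \<le> kappa z"
      using assms by (intro sums_le[OF _ sums_add[OF kappa_sums[of z0] sums_mult2[OF st]] kappa_sums[OF z]]) auto
  qed
qed

text \<open>The summable majorant \<open>kcoeff\<close> gives uniform convergence up to the
  endpoints, where the logarithms of the definition are singular.\<close>

lemma continuous_on_kappa: "continuous_on {-1..1} kappa"
proof -
  have "uniform_limit {-1..1} (\<lambda>n z. \<Sum>i<n. kcoeff i * (z\<^sup>2) ^ Suc i) (\<lambda>z. \<Sum>i. kcoeff i * (z\<^sup>2) ^ Suc i) sequentially"
  proof (rule Weierstrass_m_test[OF _ sums_summable[OF kcoeff_sums]])
    fix n and z :: real assume "z \<in> {-1..1}"
    then have "\<bar>z\<bar> \<le> 1" by auto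
    then have "(z\<^sup>2) ^ Suc n \<le> 1" by (subst power_le_one) (simp_all add: abs_square_le_1)
    then show "norm (kcoeff n * (z\<^sup>2) ^ Suc n) \<le> kcoeff n"
      using kcoeff_pos[of n] by (simp only: real_norm_def abs_mult power_abs abs_power2) (simp add: mult_left_le)
  qed
  then have "continuous_on {-1..1} (\<lambda>z::real. \<Sum>i. kcoeff i * (z\<^sup>2) ^ Suc i)"
    by (rule uniform_limit_theorem[rotated]) (auto intro!: always_eventually continuous_intros)
  moreover have "(\<Sum>i. kcoeff i * (z\<^sup>2) ^ Suc i) = kappa z" if "z \<in> {-1..1}" for z
    using sums_unique[OF kappa_sums[of z]] that by (simp add: abs_le_iff)
  ultimately show ?thesis by (subst (asm) continuous_on_cong[OF refl]) auto
qed

lemma kappa_strict_mono: "0 \<le> y \<Longrightarrow> y < z \<Longrightarrow> z \<le> 1 \<Longrightarrow> kappa y < kappa z"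
proof -
  assume a: "0 \<le> y" "y < z" "z \<le> 1"
  then have "y\<^sup>2 < z\<^sup>2" by (simp add: power_strict_mono)
  moreover have "kcoeff 0 * (z\<^sup>2 - y\<^sup>2) \<le> kappa z - kappa y" using a by (intro kappa_diff_ge) (auto intro: power_mono)
  ultimately show "kappa y < kappa z" using kcoeff_pos[of 0] by (smt (verit) mult_pos_pos)
qed

lemma kappa_inverse:
  assumes "0 \<le> u" "u \<le> 1" obtains z where "0 \<le> z" "z \<le> 1" "kappa z = u"
proof -
  have "continuous_on {0..1} kappa" using continuous_on_kappa by (rule continuous_on_subset) auto
  then have "\<exists>z\<ge>0. z \<le> 1 \<and> kappa z = u" using assms by (intro IVT') (auto simp: kappa_0 kappa_1)
  then show ?thesis using that by blast
qed

section \<open>Inverse entropy and the functions \<open>psi\<close> and \<open>Psi\<close>\<close>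

lemma hb_kappa:
  assumes "0 \<le> x" "x \<le> 1" shows "hb x = 1 - kappa (1 - 2 * x)"
proof -
  have l: "(2 * x) * log 2 (2 * x) = 2 * x + 2 * x * log 2 x" if "0 \<le> x" for x :: real
    using that by (cases "x = 0") (auto simp: log_mult algebra_simps)
  have e: "1 + (1 - 2 * x) = 2 * (1 - x)" "1 - (1 - 2 * x) = 2 * x" by auto
  have "kappa (1 - 2 * x) = (2 * (1 - x) + 2 * (1 - x) * log 2 (1 - x) + (2 * x + 2 * x * log 2 x)) / 2"
    unfolding kappa_def e using l[of x] l[of "1 - x"] assms by simp
  then show ?thesis unfolding hb_def by (simp add: field_simps)
qed

lemma hb_inv_kappa:
  assumes "0 \<le> z" "z \<le> 1" shows "1 - 2 * hb_inv (1 - kappa z) = z"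
proof -
  have "hb_inv (1 - kappa z) = (1 - z) / 2"
    unfolding hb_inv_def
  proof (rule the_equality)
    show "0 \<le> (1 - z) / 2 \<and> (1 - z) / 2 \<le> 1 / 2 \<and> hb ((1 - z) / 2) = 1 - kappa z"
      using assms hb_kappa[of "(1 - z) / 2"] by (simp add: diff_divide_distrib)
    fix x :: real assume x: "0 \<le> x \<and> x \<le> 1 / 2 \<and> hb x = 1 - kappa z"
    then have "kappa (1 - 2 * x) = kappa z" using hb_kappa[of x] by simp
    then have "1 - 2 * x = z"
      using kappa_strict_mono[of z "1 - 2 * x"] kappa_strict_mono[of "1 - 2 * x" z] x assms
      by (cases "1 - 2 * x" z rule: linorder_cases) auto
    then show "x = (1 - z) / 2" by simp
  qed
  then show ?thesis by simp
qed

text \<open>A binary symmetric channel of bias \<open>z\<close> has capacity \<open>kappa z\<close>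
  and mean square error \<open>1 - z\<^sup>2\<close>; thus \<open>psi\<close> converts the
  conditional entropy of such a channel into its mean square error.\<close>

lemma psi_kappa: "0 \<le> z \<Longrightarrow> z \<le> 1 \<Longrightarrow> psi (1 - kappa z) = 1 - z\<^sup>2"
  by (simp add: psi_def hb_inv_kappa)

lemma psi_mono:
  assumes "0 \<le> u" "u \<le> v" "v \<le> 1" shows "psi u \<le> psi v"
proof -
  obtain y where y: "0 \<le> y" "y \<le> 1" "kappa y = 1 - v" using kappa_inverse[of "1 - v"] assms by auto
  obtain z where z: "0 \<le> z" "z \<le> 1" "kappa z = 1 - u" using kappa_inverse[of "1 - u"] assms by auto
  have "y \<le> z" using kappa_strict_mono[of z y] y z assms by (cases "y \<le> z") auto
  then have "y\<^sup>2 \<le> z\<^sup>2" using y by (simp add: power_mono)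
  moreover have "psi u = 1 - z\<^sup>2" "psi v = 1 - y\<^sup>2" using psi_kappa[of z] psi_kappa[of y] y z by auto
  ultimately show ?thesis by simp
qed

lemma psi_pos:
  assumes "0 < u" "u \<le> 1" shows "0 < psi u"
proof -
  obtain z where z: "0 \<le> z" "z \<le> 1" "kappa z = 1 - u" using kappa_inverse[of "1 - u"] assms by auto
  then have "z \<noteq> 1" using assms kappa_1 by auto
  then have "z\<^sup>2 < 1" using z by (simp add: power_less_one_iff abs_square_less_1)
  then show ?thesis using psi_kappa[of z] z by simp
qed

text \<open>Up to an affine map, \<open>hb_inv\<close> inverts a continuous injection on a compact
  interval.\<close>

lemma continuous_on_psi: "continuous_on {0..1} psi"
proof -
  have "continuous_on ((\<lambda>z. 1 - kappa z) ` {0..1}) (\<lambda>u. 1 - 2 * hb_inv u)"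
    using continuous_on_subset[OF continuous_on_kappa, of "{0..1}"] hb_inv_kappa
    by (intro continuous_on_inv continuous_intros) auto
  moreover have "(\<lambda>z. 1 - kappa z) ` {0..1} = {0..1}"
  proof
    show "(\<lambda>z. 1 - kappa z) ` {0..1} \<subseteq> {0..1}" using kappa_nonneg kappa_le_1 by auto
    show "{0..1} \<subseteq> (\<lambda>z. 1 - kappa z) ` {0..1}"
    proof
      fix u :: real assume u: "u \<in> {0..1}"
      obtain z where "0 \<le> z" "z \<le> 1" "kappa z = 1 - u" using kappa_inverse[of "1 - u"] u by auto
      then show "u \<in> (\<lambda>z. 1 - kappa z) ` {0..1}" by (intro image_eqI[of _ _ z]) auto
    qed
  qed
  ultimately have "continuous_on {0..1} (\<lambda>u. 1 - 2 * hb_inv u)" by simp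
  from continuous_on_diff[OF continuous_on_const continuous_on_power[OF this]]
  show ?thesis unfolding psi_def[abs_def] .
qed

lemma psi_integrable: "0 \<le> a \<Longrightarrow> b \<le> 1 \<Longrightarrow> psi integrable_on {a..b}"
  by (intro integrable_continuous_interval continuous_on_subset[OF continuous_on_psi]) auto

text \<open>The interpolation argument produces \<open>psi\<close> at the excess rate in its
  denominator. By monotonicity \<open>Psi u\<close> is at most \<open>u * psi u\<close>, so the
  bound with \<open>Psi\<close> follows.\<close>

lemma Psi_le_psi:
  assumes "0 \<le> u" "u \<le> 1" shows "Psi u \<le> psi u"
proof -
  have "0 \<le> psi u" using psi_pos[of u] assms psi_kappa[of 1] kappa_1 by (cases "u = 0") auto
  have "Psi u \<le> integral {0..u} (\<lambda>_. psi u)"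
    unfolding Psi_def using assms by (intro integral_le psi_integrable psi_mono) auto
  also have "\<dots> = u * psi u" using assms by simp
  also have "\<dots> \<le> 1 * psi u" using assms \<open>0 \<le> psi u\<close> by (intro mult_right_mono) auto
  finally show ?thesis by simp
qed

lemma Psi_mono:
  assumes "0 \<le> u" "u \<le> v" "v \<le> 1" shows "Psi u \<le> Psi v"
proof -
  have "Psi v = Psi u + integral {u..v} psi"
    unfolding Psi_def using assms by (intro Henstock_Kurzweil_Integration.integral_combine[symmetric] psi_integrable) auto
  moreover have "0 \<le> integral {u..v} psi"
  proof (rule integral_nonneg)
    show "psi integrable_on {u..v}" using assms by (intro psi_integrable) auto
    fix x assume "x \<in> {u..v}"
    then show "0 \<le> psi x" using psi_pos[of x] assms psi_kappa[of 1] kappa_1 by (cases "x = 0") auto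
  qed
  ultimately show ?thesis by simp
qed

lemma Psi_pos:
  assumes "0 < u" "u \<le> 1" shows "0 < Psi u"
proof -
  have "Psi u = Psi (u / 2) + integral {u/2..u} psi"
    unfolding Psi_def using assms by (intro Henstock_Kurzweil_Integration.integral_combine[symmetric] psi_integrable) auto
  moreover have "0 \<le> Psi (u / 2)" using Psi_mono[of 0 "u / 2"] assms by (simp add: Psi_def)
  moreover have "integral {u/2..u} (\<lambda>_. psi (u / 2)) \<le> integral {u/2..u} psi"
    using assms by (intro integral_le psi_integrable psi_mono) auto
  moreover have "0 < u / 2 * psi (u / 2)" using assms psi_pos[of "u / 2"] by simp
  ultimately show ?thesis using assms by simp
qed

section \<open>Soft outputs of linear codes\<close>

text \<open>A BMS channel is represented by the law on \<open>[-1, 1]\<close>, under the averaged output density, of the soft bit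
  \<open>E[X | Y]\<close> for a uniform input \<open>X\<close>. Erasure is the point mass at \<open>0\<close>, full revelation is the fair law on \<open>\<plusminus>1\<close>.\<close>

definition BB :: "real measure" where
  "BB = restrict_space borel {-1..1}"

definition cube :: "nat \<Rightarrow> (nat \<Rightarrow> real) measure" where
  "cube N = PiM {..<N} (\<lambda>_. BB)"

definition iid :: "nat \<Rightarrow> real measure \<Rightarrow> (nat \<Rightarrow> real) measure" where
  "iid N M = PiM {..<N} (\<lambda>_. M)"

text \<open>Invariance under sign change is phrased through bounded test functions, the form in
  which every integral uses it.\<close>

definition sym_law :: "real measure \<Rightarrow> bool" where
  "sym_law M \<longleftrightarrow> law BB M \<and> (\<forall>f. bmeas BB f \<longrightarrow> (\<integral>x. f (- x) \<partial>M) = (\<integral>x. f x \<partial>M))"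

lemma space_BB: "space BB = {-1..1}"
  by (simp add: BB_def space_restrict_space)

lemma sym_law_law: "sym_law M \<Longrightarrow> law BB M"
  by (simp add: sym_law_def)

lemma sym_law_integral: "sym_law M \<Longrightarrow> bmeas BB f \<Longrightarrow> (\<integral>x. f (- x) \<partial>M) = (\<integral>x. f x \<partial>M)"
  by (simp add: sym_law_def)

lemma bmeas_BB:
  assumes "f \<in> borel_measurable borel" "\<And>x. \<bar>x\<bar> \<le> 1 \<Longrightarrow> \<bar>f x\<bar> \<le> B"
  shows "bmeas BB f"
proof (rule bmeasI[where B=B])
  show "f \<in> borel_measurable BB" unfolding BB_def using assms(1) by (rule measurable_restrict_space1)
  show "\<bar>f x\<bar> \<le> B" if "x \<in> space BB" for x using that assms(2)[of x] by (simp add: space_BB abs_le_iff)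
qed

lemma bmeas_BB_id: "bmeas BB (\<lambda>x. x)"
  by (rule bmeas_BB[where B=1]) auto

lemma sym_law_mean:
  assumes "sym_law M" shows "(\<integral>x. x \<partial>M) = 0"
  using sym_law_integral[OF assms bmeas_BB_id] by simp

lemma space_cube: "space (cube N) = PiE {..<N} (\<lambda>_. {-1..1})"
  by (simp add: cube_def space_PiM space_BB)

lemma cube_abs: "l \<in> space (cube N) \<Longrightarrow> j < N \<Longrightarrow> \<bar>l j\<bar> \<le> 1"
  by (auto simp: space_cube PiE_iff abs_le_iff)

lemma cube_upd: "l \<in> space (cube N) \<Longrightarrow> i < N \<Longrightarrow> \<bar>x\<bar> \<le> 1 \<Longrightarrow> l(i := x) \<in> space (cube N)"
  by (auto simp: space_cube PiE_iff extensional_def)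

lemma law_iid: "law BB M \<Longrightarrow> law (cube N) (iid N M)"
  unfolding cube_def iid_def by (rule law_PiM)

lemma bmeas_cube_component:
  assumes "j < N" shows "bmeas (cube N) (\<lambda>l. l j)"
proof -
  have "(\<lambda>l. l j) \<in> measurable (cube N) BB"
    unfolding cube_def using assms by (intro measurable_component_singleton) auto
  then show ?thesis by (rule bmeas_compose[OF _ bmeas_BB_id])
qed

lemma bmeas_cube_upd:
  assumes F: "bmeas (cube N) F" and i: "i < N" and x: "\<bar>x\<bar> \<le> 1"
  shows "bmeas (cube N) (\<lambda>l. F (l(i := x)))"
proof -
  have "insert i {..<N} = {..<N}" using i by auto
  then show ?thesis using bmeas_upd[of i "{..<N}" BB F x] F x unfolding cube_def by (auto simp: space_BB abs_le_iff)
qed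

lemma bmeas_cube_slice:
  assumes F: "bmeas (cube N) F" and i: "i < N" and l: "l \<in> space (cube N)"
  shows "bmeas BB (\<lambda>x. F (l(i := x)))"
proof -
  have "insert i {..<N} = {..<N}" using i by auto
  then show ?thesis using bmeas_slice[of i "{..<N}" BB F l] F l unfolding cube_def by auto
qed

lemma bmeas_cube_partial:
  assumes M: "law BB M" and F: "bmeas (cube N) F" and i: "i < N"
  shows "bmeas (cube N) (\<lambda>l. \<integral>x. F (l(i := x)) \<partial>M)"
proof -
  have "insert i {..<N} = {..<N}" using i by auto
  then show ?thesis using bmeas_partial_integral[OF M, of i "{..<N}" F] F unfolding cube_def by simp
qed

lemma iid_resample:
  assumes M: "law BB M" and F: "bmeas (cube N) F" and i: "i < N"
  shows "(\<integral>l. F l \<partial>iid N M) = (\<integral>l. (\<integral>x. F (l(i := x)) \<partial>M) \<partial>iid N M)"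
  using integral_resample[OF M, of "{..<N}" i F] F i unfolding iid_def cube_def by simp

text \<open>A soft bit of value 0 carries no information, so this erases the observations in
  \<open>K\<close>.\<close>

definition zeroed :: "nat set \<Rightarrow> (nat \<Rightarrow> real) \<Rightarrow> nat \<Rightarrow> real" where
  "zeroed K l = (\<lambda>j. if j \<in> K then 0 else l j)"

lemma iid_zeroed:
  assumes M: "law BB M" and F: "bmeas (cube N) F" and K: "K \<subseteq> {..<N}"
    and z: "\<And>k l. k \<in> K \<Longrightarrow> l \<in> space (cube N) \<Longrightarrow> (\<integral>x. F (l(k := x)) \<partial>M) = F (l(k := 0))"
  shows "(\<integral>l. F l \<partial>iid N M) = (\<integral>l. F (zeroed K l) \<partial>iid N M) \<and> bmeas (cube N) (\<lambda>l. F (zeroed K l))"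
proof -
  have "finite K" using K finite_subset by blast
  then show ?thesis using K F z
  proof (induction K arbitrary: F rule: finite_induct)
    case empty
    then show ?case by (simp add: zeroed_def)
  next
    case (insert k K)
    have k: "k < N" using insert.prems by auto
    let ?G = "\<lambda>l. F (l(k := 0))"
    have bG: "bmeas (cube N) ?G" by (rule bmeas_cube_upd[OF insert.prems(2) k]) simp
    have G: "(\<integral>l. ?G l \<partial>iid N M) = (\<integral>l. ?G (zeroed K l) \<partial>iid N M) \<and> bmeas (cube N) (\<lambda>l. ?G (zeroed K l))"
    proof (rule insert.IH[OF _ bG])
      show "K \<subseteq> {..<N}" using insert.prems by auto
      fix j l assume j: "j \<in> K" and l: "l \<in> space (cube N)"
      then have jk: "j \<noteq> k" using insert.hyps by auto
      have e: "l(j := x, k := 0) = l(k := 0, j := x)" for x using jk by (rule fun_upd_twist)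
      show "(\<integral>x. ?G (l(j := x)) \<partial>M) = ?G (l(j := 0))"
        unfolding e using j by (intro insert.prems(3)[OF _ cube_upd[OF l k]]) auto
    qed
    have e: "?G (zeroed K l) = F (zeroed (insert k K) l)" for l
      by (rule arg_cong[where f=F]) (auto simp: zeroed_def)
    have "(\<integral>l. F l \<partial>iid N M) = (\<integral>l. ?G l \<partial>iid N M)"
      unfolding iid_resample[OF M insert.prems(2) k]
      by (rule law_integral_cong[OF law_iid[OF M]], rule insert.prems(3)) simp_all
    then show ?case using G unfolding e by simp
  qed
qed

text \<open>A symmetric soft bit has mean zero, so integrating out a coordinate on which the
  integrand depends affinely amounts to setting it to 0. As \<open>Du\<close>, \<open>Db\<close> and
  \<open>Nb\<close> are affine in each coordinate, this is how observations are discarded and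
  densities marginalised.\<close>

lemma iid_zeroed_affine:
  assumes M: "sym_law M" and F: "bmeas (cube N) F" and K: "K \<subseteq> {..<N}"
    and aff: "\<And>k l x. k \<in> K \<Longrightarrow> l \<in> space (cube N) \<Longrightarrow> \<bar>x\<bar> \<le> 1 \<Longrightarrow> F (l(k := x)) = F (l(k := 0)) + x * \<beta> k l"
  shows "(\<integral>l. F l \<partial>iid N M) = (\<integral>l. F (zeroed K l) \<partial>iid N M)"
proof (rule conjunct1[OF iid_zeroed[OF sym_law_law[OF M] F K]])
  note L = sym_law_law[OF M]
  fix k l assume k: "k \<in> K" and l: "l \<in> space (cube N)"
  have "(\<integral>x. F (l(k := x)) \<partial>M) = (\<integral>x. F (l(k := 0)) + \<beta> k l * x \<partial>M)"
  proof (rule law_integral_cong[OF L])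
    fix x assume "x \<in> space BB"
    then have "\<bar>x\<bar> \<le> 1" by (simp add: space_BB abs_le_iff)
    from aff[OF k l this] show "F (l(k := x)) = F (l(k := 0)) + \<beta> k l * x" by (simp only: mult.commute)
  qed
  also have "\<dots> = F (l(k := 0)) + \<beta> k l * (\<integral>x. x \<partial>M)"
    by (subst law_integral_add[OF L]) (auto intro: bmeas_const bmeas_cmult bmeas_BB_id simp: law_measure[OF L])
  finally show "(\<integral>x. F (l(k := x)) \<partial>M) = F (l(k := 0))" by (simp add: sym_law_mean[OF M])
qed

definition flip :: "(nat \<Rightarrow> bool) \<Rightarrow> nat \<Rightarrow> (nat \<Rightarrow> real) \<Rightarrow> nat \<Rightarrow> real" where
  "flip v N l = (\<lambda>j\<in>{..<N}. bpsk (v j) * l j)"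

lemma bpsk_sq: "bpsk b * bpsk b = 1" and bpsk_abs: "\<bar>bpsk b\<bar> = 1"
  and bpsk_cases: "bpsk b = 1 \<or> bpsk b = -1"
  by (auto simp: bpsk_def)

lemma iid_flip:
  assumes M: "sym_law M" and F: "bmeas (cube N) F"
  shows "(\<integral>l. F (flip v N l) \<partial>iid N M) = (\<integral>l. F l \<partial>iid N M)"
proof -
  note L = sym_law_law[OF M]
  interpret prob_space M using L by (rule law_prob)
  have m: "(\<lambda>x. bpsk b * x) \<in> measurable BB BB" for b
    unfolding BB_def by (rule measurable_restrict_space3) (auto simp: bpsk_def)
  then have g: "(\<lambda>x. bpsk b * x) \<in> measurable M BB" for b
    using measurable_cong_sets[OF law_sets[OF L] refl] by blast
  have "(\<integral>l. F l \<partial>PiM {..<N} (\<lambda>_. M)) =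
      (\<integral>y. (\<Prod>j\<in>{..<N}. 1) * F (\<lambda>j\<in>{..<N}. bpsk (v j) * y j) \<partial>PiM {..<N} (\<lambda>_. M))"
  proof (rule integral_PiM_transfer[OF _ _ _ g L])
    show "sigma_finite_measure M" by unfold_locales
    show "(\<integral>x. f x \<partial>M) = (\<integral>x. 1 * f (bpsk (v j) * x) \<partial>M)" if "bmeas BB f" for j f
      using sym_law_integral[OF M that] by (simp add: bpsk_def)
  qed (use F in \<open>auto simp: cube_def\<close>)
  then show ?thesis by (simp add: iid_def flip_def)
qed

text \<open>Densities with respect to the product of the soft-bit laws: \<open>Du N u\<close> of the soft outputs given the codeword \<open>u\<close>,
  \<open>Db C N\<close> of the soft outputs for a uniform codeword. The posterior mean of \<open>X\<^sub>i\<close> is \<open>Nb C N i / Db C N\<close>.\<close>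

definition Du :: "nat \<Rightarrow> (nat \<Rightarrow> bool) \<Rightarrow> (nat \<Rightarrow> real) \<Rightarrow> real" where
  "Du N u l = (\<Prod>j<N. 1 + bpsk (u j) * l j)"

definition Db :: "(nat \<Rightarrow> bool) set \<Rightarrow> nat \<Rightarrow> (nat \<Rightarrow> real) \<Rightarrow> real" where
  "Db C N l = (\<Sum>u\<in>C. Du N u l) / card C"

definition Nb :: "(nat \<Rightarrow> bool) set \<Rightarrow> nat \<Rightarrow> nat \<Rightarrow> (nat \<Rightarrow> real) \<Rightarrow> real" where
  "Nb C N i l = (\<Sum>u\<in>C. bpsk (u i) * Du N u l) / card C"

lemma Du_cong: "(\<And>j. j < N \<Longrightarrow> l j = l' j) \<Longrightarrow> Du N u l = Du N u l'"
  unfolding Du_def by (intro prod.cong) auto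

lemma Db_cong: "(\<And>j. j < N \<Longrightarrow> l j = l' j) \<Longrightarrow> Db C N l = Db C N l'"
  unfolding Db_def using Du_cong[of N l l'] by simp

lemma Nb_cong: "(\<And>j. j < N \<Longrightarrow> l j = l' j) \<Longrightarrow> Nb C N i l = Nb C N i l'"
  unfolding Nb_def using Du_cong[of N l l'] by simp

lemma Du_nonneg:
  assumes "l \<in> space (cube N)" shows "0 \<le> Du N u l"
  unfolding Du_def
proof (rule prod_nonneg)
  fix j assume "j \<in> {..<N}"
  then have "\<bar>bpsk (u j) * l j\<bar> \<le> 1" using cube_abs[OF assms, of j] by (simp add: abs_mult bpsk_abs)
  then show "0 \<le> 1 + bpsk (u j) * l j" by (simp add: abs_le_iff)
qed

lemma Du_upd: "i < N \<Longrightarrow> Du N u (l(i := x)) = (1 + bpsk (u i) * x) * Du N u (l(i := 0))"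
proof -
  assume i: "i < N"
  have "Du N u (l(i := y)) = (1 + bpsk (u i) * y) * (\<Prod>j\<in>{..<N} - {i}. 1 + bpsk (u j) * l j)" for y
    unfolding Du_def using i by (subst prod.remove[of _ i]) (auto intro!: arg_cong2[where f="(*)"] prod.cong)
  then show ?thesis by simp
qed

lemma Db_upd: "i < N \<Longrightarrow> Db C N (l(i := x)) = Db C N (l(i := 0)) + x * Nb C N i (l(i := 0))"
proof -
  assume i: "i < N"
  have "(\<Sum>u\<in>C. Du N u (l(i := x))) = (\<Sum>u\<in>C. Du N u (l(i := 0))) + x * (\<Sum>u\<in>C. bpsk (u i) * Du N u (l(i := 0)))"
    unfolding sum_distrib_left sum.distrib[symmetric]
    by (rule sum.cong[OF refl]) (subst Du_upd[OF i], simp add: algebra_simps)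
  then show ?thesis unfolding Db_def Nb_def by (simp add: add_divide_distrib)
qed

text \<open>The sign of bit \<open>i\<close> occurs twice in the linear term and cancels, which
  turns \<open>Nb\<close> into \<open>Db\<close>. Together with \<open>Db_upd\<close> this is Bayes'
  rule for adding the observation \<open>x\<close> of bit \<open>i\<close>.\<close>

lemma Nb_upd: "i < N \<Longrightarrow> Nb C N i (l(i := x)) = Nb C N i (l(i := 0)) + x * Db C N (l(i := 0))"
proof -
  assume i: "i < N"
  have "(\<Sum>u\<in>C. bpsk (u i) * Du N u (l(i := x))) = (\<Sum>u\<in>C. bpsk (u i) * Du N u (l(i := 0))) + x * (\<Sum>u\<in>C. Du N u (l(i := 0)))"
    unfolding sum_distrib_left sum.distrib[symmetric]
  proof (rule sum.cong[OF refl])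
    fix u
    have "b * ((1 + b * x) * d) = b * d + (b * b) * (x * d)" for b d :: real by (simp add: algebra_simps)
    from this[of "bpsk (u i)"] show "bpsk (u i) * Du N u (l(i := x)) = bpsk (u i) * Du N u (l(i := 0)) + x * Du N u (l(i := 0))"
      unfolding Du_upd[OF i, of u l x] bpsk_sq by simp
  qed
  then show ?thesis unfolding Db_def Nb_def by (simp add: add_divide_distrib)
qed

lemma Du_flip:
  "Du N u (flip v N l) = Du N (bxor u v) l"
  unfolding Du_def flip_def by (intro prod.cong) (auto simp: bxor_def bpsk_def)

lemma bmeas_Du: "bmeas (cube N) (Du N u)"
proof -
  have "bmeas (cube N) (\<lambda>l. \<Prod>j<N. 1 + bpsk (u j) * l j)"
    by (intro bmeas_intros bmeas_cube_component) auto
  then show ?thesis unfolding Du_def[abs_def] .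
qed

lemma bmeas_Db: "bmeas (cube N) (Db C N)"
proof -
  have "bmeas (cube N) (\<lambda>l. (1 / card C) * (\<Sum>u\<in>C. Du N u l))"
    by (intro bmeas_intros bmeas_Du)
  then show ?thesis unfolding Db_def[abs_def] by simp
qed

lemma bmeas_Nb: "bmeas (cube N) (Nb C N i)"
proof -
  have "bmeas (cube N) (\<lambda>l. (1 / card C) * (\<Sum>u\<in>C. bpsk (u i) * Du N u l))"
    by (intro bmeas_intros bmeas_Du)
  then show ?thesis unfolding Nb_def[abs_def] by simp
qed

lemma Db_nonneg: "l \<in> space (cube N) \<Longrightarrow> 0 \<le> Db C N l"
  unfolding Db_def by (intro divide_nonneg_nonneg sum_nonneg Du_nonneg) auto

lemma Nb_abs_le: "l \<in> space (cube N) \<Longrightarrow> \<bar>Nb C N i l\<bar> \<le> Db C N l"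
proof -
  assume l: "l \<in> space (cube N)"
  have "\<bar>\<Sum>u\<in>C. bpsk (u i) * Du N u l\<bar> \<le> (\<Sum>u\<in>C. \<bar>bpsk (u i) * Du N u l\<bar>)" by (rule sum_abs)
  also have "\<dots> = (\<Sum>u\<in>C. Du N u l)"
    using Du_nonneg[OF l] by (simp add: abs_mult bpsk_abs)
  finally show ?thesis unfolding Db_def Nb_def by (simp add: divide_right_mono)
qed

lemma iid_Du_one:
  assumes M: "sym_law M" shows "(\<integral>l. Du N u l \<partial>iid N M) = 1"
proof -
  have "(\<integral>l. Du N u l \<partial>iid N M) = (\<integral>l. Du N u (zeroed {..<N} l) \<partial>iid N M)"
  proof (rule iid_zeroed_affine[OF M bmeas_Du, where \<beta>="\<lambda>k l. bpsk (u k) * Du N u (l(k := 0))"])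
    fix k l and x :: real assume "k \<in> {..<N}"
    then show "Du N u (l(k := x)) = Du N u (l(k := 0)) + x * (bpsk (u k) * Du N u (l(k := 0)))"
      by (subst Du_upd) (auto simp: algebra_simps)
  qed simp
  also have "\<dots> = 1"
    using law_measure[OF law_iid[OF sym_law_law[OF M]], of N] by (simp add: Du_def zeroed_def)
  finally show ?thesis .
qed

locale lin_code =
  fixes C :: "(nat \<Rightarrow> bool) set" and N :: nat
  assumes finite_C: "finite C" and C_ne: "C \<noteq> {}" and C_bxor: "\<And>u v. u \<in> C \<Longrightarrow> v \<in> C \<Longrightarrow> bxor u v \<in> C"
begin

lemma card_pos: "0 < card C"
  using finite_C C_ne by (simp add: card_gt_0_iff)

lemma sum_bxor: "v \<in> C \<Longrightarrow> (\<Sum>u\<in>C. G (bxor u v)) = (\<Sum>u\<in>C. (G u :: real))"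
  by (rule sum.reindex_bij_witness[of _ "\<lambda>u. bxor u v" "\<lambda>u. bxor u v"]) (auto simp: C_bxor bxor_cancel)

lemma Db_flip: "v \<in> C \<Longrightarrow> Db C N (flip v N l) = Db C N l"
  unfolding Db_def Du_flip using sum_bxor[of v "\<lambda>u. Du N u l"] by simp

lemma Nb_flip: "v \<in> C \<Longrightarrow> Nb C N i (flip v N l) = bpsk (v i) * Nb C N i l"
proof -
  assume v: "v \<in> C"
  have "bpsk (u i) * Du N (bxor u v) l = bpsk (v i) * (bpsk (bxor u v i) * Du N (bxor u v) l)" for u
  proof -
    have "bpsk (bxor u v i) = bpsk (u i) * bpsk (v i)" by (simp add: bxor_def bpsk_def)
    then have "bpsk (v i) * (bpsk (bxor u v i) * Du N (bxor u v) l) = (bpsk (v i) * bpsk (v i)) * (bpsk (u i) * Du N (bxor u v) l)"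
      by (simp only: mult_ac)
    then show ?thesis unfolding bpsk_sq by (simp only: mult_1)
  qed
  then have "(\<Sum>u\<in>C. bpsk (u i) * Du N u (flip v N l)) = (\<Sum>u\<in>C. bpsk (v i) * (bpsk (bxor u v i) * Du N (bxor u v) l))"
    by (intro sum.cong refl) (simp only: Du_flip)
  also have "\<dots> = (\<Sum>u\<in>C. bpsk (v i) * (bpsk (u i) * Du N u l))"
    using sum_bxor[OF v, of "\<lambda>u. bpsk (v i) * (bpsk (u i) * Du N u l)"] by simp
  finally show ?thesis unfolding Nb_def by (simp add: sum_distrib_left)
qed

lemma iid_Db_one: "sym_law M \<Longrightarrow> (\<integral>l. Db C N l \<partial>iid N M) = 1"
proof -
  assume M: "sym_law M"
  have "(\<integral>l. (\<Sum>u\<in>C. Du N u l) \<partial>iid N M) = (\<Sum>u\<in>C. \<integral>l. Du N u l \<partial>iid N M)"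
    by (intro Bochner_Integration.integral_sum law_integrable[OF law_iid[OF sym_law_law[OF M]] bmeas_Du])
  then show ?thesis unfolding Db_def using card_pos by (simp add: iid_Du_one[OF M])
qed

text \<open>By linearity of the code and symmetry of the channel one may assume that the all-zero codeword is sent.\<close>

lemma iid_Db_zero_codeword:
  assumes M: "sym_law M" and F: "bmeas (cube N) F"
    and inv: "\<And>u l. u \<in> C \<Longrightarrow> l \<in> space (cube N) \<Longrightarrow> F (flip u N l) = F l"
  shows "(\<integral>l. F l * Db C N l \<partial>iid N M) = (\<integral>l. F l * Du N (\<lambda>_. False) l \<partial>iid N M)"
proof -
  note L = law_iid[OF sym_law_law[OF M], of N]
  have "(\<integral>l. F l * Db C N l \<partial>iid N M) = (\<integral>l. (\<Sum>u\<in>C. F l * Du N u l) / card C \<partial>iid N M)"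
    unfolding Db_def by (simp add: sum_distrib_left)
  also have "\<dots> = (\<Sum>u\<in>C. \<integral>l. F l * Du N u l \<partial>iid N M) / card C"
    by (simp add: Bochner_Integration.integral_sum law_integrable[OF L] bmeas_mult F bmeas_Du)
  also have "(\<Sum>u\<in>C. \<integral>l. F l * Du N u l \<partial>iid N M) = (\<Sum>u\<in>C. \<integral>l. F l * Du N (\<lambda>_. False) l \<partial>iid N M)"
  proof (rule sum.cong[OF refl])
    fix u assume u: "u \<in> C"
    have "(\<integral>l. F l * Du N u l \<partial>iid N M) = (\<integral>l. F (flip u N l) * Du N u (flip u N l) \<partial>iid N M)"
      by (rule iid_flip[OF M, symmetric]) (intro bmeas_mult F bmeas_Du)
    also have "\<dots> = (\<integral>l. F l * Du N (\<lambda>_. False) l \<partial>iid N M)"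
      by (rule law_integral_cong[OF L]) (simp add: inv[OF u] Du_flip bxor_self)
    finally show "(\<integral>l. F l * Du N u l \<partial>iid N M) = (\<integral>l. F l * Du N (\<lambda>_. False) l \<partial>iid N M)" .
  qed
  finally show ?thesis using card_pos by simp
qed

text \<open>For test functions that are odd in bit \<open>i\<close>, the sign picked up by
  \<open>F\<close> cancels the sign of that bit inside \<open>Nb\<close>, so again every codeword
  contributes the same.\<close>

lemma iid_Nb_zero_codeword:
  assumes M: "sym_law M" and F: "bmeas (cube N) F"
    and inv: "\<And>u l. u \<in> C \<Longrightarrow> l \<in> space (cube N) \<Longrightarrow> F (flip u N l) = bpsk (u i) * F l"
  shows "(\<integral>l. F l * Nb C N i l \<partial>iid N M) = (\<integral>l. F l * Du N (\<lambda>_. False) l \<partial>iid N M)"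
proof -
  note L = law_iid[OF sym_law_law[OF M], of N]
  have "(\<integral>l. F l * Nb C N i l \<partial>iid N M) = (\<integral>l. (\<Sum>u\<in>C. F l * (bpsk (u i) * Du N u l)) / card C \<partial>iid N M)"
    unfolding Nb_def by (simp add: sum_distrib_left)
  also have "\<dots> = (\<Sum>u\<in>C. \<integral>l. F l * (bpsk (u i) * Du N u l) \<partial>iid N M) / card C"
    by (simp add: Bochner_Integration.integral_sum law_integrable[OF L] bmeas_mult bmeas_cmult F bmeas_Du)
  also have "(\<Sum>u\<in>C. \<integral>l. F l * (bpsk (u i) * Du N u l) \<partial>iid N M) = (\<Sum>u\<in>C. \<integral>l. F l * Du N (\<lambda>_. False) l \<partial>iid N M)"
  proof (rule sum.cong[OF refl])
    fix u assume u: "u \<in> C"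
    have "(\<integral>l. F l * (bpsk (u i) * Du N u l) \<partial>iid N M) = (\<integral>l. F (flip u N l) * (bpsk (u i) * Du N u (flip u N l)) \<partial>iid N M)"
      by (rule iid_flip[OF M, symmetric]) (intro bmeas_mult bmeas_cmult F bmeas_Du)
    also have "\<dots> = (\<integral>l. F l * Du N (\<lambda>_. False) l \<partial>iid N M)"
    proof (rule law_integral_cong[OF L])
      fix l assume "l \<in> space (cube N)"
      then have "F (flip u N l) * (bpsk (u i) * Du N u (flip u N l)) = (bpsk (u i) * bpsk (u i)) * (F l * Du N (\<lambda>_. False) l)"
        by (simp only: inv[OF u] Du_flip bxor_self mult_ac)
      then show "F (flip u N l) * (bpsk (u i) * Du N u (flip u N l)) = F l * Du N (\<lambda>_. False) l"
        unfolding bpsk_sq by simp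
    qed
    finally show "(\<integral>l. F l * (bpsk (u i) * Du N u l) \<partial>iid N M) = (\<integral>l. F l * Du N (\<lambda>_. False) l \<partial>iid N M)" .
  qed
  finally show ?thesis using card_pos by simp
qed

end

section \<open>Reindexing and restriction of coordinates\<close>

lemma iid_reindex:
  assumes M: "law BB M" and F: "bmeas (cube N) F"
    and inv: "\<And>j. \<sigma> (\<sigma> j) = j" and dom: "\<And>j. \<sigma> j < N \<longleftrightarrow> j < N"
  shows "(\<integral>l. F (\<lambda>j. l (\<sigma> j)) \<partial>iid N M) = (\<integral>l. F l \<partial>iid N M)"
    and "bmeas (cube N) (\<lambda>l. F (\<lambda>j. l (\<sigma> j)))"
proof -
  have r: "(\<lambda>j\<in>{..<N}. l (\<sigma> j)) = (\<lambda>j. l (\<sigma> j))" if "l \<in> space (cube N)" for l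
    using that dom by (auto simp: fun_eq_iff space_cube PiE_iff extensional_def)
  have inj: "inj_on \<sigma> {..<N}" by (rule inj_onI) (metis inv)
  have "(\<integral>l. F (\<lambda>j. l (\<sigma> j)) \<partial>iid N M) = (\<integral>l. F (\<lambda>j\<in>{..<N}. l (\<sigma> j)) \<partial>iid N M)"
    by (rule law_integral_cong[OF law_iid[OF M]]) (simp only: r)
  also have "\<dots> = (\<integral>l. F l \<partial>iid N M)"
    using integral_PiM_reindex[OF M inj, of "{..<N}" F] F dom unfolding iid_def cube_def by auto
  finally show "(\<integral>l. F (\<lambda>j. l (\<sigma> j)) \<partial>iid N M) = (\<integral>l. F l \<partial>iid N M)" .
  have "(\<lambda>l. \<lambda>j\<in>{..<N}. l (\<sigma> j)) \<in> measurable (cube N) (cube N)"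
    unfolding cube_def using dom by (intro measurable_restrict measurable_component_singleton) auto
  from bmeas_compose[OF this F] show "bmeas (cube N) (\<lambda>l. F (\<lambda>j. l (\<sigma> j)))"
    by (subst bmeas_cong) (simp_all only: r)
qed

lemma iid_restrict:
  assumes M: "law BB M" and F: "bmeas (cube N) F" and N: "N \<le> N'"
    and cong: "\<And>l. F (restrict l {..<N}) = F l"
  shows "(\<integral>l. F l \<partial>iid N' M) = (\<integral>l. F l \<partial>iid N M)" and "bmeas (cube N') F"
proof -
  show "(\<integral>l. F l \<partial>iid N' M) = (\<integral>l. F l \<partial>iid N M)"
    using integral_PiM_reindex[OF M, of id "{..<N}" "{..<N'}" F] F N
    unfolding iid_def cube_def by (auto simp: cong)
  have "(\<lambda>l. \<lambda>j\<in>{..<N}. l j) \<in> measurable (cube N') (cube N)"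
    unfolding cube_def using N by (intro measurable_restrict measurable_component_singleton) auto
  from bmeas_compose[OF this F] show "bmeas (cube N') F" by (simp only: cong)
qed

lemma Du_reindex:
  assumes inv: "\<And>j. \<sigma> (\<sigma> j) = j" and dom: "\<And>j. \<sigma> j < N \<longleftrightarrow> j < N"
  shows "Du N u (\<lambda>j. l (\<sigma> j)) = Du N (\<lambda>j. u (\<sigma> j)) l"
  unfolding Du_def
  by (rule prod.reindex_bij_witness[of _ \<sigma> \<sigma>]) (auto simp: inv dom)

context
  fixes C :: "(nat \<Rightarrow> bool) set" and N :: nat and \<sigma> :: "nat \<Rightarrow> nat"
  assumes inv: "\<And>j. \<sigma> (\<sigma> j) = j" and dom: "\<And>j. \<sigma> j < N \<longleftrightarrow> j < N"
    and aut: "\<And>u. u \<in> C \<Longrightarrow> (\<lambda>j. u (\<sigma> j)) \<in> C"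
begin

lemma sum_aut: "(\<Sum>u\<in>C. G (\<lambda>j. u (\<sigma> j))) = (\<Sum>u\<in>C. (G u :: real))"
  by (rule sum.reindex_bij_witness[of _ "\<lambda>u j. u (\<sigma> j)" "\<lambda>u j. u (\<sigma> j)"]) (auto simp: inv aut)

lemma Db_reindex: "Db C N (\<lambda>j. l (\<sigma> j)) = Db C N l"
  unfolding Db_def Du_reindex[OF inv dom] using sum_aut[of "\<lambda>u. Du N u l"] by simp

lemma Nb_reindex: "Nb C N i (\<lambda>j. l (\<sigma> j)) = Nb C N (\<sigma> i) l"
  unfolding Nb_def Du_reindex[OF inv dom] using sum_aut[of "\<lambda>u. bpsk (u (\<sigma> i)) * Du N u l"] by (simp add: inv)

end

lemma lin_code_rm: "lin_code (rm_code r m)"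
  by unfold_locales (auto simp: finite_rm_code rm_code_bxor intro: rm_code_zero)

lemma Du_zeroed_low:
  assumes "N \<le> N'" shows "Du N' u (zeroed {N..<N'} l) = Du N (low N u) l"
proof -
  have "Du N' u (zeroed {N..<N'} l) = (\<Prod>j\<in>{..<N} \<union> {N..<N'}. 1 + bpsk (u j) * zeroed {N..<N'} l j)"
    unfolding Du_def using assms by (intro prod.cong) auto
  also have "\<dots> = (\<Prod>j<N. 1 + bpsk (u j) * zeroed {N..<N'} l j) * (\<Prod>j\<in>{N..<N'}. 1 + bpsk (u j) * zeroed {N..<N'} l j)"
    by (intro prod.union_disjoint) auto
  also have "(\<Prod>j\<in>{N..<N'}. 1 + bpsk (u j) * zeroed {N..<N'} l j) = 1"
    by (intro prod.neutral) (auto simp: zeroed_def)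
  also have "(\<Prod>j<N. 1 + bpsk (u j) * zeroed {N..<N'} l j) = Du N (low N u) l"
    unfolding Du_def by (intro prod.cong) (auto simp: zeroed_def low_def)
  finally show ?thesis by simp
qed

lemma pow2_le_Suc: "(2::nat) ^ m \<le> 2 ^ Suc m"
  by simp

text \<open>The marginal of the output density on the lower half is that of the short code, since a
  uniform codeword restricts to a uniform codeword.\<close>

lemma Db_zeroed_low: "Db (rm_code r (Suc m)) (2 ^ Suc m) (zeroed {2 ^ m..<2 ^ Suc m} l) = Db (rm_code r m) (2 ^ m) l"
  unfolding Db_def Du_zeroed_low[OF pow2_le_Suc] using sum_low_rm_code[of "\<lambda>v. Du (2 ^ m) v l" m r] by simp

section \<open>Output divergence\<close>

definition ent :: "real \<Rightarrow> real" where
  "ent x = x * log 2 x"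

lemma ent_mult: "0 \<le> x \<Longrightarrow> 0 \<le> y \<Longrightarrow> ent (x * y) = x * ent y + y * ent x"
  by (cases "x = 0 \<or> y = 0") (auto simp: ent_def log_mult algebra_simps)

lemma ent_ge: "0 \<le> x \<Longrightarrow> (x - 1) / ln 2 \<le> ent x"
proof (cases "x = 0")
  case False
  assume "0 \<le> x"
  with False have x: "0 < x" by simp
  have "ln (1 / x) \<le> 1 / x - 1" using x by (intro ln_le_minus_one) simp
  then have "x * (1 - 1 / x) \<le> x * ln x" using x by (intro mult_left_mono) (auto simp: ln_div)
  then show ?thesis using x by (simp add: ent_def log_def divide_right_mono algebra_simps)
qed (simp add: ent_def)

lemma ent_abs_le:
  assumes "0 \<le> x" "x \<le> B" shows "\<bar>ent x\<bar> \<le> (1 + B\<^sup>2) / ln 2"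
proof (cases "x = 0")
  case False
  then have x: "0 < x" using assms by simp
  have "x * ln x \<le> x * (x - 1)" using x ln_le_minus_one[OF x] by (intro mult_left_mono) auto
  also have "\<dots> \<le> x * x" using x by (intro mult_left_mono) auto
  also have "\<dots> \<le> B\<^sup>2" using assms by (simp add: power2_eq_square mult_mono)
  finally have "ent x \<le> B\<^sup>2 / ln 2" by (simp add: ent_def log_def divide_right_mono)
  also have "\<dots> \<le> (1 + B\<^sup>2) / ln 2" by (simp add: divide_right_mono)
  finally have u: "ent x \<le> (1 + B\<^sup>2) / ln 2" .
  have "- (1 + B\<^sup>2) \<le> x - 1" using assms(1) zero_le_power2[of B] by linarith
  then have "- (1 + B\<^sup>2) / ln 2 \<le> (x - 1) / ln 2" by (rule divide_right_mono) simp
  then have "- ((1 + B\<^sup>2) / ln 2) \<le> (x - 1) / ln 2" by (simp only: minus_divide_left)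
  also have "\<dots> \<le> ent x" using assms by (intro ent_ge)
  finally show ?thesis using u by linarith
qed (simp add: ent_def)

lemma bmeas_ent:
  assumes F: "bmeas S F" and nn: "\<And>x. x \<in> space S \<Longrightarrow> 0 \<le> F x"
  shows "bmeas S (\<lambda>x. ent (F x))"
proof -
  obtain B where B: "\<And>x. x \<in> space S \<Longrightarrow> \<bar>F x\<bar> \<le> B" using bmeas_bound[OF F] by blast
  have [measurable]: "F \<in> borel_measurable S" using F by (rule bmeas_measurable)
  show ?thesis
  proof (rule bmeasI[where B="(1 + B\<^sup>2) / ln 2"])
    show "(\<lambda>x. ent (F x)) \<in> borel_measurable S" unfolding ent_def by measurable
    show "\<bar>ent (F x)\<bar> \<le> (1 + B\<^sup>2) / ln 2" if "x \<in> space S" for x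
      using nn[OF that] B[OF that] by (intro ent_abs_le) auto
  qed
qed

lemma kappa_ent: "kappa z = (ent (1 + z) + ent (1 - z)) / 2"
  by (simp add: kappa_def ent_def)

lemma bmeas_ent_BB: "bmeas BB (\<lambda>x. ent (1 + x))" "bmeas BB (\<lambda>x. ent (1 - x))"
  by (intro bmeas_ent bmeas_add bmeas_diff bmeas_const bmeas_BB_id; simp add: space_BB)+

lemma bmeas_kappa: "bmeas BB kappa"
proof -
  have "bmeas BB (\<lambda>x. (1/2) * (ent (1 + x) + ent (1 - x)))"
    by (intro bmeas_cmult bmeas_add bmeas_ent_BB)
  then show ?thesis unfolding kappa_ent[abs_def] by simp
qed

definition cap :: "real measure \<Rightarrow> real" where
  "cap M = (\<integral>x. kappa x \<partial>M)"

lemma integral_ent_cap: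
  assumes M: "sym_law M" shows "(\<integral>x. ent (1 + bpsk b * x) \<partial>M) = cap M"
proof -
  note L = sym_law_law[OF M]
  have e: "(\<integral>x. ent (1 - x) \<partial>M) = (\<integral>x. ent (1 + x) \<partial>M)"
    using sym_law_integral[OF M bmeas_ent_BB(1)] by simp
  have "cap M = (\<integral>x. ent (1 + x) + ent (1 - x) \<partial>M) / 2"
    unfolding cap_def kappa_ent by simp
  also have "\<dots> = (\<integral>x. ent (1 + x) \<partial>M)"
    by (subst law_integral_add[OF L bmeas_ent_BB]) (simp add: e)
  finally show ?thesis using e by (cases b) (auto simp: bpsk_def)
qed

lemma ent_prod:
  assumes "finite J" "\<And>j. j \<in> J \<Longrightarrow> 0 \<le> a j"
  shows "ent (\<Prod>j\<in>J. a j) = (\<Sum>j\<in>J. (\<Prod>k\<in>J - {j}. a k) * ent (a j))"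
  using assms
proof (induction J rule: finite_induct)
  case empty
  then show ?case by (simp add: ent_def)
next
  case (insert i J)
  have nn: "0 \<le> (\<Prod>j\<in>J. a j)" using insert.prems by (intro prod_nonneg) auto
  have "(\<Prod>k\<in>insert i J - {j}. a k) = a i * (\<Prod>k\<in>J - {j}. a k)" if "j \<in> J" for j
  proof -
    have "insert i J - {j} = insert i (J - {j})" using that insert.hyps by auto
    then show ?thesis using insert.hyps by simp
  qed
  then have "(\<Sum>j\<in>J. (\<Prod>k\<in>insert i J - {j}. a k) * ent (a j)) = a i * ent (\<Prod>j\<in>J. a j)"
    using insert by (simp add: sum_distrib_left mult.assoc)
  moreover have "insert i J - {i} = J" using insert.hyps by auto
  ultimately show ?case
    using insert.hyps insert.prems ent_mult[of "a i" "\<Prod>j\<in>J. a j"] nn by simp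
qed

text \<open>Information is additive over independent channel uses: \<open>ent\<close> of a product
  splits into terms with a single \<open>ent\<close> factor, and the remaining affine factors
  integrate to 1.\<close>

lemma iid_ent_Du:
  assumes M: "sym_law M" shows "(\<integral>l. ent (Du N u l) \<partial>iid N M) = N * cap M"
proof -
  note L = sym_law_law[OF M] and LI = law_iid[OF sym_law_law[OF M], of N]
  let ?a = "\<lambda>l j. 1 + bpsk (u j) * l j"
  let ?F = "\<lambda>j l. (\<Prod>k\<in>{..<N} - {j}. ?a l k) * ent (?a l j)"
  have nn: "0 \<le> ?a l j" if "l \<in> space (cube N)" "j < N" for l j
  proof -
    have "\<bar>bpsk (u j) * l j\<bar> \<le> 1" using cube_abs[OF that] by (simp add: abs_mult bpsk_abs)
    then show ?thesis by (simp add: abs_le_iff)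
  qed
  have be: "bmeas (cube N) (\<lambda>l. ent (?a l j))" if "j < N" for j
    using that nn by (intro bmeas_ent bmeas_add bmeas_mult bmeas_const bmeas_cube_component) auto
  have bF: "bmeas (cube N) (?F j)" if "j < N" for j
    using that by (intro bmeas_mult be bmeas_prod bmeas_add bmeas_const bmeas_cube_component) auto
  have int: "(\<integral>l. ?F j l \<partial>iid N M) = cap M" if j: "j < N" for j
  proof -
    have up: "?F j (l(k := x)) = (1 + bpsk (u k) * x) * ((\<Prod>i\<in>{..<N} - {j} - {k}. ?a l i) * ent (?a l j))"
      if k: "k \<in> {..<N} - {j}" for l k x
    proof -
      have "(\<Prod>i\<in>{..<N} - {j}. ?a (l(k := x)) i) = (1 + bpsk (u k) * x) * (\<Prod>i\<in>{..<N} - {j} - {k}. ?a l i)"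
        using k by (subst prod.remove[of _ k]) (auto intro!: arg_cong2[where f="(*)"] prod.cong)
      then show ?thesis using k by simp
    qed
    have "(\<integral>l. ?F j l \<partial>iid N M) = (\<integral>l. ?F j (zeroed ({..<N} - {j}) l) \<partial>iid N M)"
    proof (rule iid_zeroed_affine[OF M bF[OF j], where \<beta>="\<lambda>k l. bpsk (u k) * ((\<Prod>i\<in>{..<N} - {j} - {k}. ?a l i) * ent (?a l j))"])
      fix k l and x :: real assume k: "k \<in> {..<N} - {j}"
      show "?F j (l(k := x)) = ?F j (l(k := 0)) + x * (bpsk (u k) * ((\<Prod>i\<in>{..<N} - {j} - {k}. ?a l i) * ent (?a l j)))"
        unfolding up[OF k] by (simp add: algebra_simps)
    qed auto
    also have "\<dots> = (\<integral>l. ent (?a l j) \<partial>iid N M)"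
    proof (rule law_integral_cong[OF LI])
      fix l
      have "(\<Prod>k\<in>{..<N} - {j}. ?a (zeroed ({..<N} - {j}) l) k) = 1" by (intro prod.neutral) (auto simp: zeroed_def)
      then show "?F j (zeroed ({..<N} - {j}) l) = ent (?a l j)" by (simp add: zeroed_def)
    qed
    also have "\<dots> = (\<integral>l. (\<integral>x. ent (?a (l(j := x)) j) \<partial>M) \<partial>iid N M)"
      by (rule iid_resample[OF L be[OF j] j])
    also have "\<dots> = cap M" using law_measure[OF LI] by (simp add: integral_ent_cap[OF M])
    finally show ?thesis .
  qed
  have "(\<integral>l. ent (Du N u l) \<partial>iid N M) = (\<integral>l. (\<Sum>j<N. ?F j l) \<partial>iid N M)"
    unfolding Du_def by (rule law_integral_cong[OF LI], rule ent_prod) (auto intro: nn)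
  also have "\<dots> = (\<Sum>j<N. \<integral>l. ?F j l \<partial>iid N M)"
    by (rule Bochner_Integration.integral_sum) (simp add: law_integrable[OF LI bF])
  finally show ?thesis by (simp add: int)
qed

text \<open>The divergence of the output law from the product law; \<open>H(X | Y) = log 2 (card C) - N * cap M + JJ C N M\<close>.\<close>

definition JJ :: "(nat \<Rightarrow> bool) set \<Rightarrow> nat \<Rightarrow> real measure \<Rightarrow> real" where
  "JJ C N M = (\<integral>l. ent (Db C N l) \<partial>iid N M)"

lemma bmeas_ent_Db: "bmeas (cube N) (\<lambda>l. ent (Db C N l))"
  by (intro bmeas_ent bmeas_Db Db_nonneg)

lemma sum_Du_all: "(\<Sum>X\<in>Pow {..<N}. Du N (\<lambda>i. i \<in> X) l) = 2 ^ N"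
proof -
  have "Du N (\<lambda>i. i \<in> X) l = (\<Prod>x\<in>X. 1 - l x) * (\<Prod>x\<in>{..<N} - X. 1 + l x)" if "X \<in> Pow {..<N}" for X
  proof -
    have "{..<N} = X \<union> ({..<N} - X)" using that by auto
    then have "Du N (\<lambda>i. i \<in> X) l = (\<Prod>j\<in>X \<union> ({..<N} - X). 1 + bpsk (j \<in> X) * l j)" unfolding Du_def by simp
    also have "\<dots> = (\<Prod>j\<in>X. 1 + bpsk (j \<in> X) * l j) * (\<Prod>j\<in>{..<N} - X. 1 + bpsk (j \<in> X) * l j)"
      using that by (intro prod.union_disjoint) (auto intro: finite_subset)
    also have "\<dots> = (\<Prod>x\<in>X. 1 - l x) * (\<Prod>x\<in>{..<N} - X. 1 + l x)"
      by (intro arg_cong2[where f="(*)"] prod.cong) (auto simp: bpsk_def)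
    finally show ?thesis .
  qed
  then have "(\<Sum>X\<in>Pow {..<N}. Du N (\<lambda>i. i \<in> X) l) = (\<Prod>x<N. (1 - l x) + (1 + l x))"
    by (subst prod_add) auto
  then show ?thesis by simp
qed

context lin_code
begin

lemma JJ_nonneg: "sym_law M \<Longrightarrow> 0 \<le> JJ C N M"
proof -
  assume M: "sym_law M"
  note LI = law_iid[OF sym_law_law[OF M], of N]
  have "(\<integral>l. (Db C N l - 1) / ln 2 \<partial>iid N M) \<le> JJ C N M"
    unfolding JJ_def
    by (rule law_integral_mono[OF LI _ bmeas_ent_Db ent_ge[OF Db_nonneg]], unfold divide_inverse)
      (intro bmeas_mult bmeas_diff bmeas_const bmeas_Db)
  moreover have "(\<integral>l. (Db C N l - 1) / ln 2 \<partial>iid N M) = 0"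
    using law_integral_diff[OF LI bmeas_Db bmeas_const, of C 1] by (simp add: iid_Db_one[OF M] law_measure[OF LI])
  ultimately show ?thesis by simp
qed

text \<open>Enlarging the sum over the code to all words bounds the output density pointwise by
  \<open>2 ^ N / card C\<close>, hence also the mean of its logarithm.\<close>

lemma JJ_le:
  assumes M: "sym_law M" and supp: "\<And>u i. u \<in> C \<Longrightarrow> u i \<Longrightarrow> i < N"
  shows "JJ C N M \<le> N - log 2 (card C)"
proof -
  note LI = law_iid[OF sym_law_law[OF M], of N]
  have "ent (Db C N l) \<le> (N - log 2 (card C)) * Db C N l" if l: "l \<in> space (cube N)" for l
  proof (cases "Db C N l = 0")
    case False
    then have D: "0 < Db C N l" using Db_nonneg[OF l, of C] by simp
    have inj: "inj_on Collect C" by (auto intro: inj_onI)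
    have "(\<Sum>u\<in>C. Du N u l) = (\<Sum>X\<in>Collect ` C. Du N (\<lambda>i. i \<in> X) l)"
      by (subst sum.reindex[OF inj]) simp
    also have "\<dots> \<le> (\<Sum>X\<in>Pow {..<N}. Du N (\<lambda>i. i \<in> X) l)"
      using supp by (intro sum_mono2) (auto intro: Du_nonneg[OF l])
    also have "\<dots> = 2 ^ N" by (rule sum_Du_all)
    finally have "Db C N l \<le> 2 ^ N / card C" unfolding Db_def by (simp add: divide_right_mono)
    then have "log 2 (Db C N l) \<le> log 2 (2 ^ N / card C)" using D card_pos by (subst log_le_cancel_iff) auto
    also have "\<dots> = N - log 2 (card C)" using card_pos by (simp add: log_divide log_nat_power)
    finally show ?thesis unfolding ent_def using D by (simp add: mult.commute[of "Db C N l"])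
  qed (simp add: ent_def)
  then have "JJ C N M \<le> (\<integral>l. (N - log 2 (card C)) * Db C N l \<partial>iid N M)"
    unfolding JJ_def by (intro law_integral_mono[OF LI bmeas_ent_Db] bmeas_cmult bmeas_Db)
  also have "\<dots> = N - log 2 (card C)" by (simp add: iid_Db_one[OF M])
  finally show ?thesis .
qed

text \<open>Amounts to H(X | Y) >= 0: the posterior probability of a codeword is at most 1, i.e.
  \<open>Du N u l / card C\<close> is at most \<open>Db C N l\<close>.\<close>

lemma JJ_ge:
  assumes M: "sym_law M" shows "N * cap M - log 2 (card C) \<le> JJ C N M"
proof -
  note LI = law_iid[OF sym_law_law[OF M], of N]
  let ?c = "real (card C)"
  have c: "0 < ?c" using card_pos by simp
  have pt: "(\<Sum>u\<in>C. ent (Du N u l)) / ?c - log 2 ?c * Db C N l \<le> ent (Db C N l)" if l: "l \<in> space (cube N)" for l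
  proof -
    have "ent (Du N u l) - log 2 ?c * Du N u l \<le> Du N u l * log 2 (Db C N l)" if u: "u \<in> C" for u
    proof (cases "Du N u l = 0")
      case False
      then have d: "0 < Du N u l" using Du_nonneg[OF l, of u] by simp
      have "Du N u l \<le> (\<Sum>u\<in>C. Du N u l)" using finite_C u by (intro member_le_sum Du_nonneg[OF l]) auto
      then have "Du N u l / ?c \<le> Db C N l" unfolding Db_def by (simp add: divide_right_mono)
      moreover have "0 < Du N u l / ?c" using d c by simp
      ultimately have "log 2 (Du N u l / ?c) \<le> log 2 (Db C N l)" by (subst log_le_cancel_iff) auto
      then have "Du N u l * (log 2 (Du N u l) - log 2 ?c) \<le> Du N u l * log 2 (Db C N l)"
        using d c by (intro mult_left_mono) (auto simp: log_divide)
      then show ?thesis unfolding ent_def by (simp add: algebra_simps)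
    qed (simp add: ent_def)
    then have "(\<Sum>u\<in>C. ent (Du N u l) - log 2 ?c * Du N u l) \<le> (\<Sum>u\<in>C. Du N u l * log 2 (Db C N l))"
      by (rule sum_mono)
    then have "((\<Sum>u\<in>C. ent (Du N u l)) - log 2 ?c * (\<Sum>u\<in>C. Du N u l)) / ?c \<le> (\<Sum>u\<in>C. Du N u l) * log 2 (Db C N l) / ?c"
      by (intro divide_right_mono) (auto simp: sum_subtractf sum_distrib_left sum_distrib_right)
    moreover have "((\<Sum>u\<in>C. ent (Du N u l)) - log 2 ?c * (\<Sum>u\<in>C. Du N u l)) / ?c = (\<Sum>u\<in>C. ent (Du N u l)) / ?c - log 2 ?c * Db C N l"
      unfolding Db_def by (simp add: diff_divide_distrib)
    moreover have "(\<Sum>u\<in>C. Du N u l) * log 2 (Db C N l) / ?c = ent (Db C N l)"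
      unfolding ent_def by (subst (2) Db_def) simp
    ultimately show ?thesis by simp
  qed
  have bs: "bmeas (cube N) (\<lambda>l. (\<Sum>u\<in>C. ent (Du N u l)) * (1 / ?c))"
    by (intro bmeas_mult bmeas_const bmeas_sum bmeas_ent bmeas_Du Du_nonneg)
  have "(\<integral>l. (\<Sum>u\<in>C. ent (Du N u l)) * (1 / ?c) - log 2 ?c * Db C N l \<partial>iid N M) \<le> JJ C N M"
    unfolding JJ_def using pt by (intro law_integral_mono[OF LI _ bmeas_ent_Db] bmeas_diff bs bmeas_cmult bmeas_Db) simp
  moreover have "(\<integral>l. (\<Sum>u\<in>C. ent (Du N u l)) * (1 / ?c) - log 2 ?c * Db C N l \<partial>iid N M)
      = (\<integral>l. (\<Sum>u\<in>C. ent (Du N u l)) * (1 / ?c) \<partial>iid N M) - (\<integral>l. log 2 ?c * Db C N l \<partial>iid N M)"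
    by (intro law_integral_diff[OF LI] bs bmeas_cmult bmeas_Db)
  moreover have "(\<integral>l. (\<Sum>u\<in>C. ent (Du N u l)) \<partial>iid N M) = ?c * (N * cap M)"
    by (subst Bochner_Integration.integral_sum)
      (auto simp: iid_ent_Du[OF M] intro!: law_integrable[OF LI] bmeas_ent bmeas_Du Du_nonneg)
  ultimately show ?thesis using c by (simp add: iid_Db_one[OF M])
qed

end

section \<open>Extrinsic estimates\<close>

lemma restrict_upd_ge: "(N::nat) \<le> k \<Longrightarrow> restrict (l(k := x)) {..<N} = restrict l {..<N}"
  by (auto simp: fun_eq_iff restrict_def)

lemma low_zero: "low N (\<lambda>_. False) = (\<lambda>_. False)"
  by (simp add: low_def fun_eq_iff)

text \<open>With the all-zero codeword sent, coordinates that \<open>h\<close> does not read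
  contribute independent factors 1 + x of mean one.\<close>

lemma iid_low_zero_codeword:
  assumes M: "sym_law M" and h: "bmeas (cube N) h" and N: "N \<le> N'"
    and cong: "\<And>l. h (restrict l {..<N}) = h l"
  shows "(\<integral>l. h l * Du N' (\<lambda>_. False) l \<partial>iid N' M) = (\<integral>l. h l * Du N (\<lambda>_. False) l \<partial>iid N M)"
proof -
  note L = sym_law_law[OF M]
  let ?d = "Du N (\<lambda>_. False)" and ?d' = "Du N' (\<lambda>_. False)"
  have bh': "bmeas (cube N') h" by (rule iid_restrict(2)[OF L h N cong])
  have hk: "h (l(k := x)) = h l" if "N \<le> k" for l k x
    using cong[of "l(k := x)"] cong[of l] restrict_upd_ge[OF that, of l x] by simp
  have hz: "h (zeroed {N..<N'} l) = h l" for l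
  proof -
    have "restrict (zeroed {N..<N'} l) {..<N} = restrict l {..<N}" by (auto simp: fun_eq_iff zeroed_def restrict_def)
    then show ?thesis using cong[of l] cong[of "zeroed {N..<N'} l"] by simp
  qed
  have "(\<integral>l. h l * ?d' l \<partial>iid N' M) = (\<integral>l. h (zeroed {N..<N'} l) * ?d' (zeroed {N..<N'} l) \<partial>iid N' M)"
  proof (rule iid_zeroed_affine[OF M bmeas_mult[OF bh' bmeas_Du], where \<beta>="\<lambda>k l. h l * (bpsk False * ?d' (l(k := 0)))"])
    show "{N..<N'} \<subseteq> {..<N'}" by auto
    fix k l and x :: real assume k: "k \<in> {N..<N'}"
    then have "?d' (l(k := x)) = (1 + bpsk False * x) * ?d' (l(k := 0))" by (intro Du_upd) simp
    moreover have "h (l(k := y)) = h l" for y using hk k by simp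
    ultimately show "h (l(k := x)) * ?d' (l(k := x)) = h (l(k := 0)) * ?d' (l(k := 0)) + x * (h l * (bpsk False * ?d' (l(k := 0))))"
      by (simp only:) (simp add: algebra_simps)
  qed
  also have "\<dots> = (\<integral>l. h l * ?d l \<partial>iid N' M)"
    by (simp only: hz Du_zeroed_low[OF N] low_zero)
  also have "\<dots> = (\<integral>l. h l * ?d l \<partial>iid N M)"
  proof (rule iid_restrict(1)[OF L bmeas_mult[OF h bmeas_Du] N])
    show "h (restrict l {..<N}) * ?d (restrict l {..<N}) = h l * ?d l" for l
      unfolding cong using Du_cong[of N "restrict l {..<N}" l "\<lambda>_. False"] by simp
  qed
  finally show ?thesis .
qed

text \<open>Setting \<open>l 0 = 0\<close> discards the observation of bit \<open>0\<close>, so \<open>ff\<close> is its extrinsic posterior mean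
  (with value \<open>0\<close> where the density \<open>D0\<close> vanishes) and \<open>1 - mom C N M 0\<close> its extrinsic MMSE.\<close>

definition D0 :: "(nat \<Rightarrow> bool) set \<Rightarrow> nat \<Rightarrow> (nat \<Rightarrow> real) \<Rightarrow> real" where
  "D0 C N l = Db C N (l(0 := 0))"

definition n0 :: "(nat \<Rightarrow> bool) set \<Rightarrow> nat \<Rightarrow> (nat \<Rightarrow> real) \<Rightarrow> real" where
  "n0 C N l = Nb C N 0 (l(0 := 0))"

definition ff :: "(nat \<Rightarrow> bool) set \<Rightarrow> nat \<Rightarrow> (nat \<Rightarrow> real) \<Rightarrow> real" where
  "ff C N l = n0 C N l / D0 C N l"

text \<open>Index \<open>n\<close> belongs to the moment of order \<open>2 * n + 2\<close>, matching
  the power that goes with \<open>kcoeff n\<close>.\<close>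

definition mom :: "(nat \<Rightarrow> bool) set \<Rightarrow> nat \<Rightarrow> real measure \<Rightarrow> nat \<Rightarrow> real" where
  "mom C N M n = (\<integral>l. (ff C N l)\<^sup>2 ^ Suc n * D0 C N l \<partial>iid N M)"

lemma D0_upd: "D0 C N (l(0 := x)) = D0 C N l" and n0_upd: "n0 C N (l(0 := x)) = n0 C N l"
  and ff_upd: "ff C N (l(0 := x)) = ff C N l"
  by (simp_all add: D0_def n0_def ff_def)

lemma ff_restrict: "ff C N (restrict l {..<N}) = ff C N l"
proof -
  have "D0 C N (restrict l {..<N}) = D0 C N l" unfolding D0_def by (rule Db_cong) auto
  moreover have "n0 C N (restrict l {..<N}) = n0 C N l" unfolding n0_def by (rule Nb_cong) auto
  ultimately show ?thesis unfolding ff_def by simp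
qed

context
  fixes N :: nat assumes N: "0 < N"
begin

lemma bmeas_D0: "bmeas (cube N) (D0 C N)"
  using bmeas_cube_upd[OF bmeas_Db N, of 0 C] unfolding D0_def[abs_def] by simp

lemma bmeas_n0: "bmeas (cube N) (n0 C N)"
  using bmeas_cube_upd[OF bmeas_Nb N, of 0 C 0] unfolding n0_def[abs_def] by simp

lemma D0_nonneg: "l \<in> space (cube N) \<Longrightarrow> 0 \<le> D0 C N l"
  unfolding D0_def by (intro Db_nonneg cube_upd N) auto

lemma n0_abs_le: "l \<in> space (cube N) \<Longrightarrow> \<bar>n0 C N l\<bar> \<le> D0 C N l"
  unfolding D0_def n0_def by (intro Nb_abs_le cube_upd N) auto

lemma ff_abs_le: "l \<in> space (cube N) \<Longrightarrow> \<bar>ff C N l\<bar> \<le> 1"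
  using n0_abs_le[of l C] D0_nonneg[of l C] unfolding ff_def by (cases "D0 C N l = 0") (auto simp: abs_divide divide_le_eq)

lemma ff_D0: "l \<in> space (cube N) \<Longrightarrow> ff C N l * D0 C N l = n0 C N l"
  using n0_abs_le[of l C] unfolding ff_def by (cases "D0 C N l = 0") auto

lemma bmeas_ff: "bmeas (cube N) (ff C N)"
proof (rule bmeasI[where B=1])
  show "ff C N \<in> borel_measurable (cube N)"
    unfolding ff_def[abs_def]
    by (intro borel_measurable_divide bmeas_measurable bmeas_n0 bmeas_D0)
qed (rule ff_abs_le)

lemma bmeas_mom: "bmeas (cube N) (\<lambda>l. (ff C N l)\<^sup>2 ^ n * D0 C N l)"
  by (intro bmeas_mult bmeas_power bmeas_ff bmeas_D0)

lemma flip_upd: "flip u N (l(0 := 0)) = (flip u N l)(0 := 0)"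
  using N by (auto simp: flip_def fun_eq_iff)

end

lemma (in lin_code) ff_flip:
  assumes "0 < N" "u \<in> C" shows "ff C N (flip u N l) = bpsk (u 0) * ff C N l"
  unfolding ff_def n0_def D0_def flip_upd[OF assms(1), symmetric] Nb_flip[OF assms(2)] Db_flip[OF assms(2)] by simp

text \<open>The test function ignores coordinate 0 and \<open>Db\<close> is affine in it, so
  \<open>Db\<close> may be replaced by \<open>D0\<close> under the integral. After that the codeword
  may be taken to be zero.\<close>

lemma (in lin_code) ext_even:
  assumes M: "sym_law M" and N: "0 < N" and h: "bmeas (cube N) h"
    and h0: "\<And>l x. h (l(0 := x)) = h l"
    and inv: "\<And>u l. u \<in> C \<Longrightarrow> l \<in> space (cube N) \<Longrightarrow> h (flip u N l) = h l"
  shows "(\<integral>l. h l * D0 C N l \<partial>iid N M) = (\<integral>l. h l * Du N (\<lambda>_. False) l \<partial>iid N M)"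
proof -
  have z: "zeroed {0} l = l(0 := 0)" for l by (auto simp: zeroed_def fun_eq_iff)
  have "(\<integral>l. h l * Db C N l \<partial>iid N M) = (\<integral>l. h (zeroed {0} l) * Db C N (zeroed {0} l) \<partial>iid N M)"
  proof (rule iid_zeroed_affine[OF M bmeas_mult[OF h bmeas_Db], where \<beta>="\<lambda>k l. h l * n0 C N l"])
    fix k l and x :: real assume "k \<in> {0::nat}"
    then show "h (l(k := x)) * Db C N (l(k := x)) = h (l(k := 0)) * Db C N (l(k := 0)) + x * (h l * n0 C N l)"
      using Db_upd[OF N, of C l x] by (simp add: h0 n0_def algebra_simps)
  qed (use N in auto)
  also have "\<dots> = (\<integral>l. h l * D0 C N l \<partial>iid N M)" by (simp only: z h0 D0_def)
  finally show ?thesis using iid_Db_zero_codeword[OF M h inv] by simp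
qed

lemma (in lin_code) ext_odd:
  assumes M: "sym_law M" and N: "0 < N" and h: "bmeas (cube N) h"
    and h0: "\<And>l x. h (l(0 := x)) = h l"
    and inv: "\<And>u l. u \<in> C \<Longrightarrow> l \<in> space (cube N) \<Longrightarrow> h (flip u N l) = bpsk (u 0) * h l"
  shows "(\<integral>l. h l * n0 C N l \<partial>iid N M) = (\<integral>l. h l * Du N (\<lambda>_. False) l \<partial>iid N M)"
proof -
  have z: "zeroed {0} l = l(0 := 0)" for l by (auto simp: zeroed_def fun_eq_iff)
  have "(\<integral>l. h l * Nb C N 0 l \<partial>iid N M) = (\<integral>l. h (zeroed {0} l) * Nb C N 0 (zeroed {0} l) \<partial>iid N M)"
  proof (rule iid_zeroed_affine[OF M bmeas_mult[OF h bmeas_Nb], where \<beta>="\<lambda>k l. h l * D0 C N l"])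
    fix k l and x :: real assume "k \<in> {0::nat}"
    then show "h (l(k := x)) * Nb C N 0 (l(k := x)) = h (l(k := 0)) * Nb C N 0 (l(k := 0)) + x * (h l * D0 C N l)"
      using Nb_upd[OF N, of C l x] by (simp add: h0 D0_def algebra_simps)
  qed (use N in auto)
  also have "\<dots> = (\<integral>l. h l * n0 C N l \<partial>iid N M)" by (simp only: z h0 n0_def)
  finally show ?thesis using iid_Nb_zero_codeword[OF M h inv] by simp
qed

lemma bpsk_power_even: "(bpsk b * x)\<^sup>2 = x\<^sup>2"
  by (simp add: bpsk_def)

text \<open>The Nishimori identity: with the all-zero codeword sent, the moments of orders 2n + 1
  and 2n + 2 of the posterior mean coincide. An odd function is paired with \<open>n0\<close>, which
  is \<open>ff\<close> times \<open>D0\<close> and so supplies the missing power.\<close>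

lemma (in lin_code) mom_zero_codeword:
  assumes M: "sym_law M" and N: "0 < N"
  shows "(\<integral>l. (ff C N l)\<^sup>2 ^ Suc n * Du N (\<lambda>_. False) l \<partial>iid N M) = mom C N M n"
    and "(\<integral>l. ((ff C N l)\<^sup>2 ^ n * ff C N l) * Du N (\<lambda>_. False) l \<partial>iid N M) = mom C N M n"
proof -
  note LI = law_iid[OF sym_law_law[OF M], of N]
  show "(\<integral>l. (ff C N l)\<^sup>2 ^ Suc n * Du N (\<lambda>_. False) l \<partial>iid N M) = mom C N M n"
    unfolding mom_def
    by (rule ext_even[OF M N, symmetric]) (auto intro!: bmeas_power bmeas_mult bmeas_ff[OF N] simp: ff_upd ff_flip[OF N] bpsk_power_even simp del: power_Suc)
  have "(\<integral>l. ((ff C N l)\<^sup>2 ^ n * ff C N l) * Du N (\<lambda>_. False) l \<partial>iid N M) = (\<integral>l. ((ff C N l)\<^sup>2 ^ n * ff C N l) * n0 C N l \<partial>iid N M)"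
    by (rule ext_odd[OF M N, symmetric]) (auto intro!: bmeas_power bmeas_mult bmeas_ff[OF N] simp: ff_upd ff_flip[OF N] bpsk_power_even)
  also have "\<dots> = mom C N M n"
    unfolding mom_def
    by (rule law_integral_cong[OF LI]) (simp add: ff_D0[OF N, symmetric] power2_eq_square)
  finally show "(\<integral>l. ((ff C N l)\<^sup>2 ^ n * ff C N l) * Du N (\<lambda>_. False) l \<partial>iid N M) = mom C N M n" .
qed

text \<open>The law of a soft bit given that \<open>+1\<close> was sent.\<close>

definition tilt :: "real measure \<Rightarrow> real measure" where
  "tilt M = density M (\<lambda>x. ennreal (1 + x))"

lemma tilt_integral:
  assumes M: "sym_law M" and f: "bmeas BB f"
  shows "(\<integral>x. f x \<partial>tilt M) = (\<integral>x. \<bar>1 + x\<bar> * f x \<partial>M)"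
proof -
  note L = sym_law_law[OF M]
  have "(\<integral>x. f x \<partial>tilt M) = (\<integral>x. (1 + x) *\<^sub>R f x \<partial>M)"
    unfolding tilt_def
    by (rule integral_density)
      (use bmeas_measurable[OF law_bmeas[OF L f]] bmeas_measurable[OF law_bmeas[OF L bmeas_BB_id]] law_space[OF L] in \<open>auto simp: space_BB\<close>)
  also have "\<dots> = (\<integral>x. \<bar>1 + x\<bar> * f x \<partial>M)" by (rule law_integral_cong[OF L]) (simp add: space_BB)
  finally show ?thesis .
qed

lemma law_tilt:
  assumes M: "sym_law M" shows "law BB (tilt M)"
proof -
  note L = sym_law_law[OF M]
  have b: "bmeas BB (\<lambda>x. 1 + x)" by (intro bmeas_add bmeas_const bmeas_BB_id)
  have "emeasure (tilt M) (space (tilt M)) = (\<integral>\<^sup>+ x. ennreal (1 + x) \<partial>M)"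
    unfolding tilt_def using bmeas_measurable[OF law_bmeas[OF L b]]
    by (simp add: emeasure_density cong: nn_integral_cong)
  also have "\<dots> = ennreal (\<integral>x. 1 + x \<partial>M)"
    by (rule nn_integral_eq_integral[OF law_integrable[OF L b]]) (auto simp: law_space[OF L] space_BB)
  also have "(\<integral>x. 1 + x \<partial>M) = 1"
    by (subst law_integral_add[OF L bmeas_const bmeas_BB_id]) (simp add: sym_law_mean[OF M] law_measure[OF L])
  finally have "prob_space (tilt M)" by (intro prob_spaceI) simp
  moreover have "sets (tilt M) = sets BB" unfolding tilt_def using law_sets[OF L] by simp
  ultimately show ?thesis by (simp add: law_def)
qed

lemma iid_tilt:
  assumes M: "sym_law M" and F: "bmeas (cube N) F"
  shows "(\<integral>l. F l \<partial>iid N (tilt M)) = (\<integral>l. F l * Du N (\<lambda>_. False) l \<partial>iid N M)"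
proof -
  note L = sym_law_law[OF M]
  interpret prob_space M using L by (rule law_prob)
  have "(\<integral>l. F l \<partial>PiM {..<N} (\<lambda>_. tilt M)) = (\<integral>y. (\<Prod>j\<in>{..<N}. \<bar>1 + y j\<bar>) * F (\<lambda>j\<in>{..<N}. y j) \<partial>PiM {..<N} (\<lambda>_. M))"
  proof (rule integral_PiM_transfer[where g="\<lambda>_ x. x" and s="\<lambda>x. \<bar>1 + x\<bar>", OF _ _ _ _ law_tilt[OF M] tilt_integral[OF M]])
    show "sigma_finite_measure M" by unfold_locales
    show "integrable M (\<lambda>x. \<bar>1 + x\<bar>)"
      by (intro law_integrable[OF L] bmeas_abs bmeas_add bmeas_const bmeas_BB_id)
    show "(\<lambda>x. x) \<in> measurable M BB" using measurable_cong_sets[OF law_sets[OF L] refl, of BB] by simp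
  qed (use F in \<open>auto simp: cube_def\<close>)
  also have "\<dots> = (\<integral>l. F l * Du N (\<lambda>_. False) l \<partial>iid N M)"
    unfolding iid_def[symmetric]
  proof (rule law_integral_cong[OF law_iid[OF L]])
    fix l assume l: "l \<in> space (cube N)"
    have "(\<lambda>j\<in>{..<N}. l j) = l" using l by (auto simp: space_cube PiE_iff extensional_def fun_eq_iff)
    moreover have "(\<Prod>j\<in>{..<N}. \<bar>1 + l j\<bar>) = Du N (\<lambda>_. False) l"
      unfolding Du_def
    proof (rule prod.cong[OF refl])
      fix j assume "j \<in> {..<N}"
      then have "\<bar>l j\<bar> \<le> 1" using cube_abs[OF l] by simp
      then show "\<bar>1 + l j\<bar> = 1 + bpsk False * l j" by (simp add: bpsk_def abs_le_iff)
    qed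
    ultimately show "(\<Prod>j\<in>{..<N}. \<bar>1 + l j\<bar>) * F (\<lambda>j\<in>{..<N}. l j) = F l * Du N (\<lambda>_. False) l" by simp
  qed
  finally show ?thesis by (simp add: iid_def)
qed

definition unpair :: "nat \<Rightarrow> nat set \<Rightarrow> (nat \<Rightarrow> real \<times> real) \<Rightarrow> nat \<Rightarrow> real" where
  "unpair N J w = (\<lambda>k\<in>J \<union> (+) N ` J. if k < N then fst (w k) else snd (w (k - N)))"

text \<open>For \<open>J\<close> below \<open>N\<close> the set and its translate by
  \<open>N\<close> are disjoint, so independent samples on their union are independent pairs on
  \<open>J\<close>. This puts the two halves of the long code into the form used by
  \<open>energy\<close>.\<close>

lemma integral_unpair:
  assumes L: "law BB M" and J: "finite J" "J \<subseteq> {..<N}" and F: "bmeas (PiM (J \<union> (+) N ` J) (\<lambda>_. BB)) F"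
  shows "(\<integral>l. F l \<partial>PiM (J \<union> (+) N ` J) (\<lambda>_. M)) = (\<integral>w. F (unpair N J w) \<partial>PiM J (\<lambda>_. M \<Otimes>\<^sub>M M))"
  using J F
proof (induction J arbitrary: F rule: finite_induct)
  case empty
  then show ?case by (simp add: PiM_empty lebesgue_integral_count_space_finite unpair_def)
next
  case (insert i J)
  note LL = law_pair[OF L L]
  let ?I = "J \<union> (+) N ` J"
  have iN: "i < N" and JN: "J \<subseteq> {..<N}" using insert.prems by auto
  have I: "insert i J \<union> (+) N ` insert i J = insert (N + i) (insert i ?I)" by auto
  have ni: "i \<notin> ?I" "N + i \<notin> insert i ?I" using insert.hyps iN JN by auto
  have fin: "finite ?I" using insert.hyps by auto
  have F: "bmeas (PiM (insert (N + i) (insert i ?I)) (\<lambda>_. BB)) F" using insert.prems(2) unfolding I .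
  let ?F1 = "\<lambda>l. \<integral>y. F (l(N + i := y)) \<partial>M"
  let ?F2 = "\<lambda>l. \<integral>x. ?F1 (l(i := x)) \<partial>M"
  have bF1: "bmeas (PiM (insert i ?I) (\<lambda>_. BB)) ?F1" by (rule bmeas_partial_integral[OF L F])
  have bF2: "bmeas (PiM ?I (\<lambda>_. BB)) ?F2" by (rule bmeas_partial_integral[OF L bF1])
  have meas: "unpair N K \<in> measurable (PiM K (\<lambda>_. BB \<Otimes>\<^sub>M BB)) (PiM (K \<union> (+) N ` K) (\<lambda>_. BB))" if K: "K \<subseteq> {..<N}" for K
  proof -
    have "(\<lambda>w. if k < N then fst (w k) else snd (w (k - N))) \<in> measurable (PiM K (\<lambda>_. BB \<Otimes>\<^sub>M BB)) BB"
      if k: "k \<in> K \<union> (+) N ` K" for k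
    proof (cases "k < N")
      case True
      then have "k \<in> K" using k by auto
      then have [measurable]: "(\<lambda>w. w k) \<in> measurable (PiM K (\<lambda>_. BB \<Otimes>\<^sub>M BB)) (BB \<Otimes>\<^sub>M BB)"
        using measurable_component_singleton[of k K "\<lambda>_. BB \<Otimes>\<^sub>M BB"] by simp
      show ?thesis using True by simp
    next
      case False
      then have "k - N \<in> K" using k K by auto
      then have [measurable]: "(\<lambda>w. w (k - N)) \<in> measurable (PiM K (\<lambda>_. BB \<Otimes>\<^sub>M BB)) (BB \<Otimes>\<^sub>M BB)"
        using measurable_component_singleton[of "k - N" K "\<lambda>_. BB \<Otimes>\<^sub>M BB"] by simp
      show ?thesis using False by simp
    qed
    then show ?thesis unfolding unpair_def by (intro measurable_restrict)
  qed
  have up: "unpair N (insert i J) (w(i := z)) = (unpair N J w)(i := fst z, N + i := snd z)" for w z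
    using iN JN insert.hyps by (auto simp: unpair_def fun_eq_iff restrict_def)
  have "(\<integral>l. F l \<partial>PiM (insert i J \<union> (+) N ` insert i J) (\<lambda>_. M)) = (\<integral>l. ?F1 l \<partial>PiM (insert i ?I) (\<lambda>_. M))"
    unfolding I using fin ni by (intro integral_PiM_insert[OF L _ _ F]) auto
  also have "\<dots> = (\<integral>l. ?F2 l \<partial>PiM ?I (\<lambda>_. M))"
    by (rule integral_PiM_insert[OF L fin ni(1) bF1])
  also have "\<dots> = (\<integral>w. ?F2 (unpair N J w) \<partial>PiM J (\<lambda>_. M \<Otimes>\<^sub>M M))"
    by (rule insert.IH[OF JN bF2])
  also have "\<dots> = (\<integral>w. (\<integral>z. F (unpair N (insert i J) (w(i := z))) \<partial>(M \<Otimes>\<^sub>M M)) \<partial>PiM J (\<lambda>_. M \<Otimes>\<^sub>M M))"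
  proof (rule law_integral_cong[OF law_PiM[OF LL]])
    fix w assume w: "w \<in> space (PiM J (\<lambda>_. BB \<Otimes>\<^sub>M BB))"
    have "(\<lambda>z. unpair N (insert i J) (w(i := z))) \<in> measurable (BB \<Otimes>\<^sub>M BB) (PiM (insert (N + i) (insert i ?I)) (\<lambda>_. BB))"
      using measurable_compose[OF measurable_upd1[OF w, of i] meas[of "insert i J"]] insert.prems(1) unfolding I by simp
    from integral_pair[OF L L bmeas_compose[OF this F]]
    show "?F2 (unpair N J w) = (\<integral>z. F (unpair N (insert i J) (w(i := z))) \<partial>(M \<Otimes>\<^sub>M M))"
      unfolding up by simp
  qed
  also have "\<dots> = (\<integral>w. F (unpair N (insert i J) w) \<partial>PiM (insert i J) (\<lambda>_. M \<Otimes>\<^sub>M M))"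
    using insert.hyps bmeas_compose[OF meas[OF insert.prems(1)] insert.prems(2)]
    by (intro integral_PiM_insert[OF LL, symmetric]) auto
  finally show ?case .
qed

section \<open>Extrinsic estimates of consecutive codes\<close>

lemma ff_cong: "(\<And>j. 0 < j \<Longrightarrow> j < N \<Longrightarrow> l j = l' j) \<Longrightarrow> ff C N l = ff C N l'"
proof -
  assume a: "\<And>j. 0 < j \<Longrightarrow> j < N \<Longrightarrow> l j = l' j"
  have "Db C N (l(0 := 0)) = Db C N (l'(0 := 0))" by (rule Db_cong) (use a in auto)
  moreover have "Nb C N 0 (l(0 := 0)) = Nb C N 0 (l'(0 := 0))" by (rule Nb_cong) (use a in auto)
  ultimately show ?thesis unfolding ff_def n0_def D0_def by simp
qed

lemma ff_reindex:
  assumes inv: "\<And>j. \<sigma> (\<sigma> j) = j" and dom: "\<And>j. \<sigma> j < N \<longleftrightarrow> j < N"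
    and aut: "\<And>u. u \<in> C \<Longrightarrow> (\<lambda>j. u (\<sigma> j)) \<in> C" and z: "\<sigma> 0 = 0"
  shows "ff C N (\<lambda>j. l (\<sigma> j)) = ff C N l"
proof -
  have "\<sigma> j = 0 \<longleftrightarrow> j = 0" for j using inv[of j] z by metis
  then have e: "(\<lambda>j. l (\<sigma> j))(0 := 0) = (\<lambda>j. (l(0 := 0)) (\<sigma> j))" by (auto simp: fun_eq_iff)
  have "Db C N (\<lambda>j. (l(0 := 0)) (\<sigma> j)) = Db C N (l(0 := 0))" by (rule Db_reindex[OF inv dom aut])
  moreover have "Nb C N 0 (\<lambda>j. (l(0 := 0)) (\<sigma> j)) = Nb C N (\<sigma> 0) (l(0 := 0))" by (rule Nb_reindex[OF inv dom aut])
  ultimately show ?thesis unfolding ff_def n0_def D0_def e z by simp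
qed

lemma ff_low_flip:
  assumes "u \<in> rm_code r (Suc m)"
  shows "ff (rm_code r m) (2 ^ m) (flip u (2 ^ Suc m) l) = bpsk (u 0) * ff (rm_code r m) (2 ^ m) l"
proof -
  interpret lin_code "rm_code r m" "2 ^ m" by (rule lin_code_rm)
  have v: "low (2 ^ m) u \<in> rm_code r m" using assms low_rm_code[of m r] by blast
  have "ff (rm_code r m) (2 ^ m) (flip u (2 ^ Suc m) l) = ff (rm_code r m) (2 ^ m) (flip (low (2 ^ m) u) (2 ^ m) l)"
    by (rule ff_cong) (auto simp: flip_def low_def)
  then show ?thesis using ff_flip[OF _ v, of l] by (simp add: low_def)
qed

text \<open>The estimate from the short code changes sign with bit 0 under every codeword of the
  long code as well. Hence both integrals may be taken with the all-zero codeword, where the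
  coordinates of the upper half integrate out.\<close>

lemma mom_level:
  fixes r m :: nat
  defines "f \<equiv> ff (rm_code r m) (2 ^ m)"
  assumes M: "sym_law M"
  shows "(\<integral>l. (f l)\<^sup>2 ^ Suc n * D0 (rm_code r (Suc m)) (2 ^ Suc m) l \<partial>iid (2 ^ Suc m) M) = mom (rm_code r m) (2 ^ m) M n"
    and "(\<integral>l. ((f l)\<^sup>2 ^ n * f l) * n0 (rm_code r (Suc m)) (2 ^ Suc m) l \<partial>iid (2 ^ Suc m) M) = mom (rm_code r m) (2 ^ m) M n"
proof -
  interpret A: lin_code "rm_code r m" "2 ^ m" by (rule lin_code_rm)
  interpret B: lin_code "rm_code r (Suc m)" "2 ^ Suc m" by (rule lin_code_rm)
  note L = sym_law_law[OF M]
  have bf: "bmeas (cube (2 ^ m)) f" unfolding f_def by (rule bmeas_ff) simp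
  have fr: "f (restrict l {..<2 ^ m}) = f l" for l unfolding f_def by (rule ff_restrict)
  have bf': "bmeas (cube (2 ^ Suc m)) f" by (rule iid_restrict(2)[OF L bf pow2_le_Suc fr])
  have fu: "f (l(0 := x)) = f l" for l x unfolding f_def by (rule ff_upd)
  have ffl: "f (flip u (2 ^ Suc m) l) = bpsk (u 0) * f l" if "u \<in> rm_code r (Suc m)" for u l
    unfolding f_def using that by (rule ff_low_flip)
  have "(\<integral>l. (f l)\<^sup>2 ^ Suc n * D0 (rm_code r (Suc m)) (2 ^ Suc m) l \<partial>iid (2 ^ Suc m) M) =
      (\<integral>l. (f l)\<^sup>2 ^ Suc n * Du (2 ^ Suc m) (\<lambda>_. False) l \<partial>iid (2 ^ Suc m) M)"
    by (rule B.ext_even[OF M]) (auto intro!: bmeas_power bf' simp: fu ffl bpsk_power_even simp del: power_Suc)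
  also have "\<dots> = (\<integral>l. (f l)\<^sup>2 ^ Suc n * Du (2 ^ m) (\<lambda>_. False) l \<partial>iid (2 ^ m) M)"
    by (rule iid_low_zero_codeword[OF M _ pow2_le_Suc]) (auto intro!: bmeas_power bf simp: fr simp del: power_Suc)
  finally show "(\<integral>l. (f l)\<^sup>2 ^ Suc n * D0 (rm_code r (Suc m)) (2 ^ Suc m) l \<partial>iid (2 ^ Suc m) M) = mom (rm_code r m) (2 ^ m) M n"
    unfolding f_def by (simp only: A.mom_zero_codeword(1)[OF M zero_less_power[OF zero_less_numeral]])
  have "(\<integral>l. ((f l)\<^sup>2 ^ n * f l) * n0 (rm_code r (Suc m)) (2 ^ Suc m) l \<partial>iid (2 ^ Suc m) M) =
      (\<integral>l. ((f l)\<^sup>2 ^ n * f l) * Du (2 ^ Suc m) (\<lambda>_. False) l \<partial>iid (2 ^ Suc m) M)"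
    by (rule B.ext_odd[OF M]) (auto intro!: bmeas_power bmeas_mult bf' simp: fu ffl bpsk_power_even simp del: power_Suc)
  also have "\<dots> = (\<integral>l. ((f l)\<^sup>2 ^ n * f l) * Du (2 ^ m) (\<lambda>_. False) l \<partial>iid (2 ^ m) M)"
    by (rule iid_low_zero_codeword[OF M _ pow2_le_Suc]) (auto intro!: bmeas_power bmeas_mult bf simp: fr)
  finally show "(\<integral>l. ((f l)\<^sup>2 ^ n * f l) * n0 (rm_code r (Suc m)) (2 ^ Suc m) l \<partial>iid (2 ^ Suc m) M) = mom (rm_code r m) (2 ^ m) M n"
    unfolding f_def by (simp only: A.mom_zero_codeword(2)[OF M zero_less_power[OF zero_less_numeral]])
qed

text \<open>Conditional Jensen: the short estimate is a coarser estimate of the same bit. The even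
  power is bounded below by its tangent at the short estimate, and the linear term integrates to
  zero because the two integrals of \<open>mom_level\<close> agree.\<close>

lemma mom_mono:
  assumes M: "sym_law M"
  shows "mom (rm_code r m) (2 ^ m) M n \<le> mom (rm_code r (Suc m)) (2 ^ Suc m) M n"
proof -
  note L = sym_law_law[OF M] and LI = law_iid[OF sym_law_law[OF M], of "2 ^ Suc m"]
  let ?C' = "rm_code r (Suc m)" and ?N' = "2 ^ Suc m :: nat"
  have N': "0 < ?N'" by simp
  define f where "f = ff (rm_code r m) (2 ^ m)"
  define \<mu> where "\<mu> = mom (rm_code r m) (2 ^ m) M n"
  have bf: "bmeas (cube ?N') f"
    unfolding f_def by (rule iid_restrict(2)[OF L bmeas_ff pow2_le_Suc ff_restrict]) simp
  let ?k = "real (Suc n)"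
  let ?A = "\<lambda>l. (f l)\<^sup>2 ^ Suc n * D0 ?C' ?N' l" and ?B = "\<lambda>l. ((f l)\<^sup>2 ^ n * f l) * n0 ?C' ?N' l"
  have lev: "(\<integral>l. ?A l \<partial>iid ?N' M) = \<mu>" "(\<integral>l. ?B l \<partial>iid ?N' M) = \<mu>"
    unfolding f_def \<mu>_def by (rule mom_level(1)[OF M], rule mom_level(2)[OF M])
  have bA: "bmeas (cube ?N') ?A" by (intro bmeas_mult bmeas_power bf bmeas_D0 N')
  have bB: "bmeas (cube ?N') ?B" by (intro bmeas_mult bmeas_power bf bmeas_n0 N')
  have "(\<integral>l. (1 - 2 * ?k) * ?A l + (2 * ?k) * ?B l \<partial>iid ?N' M) \<le> mom ?C' ?N' M n"
    unfolding mom_def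
  proof (rule law_integral_mono[OF LI bmeas_add[OF bmeas_cmult[OF bA] bmeas_cmult[OF bB]] bmeas_mom[OF N']])
    fix l assume l: "l \<in> space (cube ?N')"
    define a where "a = ff ?C' ?N' l"
    define d where "d = D0 ?C' ?N' l"
    have d: "0 \<le> d" unfolding d_def by (rule D0_nonneg[OF N' l])
    have n: "n0 ?C' ?N' l = a * d" unfolding a_def d_def by (rule ff_D0[OF N' l, symmetric])
    have "2 * f l * (a - f l) \<le> a\<^sup>2 - (f l)\<^sup>2"
      using zero_le_power2[of "a - f l"] by (simp add: power2_eq_square algebra_simps)
    then have "?k * (f l)\<^sup>2 ^ n * (2 * f l * (a - f l)) \<le> ?k * (f l)\<^sup>2 ^ n * (a\<^sup>2 - (f l)\<^sup>2)"
      by (intro mult_left_mono) auto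
    with power_tangent[OF zero_le_power2[of a] zero_le_power2[of "f l"], of n]
    have "(f l)\<^sup>2 ^ Suc n + ?k * (f l)\<^sup>2 ^ n * (2 * f l * (a - f l)) \<le> (a\<^sup>2) ^ Suc n" by linarith
    then have "((f l)\<^sup>2 ^ Suc n + ?k * (f l)\<^sup>2 ^ n * (2 * f l * (a - f l))) * d \<le> (a\<^sup>2) ^ Suc n * d"
      using d by (rule mult_right_mono)
    also have "((f l)\<^sup>2 ^ Suc n + ?k * (f l)\<^sup>2 ^ n * (2 * f l * (a - f l))) * d = (1 - 2 * ?k) * ?A l + (2 * ?k) * ?B l"
      unfolding n d_def[symmetric] by (simp add: power2_eq_square algebra_simps)
    finally show "(1 - 2 * ?k) * ?A l + (2 * ?k) * ?B l \<le> (ff ?C' ?N' l)\<^sup>2 ^ Suc n * D0 ?C' ?N' l"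
      unfolding a_def d_def .
  qed
  moreover have "(\<integral>l. (1 - 2 * ?k) * ?A l + (2 * ?k) * ?B l \<partial>iid ?N' M) = (1 - 2 * ?k) * \<mu> + (2 * ?k) * \<mu>"
    by (subst law_integral_add[OF LI bmeas_cmult[OF bA] bmeas_cmult[OF bB]]) (simp only: integral_mult_right_zero lev)
  ultimately show ?thesis unfolding \<mu>_def by (simp add: algebra_simps)
qed

lemma flip_bit_eq_add: "\<not> bit (j::nat) m \<Longrightarrow> flip_bit m j = 2 ^ m + j"
proof -
  assume a: "\<not> bit j m"
  have "and (2 ^ m) j = 0"
    by (rule bit_eqI) (use a in \<open>auto simp: bit_and_iff bit_exp_iff\<close>)
  then have e: "2 ^ m + j = semiring_bit_operations_class.or (2 ^ m) j"
    by (rule disjunctive_add_eq_or)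
  show ?thesis
    unfolding e by (rule bit_eqI) (use a in \<open>auto simp: bit_or_iff bit_exp_iff bit_flip_bit_iff\<close>)
qed

text \<open>Describes the second copy of the short code: points with bit \<open>b\<close> unset stay
  in the common hyperplane, the others move to the upper half.\<close>

lemma transvect_top:
  assumes "j < 2 ^ Suc b"
  shows "transvect (Suc b) {b} j = (if j < 2 ^ b then j else 2 ^ Suc b + j)"
proof -
  have "j < 2 ^ b \<longleftrightarrow> \<not> bit j b"
    using assms unfolding less_pow2_iff_bit by (metis le_eq_less_or_eq Suc_le_eq order_refl)
  moreover have "\<not> bit j (Suc b)" using assms unfolding less_pow2_iff_bit by blast
  moreover have "{i \<in> {b}. bit j i} = (if bit j b then {b} else {})" by auto
  ultimately show ?thesis unfolding transvect_def using flip_bit_eq_add[of j "Suc b"] by auto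
qed

text \<open>The left side is the variance, because the first two moments agree. The transvections
  fix bit 0 and permute the hyperplanes, so all energies in the averaged bound coincide and the
  bound holds for a single hyperplane.\<close>

lemma ff_energy:
  fixes r b :: nat
  defines "N \<equiv> 2 ^ Suc b :: nat" and "C \<equiv> rm_code r (Suc b)"
  assumes M: "sym_law M"
  shows "mom C N M 0 * (1 - mom C N M 0) \<le> energy {..<N} (tilt M) {1..<2 ^ b} (ff C N)"
proof -
  interpret lin_code C N unfolding C_def by (rule lin_code_rm)
  have N: "0 < N" by (simp add: N_def)
  note LP = law_tilt[OF M]
  note bf = bmeas_ff[OF N, of C]
  let ?H = "Pow {..<b}"
  let ?Ch = "\<lambda>h. {j. transvect b h j \<in> {1..<2 ^ b}}"
  have "real (card ?H) * ((\<integral>l. ff C N l ^ 2 \<partial>PiM {..<N} (\<lambda>_. tilt M)) - (\<integral>l. ff C N l \<partial>PiM {..<N} (\<lambda>_. tilt M))^2)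
      \<le> (\<Sum>h\<in>?H. energy {..<N} (tilt M) (?Ch h) (ff C N))"
  proof (rule variance_le_energy[OF LP])
    show "card ?H \<le> 2 * card {h \<in> ?H. j \<notin> ?Ch h}" if "j \<in> {..<N}" for j
      using half_of_hyperplanes_miss[of j b] that by (simp add: N_def)
  qed (use bf in \<open>auto simp: cube_def\<close>)
  also have "\<dots> = (\<Sum>h\<in>?H. energy {..<N} (tilt M) {1..<2 ^ b} (ff C N))"
  proof (rule sum.cong[OF refl])
    fix h assume h: "h \<in> ?H"
    then have bh: "b \<notin> h" "h \<subseteq> {..<Suc b}" by auto
    have inv: "transvect b h (transvect b h j) = j" for j by (rule transvect_invol[OF bh(1)])
    have dom: "transvect b h j < N \<longleftrightarrow> j < N" for j unfolding N_def by (rule transvect_less) simp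
    have aut: "(\<lambda>j. u (transvect b h j)) \<in> C" if "u \<in> C" for u
      using that unfolding C_def by (rule rm_code_transvect) (use bh in auto)
    have z: "transvect b h 0 = 0" by (simp add: transvect_def)
    show "energy {..<N} (tilt M) (?Ch h) (ff C N) = energy {..<N} (tilt M) {1..<2 ^ b} (ff C N)"
    proof (rule energy_reindex[OF LP, where \<sigma>="transvect b h"])
      show "bij_betw (transvect b h) {..<N} {..<N}"
        by (rule bij_betw_byWitness[where f'="transvect b h"]) (auto simp: inv dom)
      show "ff C N (\<lambda>j\<in>{..<N}. l (transvect b h j)) = ff C N l" for l
        unfolding ff_restrict by (rule ff_reindex[OF inv dom aut z])
    qed (use bf in \<open>auto simp: cube_def\<close>)
  qed
  also have "\<dots> = real (card ?H) * energy {..<N} (tilt M) {1..<2 ^ b} (ff C N)" by simp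
  finally have "(\<integral>l. ff C N l ^ 2 \<partial>iid N (tilt M)) - (\<integral>l. ff C N l \<partial>iid N (tilt M))^2
      \<le> energy {..<N} (tilt M) {1..<2 ^ b} (ff C N)"
    unfolding iid_def by (rule mult_left_le_imp_le) (simp add: card_Pow)
  moreover have "(\<integral>l. ff C N l ^ 2 \<partial>iid N (tilt M)) = mom C N M 0"
    using mom_zero_codeword(1)[OF M N, of 0] iid_tilt[OF M bmeas_power[OF bf], of 2] by simp
  moreover have "(\<integral>l. ff C N l \<partial>iid N (tilt M)) = mom C N M 0"
    using mom_zero_codeword(2)[OF M N, of 0] iid_tilt[OF M bf] by simp
  ultimately show ?thesis by (simp add: power2_eq_square algebra_simps)
qed

text \<open>The restrictions of \<open>RM(r, m+1)\<close> to the half-spaces \<open>v\<^sub>m = 0\<close> and \<open>v\<^sub>m = v\<^bsub>m-1\<^esub>\<close> are copies of \<open>RM(r, m)\<close>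
  that meet in a hyperplane of each, so their extrinsic estimates of bit \<open>0\<close> are weakly correlated; averaging them
  must improve on either unless the estimate is already deterministic.\<close>

lemma two_look:
  fixes r m :: nat
  assumes M: "sym_law M" and m: "1 \<le> m"
  defines "p \<equiv> mom (rm_code r m) (2 ^ m) M 0" and "p' \<equiv> mom (rm_code r (Suc m)) (2 ^ Suc m) M 0"
  shows "p * (1 - p) / 4 \<le> p' - p"
proof -
  obtain b where b: "m = Suc b" using m by (cases m) auto
  define N :: nat where "N = 2 ^ m"
  define N' :: nat where "N' = 2 ^ Suc m"
  define C where "C = rm_code r m"
  define C' where "C' = rm_code r (Suc m)"
  define f where "f = ff C N"
  define \<tau> where "\<tau> = transvect m {b}"
  define fB where "fB l = f (\<lambda>j. l (\<tau> j))" for l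
  let ?d = "Du N' (\<lambda>_. False)"
  interpret A: lin_code C N unfolding C_def by (rule lin_code_rm)
  interpret B: lin_code C' N' unfolding C'_def by (rule lin_code_rm)
  note L = sym_law_law[OF M] and LI = law_iid[OF sym_law_law[OF M], of N']
  have N: "0 < N" "0 < N'" "N \<le> N'" "N' = N + N" by (auto simp: N_def N'_def)
  have fr: "f (restrict l {..<N}) = f l" for l unfolding f_def by (rule ff_restrict)
  have bfN: "bmeas (cube N) f" unfolding f_def by (rule bmeas_ff[OF N(1)])
  have bf: "bmeas (cube N') f" by (rule iid_restrict(2)[OF L bfN N(3) fr])
  have inv: "\<tau> (\<tau> j) = j" for j unfolding \<tau>_def b by (rule transvect_invol) simp
  have dom: "\<tau> j < N' \<longleftrightarrow> j < N'" for j unfolding \<tau>_def N'_def by (rule transvect_less) simp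
  have aut: "(\<lambda>j. u (\<tau> j)) \<in> C'" if "u \<in> C'" for u
    using that unfolding C'_def \<tau>_def by (rule rm_code_transvect) (auto simp: b)
  have z: "\<tau> 0 = 0" unfolding \<tau>_def by (simp add: transvect_def)
  have bfB: "bmeas (cube N') fB" unfolding fB_def by (rule iid_reindex(2)[OF L bf inv dom])
  \<comment> \<open>The symmetry \<tau> preserves the density of the all-zero codeword, so the
    second estimate has the same law as the first.\<close>
  have sw: "(\<integral>l. G (fB l) * ?d l \<partial>iid N' M) = (\<integral>l. G (f l) * ?d l \<partial>iid N' M)"
    if G: "bmeas (cube N') (\<lambda>l. G (f l))" for G :: "real \<Rightarrow> real"
  proof -
    have "?d (\<lambda>j. l (\<tau> j)) = ?d l" for l unfolding Du_reindex[OF inv dom] ..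
    then show ?thesis
      using iid_reindex(1)[OF L bmeas_mult[OF G bmeas_Du[of N' "\<lambda>_. False"]] inv dom] unfolding fB_def by simp
  qed
  have fu: "f (l(0 := x)) = f l" for l x unfolding f_def by (rule ff_upd)
  have fBu: "fB (l(0 := x)) = fB l" for l x
  proof -
    have "\<tau> j = 0 \<longleftrightarrow> j = 0" for j using inv[of j] z by metis
    then have "(\<lambda>j. (l(0 := x)) (\<tau> j)) = (\<lambda>j. l (\<tau> j))(0 := x)" by (auto simp: fun_eq_iff)
    then show ?thesis unfolding fB_def using fu by simp
  qed
  have ffl: "f (flip u N' l) = bpsk (u 0) * f l" if "u \<in> C'" for u l
    unfolding f_def C_def N_def N'_def using that unfolding C'_def by (rule ff_low_flip)
  have fBfl: "fB (flip u N' l) = bpsk (u 0) * fB l" if u: "u \<in> C'" for u l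
  proof -
    have "f (\<lambda>j. flip u N' l (\<tau> j)) = f (flip (\<lambda>j. u (\<tau> j)) N' (\<lambda>j. l (\<tau> j)))"
      unfolding f_def by (rule ff_cong) (use N(3) dom in \<open>auto simp: flip_def\<close>)
    then show ?thesis unfolding fB_def using ffl[OF aut[OF u]] by (simp add: z)
  qed
  define g where "g l = f l + fB l" for l
  have bg: "bmeas (cube N') g" unfolding g_def by (intro bmeas_add bf bfB)
  have q1: "(\<integral>l. f l * ?d l \<partial>iid N' M) = p"
    using iid_low_zero_codeword[OF M bfN N(3) fr] A.mom_zero_codeword(2)[OF M N(1), of 0]
    unfolding p_def C_def[symmetric] N_def[symmetric] f_def by simp
  have q2: "(\<integral>l. (f l)\<^sup>2 * ?d l \<partial>iid N' M) = p"
    using iid_low_zero_codeword[OF M bmeas_power[OF bfN, of 2] N(3)] A.mom_zero_codeword(1)[OF M N(1), of 0] fr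
    unfolding p_def C_def[symmetric] N_def[symmetric] f_def by simp
  have q1B: "(\<integral>l. fB l * ?d l \<partial>iid N' M) = p" using sw[of "\<lambda>x. x"] bf q1 by simp
  have q2B: "(\<integral>l. (fB l)\<^sup>2 * ?d l \<partial>iid N' M) = p" using sw[of "\<lambda>x. x\<^sup>2"] bmeas_power[OF bf, of 2] q2 by simp
  define v where "v = (\<integral>l. (f l - fB l)\<^sup>2 * ?d l \<partial>iid N' M)"
  note bd = bmeas_Du[of N' "\<lambda>_. False"]
  have X: "(\<integral>l. g l * n0 C' N' l \<partial>iid N' M) = 2 * p"
  proof -
    have "(\<integral>l. g l * n0 C' N' l \<partial>iid N' M) = (\<integral>l. g l * ?d l \<partial>iid N' M)"
      by (rule B.ext_odd[OF M N(2) bg]) (simp_all add: g_def fu fBu ffl fBfl distrib_left)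
    also have "\<dots> = (\<integral>l. f l * ?d l + fB l * ?d l \<partial>iid N' M)" unfolding g_def by (simp add: distrib_right)
    also have "\<dots> = 2 * p"
      by (subst law_integral_add[OF LI]) (auto intro!: bmeas_mult bf bfB bd simp: q1 q1B)
    finally show ?thesis .
  qed
  have Y: "(\<integral>l. (g l)\<^sup>2 * D0 C' N' l \<partial>iid N' M) = 4 * p - v"
  proof -
    have gfl: "g (flip u N' l) = bpsk (u 0) * g l" if "u \<in> C'" for u l
      using that by (simp add: g_def ffl fBfl distrib_left)
    have gu: "g (l(0 := x)) = g l" for l x by (simp add: g_def fu fBu)
    have "(\<integral>l. (g l)\<^sup>2 * D0 C' N' l \<partial>iid N' M) = (\<integral>l. (g l)\<^sup>2 * ?d l \<partial>iid N' M)"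
      by (rule B.ext_even[OF M N(2) bmeas_power[OF bg]]) (simp_all add: gu gfl bpsk_power_even)
    also have "\<dots> = (\<integral>l. (2 * ((f l)\<^sup>2 * ?d l) + 2 * ((fB l)\<^sup>2 * ?d l)) - (f l - fB l)\<^sup>2 * ?d l \<partial>iid N' M)"
      by (rule law_integral_cong[OF LI]) (simp add: g_def power2_eq_square algebra_simps)
    also have "\<dots> = (\<integral>l. 2 * ((f l)\<^sup>2 * ?d l) + 2 * ((fB l)\<^sup>2 * ?d l) \<partial>iid N' M) - v"
      unfolding v_def by (rule law_integral_diff[OF LI]) (intro bmeas_add bmeas_cmult bmeas_mult bmeas_power bmeas_diff bf bfB bd)+
    also have "(\<integral>l. 2 * ((f l)\<^sup>2 * ?d l) + 2 * ((fB l)\<^sup>2 * ?d l) \<partial>iid N' M) = 4 * p"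
      by (subst law_integral_add[OF LI]) (auto intro!: bmeas_cmult bmeas_mult bmeas_power bf bfB bd simp: q2 q2B)
    finally show ?thesis .
  qed
  \<comment> \<open>Arranged in pairs, \<open>fB\<close> reads the first entry where the copies
    overlap and the second entry elsewhere; thus \<open>v\<close> is the energy of the common
    hyperplane.\<close>
  have v: "p * (1 - p) \<le> v"
  proof -
    have I: "{..<N} \<union> (+) N ` {..<N} = {..<N'}"
    proof -
      have "(+) N ` {..<N} = {N..<N + N}" 
        unfolding lessThan_atLeast0 image_add_atLeastLessThan by simp
      then show ?thesis unfolding N(4) by auto
    qed
    have bq: "bmeas (cube N') (\<lambda>l. (f l - fB l)\<^sup>2)" by (intro bmeas_power bmeas_diff bf bfB)
    have "v = (\<integral>l. (f l - fB l)\<^sup>2 \<partial>iid N' (tilt M))" unfolding v_def by (rule iid_tilt[OF M bq, symmetric])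
    also have "\<dots> = (\<integral>w. (f (unpair N {..<N} w) - fB (unpair N {..<N} w))\<^sup>2 \<partial>PiM {..<N} (\<lambda>_. tilt M \<Otimes>\<^sub>M tilt M))"
      using integral_unpair[OF law_tilt[OF M], of "{..<N}" N "\<lambda>l. (f l - fB l)\<^sup>2"] bq
      unfolding I iid_def cube_def by simp
    also have "\<dots> = energy {..<N} (tilt M) {1..<2 ^ b} f"
      unfolding energy_def
    proof (rule Bochner_Integration.integral_cong[OF refl])
      fix w
      have u: "unpair N {..<N} w k = (if k < N then fst (w k) else snd (w (k - N)))" if "k < N'" for k
        using that unfolding unpair_def I by simp
      have 1: "f (unpair N {..<N} w) = f (resamp {..<N} UNIV w)"
        unfolding f_def by (rule ff_cong) (use N(3) in \<open>simp add: u resamp_def\<close>)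
      have "fB (unpair N {..<N} w) = f (resamp {..<N} {1..<2 ^ b} w)"
        unfolding f_def fB_def
      proof (rule ff_cong)
        fix j assume j: "0 < j" "j < N"
        then have "\<tau> j = (if j < 2 ^ b then j else N + j)" unfolding \<tau>_def N_def b by (intro transvect_top) simp
        moreover have "\<tau> j < N'" using dom[of j] j N(3) by simp
        ultimately show "unpair N {..<N} w (\<tau> j) = resamp {..<N} {1..<2 ^ b} w j"
          using j by (simp only: u) (auto simp: resamp_def)
      qed
      with 1 show "(f (unpair N {..<N} w) - fB (unpair N {..<N} w))\<^sup>2 = (f (resamp {..<N} UNIV w) - f (resamp {..<N} {1..<2 ^ b} w))\<^sup>2"
        by simp
    qed
    finally show ?thesis
      using ff_energy[OF M, of r b] unfolding p_def f_def C_def N_def b by simp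
  qed
  have p0: "0 \<le> p" unfolding p_def mom_def
    by (rule law_integral_nonneg[OF law_iid[OF L]]) (auto intro!: mult_nonneg_nonneg D0_nonneg simp del: power_Suc)
  have p1: "p \<le> 1"
  proof -
    have "p * p \<le> p"
    proof -
      have "(\<integral>l. f l \<partial>iid N (tilt M))^2 \<le> (\<integral>l. f l ^ 2 \<partial>iid N (tilt M))"
        by (rule law_square_mean_le[OF law_iid[OF law_tilt[OF M]] bfN])
      moreover have "(\<integral>l. f l \<partial>iid N (tilt M)) = p"
        using iid_tilt[OF M bfN] iid_low_zero_codeword[OF M bfN N(3) fr] q1 by simp
      moreover have "(\<integral>l. f l ^ 2 \<partial>iid N (tilt M)) = p"
        using iid_tilt[OF M bmeas_power[OF bfN, of 2]] iid_low_zero_codeword[OF M bmeas_power[OF bfN, of 2] N(3)] fr q2 by simp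
      ultimately show ?thesis by (simp add: power2_eq_square)
    qed
    then show ?thesis using p0 by (cases "p = 0") auto
  qed
  \<comment> \<open>With \<open>v\<close> replaced by its lower bound, \<open>4 * p - v\<close>
    becomes \<open>p * (3 + p)\<close>; this \<open>t\<close> maximises the resulting quadratic
    \<open>4 * t * p - t\<^sup>2 * p * (3 + p)\<close>.\<close>
  define t where "t = 2 / (3 + p)"
  have "3 + p \<noteq> 0" using p0 by linarith
  then have t: "t * (3 + p) = 2" unfolding t_def by (rule nonzero_eq_divide_eq[THEN iffD1, OF _ refl])
  have "2 * t * (2 * p) - t\<^sup>2 * (4 * p - v) \<le> p'"
  proof -
    have bX: "bmeas (cube N') (\<lambda>l. g l * n0 C' N' l)" by (intro bmeas_mult bg bmeas_n0 N)
    have bY: "bmeas (cube N') (\<lambda>l. (g l)\<^sup>2 * D0 C' N' l)" by (intro bmeas_mult bmeas_power bg bmeas_D0 N)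
    have "(\<integral>l. (2 * t) * (g l * n0 C' N' l) - t\<^sup>2 * ((g l)\<^sup>2 * D0 C' N' l) \<partial>iid N' M) \<le> p'"
      unfolding p'_def mom_def C'_def[symmetric] N'_def[symmetric]
    proof (rule law_integral_mono[OF LI bmeas_diff[OF bmeas_cmult[OF bX] bmeas_cmult[OF bY]] bmeas_mom[OF N(2)]])
      fix l assume l: "l \<in> space (cube N')"
      define a where "a = ff C' N' l"
      define d where "d = D0 C' N' l"
      \<comment> \<open>Completing the square compares the posterior mean \<open>a\<close> with the
        estimator \<open>t * g l\<close>.\<close>
      have "0 \<le> d * (a - t * g l)\<^sup>2" unfolding d_def using D0_nonneg[OF N(2) l] by simp
      then have "(2 * t) * (g l * (a * d)) - t\<^sup>2 * ((g l)\<^sup>2 * d) \<le> a\<^sup>2 * d"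
        by (simp add: power2_eq_square algebra_simps)
      then show "(2 * t) * (g l * n0 C' N' l) - t\<^sup>2 * ((g l)\<^sup>2 * D0 C' N' l) \<le> (ff C' N' l)\<^sup>2 ^ Suc 0 * D0 C' N' l"
        unfolding ff_D0[OF N(2) l, symmetric] a_def d_def by simp
    qed
    then show ?thesis
      by (subst (asm) law_integral_diff[OF LI bmeas_cmult[OF bX] bmeas_cmult[OF bY]]) (simp add: X Y)
  qed
  moreover have "t\<^sup>2 * (4 * p - v) \<le> t\<^sup>2 * (p * (3 + p))"
    using v by (intro mult_left_mono) (auto simp: algebra_simps)
  moreover have "t\<^sup>2 * (p * (3 + p)) = 2 * t * p"
  proof -
    have "t\<^sup>2 * (p * (3 + p)) = t * p * (t * (3 + p))" by (simp add: power2_eq_square)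
    then show ?thesis unfolding t by (simp only: mult_ac)
  qed
  ultimately have "2 * t * p \<le> p'" by simp
  moreover have "p + p * (1 - p) / 4 \<le> 2 * t * p"
  proof -
    \<comment> \<open>Equivalent to (1 - p)^2 >= 0; linearising 4 p / (3 + p) in this way is the
      origin of the factor 1 / 4.\<close>
    have "(1 + (1 - p) / 4) * (3 + p) \<le> 4"
      using p0 p1 zero_le_power2[of "1 - p"] by (simp add: power2_eq_square field_simps)
    then have "1 + (1 - p) / 4 \<le> 4 / (3 + p)" using p0 by (simp add: pos_le_divide_eq)
    then have "p * (1 + (1 - p) / 4) \<le> p * (4 / (3 + p))" using p0 by (intro mult_left_mono)
    then show ?thesis by (simp add: t_def algebra_simps)
  qed
  ultimately show ?thesis by simp
qed

section \<open>Nesting of the output divergence\<close>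

definition top_flip :: "nat \<Rightarrow> nat \<Rightarrow> nat" where
  "top_flip m j = xor j (2 ^ m)"

lemma top_flip_invol: "top_flip m (top_flip m j) = j"
  by (rule bit_eqI) (auto simp: top_flip_def bit_xor_iff)

lemma top_flip_less: "top_flip m j < 2 ^ Suc m \<longleftrightarrow> j < 2 ^ Suc m"
  unfolding top_flip_def by (rule xor_less_iff) simp

lemma less_Suc_pow2_iff: "(j::nat) < 2 ^ Suc m \<Longrightarrow> j < 2 ^ m \<longleftrightarrow> \<not> bit j m"
proof
  assume "j < 2 ^ m" then show "\<not> bit j m" unfolding less_pow2_iff_bit by blast
next
  assume j: "j < 2 ^ Suc m" and nb: "\<not> bit j m"
  have "\<not> bit j i" if "m \<le> i" for i
  proof (cases "i = m")
    case False
    then have "Suc m \<le> i" using that by simp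
    then show ?thesis using j unfolding less_pow2_iff_bit by blast
  qed (use nb in simp)
  then show "j < 2 ^ m" unfolding less_pow2_iff_bit by blast
qed

lemma top_flip_low: "j < 2 ^ Suc m \<Longrightarrow> top_flip m j < 2 ^ m \<longleftrightarrow> \<not> j < 2 ^ m"
  using less_Suc_pow2_iff[of j m] less_Suc_pow2_iff[of "top_flip m j" m] top_flip_less[of m j]
  by (simp add: top_flip_def bit_xor_iff bit_exp_iff)

lemma rm_code_top_flip: "u \<in> rm_code r (Suc m) \<Longrightarrow> (\<lambda>j. u (top_flip m j)) \<in> rm_code r (Suc m)"
  unfolding top_flip_def by (rule rm_code_translate) simp_all

lemma Du_split:
  "Du (2 ^ Suc m) u l = Du (2 ^ m) (low (2 ^ m) u) l * Du (2 ^ m) (low (2 ^ m) (\<lambda>j. u (top_flip m j))) (\<lambda>j. l (top_flip m j))"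
proof -
  let ?N = "2 ^ m :: nat" and ?N' = "2 ^ Suc m :: nat" and ?s = "top_flip m"
  have "Du ?N' u l = (\<Prod>j\<in>{..<?N} \<union> {?N..<?N'}. 1 + bpsk (u j) * l j)"
    unfolding Du_def by (intro prod.cong) auto
  also have "\<dots> = (\<Prod>j<?N. 1 + bpsk (u j) * l j) * (\<Prod>j\<in>{?N..<?N'}. 1 + bpsk (u j) * l j)"
    by (intro prod.union_disjoint) auto
  also have "(\<Prod>j\<in>{?N..<?N'}. 1 + bpsk (u j) * l j) = (\<Prod>j<?N. 1 + bpsk (u (?s j)) * l (?s j))"
  proof (rule prod.reindex_bij_witness[of _ ?s ?s])
    show "?s j \<in> {..<?N}" if "j \<in> {?N..<?N'}" for j using that top_flip_low[of j m] by simp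
    show "?s j \<in> {?N..<?N'}" if "j \<in> {..<?N}" for j
    proof -
      have "j < ?N'" using that pow2_le_Suc[of m] by simp
      then show ?thesis using that top_flip_low[of j m] top_flip_less[of m j] by simp
    qed
  qed (simp_all add: top_flip_invol)
  finally show ?thesis unfolding Du_def low_def by simp
qed

lemma cube_restrict: "l \<in> space (cube N') \<Longrightarrow> N \<le> N' \<Longrightarrow> restrict l {..<N} \<in> space (cube N)"
  by (auto simp: space_cube PiE_iff)

lemma Du_nonneg_low:
  assumes "l \<in> space (cube N')" "N \<le> N'" shows "0 \<le> Du N u l"
  using Du_nonneg[OF cube_restrict[OF assms], of u] Du_cong[of N "restrict l {..<N}" l u] by simp

lemma Db_nonneg_low: "l \<in> space (cube N') \<Longrightarrow> N \<le> N' \<Longrightarrow> 0 \<le> Db C N l"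
  unfolding Db_def by (intro divide_nonneg_nonneg sum_nonneg Du_nonneg_low) auto

lemma Db_restrict: "Db C N (restrict l {..<N}) = Db C N l"
  by (rule Db_cong) simp

lemma cube_reindex:
  "l \<in> space (cube N) \<Longrightarrow> (\<And>j. \<sigma> j < N \<longleftrightarrow> j < N) \<Longrightarrow> (\<lambda>j. l (\<sigma> j)) \<in> space (cube N)"
  by (auto simp: space_cube PiE_iff extensional_def)

text \<open>A long codeword is determined by its two halves, and both are short codewords.
  Forgetting the relation between them enlarges the sum to the full product of two codes; the
  constant is the ratio of the numbers of words.\<close>

lemma Db_le_prod:
  fixes r m :: nat
  defines "C \<equiv> rm_code r m" and "C' \<equiv> rm_code r (Suc m)"
  assumes l: "l \<in> space (cube (2 ^ Suc m))"
  shows "Db C' (2 ^ Suc m) l \<le> (card C)\<^sup>2 / card C' * (Db C (2 ^ m) l * Db C (2 ^ m) (\<lambda>j. l (top_flip m j)))"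
proof -
  let ?N = "2 ^ m :: nat" and ?N' = "2 ^ Suc m :: nat" and ?s = "top_flip m"
  let ?l' = "\<lambda>j. l (?s j)"
  interpret A: lin_code C ?N unfolding C_def by (rule lin_code_rm)
  interpret B: lin_code C' ?N' unfolding C'_def by (rule lin_code_rm)
  have l': "?l' \<in> space (cube ?N')" by (rule cube_reindex[OF l top_flip_less])
  let ?\<phi> = "\<lambda>u. (low ?N u, low ?N (\<lambda>j. u (?s j)))"
  let ?G = "\<lambda>(v, w). Du ?N v l * Du ?N w ?l'"
  have lowC: "low ?N u \<in> C" if "u \<in> C'" for u using that low_rm_code[of m r] unfolding C_def C'_def by blast
  have inj: "inj_on ?\<phi> C'"
  proof (rule inj_onI)
    fix u v assume uv: "u \<in> C'" "v \<in> C'" "?\<phi> u = ?\<phi> v"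
    have low_eq: "u j = v j" if "j < ?N" for j using uv(3) that by (auto simp: low_def fun_eq_iff)
    have high_eq: "u (?s j) = v (?s j)" if "j < ?N" for j using uv(3) that by (auto simp: low_def fun_eq_iff)
    show "u = v"
    proof
      fix j
      consider "j < ?N" | "j < ?N'" "\<not> j < ?N" | "\<not> j < ?N'" by blast
      then show "u j = v j"
      proof cases
        case 2
        then have "?s j < ?N" using top_flip_low by simp
        from high_eq[OF this] show ?thesis by (simp add: top_flip_invol)
      next
        case 3
        then show ?thesis using uv(1,2) rm_code_support unfolding C'_def by blast
      qed (rule low_eq)
    qed
  qed
  have nnG: "0 \<le> Du ?N v l * Du ?N w ?l'" for v w
    using Du_nonneg_low[OF l pow2_le_Suc] Du_nonneg_low[OF l' pow2_le_Suc] by simp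
  have "(\<Sum>u\<in>C'. Du ?N' u l) = (\<Sum>u\<in>C'. ?G (?\<phi> u))" by (simp only: Du_split prod.case)
  also have "\<dots> = (\<Sum>z\<in>?\<phi> ` C'. ?G z)" by (subst sum.reindex[OF inj]) (simp only: o_def)
  also have "\<dots> \<le> (\<Sum>z\<in>C \<times> C. ?G z)"
  proof (rule sum_mono2)
    show "finite (C \<times> C)" using A.finite_C by simp
    show "?\<phi> ` C' \<subseteq> C \<times> C" using lowC rm_code_top_flip unfolding C'_def by auto
  qed (use nnG in auto)
  also have "\<dots> = (\<Sum>v\<in>C. Du ?N v l) * (\<Sum>w\<in>C. Du ?N w ?l')"
    by (simp only: sum.cartesian_product[symmetric] sum_product)
  also have "\<dots> = (card C)\<^sup>2 * (Db C ?N l * Db C ?N ?l')"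
    unfolding Db_def using A.card_pos by (simp add: power2_eq_square)
  finally have "(\<Sum>u\<in>C'. Du ?N' u l) / card C' \<le> (card C)\<^sup>2 * (Db C ?N l * Db C ?N ?l') / card C'"
    by (rule divide_right_mono) simp
  then show ?thesis unfolding Db_def[of C' ?N'] by simp
qed

text \<open>The density \<open>D\<close> has marginals \<open>A\<close> and \<open>B\<close> on the
  halves, so \<open>log 2 (A l)\<close> and \<open>log 2 (B l)\<close> both integrate to
  \<open>J\<close> under \<open>D\<close>. Gibbs' inequality against \<open>A * B\<close> gives the
  lower bound and the pointwise bound by \<open>c * A * B\<close> the upper one;
  \<open>log 2 c\<close> is the rate difference times the length.\<close>

lemma JJ_level:
  fixes r m :: nat
  assumes M: "sym_law M"
  defines "J \<equiv> JJ (rm_code r m) (2 ^ m) M" and "J' \<equiv> JJ (rm_code r (Suc m)) (2 ^ Suc m) M"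
  shows "2 * J \<le> J'" and "J' \<le> 2 * J + 2 ^ Suc m * (rm_rate r m - rm_rate r (Suc m))"
proof -
  define N :: nat where "N = 2 ^ m"
  define N' :: nat where "N' = 2 ^ Suc m"
  define C where "C = rm_code r m"
  define C' where "C' = rm_code r (Suc m)"
  define s where "s = top_flip m"
  define A where "A l = Db C N l" for l
  define B where "B l = Db C N (\<lambda>j. l (s j))" for l
  define D where "D l = Db C' N' l" for l
  define c where "c = real ((card C)\<^sup>2) / card C'"
  interpret A: lin_code C N unfolding C_def by (rule lin_code_rm)
  interpret B: lin_code C' N' unfolding C'_def by (rule lin_code_rm)
  note L = sym_law_law[OF M] and LI = law_iid[OF sym_law_law[OF M], of N']
  have NN: "N \<le> N'" unfolding N_def N'_def by (rule pow2_le_Suc)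
  have inv: "s (s j) = j" for j unfolding s_def by (rule top_flip_invol)
  have dom: "s j < N' \<longleftrightarrow> j < N'" for j unfolding s_def N'_def by (rule top_flip_less)
  have aut: "(\<lambda>j. u (s j)) \<in> C'" if "u \<in> C'" for u using that unfolding C'_def s_def by (rule rm_code_top_flip)
  have c: "0 < c" unfolding c_def using A.card_pos B.card_pos by simp
  have Ar: "A (restrict l {..<N}) = A l" for l unfolding A_def by (rule Db_restrict)
  have bAN: "bmeas (cube N) A" unfolding A_def[abs_def] by (rule bmeas_Db)
  have bA: "bmeas (cube N') A" by (rule iid_restrict(2)[OF L bAN NN Ar])
  have BA: "B l = A (\<lambda>j. l (s j))" for l unfolding A_def B_def ..
  have bB: "bmeas (cube N') B" unfolding BA[abs_def] by (rule iid_reindex(2)[OF L bA inv dom])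
  have bD: "bmeas (cube N') D" unfolding D_def[abs_def] by (rule bmeas_Db)
  have Ds: "D (\<lambda>j. l (s j)) = D l" for l unfolding D_def by (rule Db_reindex[OF inv dom aut])
  have As: "A (\<lambda>j. l (s j)) = B l" "B (\<lambda>j. l (s j)) = A l" for l unfolding A_def B_def by (simp_all add: inv)
  have nn: "0 \<le> A l" "0 \<le> B l" "0 \<le> D l" if l: "l \<in> space (cube N')" for l
    using Db_nonneg_low[OF l NN] Db_nonneg_low[OF cube_reindex[OF l dom] NN] Db_nonneg[OF l]
    by (auto simp: A_def B_def D_def)
  have le: "D l \<le> c * (A l * B l)" if "l \<in> space (cube N')" for l
    using Db_le_prod[of l m r] that unfolding A_def B_def D_def c_def s_def N_def N'_def C_def C'_def by simp
  \<comment> \<open>The logarithm is unbounded where \<open>A\<close> is small, but \<open>D\<close>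
    is dominated by a multiple of \<open>A\<close>, so the product is controlled by
    \<open>ent (A l)\<close>.\<close>
  have bDA: "bmeas (cube N') (\<lambda>l. D l * log 2 (A l))"
  proof -
    obtain K where K: "0 \<le> K" "\<And>l. l \<in> space (cube N') \<Longrightarrow> \<bar>B l\<bar> \<le> K" using bmeas_bound[OF bB] by blast
    have "bmeas (cube N') (\<lambda>l. ent (A l))" using nn by (intro bmeas_ent bA) auto
    then obtain E where E: "0 \<le> E" "\<And>l. l \<in> space (cube N') \<Longrightarrow> \<bar>ent (A l)\<bar> \<le> E" using bmeas_bound by blast
    have [measurable]: "A \<in> borel_measurable (cube N')" "D \<in> borel_measurable (cube N')"
      using bA bD by (auto intro: bmeas_measurable)
    show ?thesis
    proof (rule bmeasI[where B="c * K * E"])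
      show "(\<lambda>l. D l * log 2 (A l)) \<in> borel_measurable (cube N')" by measurable
      fix l assume l: "l \<in> space (cube N')"
      have "D l \<le> c * K * A l"
      proof -
        have "A l * B l \<le> A l * K" using nn[OF l] K(2)[OF l] by (intro mult_left_mono) auto
        then have "c * (A l * B l) \<le> c * (A l * K)" using c by simp
        then show ?thesis using le[OF l] by (simp add: mult_ac)
      qed
      then have "D l * \<bar>log 2 (A l)\<bar> \<le> (c * K * A l) * \<bar>log 2 (A l)\<bar>" by (intro mult_right_mono) auto
      also have "\<dots> = c * K * \<bar>ent (A l)\<bar>" unfolding ent_def using nn(1)[OF l] by (simp add: abs_mult)
      also have "\<dots> \<le> c * K * E" using c K(1) E(2)[OF l] by (intro mult_left_mono) auto
      finally show "\<bar>D l * log 2 (A l)\<bar> \<le> c * K * E" using nn(3)[OF l] by (simp add: abs_mult)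
    qed
  qed
  have bDB: "bmeas (cube N') (\<lambda>l. D l * log 2 (B l))"
    using iid_reindex(2)[OF L bDA inv dom] by (simp add: Ds As)
  have Aup: "A (l(k := x)) = A l" if "N \<le> k" for l k x
    unfolding A_def by (rule Db_cong) (use that in auto)
  have Az: "A (zeroed {N..<N'} l) = A l" for l unfolding A_def by (rule Db_cong) (simp add: zeroed_def)
  \<comment> \<open>In the upper coordinates \<open>D\<close> is affine and \<open>A\<close>
    constant; erasing them replaces \<open>D\<close> by its marginal \<open>A\<close>.\<close>
  have IA: "(\<integral>l. D l * log 2 (A l) \<partial>iid N' M) = J"
  proof -
    have "(\<integral>l. D l * log 2 (A l) \<partial>iid N' M) = (\<integral>l. D (zeroed {N..<N'} l) * log 2 (A (zeroed {N..<N'} l)) \<partial>iid N' M)"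
    proof (rule iid_zeroed_affine[OF M bDA, where \<beta>="\<lambda>k l. Nb C' N' k (l(k := 0)) * log 2 (A l)"])
      show "{N..<N'} \<subseteq> {..<N'}" by auto
      fix k and l :: "nat \<Rightarrow> real" and x :: real assume k: "k \<in> {N..<N'}"
      then have "D (l(k := x)) = D (l(k := 0)) + x * Nb C' N' k (l(k := 0))" unfolding D_def by (intro Db_upd) simp
      moreover have "A (l(k := y)) = A l" for y using k by (intro Aup) simp
      ultimately show "D (l(k := x)) * log 2 (A (l(k := x))) = D (l(k := 0)) * log 2 (A (l(k := 0))) + x * (Nb C' N' k (l(k := 0)) * log 2 (A l))"
        by (simp only:) (simp add: algebra_simps)
    qed
    also have "\<dots> = (\<integral>l. ent (A l) \<partial>iid N' M)"
    proof -
      have "D (zeroed {N..<N'} l) = A l" for l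
        unfolding D_def A_def C_def C'_def N_def N'_def by (rule Db_zeroed_low)
      then show ?thesis by (simp add: Az ent_def)
    qed
    also have "\<dots> = (\<integral>l. ent (A l) \<partial>iid N M)"
      by (rule iid_restrict(1)[OF L _ NN]) (auto intro!: bmeas_ent bAN bmeas_Db simp: Ar Db_nonneg A_def Db_restrict)
    also have "\<dots> = J" unfolding J_def JJ_def A_def C_def N_def ..
    finally show ?thesis .
  qed
  have IB: "(\<integral>l. D l * log 2 (B l) \<partial>iid N' M) = J"
    using iid_reindex(1)[OF L bDA inv dom] IA by (simp add: Ds As)
  have ID: "(\<integral>l. D l \<partial>iid N' M) = 1" unfolding D_def by (rule B.iid_Db_one[OF M])
  have bAB: "bmeas (cube N') (\<lambda>l. A l * B l)" by (intro bmeas_mult bA bB)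
  have IAB: "(\<integral>l. A l * B l \<partial>iid N' M) = 1"
  proof -
    have "(\<integral>l. A l * B l \<partial>iid N' M) = (\<integral>l. A (zeroed {N..<N'} l) * B (zeroed {N..<N'} l) \<partial>iid N' M)"
    proof (rule iid_zeroed_affine[OF M bAB, where \<beta>="\<lambda>k l. A l * Nb C N (s k) ((\<lambda>j. l (s j))(s k := 0))"])
      show "{N..<N'} \<subseteq> {..<N'}" by auto
      fix k and l :: "nat \<Rightarrow> real" and x :: real assume k: "k \<in> {N..<N'}"
      have sk: "s k < N" using k top_flip_low[of k m] by (simp add: s_def N_def N'_def)
      have "(\<lambda>j. (l(k := y)) (s j)) = (\<lambda>j. l (s j))(s k := y)" for y using inv by (auto simp: fun_eq_iff)
      then have "B (l(k := x)) = B (l(k := 0)) + x * Nb C N (s k) ((\<lambda>j. l (s j))(s k := 0))"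
        unfolding B_def using Db_upd[OF sk, of C "\<lambda>j. l (s j)" x] by simp
      moreover have "A (l(k := y)) = A l" for y using k by (intro Aup) simp
      ultimately show "A (l(k := x)) * B (l(k := x)) = A (l(k := 0)) * B (l(k := 0)) + x * (A l * Nb C N (s k) ((\<lambda>j. l (s j))(s k := 0)))"
        by (simp only:) (simp add: algebra_simps)
    qed
    also have "\<dots> = (\<integral>l. A l \<partial>iid N' M)"
    proof -
      have "B (zeroed {N..<N'} l) = 1" for l
      proof -
        have "zeroed {N..<N'} l (s j) = 0" if "j < N" for j
          using that top_flip_low[of j m] top_flip_less[of m j] NN by (simp add: zeroed_def s_def N_def N'_def)
        then have "B (zeroed {N..<N'} l) = Db C N (\<lambda>_. 0)" unfolding B_def by (rule Db_cong)
        also have "\<dots> = 1" unfolding Db_def Du_def using A.card_pos by simp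
        finally show ?thesis .
      qed
      then show ?thesis by (simp add: Az)
    qed
    also have "\<dots> = (\<integral>l. A l \<partial>iid N M)" by (rule iid_restrict(1)[OF L bAN NN Ar])
    also have "\<dots> = 1" unfolding A_def by (rule A.iid_Db_one[OF M])
    finally show ?thesis .
  qed
  have bE: "bmeas (cube N') (\<lambda>l. ent (D l))" unfolding D_def by (rule bmeas_ent_Db)
  have J': "J' = (\<integral>l. ent (D l) \<partial>iid N' M)" unfolding J'_def JJ_def D_def C'_def N'_def ..
  have "(\<integral>l. (D l * log 2 (A l) + D l * log 2 (B l)) + (D l - A l * B l) * (1 / ln 2) \<partial>iid N' M) \<le> J'"
    unfolding J'
  proof (rule law_integral_mono[OF LI _ bE])
    show "bmeas (cube N') (\<lambda>l. (D l * log 2 (A l) + D l * log 2 (B l)) + (D l - A l * B l) * (1 / ln 2))"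
      by (intro bmeas_add[OF bmeas_add[OF bDA bDB]] bmeas_mult[OF bmeas_diff[OF bD bAB]] bmeas_const)
    fix l assume l: "l \<in> space (cube N')"
    show "(D l * log 2 (A l) + D l * log 2 (B l)) + (D l - A l * B l) * (1 / ln 2) \<le> ent (D l)"
    proof (cases "D l = 0")
      case True
      then show ?thesis using nn[OF l] by (simp add: ent_def)
    next
      case False
      then have d: "0 < D l" using nn[OF l] by simp
      then have "0 < A l * B l" using le[OF l] c by (smt (verit) mult_pos_pos zero_less_mult_pos)
      then have ab: "0 < A l" "0 < B l" using nn[OF l] by (auto simp: zero_less_mult_iff)
      have "ln (A l * B l / D l) \<le> A l * B l / D l - 1" using d ab by (intro ln_le_minus_one) simp
      then have "ln (A l) + ln (B l) - ln (D l) \<le> A l * B l / D l - 1" using d ab by (simp add: ln_div ln_mult)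
      then have "D l * (ln (A l) + ln (B l) - ln (D l)) \<le> D l * (A l * B l / D l - 1)" using d by (intro mult_left_mono) auto
      also have "\<dots> = A l * B l - D l" using d by (simp add: algebra_simps)
      finally have "(D l * ln (A l) + D l * ln (B l) + (D l - A l * B l)) / ln 2 \<le> D l * ln (D l) / ln 2"
        by (intro divide_right_mono) (auto simp: algebra_simps)
      then show ?thesis unfolding ent_def log_def by (simp add: add_divide_distrib diff_divide_distrib)
    qed
  qed
  moreover have "(\<integral>l. (D l * log 2 (A l) + D l * log 2 (B l)) + (D l - A l * B l) * (1 / ln 2) \<partial>iid N' M) = 2 * J"
    by (subst law_integral_add[OF LI bmeas_add[OF bDA bDB] bmeas_mult[OF bmeas_diff[OF bD bAB] bmeas_const]],
        subst law_integral_add[OF LI bDA bDB])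
      (simp add: IA IB law_integral_diff[OF LI bD bAB] ID IAB)
  ultimately show "2 * J \<le> J'" by simp
  have "J' \<le> (\<integral>l. log 2 c * D l + (D l * log 2 (A l) + D l * log 2 (B l)) \<partial>iid N' M)"
    unfolding J'
  proof (rule law_integral_mono[OF LI bE bmeas_add[OF bmeas_cmult[OF bD] bmeas_add[OF bDA bDB]]])
    fix l assume l: "l \<in> space (cube N')"
    show "ent (D l) \<le> log 2 c * D l + (D l * log 2 (A l) + D l * log 2 (B l))"
    proof (cases "D l = 0")
      case True
      then show ?thesis by (simp add: ent_def)
    next
      case False
      then have d: "0 < D l" using nn[OF l] by simp
      then have "0 < A l * B l" using le[OF l] c by (smt (verit) mult_pos_pos zero_less_mult_pos)
      then have ab: "0 < A l" "0 < B l" using nn[OF l] by (auto simp: zero_less_mult_iff)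
      have "log 2 (D l) \<le> log 2 (c * (A l * B l))" using le[OF l] d by (subst log_le_cancel_iff) auto
      also have "\<dots> = log 2 c + (log 2 (A l) + log 2 (B l))" using c ab by (simp add: log_mult)
      finally have "D l * log 2 (D l) \<le> D l * (log 2 c + (log 2 (A l) + log 2 (B l)))" using d by (intro mult_left_mono) auto
      then show ?thesis unfolding ent_def by (simp add: algebra_simps)
    qed
  qed
  also have "\<dots> = log 2 c + 2 * J"
    by (subst law_integral_add[OF LI bmeas_cmult[OF bD] bmeas_add[OF bDA bDB]], subst law_integral_add[OF LI bDA bDB])
      (simp add: IA IB ID)
  also have "log 2 c = 2 ^ Suc m * (rm_rate r m - rm_rate r (Suc m))"
  proof -
    have "log 2 c = 2 * log 2 (card C) - log 2 (card C')"
      unfolding c_def using A.card_pos B.card_pos by (simp add: log_divide log_nat_power)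
    then show ?thesis unfolding C_def C'_def log_card_rm_code by (simp add: algebra_simps)
  qed
  finally show "J' \<le> 2 * J + 2 ^ Suc m * (rm_rate r m - rm_rate r (Suc m))" by simp
qed

section \<open>Power series of the information functional\<close>

lemma law_integral_sums:
  assumes M: "law S M" and F: "\<And>n. bmeas S (F n)"
    and bd: "\<And>n x. x \<in> space S \<Longrightarrow> \<bar>F n x\<bar> \<le> c n" and c: "summable c"
    and G: "\<And>x. x \<in> space S \<Longrightarrow> (\<lambda>n. F n x) sums G x"
  shows "(\<lambda>n. \<integral>x. F n x \<partial>M) sums (\<integral>x. G x \<partial>M)"
proof -
  have "(\<lambda>n. \<integral>x. F n x \<partial>M) sums (\<integral>x. (\<Sum>n. F n x) \<partial>M)"
  proof (rule sums_integral)
    show "integrable M (F n)" for n by (rule law_integrable[OF M F])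
    show "AE x in M. summable (\<lambda>n. norm (F n x))"
      using bd law_space[OF M] by (intro AE_I2 summable_comparison_test'[OF c, of 0]) auto
    show "summable (\<lambda>n. \<integral>x. norm (F n x) \<partial>M)"
    proof (rule summable_comparison_test'[OF c, of 0])
      show "norm (\<integral>x. norm (F n x) \<partial>M) \<le> c n" for n
        using law_integral_abs_le[OF M bmeas_abs[OF F[of n]], of "c n"] bd by simp
    qed
  qed
  also have "(\<integral>x. (\<Sum>n. F n x) \<partial>M) = (\<integral>x. G x \<partial>M)"
    by (rule law_integral_cong[OF M]) (simp add: sums_unique[OF G])
  finally show ?thesis .
qed

definition m2 :: "real measure \<Rightarrow> nat \<Rightarrow> real" where
  "m2 L n = (\<integral>x. (x\<^sup>2) ^ Suc n \<partial>L)"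

lemma bmeas_m2: "bmeas BB (\<lambda>x. (x\<^sup>2) ^ n)"
  by (intro bmeas_power bmeas_BB_id)

lemma m2_bounds: assumes L: "law BB L" shows "0 \<le> m2 L n" "m2 L n \<le> 1"
proof -
  show "0 \<le> m2 L n" unfolding m2_def by (rule law_integral_nonneg[OF L]) simp
  have "m2 L n \<le> (\<integral>x. 1 \<partial>L)" unfolding m2_def
  proof (rule law_integral_mono[OF L bmeas_m2 bmeas_const])
    fix x :: real assume "x \<in> space BB"
    then have "\<bar>x\<bar> \<le> 1" by (simp add: space_BB abs_le_iff)
    then show "(x\<^sup>2) ^ Suc n \<le> 1" by (subst power_le_one) (simp_all add: abs_square_le_1)
  qed
  then show "m2 L n \<le> 1" by (simp add: law_measure[OF L])
qed

lemma kappa_integral_sums: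
  assumes L: "law BB L" and z: "\<bar>z\<bar> \<le> 1"
  shows "(\<lambda>n. kcoeff n * m2 L n * (z\<^sup>2) ^ Suc n) sums (\<integral>x. kappa (x * z) \<partial>L)"
proof -
  have "(\<lambda>n. \<integral>x. kcoeff n * ((x * z)\<^sup>2) ^ Suc n \<partial>L) sums (\<integral>x. kappa (x * z) \<partial>L)"
  proof (rule law_integral_sums[OF L _ _ sums_summable[OF kcoeff_sums]])
    show "bmeas BB (\<lambda>x. kcoeff n * ((x * z)\<^sup>2) ^ Suc n)" for n
      by (intro bmeas_cmult bmeas_power bmeas_mult bmeas_BB_id bmeas_const)
    fix n and x :: real assume "x \<in> space BB"
    then have "\<bar>x\<bar> \<le> 1" by (simp add: space_BB abs_le_iff)
    then have xz: "\<bar>x * z\<bar> \<le> 1" using z by (simp add: abs_mult mult_le_one)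
    then have "((x * z)\<^sup>2) ^ Suc n \<le> 1" by (subst power_le_one) (simp_all add: abs_square_le_1)
    then have "kcoeff n * ((x * z)\<^sup>2) ^ Suc n \<le> kcoeff n * 1" using kcoeff_pos[of n] by (intro mult_left_mono) auto
    moreover have "0 \<le> kcoeff n * ((x * z)\<^sup>2) ^ Suc n" using kcoeff_pos[of n] by (intro mult_nonneg_nonneg) auto
    ultimately show "\<bar>kcoeff n * ((x * z)\<^sup>2) ^ Suc n\<bar> \<le> kcoeff n" by simp
    show "(\<lambda>n. kcoeff n * ((x * z)\<^sup>2) ^ Suc n) sums kappa (x * z)" by (rule kappa_sums[OF xz])
  qed
  moreover have "(\<integral>x. kcoeff n * ((x * z)\<^sup>2) ^ Suc n \<partial>L) = kcoeff n * m2 L n * (z\<^sup>2) ^ Suc n" for n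
  proof -
    have "(\<integral>x. kcoeff n * ((x * z)\<^sup>2) ^ Suc n \<partial>L) = (\<integral>x. (kcoeff n * (z\<^sup>2) ^ Suc n) * (x\<^sup>2) ^ Suc n \<partial>L)"
      by (rule law_integral_cong[OF L]) (simp only: power_mult_distrib mult_ac)
    also have "\<dots> = (kcoeff n * (z\<^sup>2) ^ Suc n) * m2 L n" unfolding m2_def by (rule integral_mult_right_zero)
    finally show ?thesis by (simp only: mult_ac)
  qed
  ultimately show ?thesis by (simp only:)
qed

text \<open>\<open>cap L - gam C N M L\<close> is the conditional mutual information between bit \<open>0\<close> and its observation through
  the channel \<open>L\<close>, given the other outputs through \<open>M\<close>.\<close>

definition gam :: "(nat \<Rightarrow> bool) set \<Rightarrow> nat \<Rightarrow> real measure \<Rightarrow> real measure \<Rightarrow> real" where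
  "gam C N M L = (\<integral>l. D0 C N l * (\<integral>x. kappa (x * ff C N l) \<partial>L) \<partial>iid N M)"

text \<open>The series separates the channel of bit 0, which enters through \<open>m2 L n\<close>,
  from the other observations, which enter through \<open>mom C N M n\<close>. This product form is
  what allows codes and channels to be compared term by term.\<close>

lemma gam_sums:
  assumes M: "law BB M" and L: "law BB L" and N: "0 < N"
  shows "(\<lambda>n. kcoeff n * m2 L n * mom C N M n) sums gam C N M L"
proof -
  obtain K where K: "0 \<le> K" "\<And>l. l \<in> space (cube N) \<Longrightarrow> \<bar>D0 C N l\<bar> \<le> K" using bmeas_bound[OF bmeas_D0[OF N]] by blast
  have "(\<lambda>n. \<integral>l. (kcoeff n * m2 L n) * ((ff C N l)\<^sup>2 ^ Suc n * D0 C N l) \<partial>iid N M) sums gam C N M L"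
    unfolding gam_def
  proof (rule law_integral_sums[OF law_iid[OF M]])
    show "summable (\<lambda>n. kcoeff n * K)" using sums_summable[OF kcoeff_sums] by (rule summable_mult2)
    show "bmeas (cube N) (\<lambda>l. (kcoeff n * m2 L n) * ((ff C N l)\<^sup>2 ^ Suc n * D0 C N l))" for n
      by (intro bmeas_cmult bmeas_mom N)
    fix n l assume l: "l \<in> space (cube N)"
    have f: "\<bar>ff C N l\<bar> \<le> 1" by (rule ff_abs_le[OF N l])
    then have "(ff C N l)\<^sup>2 ^ Suc n \<le> 1" by (subst power_le_one) (simp_all add: abs_square_le_1)
    moreover have d: "0 \<le> D0 C N l" "D0 C N l \<le> K" using D0_nonneg[OF N l] K(2)[OF l] by auto
    ultimately have 1: "(ff C N l)\<^sup>2 ^ Suc n * D0 C N l \<le> 1 * K" by (intro mult_mono) auto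
    have 2: "kcoeff n * m2 L n \<le> kcoeff n * 1" using m2_bounds[OF L] kcoeff_pos[of n] by (intro mult_left_mono) auto
    have 3: "0 \<le> kcoeff n * m2 L n" "0 \<le> (ff C N l)\<^sup>2 ^ Suc n * D0 C N l"
      using m2_bounds[OF L] kcoeff_pos[of n] d by (auto intro!: mult_nonneg_nonneg simp del: power_Suc)
    have "(kcoeff n * m2 L n) * ((ff C N l)\<^sup>2 ^ Suc n * D0 C N l) \<le> kcoeff n * K"
      using mult_mono[OF 2 1] 3 kcoeff_pos[of n] by simp
    then show "\<bar>(kcoeff n * m2 L n) * ((ff C N l)\<^sup>2 ^ Suc n * D0 C N l)\<bar> \<le> kcoeff n * K"
      using mult_nonneg_nonneg[OF 3] by simp
    show "(\<lambda>n. (kcoeff n * m2 L n) * ((ff C N l)\<^sup>2 ^ Suc n * D0 C N l)) sums (D0 C N l * (\<integral>x. kappa (x * ff C N l) \<partial>L))"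
      using sums_mult[OF kappa_integral_sums[OF L f], of "D0 C N l"] by (simp only: mult_ac)
  qed
  then show ?thesis unfolding mom_def by (simp only: integral_mult_right_zero)
qed

section \<open>Interpolation between channels\<close>

text \<open>A Bernoulli variable of parameter \<open>t\<close> selects one of two independent
  samples.\<close>

lemma ex_mixture:
  assumes M0: "law S M0" and M1: "law S M1" and t: "t \<in> {0..1}"
  shows "\<exists>M. law S M \<and> (\<forall>f. bmeas S f \<longrightarrow> (\<integral>x. f x \<partial>M) = (1 - t) * (\<integral>x. f x \<partial>M0) + t * (\<integral>x. f x \<partial>M1))"
proof -
  let ?B = "measure_pmf (bernoulli_pmf t)" and ?U = "count_space UNIV :: bool measure"
  let ?P = "?B \<Otimes>\<^sub>M (M0 \<Otimes>\<^sub>M M1)"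
  define h :: "bool \<times> 'a \<times> 'a \<Rightarrow> 'a" where "h = (\<lambda>z. if fst z then snd (snd z) else fst (snd z))"
  have LB: "law ?U ?B" unfolding law_def by (simp add: measure_pmf.prob_space_axioms)
  note LP = law_pair[OF LB law_pair[OF M0 M1]]
  have hm: "h \<in> measurable (?U \<Otimes>\<^sub>M (S \<Otimes>\<^sub>M S)) S"
    unfolding h_def by measurable
  have hm': "h \<in> measurable ?P S"
    using hm measurable_cong_sets[OF law_sets[OF LP] refl, of S] by blast
  interpret P: prob_space ?P by (rule law_prob[OF LP])
  let ?M = "distr ?P S h"
  have "law S ?M" unfolding law_def using P.prob_space_distr[OF hm'] by simp
  moreover have "(\<integral>x. f x \<partial>?M) = (1 - t) * (\<integral>x. f x \<partial>M0) + t * (\<integral>x. f x \<partial>M1)" if f: "bmeas S f" for f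
  proof -
    have "(\<integral>x. f x \<partial>?M) = (\<integral>z. f (h z) \<partial>?P)"
      by (rule integral_distr[OF hm' bmeas_measurable[OF f]])
    also have "\<dots> = (\<integral>b. (\<integral>z. f (h (b, z)) \<partial>(M0 \<Otimes>\<^sub>M M1)) \<partial>?B)"
      by (rule integral_pair[OF LB law_pair[OF M0 M1] bmeas_compose[OF hm f]])
    also have "\<dots> = (\<integral>z. f (h (True, z)) \<partial>(M0 \<Otimes>\<^sub>M M1)) * t + (\<integral>z. f (h (False, z)) \<partial>(M0 \<Otimes>\<^sub>M M1)) * (1 - t)"
      using t by (subst integral_bernoulli_pmf) auto
    also have "(\<integral>z. f (h (True, z)) \<partial>(M0 \<Otimes>\<^sub>M M1)) = (\<integral>x. f x \<partial>M1)"
      using integral_pair[OF M0 M1 bmeas_compose[OF measurable_snd f]] by (simp add: h_def law_measure[OF M0])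
    also have "(\<integral>z. f (h (False, z)) \<partial>(M0 \<Otimes>\<^sub>M M1)) = (\<integral>x. f x \<partial>M0)"
      using integral_pair[OF M0 M1 bmeas_compose[OF measurable_fst f]] by (simp add: h_def law_measure[OF M1])
    finally show ?thesis by (simp add: mult.commute)
  qed
  ultimately show ?thesis by blast
qed

lemma measurable_BB_uminus: "uminus \<in> measurable BB BB"
  unfolding BB_def by (rule measurable_restrict_space3) auto

lemma ex_path:
  assumes M0: "sym_law M0" and M1: "sym_law M1"
  obtains Mt where "Mt 0 = M0" "Mt 1 = M1" "\<And>t. t \<in> {0..1} \<Longrightarrow> sym_law (Mt t)"
    "\<And>t f. t \<in> {0..1} \<Longrightarrow> bmeas BB f \<Longrightarrow> (\<integral>x. f x \<partial>Mt t) = (1 - t) * (\<integral>x. f x \<partial>M0) + t * (\<integral>x. f x \<partial>M1)"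
proof -
  define P where "P t M \<longleftrightarrow> law BB M \<and> (\<forall>f. bmeas BB f \<longrightarrow> (\<integral>x. f x \<partial>M) = (1 - t) * (\<integral>x. f x \<partial>M0) + t * (\<integral>x. f x \<partial>M1))" for t :: real and M
  have ex: "\<exists>M. P t M" if "t \<in> {0..1}" for t
    unfolding P_def by (rule ex_mixture[OF sym_law_law[OF M0] sym_law_law[OF M1] that])
  \<comment> \<open>The endpoints are set to the given laws themselves, not merely to laws with the
    same integrals, so that facts about \<open>M0\<close> and \<open>M1\<close> apply verbatim at 0
    and 1.\<close>
  define Mt where "Mt t = (if t = 0 then M0 else if t = 1 then M1 else SOME M. P t M)" for t
  have Pt: "P t (Mt t)" if t: "t \<in> {0..1}" for t
  proof -
    have "P 0 M0" "P 1 M1" unfolding P_def using sym_law_law[OF M0] sym_law_law[OF M1] by auto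
    then show ?thesis unfolding Mt_def using someI_ex[OF ex[OF t]] by auto
  qed
  show ?thesis
  proof
    show mix: "(\<integral>x. f x \<partial>Mt t) = (1 - t) * (\<integral>x. f x \<partial>M0) + t * (\<integral>x. f x \<partial>M1)" if "t \<in> {0..1}" "bmeas BB f" for t f
      using Pt[OF that(1)] that(2) unfolding P_def by blast
    show "sym_law (Mt t)" if t: "t \<in> {0..1}" for t
      unfolding sym_law_def
    proof (intro conjI allI impI)
      show "law BB (Mt t)" using Pt[OF t] unfolding P_def by blast
      fix f assume f: "bmeas BB f"
      have f': "bmeas BB (\<lambda>x. f (- x))" by (rule bmeas_compose[OF measurable_BB_uminus f])
      show "(\<integral>x. f (- x) \<partial>Mt t) = (\<integral>x. f x \<partial>Mt t)"
        unfolding mix[OF t f] mix[OF t f'] sym_law_integral[OF M0 f] sym_law_integral[OF M1 f] ..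
    qed
  qed (simp_all add: Mt_def)
qed

definition erased :: "real measure" where
  "erased = return BB 0"

lemma law_return: "\<bar>x\<bar> \<le> 1 \<Longrightarrow> law BB (return BB x)"
  unfolding law_def by (auto intro!: prob_space_return simp: space_BB abs_le_iff)

lemma integral_return_BB: "\<bar>x\<bar> \<le> 1 \<Longrightarrow> bmeas BB f \<Longrightarrow> (\<integral>y. f y \<partial>return BB x) = f x"
  by (intro integral_return bmeas_measurable) (auto simp: space_BB abs_le_iff)

lemma integral_erased: "bmeas BB f \<Longrightarrow> (\<integral>x. f x \<partial>erased) = f 0"
  unfolding erased_def by (rule integral_return_BB) auto

lemma sym_law_erased: "sym_law erased"
  unfolding sym_law_def
  using integral_erased integral_erased[OF bmeas_compose[OF measurable_BB_uminus]] law_return[of 0] by (auto simp: erased_def)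

lemma ex_revealed:
  obtains Q where "sym_law Q" "\<And>f. bmeas BB f \<Longrightarrow> (\<integral>x. f x \<partial>Q) = (f 1 + f (-1)) / 2"
proof -
  have h: "(1/2::real) \<in> {0..1}" by simp
  from ex_mixture[OF law_return[of 1] law_return[of "-1"] h]
  obtain Q where Q: "law BB Q" "\<And>f. bmeas BB f \<Longrightarrow> (\<integral>x. f x \<partial>Q) = (1 - 1/2) * (\<integral>x. f x \<partial>return BB 1) + 1/2 * (\<integral>x. f x \<partial>return BB (-1))"
    by auto
  have *: "(\<integral>x. f x \<partial>Q) = (f 1 + f (-1)) / 2" if "bmeas BB f" for f
    using Q(2)[OF that] integral_return_BB[OF _ that, of 1] integral_return_BB[OF _ that, of "-1"] by simp
  show ?thesis
  proof (rule that[OF _ *])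
    show "sym_law Q" unfolding sym_law_def
    proof (intro conjI allI impI)
      fix f assume f: "bmeas BB f"
      show "(\<integral>x. f (- x) \<partial>Q) = (\<integral>x. f x \<partial>Q)"
        unfolding *[OF f] *[OF bmeas_compose[OF measurable_BB_uminus f]] by simp
    qed (rule Q(1))
  qed
qed

text \<open>Taking out the factor \<open>D\<close> leaves \<open>ent (1 + x * z)\<close> with
  \<open>z = n / D\<close>, and symmetry of \<open>L\<close> averages this to
  \<open>kappa (x * z)\<close>. If \<open>D = 0\<close> then also \<open>n = 0\<close> and both
  sides vanish.\<close>

lemma integral_ent_affine:
  assumes L: "sym_law L" and nD: "\<bar>n\<bar> \<le> D"
  shows "(\<integral>x. ent (D + x * n) \<partial>L) = ent D + D * (\<integral>x. kappa (x * (n / D)) \<partial>L)"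
proof (cases "D = 0")
  case True
  then show ?thesis using nD by (simp add: ent_def)
next
  case False
  then have D: "0 < D" using nD by linarith
  define z where "z = n / D"
  have z: "\<bar>z\<bar> \<le> 1" using nD D by (simp add: z_def abs_divide)
  note LL = sym_law_law[OF L]
  have xz: "\<bar>x * z\<bar> \<le> 1" if "x \<in> space BB" for x
  proof -
    have "\<bar>x\<bar> \<le> 1" using that by (simp add: space_BB abs_le_iff)
    then show ?thesis using z by (simp add: abs_mult mult_le_one)
  qed
  have b1: "bmeas BB (\<lambda>x. 1 + x * z)" "bmeas BB (\<lambda>x. 1 - x * z)"
    by (intro bmeas_add bmeas_diff bmeas_mult bmeas_const bmeas_BB_id)+
  have b: "bmeas BB (\<lambda>x. ent (1 + x * z))" "bmeas BB (\<lambda>x. ent (1 - x * z))"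
    by (intro bmeas_ent b1; use xz in \<open>force simp: abs_le_iff\<close>)+
  have "(\<integral>x. ent (1 - x * z) \<partial>L) = (\<integral>x. ent (1 + x * z) \<partial>L)"
    using sym_law_integral[OF L b(1)] by simp
  then have k: "(\<integral>x. kappa (x * z) \<partial>L) = (\<integral>x. ent (1 + x * z) \<partial>L)"
    unfolding kappa_ent using law_integral_add[OF LL b] by simp
  have "(\<integral>x. ent (D + x * n) \<partial>L) = (\<integral>x. D * ent (1 + x * z) + (1 + x * z) * ent D \<partial>L)"
  proof (rule law_integral_cong[OF LL])
    fix x assume "x \<in> space BB"
    then have "0 \<le> 1 + x * z" using xz by (force simp: abs_le_iff)
    then have "ent (D * (1 + x * z)) = D * ent (1 + x * z) + (1 + x * z) * ent D" using D by (intro ent_mult) auto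
    moreover have "D * (1 + x * z) = D + x * n" using D by (simp add: z_def algebra_simps)
    ultimately show "ent (D + x * n) = D * ent (1 + x * z) + (1 + x * z) * ent D" by simp
  qed
  also have "\<dots> = D * (\<integral>x. ent (1 + x * z) \<partial>L) + (\<integral>x. 1 + x * z \<partial>L) * ent D"
    by (subst law_integral_add[OF LL bmeas_cmult[OF b(1)] bmeas_mult[OF b1(1) bmeas_const]]) simp
  also have "(\<integral>x. 1 + x * z \<partial>L) = 1"
    by (subst law_integral_add[OF LL]) (auto intro!: bmeas_const bmeas_mult bmeas_BB_id simp: law_measure[OF LL] sym_law_mean[OF L])
  finally show ?thesis using k by (simp add: z_def)
qed

lemma path_mono:
  assumes h: "\<And>t. t \<in> {0..1} \<Longrightarrow> (h has_real_derivative h' t) (at t within {0..1})"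
    and nn: "\<And>t. t \<in> {0..1} \<Longrightarrow> 0 \<le> h' t" and st: "0 \<le> a" "a \<le> b" "b \<le> 1"
  shows "h a \<le> h b"
proof (rule DERIV_nonneg_imp_increasing_open[OF st(2)])
  fix x assume x: "a < x" "x < b"
  then have "at x within {0..1} = at x" using st by (intro at_within_Icc_at) auto
  then show "\<exists>y. (h has_real_derivative y) (at x) \<and> 0 \<le> y"
    using h[of x] nn[of x] x st by (intro exI[of _ "h' x"]) auto
next
  have "continuous_on {0..1} h"
    unfolding continuous_on_eq_continuous_within using h has_field_derivative_imp_has_derivative has_derivative_continuous by blast
  then show "continuous_on {a..b} h" by (rule continuous_on_subset) (use st in auto)
qed

context
  fixes M0 M1 :: "real measure" and Mt :: "real \<Rightarrow> real measure"
  assumes M0: "sym_law M0" and M1: "sym_law M1" and Mt: "\<And>t. t \<in> {0..1} \<Longrightarrow> sym_law (Mt t)"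
    and mix: "\<And>t f. t \<in> {0..1} \<Longrightarrow> bmeas BB f \<Longrightarrow> (\<integral>x. f x \<partial>Mt t) = (1 - t) * (\<integral>x. f x \<partial>M0) + t * (\<integral>x. f x \<partial>M1)"
begin

lemma iid_derivative:
  assumes F: "bmeas (cube N) F" and t: "t \<in> {0..1}"
  shows "((\<lambda>t. \<integral>l. F l \<partial>iid N (Mt t)) has_real_derivative
      (\<Sum>i<N. \<integral>l. (\<integral>x. F (l(i := x)) \<partial>M1) - (\<integral>x. F (l(i := x)) \<partial>M0) \<partial>iid N (Mt t))) (at t within {0..1})"
  unfolding iid_def
  by (rule integral_mixture_derivative[OF sym_law_law[OF M0] sym_law_law[OF M1] sym_law_law[OF Mt] mix _ _ t])
    (use F in \<open>auto simp: cube_def\<close>)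

text \<open>The derivative of the output divergence along the path is the extrinsic (EXIT-type) functional.\<close>

lemma JJ_derivative:
  fixes r m :: nat
  defines "C \<equiv> rm_code r m" and "N \<equiv> 2 ^ m :: nat"
  assumes t: "t \<in> {0..1}"
  shows "((\<lambda>t. JJ C N (Mt t)) has_real_derivative N * (gam C N (Mt t) M1 - gam C N (Mt t) M0)) (at t within {0..1})"
proof -
  have N: "0 < N" by (simp add: N_def)
  note LM = sym_law_law[OF Mt[OF t]]
  note LI = law_iid[OF LM, of N]
  let ?F = "\<lambda>l. ent (Db C N l)"
  let ?K = "\<lambda>L l. D0 C N l * (\<integral>x. kappa (x * ff C N l) \<partial>L)"
  have bF: "bmeas (cube N) ?F" by (rule bmeas_ent_Db)
  have bK: "bmeas (cube N) (?K L)" if L: "sym_law L" for L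
  proof -
    \<comment> \<open>Measurability of the information functional is inherited from the partial
      integral of the entropy, of which it is the increment over the erased coordinate.\<close>
    have "?K L l = (\<integral>x. ?F (l(0 := x)) \<partial>L) - ent (D0 C N l)" if l: "l \<in> space (cube N)" for l
    proof -
      have "Db C N (l(0 := x)) = D0 C N l + x * n0 C N l" for x unfolding D0_def n0_def by (rule Db_upd[OF N])
      then show ?thesis using integral_ent_affine[OF L n0_abs_le[OF N l, of C]] unfolding ff_def by simp
    qed
    moreover have "bmeas (cube N) (\<lambda>l. (\<integral>x. ?F (l(0 := x)) \<partial>L) - ent (D0 C N l))"
      by (intro bmeas_diff bmeas_cube_partial[OF sym_law_law[OF L] bF N] bmeas_ent bmeas_D0[OF N] D0_nonneg[OF N])
    ultimately show ?thesis by (subst bmeas_cong) auto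
  qed
  have each: "(\<integral>l. (\<integral>x. ?F (l(i := x)) \<partial>M1) - (\<integral>x. ?F (l(i := x)) \<partial>M0) \<partial>iid N (Mt t)) = gam C N (Mt t) M1 - gam C N (Mt t) M0"
    if i: "i < N" for i
  proof -
    \<comment> \<open>Translation by \<open>i\<close> carries bit \<open>i\<close> to bit 0, so
      every coordinate contributes the same derivative; hence the factor \<open>N\<close>.\<close>
    define \<sigma> where "\<sigma> j = xor j i" for j
    have inv: "\<sigma> (\<sigma> j) = j" for j by (rule bit_eqI) (auto simp: \<sigma>_def bit_xor_iff)
    have dom: "\<sigma> j < N \<longleftrightarrow> j < N" for j unfolding \<sigma>_def N_def by (rule xor_less_iff) (use i in \<open>simp add: N_def\<close>)
    have aut: "(\<lambda>j. u (\<sigma> j)) \<in> C" if "u \<in> C" for u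
      using that unfolding C_def \<sigma>_def by (rule rm_code_translate) (use i in \<open>simp add: N_def\<close>)
    have z: "\<sigma> 0 = i" by (simp add: \<sigma>_def)
    have e: "(\<lambda>j. l (\<sigma> j))(0 := 0) = (\<lambda>j. (l(i := 0)) (\<sigma> j))" for l :: "nat \<Rightarrow> real"
    proof -
      have "\<sigma> j = i \<longleftrightarrow> j = 0" for j using inv[of j] inv[of 0] z by metis
      then show ?thesis by (auto simp: fun_eq_iff)
    qed
    have D: "D0 C N (\<lambda>j. l (\<sigma> j)) = Db C N (l(i := 0))" for l
      unfolding D0_def e by (rule Db_reindex[OF inv dom aut])
    have n: "n0 C N (\<lambda>j. l (\<sigma> j)) = Nb C N i (l(i := 0))" for l
      unfolding n0_def e by (subst (2) z[symmetric]) (rule Nb_reindex[OF inv dom aut])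
    have pt: "(\<integral>x. ?F (l(i := x)) \<partial>L) = ent (Db C N (l(i := 0))) + ?K L (\<lambda>j. l (\<sigma> j))"
      if L: "sym_law L" and l: "l \<in> space (cube N)" for L l
    proof -
      have "\<bar>Nb C N i (l(i := 0))\<bar> \<le> Db C N (l(i := 0))" by (intro Nb_abs_le cube_upd l i) simp
      note e = integral_ent_affine[OF L this]
      have "(\<integral>x. ?F (l(i := x)) \<partial>L) = (\<integral>x. ent (Db C N (l(i := 0)) + x * Nb C N i (l(i := 0))) \<partial>L)"
        by (rule Bochner_Integration.integral_cong[OF refl], rule arg_cong[where f=ent], rule Db_upd[OF i])
      then show ?thesis unfolding ff_def D n e .
    qed
    have "(\<integral>l. (\<integral>x. ?F (l(i := x)) \<partial>M1) - (\<integral>x. ?F (l(i := x)) \<partial>M0) \<partial>iid N (Mt t)) =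
        (\<integral>l. (\<lambda>l. ?K M1 l - ?K M0 l) (\<lambda>j. l (\<sigma> j)) \<partial>iid N (Mt t))"
      by (rule law_integral_cong[OF LI]) (simp add: pt[OF M1] pt[OF M0])
    also have "\<dots> = (\<integral>l. ?K M1 l - ?K M0 l \<partial>iid N (Mt t))"
      by (rule iid_reindex(1)[OF LM bmeas_diff[OF bK[OF M1] bK[OF M0]] inv dom])
    also have "\<dots> = gam C N (Mt t) M1 - gam C N (Mt t) M0"
      unfolding gam_def by (rule law_integral_diff[OF LI bK[OF M1] bK[OF M0]])
    finally show ?thesis .
  qed
  show ?thesis
    using iid_derivative[OF bF t] each unfolding JJ_def by simp
qed

text \<open>The difference of differences is a series of products of two nonnegative moment
  differences, one of the endpoint channels and one of the codes. Only the quadratic term is kept,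
  the one that \<open>two_look\<close> controls.\<close>

lemma gam_diff:
  fixes r m :: nat
  assumes t: "t \<in> {0..1}" and le: "\<And>n. m2 M0 n \<le> m2 M1 n"
  defines "G \<equiv> gam (rm_code r m) (2 ^ m) (Mt t)" and "G' \<equiv> gam (rm_code r (Suc m)) (2 ^ Suc m) (Mt t)"
  shows "kcoeff 0 * (m2 M1 0 - m2 M0 0) * (mom (rm_code r (Suc m)) (2 ^ Suc m) (Mt t) 0 - mom (rm_code r m) (2 ^ m) (Mt t) 0)
    \<le> (G' M1 - G' M0) - (G M1 - G M0)"
proof -
  note LM = sym_law_law[OF Mt[OF t]]
  let ?m = "\<lambda>n. mom (rm_code r m) (2 ^ m) (Mt t) n" and ?m' = "\<lambda>n. mom (rm_code r (Suc m)) (2 ^ Suc m) (Mt t) n"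
  let ?a = "\<lambda>n. kcoeff n * (m2 M1 n - m2 M0 n) * (?m' n - ?m n)"
  have "(\<lambda>n. (kcoeff n * m2 M1 n * ?m' n - kcoeff n * m2 M0 n * ?m' n) - (kcoeff n * m2 M1 n * ?m n - kcoeff n * m2 M0 n * ?m n))
      sums ((G' M1 - G' M0) - (G M1 - G M0))"
    unfolding G_def G'_def
    by (intro sums_diff gam_sums[OF LM] sym_law_law[OF M1] sym_law_law[OF M0]) simp_all
  moreover have "(kcoeff n * m2 M1 n * ?m' n - kcoeff n * m2 M0 n * ?m' n) - (kcoeff n * m2 M1 n * ?m n - kcoeff n * m2 M0 n * ?m n) = ?a n" for n
    by (simp only: algebra_simps)
  ultimately have s: "?a sums ((G' M1 - G' M0) - (G M1 - G M0))" by (simp only:)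
  have "0 \<le> ?a n" for n
    using kcoeff_pos[of n] le[of n] mom_mono[OF Mt[OF t], of r m n] by (intro mult_nonneg_nonneg) auto
  then have "(\<Sum>n<1. ?a n) \<le> (G' M1 - G' M0) - (G M1 - G M0)"
    using sum_le_suminf[OF sums_summable[OF s], of "{..<1}"] sums_unique[OF s] by auto
  then show ?thesis by simp
qed

end

section \<open>Monotonicity of the extrinsic moment along a path\<close>

lemma mom0_eq: "mom C N M 0 = (\<integral>l. (ff C N l)\<^sup>2 * D0 C N l \<partial>iid N M)"
  by (simp add: mom_def)

lemma mom_bounds:
  assumes M: "sym_law M" and C: "lin_code C" and N: "0 < N"
  shows "0 \<le> mom C N M n" "mom C N M 0 \<le> 1" "(\<integral>l. D0 C N l \<partial>iid N M) = 1"
proof -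
  interpret lin_code C N by (rule C)
  note LI = law_iid[OF sym_law_law[OF M], of N]
  show "0 \<le> mom C N M n" unfolding mom_def
    by (rule law_integral_nonneg[OF LI]) (auto intro!: mult_nonneg_nonneg D0_nonneg[OF N] simp del: power_Suc)
  show 1: "(\<integral>l. D0 C N l \<partial>iid N M) = 1"
    using ext_even[OF M N bmeas_const[of _ 1]] iid_Du_one[OF M] by simp
  have "mom C N M 0 \<le> (\<integral>l. D0 C N l \<partial>iid N M)"
    unfolding mom_def
  proof (rule law_integral_mono[OF LI bmeas_mom[OF N] bmeas_D0[OF N]])
    fix l assume l: "l \<in> space (cube N)"
    have "(ff C N l)\<^sup>2 \<le> 1" using ff_abs_le[OF N l, of C] by (simp add: abs_square_le_1)
    then show "(ff C N l)\<^sup>2 ^ Suc 0 * D0 C N l \<le> D0 C N l" using D0_nonneg[OF N l, of C] by (simp add: mult_left_le_one_le)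
  qed
  then show "mom C N M 0 \<le> 1" unfolding 1 .
qed

text \<open>For an estimate in [-1, 1] every even moment is at most the second one, and the
  remaining series sums to the capacity.\<close>

lemma gam_le_cap:
  assumes M: "sym_law M" and L: "sym_law L" and N: "0 < N"
  shows "gam C N M L \<le> cap L * mom C N M 0"
proof -
  note LM = sym_law_law[OF M] and LL = sym_law_law[OF L]
  have s1: "(\<lambda>n. kcoeff n * m2 L n * mom C N M n) sums gam C N M L" by (rule gam_sums[OF LM LL N])
  have s2: "(\<lambda>n. kcoeff n * m2 L n * mom C N M 0) sums (cap L * mom C N M 0)"
    using sums_mult2[OF kappa_integral_sums[OF LL, of 1], of "mom C N M 0"] unfolding cap_def by simp
  have mm: "mom C N M n \<le> mom C N M 0" for n
    unfolding mom_def
  proof (rule law_integral_mono[OF law_iid[OF LM] bmeas_mom[OF N] bmeas_mom[OF N]])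
    fix l assume l: "l \<in> space (cube N)"
    have "(ff C N l)\<^sup>2 \<le> 1" using ff_abs_le[OF N l, of C] by (simp add: abs_square_le_1)
    then have "(ff C N l)\<^sup>2 ^ Suc n \<le> (ff C N l)\<^sup>2 ^ Suc 0" by (intro power_decreasing) auto
    then show "(ff C N l)\<^sup>2 ^ Suc n * D0 C N l \<le> (ff C N l)\<^sup>2 ^ Suc 0 * D0 C N l"
      using D0_nonneg[OF N l, of C] by (rule mult_right_mono)
  qed
  have nn: "0 \<le> kcoeff n * m2 L n" for n
    using kcoeff_pos[of n] m2_bounds(1)[OF LL, of n] by (intro mult_nonneg_nonneg) auto
  show ?thesis by (rule sums_le[OF _ s1 s2]) (rule mult_left_mono[OF mm nn])
qed

text \<open>Joint convexity of u^2 / s. A vanishing denominator forces a vanishing numerator, so the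
  convention for division by zero gives the right value.\<close>

lemma quad_over_lin:
  fixes u w s t :: real
  assumes "\<bar>u\<bar> \<le> s" "\<bar>w\<bar> \<le> t"
  shows "(u + w)\<^sup>2 / (s + t) \<le> u\<^sup>2 / s + w\<^sup>2 / t"
proof (cases "s = 0 \<or> t = 0")
  case True
  then show ?thesis using assms by auto
next
  case False
  then have s: "0 < s" "0 < t" using assms by auto
  have "0 \<le> (u * t - w * s)\<^sup>2" by simp
  then have "(u + w)\<^sup>2 * (s * t) \<le> (u\<^sup>2 * t + w\<^sup>2 * s) * (s + t)"
    by (simp add: power2_eq_square algebra_simps)
  then have "(u + w)\<^sup>2 / (s + t) \<le> (u\<^sup>2 * t + w\<^sup>2 * s) / (s * t)"
    using s by (simp add: frac_le_eq pos_divide_le_eq pos_le_divide_eq mult.commute)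
  also have "\<dots> = u\<^sup>2 / s + w\<^sup>2 / t" using s by (simp add: add_divide_distrib)
  finally show ?thesis .
qed

lemma Nb_affine: "i < N \<Longrightarrow> Nb C N k (l(i := x)) = Nb C N k (l(i := 0)) + x * ((\<Sum>u\<in>C. bpsk (u k) * bpsk (u i) * Du N u (l(i := 0))) / card C)"
proof -
  assume i: "i < N"
  have "(\<Sum>u\<in>C. bpsk (u k) * Du N u (l(i := x))) = (\<Sum>u\<in>C. bpsk (u k) * Du N u (l(i := 0))) + x * (\<Sum>u\<in>C. bpsk (u k) * bpsk (u i) * Du N u (l(i := 0)))"
    unfolding sum_distrib_left sum.distrib[symmetric]
  proof (rule sum.cong[OF refl])
    fix u
    show "bpsk (u k) * Du N u (l(i := x)) = bpsk (u k) * Du N u (l(i := 0)) + x * (bpsk (u k) * bpsk (u i) * Du N u (l(i := 0)))"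
      unfolding Du_upd[OF i, of u l x] by (simp add: algebra_simps)
  qed
  then show ?thesis unfolding Nb_def by (simp add: add_divide_distrib)
qed

text \<open>The integrand is n^2 / d with \<open>n\<close> and \<open>d\<close> affine in any single
  coordinate, hence convex there. Erasing an observation can therefore only lower the moment, and
  revealing it can only raise it.\<close>

lemma mom_integrand_convex:
  fixes C :: "(nat \<Rightarrow> bool) set"
  assumes N: "0 < N" and i: "i < N" and l: "l \<in> space (cube N)" and x: "\<bar>x\<bar> \<le> 1"
  defines "v \<equiv> \<lambda>x. (ff C N (l(i := x)))\<^sup>2 * D0 C N (l(i := x))"
  shows "2 * v 0 \<le> v x + v (- x)" and "v x \<le> (1 + x) / 2 * v 1 + (1 - x) / 2 * v (-1)"
proof -
  define n where "n x = n0 C N (l(i := x))" for x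
  define d where "d x = D0 C N (l(i := x))" for x
  have vnd: "v x = (n x)\<^sup>2 / d x" for x
    unfolding v_def n_def d_def ff_def by (cases "D0 C N (l(i := x)) = 0") (auto simp: power2_eq_square)
  have nd: "\<bar>n x\<bar> \<le> d x" if "\<bar>x\<bar> \<le> 1" for x
    unfolding n_def d_def by (intro n0_abs_le N cube_upd l i that)
  obtain \<alpha> \<beta> where ab: "\<And>x. n x = n 0 + x * \<alpha>" "\<And>x. d x = d 0 + x * \<beta>"
  proof (cases "i = 0")
    case True
    then show ?thesis using that[of 0 0] by (simp add: n_def d_def n0_upd D0_upd)
  next
    case False
    then have e: "(l(i := x))(0 := 0) = (l(0 := 0))(i := x)" for x by (rule fun_upd_twist)
    show ?thesis
      by (rule that) (unfold n_def d_def n0_def D0_def e, rule Nb_affine[OF i], rule Db_upd[OF i])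
  qed
  have "(n x + n (- x))\<^sup>2 / (d x + d (- x)) \<le> (n x)\<^sup>2 / d x + (n (- x))\<^sup>2 / d (- x)"
    using nd[of x] nd[of "- x"] x by (intro quad_over_lin) auto
  moreover have "n x + n (- x) = 2 * n 0" "d x + d (- x) = 2 * d 0"
    using ab(1)[of x] ab(1)[of "- x"] ab(2)[of x] ab(2)[of "- x"] by auto
  moreover have "(2 * n 0)\<^sup>2 / (2 * d 0) = 2 * ((n 0)\<^sup>2 / d 0)" by (simp add: power2_eq_square)
  ultimately show "2 * v 0 \<le> v x + v (- x)" unfolding vnd by simp
  define a where "a = (1 + x) / 2"
  define b where "b = (1 - x) / 2"
  have a: "0 \<le> a" "0 \<le> b" using x unfolding a_def b_def by (auto simp: abs_le_iff)
  have "(a * n 1 + b * n (-1))\<^sup>2 / (a * d 1 + b * d (-1)) \<le> (a * n 1)\<^sup>2 / (a * d 1) + (b * n (-1))\<^sup>2 / (b * d (-1))"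
    using nd[of 1] nd[of "-1"] a by (intro quad_over_lin) (auto simp: abs_mult intro!: mult_left_mono)
  moreover have "a * n 1 + b * n (-1) = n x" "a * d 1 + b * d (-1) = d x"
    unfolding ab(1)[of 1] ab(1)[of "-1"] ab(1)[of x] ab(2)[of 1] ab(2)[of "-1"] ab(2)[of x] a_def b_def
    by (simp_all add: field_simps)
  moreover have "(a * n 1)\<^sup>2 / (a * d 1) = a * ((n 1)\<^sup>2 / d 1)" "(b * n (-1))\<^sup>2 / (b * d (-1)) = b * ((n (-1))\<^sup>2 / d (-1))"
    by (auto simp: power2_eq_square)
  ultimately show "v x \<le> (1 + x) / 2 * v 1 + (1 - x) / 2 * v (-1)" unfolding vnd a_def b_def by simp
qed

context
  fixes M0 M1 :: "real measure" and Mt :: "real \<Rightarrow> real measure" and C :: "(nat \<Rightarrow> bool) set" and N :: nat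
  assumes M0: "sym_law M0" and M1: "sym_law M1" and Mt: "\<And>t. t \<in> {0..1} \<Longrightarrow> sym_law (Mt t)"
    and mix: "\<And>t f. t \<in> {0..1} \<Longrightarrow> bmeas BB f \<Longrightarrow> (\<integral>x. f x \<partial>Mt t) = (1 - t) * (\<integral>x. f x \<partial>M0) + t * (\<integral>x. f x \<partial>M1)"
    and N: "0 < N"
    and cx: "\<And>i l. i < N \<Longrightarrow> l \<in> space (cube N) \<Longrightarrow>
      (\<integral>x. (ff C N (l(i := x)))\<^sup>2 * D0 C N (l(i := x)) \<partial>M0) \<le> (\<integral>x. (ff C N (l(i := x)))\<^sup>2 * D0 C N (l(i := x)) \<partial>M1)"
begin

lemma mom_path_mono:
  assumes "0 \<le> a" "a \<le> b" "b \<le> 1" shows "mom C N (Mt a) 0 \<le> mom C N (Mt b) 0"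
proof -
  let ?V = "\<lambda>l. (ff C N l)\<^sup>2 * D0 C N l"
  have bV: "bmeas (cube N) ?V" using bmeas_mom[OF N, of C 1] by simp
  show ?thesis unfolding mom0_eq
  proof (rule path_mono[OF iid_derivative[OF M0 M1 Mt mix bV] _ assms])
    fix t :: real assume t: "t \<in> {0..1}"
    show "0 \<le> (\<Sum>i<N. \<integral>l. (\<integral>x. ?V (l(i := x)) \<partial>M1) - (\<integral>x. ?V (l(i := x)) \<partial>M0) \<partial>iid N (Mt t))"
      using cx by (intro sum_nonneg law_integral_nonneg[OF law_iid[OF sym_law_law[OF Mt[OF t]]]]) simp
  qed
qed

end

section \<open>The threshold bounds below and above capacity\<close>

lemma kcoeff_0: "kcoeff 0 = 1 / (2 * ln 2)"
  by (simp add: kcoeff_def)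

lemma cap_le_m2: assumes L: "law BB L" shows "cap L \<le> m2 L 0"
  unfolding cap_def m2_def
proof (rule law_integral_mono[OF L bmeas_kappa bmeas_m2])
  fix x :: real assume "x \<in> space BB"
  then have "\<bar>x\<bar> \<le> 1" by (simp add: space_BB abs_le_iff)
  then show "kappa x \<le> (x\<^sup>2) ^ Suc 0" using kappa_le_sq by simp
qed

lemma JJ_erased: "lin_code C \<Longrightarrow> JJ C N erased = 0"
proof -
  assume "lin_code C"
  then interpret lin_code C N .
  note L = sym_law_law[OF sym_law_erased]
  have "JJ C N erased = (\<integral>l. ent (Db C N (zeroed {..<N} l)) \<partial>iid N erased)"
    unfolding JJ_def
  proof (rule conjunct1[OF iid_zeroed[OF L bmeas_ent_Db]])
    fix k l assume k: "k \<in> {..<N}" and l: "l \<in> space (cube N)"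
    show "(\<integral>x. ent (Db C N (l(k := x))) \<partial>erased) = ent (Db C N (l(k := 0)))"
      by (rule integral_erased) (use k bmeas_cube_slice[OF bmeas_ent_Db _ l] in simp)
  qed simp
  moreover have "Db C N (zeroed {..<N} l) = 1" for l
    unfolding Db_def Du_def zeroed_def using card_pos by simp
  ultimately show ?thesis by (simp add: ent_def)
qed

text \<open>The path runs from the erasure channel to the channel \<open>M\<close>; all estimates are integrated along it by
  comparing derivatives.\<close>

lemma below_capacity:
  fixes r m :: nat
  assumes M: "sym_law M" and C0: "0 < cap M" and R: "rm_rate r m < cap M" and m: "1 \<le> m"
  shows "(1 - mom (rm_code r m) (2 ^ m) M 0) * (cap M - rm_rate r m) \<le> 8 * ln 2 * (rm_rate r m - rm_rate r (Suc m))"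
proof -
  let ?C = "rm_code r m" and ?C' = "rm_code r (Suc m)"
  let ?N = "2 ^ m :: nat" and ?N' = "2 ^ Suc m :: nat"
  let ?\<Delta> = "rm_rate r m - rm_rate r (Suc m)"
  have N: "0 < ?N" "0 < ?N'" by simp_all
  define p where "p = mom ?C ?N M 0"
  define c where "c = cap M"
  define V where "V = m2 M 0"
  define a1 where "a1 = kcoeff 0 * V"
  note LM = sym_law_law[OF M]
  have c: "0 < c" "c \<le> V" unfolding c_def V_def using C0 cap_le_m2[OF LM] by auto
  then have a1: "0 < a1" unfolding a1_def using kcoeff_pos[of 0] by simp
  obtain Mt where Mt: "Mt 0 = erased" "Mt 1 = M" "\<And>t. t \<in> {0..1} \<Longrightarrow> sym_law (Mt t)"
    "\<And>t f. t \<in> {0..1} \<Longrightarrow> bmeas BB f \<Longrightarrow> (\<integral>x. f x \<partial>Mt t) = (1 - t) * (\<integral>x. f x \<partial>erased) + t * (\<integral>x. f x \<partial>M)"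
    by (rule ex_path[OF sym_law_erased M]) blast
  have m2e: "m2 erased n = 0" for n unfolding m2_def using integral_erased[OF bmeas_m2, of "Suc n"] by simp
  have game: "gam D K (Mt t) erased = 0" if "t \<in> {0..1}" "0 < K" for D K t
    using sums_unique2[OF gam_sums[OF sym_law_law[OF Mt(3)[OF that(1)]] sym_law_law[OF sym_law_erased] that(2), of D]] sums_zero by (simp add: m2e)
  have cx: "(\<integral>x. (ff ?C ?N (l(i := x)))\<^sup>2 * D0 ?C ?N (l(i := x)) \<partial>erased) \<le> (\<integral>x. (ff ?C ?N (l(i := x)))\<^sup>2 * D0 ?C ?N (l(i := x)) \<partial>M)"
    if i: "i < ?N" and l: "l \<in> space (cube ?N)" for i l
  proof -
    define v where "v x = (ff ?C ?N (l(i := x)))\<^sup>2 * D0 ?C ?N (l(i := x))" for x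
    have bv: "bmeas BB v" unfolding v_def using bmeas_cube_slice[OF _ i l] bmeas_mom[OF N(1), of ?C 1] by simp
    have bv': "bmeas BB (\<lambda>x. v (- x))" by (rule bmeas_compose[OF measurable_BB_uminus bv])
    have "(\<integral>x. 2 * v 0 \<partial>M) \<le> (\<integral>x. v x + v (- x) \<partial>M)"
    proof (rule law_integral_mono[OF LM bmeas_const bmeas_add[OF bv bv']])
      fix x assume "x \<in> space BB"
      then have "\<bar>x\<bar> \<le> 1" by (simp add: space_BB abs_le_iff)
      from mom_integrand_convex(1)[OF N(1) i l this] show "2 * v 0 \<le> v x + v (- x)" unfolding v_def .
    qed
    also have "\<dots> = 2 * (\<integral>x. v x \<partial>M)"
      by (subst law_integral_add[OF LM bv bv']) (simp add: sym_law_integral[OF M bv])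
    finally have "v 0 \<le> (\<integral>x. v x \<partial>M)" by (simp add: law_measure[OF LM])
    then show ?thesis using integral_erased[OF bv] unfolding v_def by simp
  qed
  have pt: "mom ?C ?N (Mt t) 0 \<le> p" if "t \<in> {0..1}" for t
    using mom_path_mono[OF sym_law_erased M Mt(3,4) N(1) cx, of t 1] that Mt(2) unfolding p_def by simp
  have p1: "p \<le> 1" unfolding p_def by (rule mom_bounds(2)[OF M lin_code_rm N(1)])
  define J where "J t = JJ ?C ?N (Mt t)" for t
  define J' where "J' t = JJ ?C' ?N' (Mt t)" for t
  define G where "G t = gam ?C ?N (Mt t) M" for t
  define G' where "G' t = gam ?C' ?N' (Mt t) M" for t
  \<comment> \<open>The first part has derivative at least \<open>q * (1 - q)\<close>. The second
    subtracts at most \<open>q * (1 - p)\<close>, by \<open>gam_le_cap\<close> and because 1 - p <=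
    1 - q all along the path; so \<open>h\<close> increases.\<close>
  define h where "h t = (4 / a1) * (J' t / ?N' - J t / ?N) - ((1 - p) / c) * (J t / ?N)" for t
  have dJ: "(J has_real_derivative ?N * G t) (at t within {0..1})" if "t \<in> {0..1}" for t
    using JJ_derivative[OF sym_law_erased M Mt(3,4) that, of r m] game[OF that N(1)] unfolding J_def[abs_def] G_def by simp
  have dJ': "(J' has_real_derivative ?N' * G' t) (at t within {0..1})" if "t \<in> {0..1}" for t
    using JJ_derivative[OF sym_law_erased M Mt(3,4) that, of r "Suc m"] game[OF that N(2)] unfolding J'_def[abs_def] G'_def by simp
  have "h 0 \<le> h 1"
  proof (rule path_mono[where h=h and a=0 and b=1 and h'="\<lambda>t. (4 / a1) * (?N' * G' t / ?N' - ?N * G t / ?N) - ((1 - p) / c) * (?N * G t / ?N)"])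
    fix t :: real assume t: "t \<in> {0..1}"
    show "(h has_real_derivative (4 / a1) * (?N' * G' t / ?N' - ?N * G t / ?N) - ((1 - p) / c) * (?N * G t / ?N)) (at t within {0..1})"
      unfolding h_def[abs_def]
      by (intro DERIV_diff DERIV_cmult DERIV_cdivide dJ[OF t] dJ'[OF t])
    define q where "q = mom ?C ?N (Mt t) 0"
    define q' where "q' = mom ?C' ?N' (Mt t) 0"
    have "a1 * (q' - q) \<le> G' t - G t"
      using gam_diff[OF sym_law_erased M Mt(3,4) t, of r m] m2_bounds(1)[OF LM] game[OF t N(1)] game[OF t N(2)]
      unfolding m2e a1_def V_def q_def q'_def G_def G'_def by simp
    moreover have "q * (1 - q) / 4 \<le> q' - q" unfolding q_def q'_def by (rule two_look[OF Mt(3)[OF t] m])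
    then have "a1 * (q * (1 - q) / 4) \<le> a1 * (q' - q)" using a1 by (intro mult_left_mono) auto
    ultimately have 1: "q * (1 - q) \<le> (4 / a1) * (G' t - G t)" using a1 by (simp add: field_simps)
    have q: "0 \<le> q" "q \<le> p" unfolding q_def using mom_bounds(1)[OF Mt(3)[OF t] lin_code_rm N(1)] pt[OF t] by auto
    have "G t \<le> c * q" unfolding G_def c_def q_def by (rule gam_le_cap[OF Mt(3)[OF t] M N(1)])
    then have "((1 - p) / c) * G t \<le> ((1 - p) / c) * (c * q)" using p1 c by (intro mult_left_mono) auto
    also have "\<dots> = q * (1 - p)" using c by simp
    also have "\<dots> \<le> q * (1 - q)" using q by (intro mult_left_mono) auto
    finally have 2: "((1 - p) / c) * G t \<le> q * (1 - q)" .
    have e: "real ?N' * G' t / real ?N' = G' t" "real ?N * G t / real ?N = G t" by simp_all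
    show "0 \<le> (4 / a1) * (?N' * G' t / ?N' - ?N * G t / ?N) - ((1 - p) / c) * (?N * G t / ?N)"
      unfolding e using 1 2 by linarith
  qed auto
  moreover have "h 0 = 0" unfolding h_def J_def J'_def Mt(1) using JJ_erased[OF lin_code_rm] by simp
  ultimately have "((1 - p) / c) * (J 1 / ?N) \<le> (4 / a1) * (J' 1 / ?N' - J 1 / ?N)" unfolding h_def by simp
  moreover have "J' 1 / ?N' - J 1 / ?N \<le> ?\<Delta>"
    using JJ_level(2)[OF M, of r m] unfolding J_def J'_def Mt(2) by (simp add: field_simps)
  then have "(4 / a1) * (J' 1 / ?N' - J 1 / ?N) \<le> (4 / a1) * ?\<Delta>" using a1 by (intro mult_left_mono) auto
  \<comment> \<open>Replacing \<open>V\<close> by the smaller \<open>c\<close> puts the same factor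
    1 / c on both sides, so that it cancels at the end.\<close>
  moreover have "(4 / a1) * ?\<Delta> \<le> (8 * ln 2 / c) * ?\<Delta>"
  proof (rule mult_right_mono)
    have "4 / a1 = 8 * ln 2 / V" unfolding a1_def kcoeff_0 by simp
    also have "\<dots> \<le> 8 * ln 2 / c" using c by (intro divide_left_mono) auto
    finally show "4 / a1 \<le> 8 * ln 2 / c" .
    show "0 \<le> ?\<Delta>" unfolding rm_rate_diff by simp
  qed
  \<comment> \<open>The entropy balance: H(X | Y) >= 0 forces the divergence per bit to be at least
    the gap between capacity and rate.\<close>
  moreover have "((1 - p) / c) * (c - rm_rate r m) \<le> ((1 - p) / c) * (J 1 / ?N)"
  proof (rule mult_left_mono)
    interpret lin_code ?C ?N by (rule lin_code_rm)
    have "?N * c - log 2 (card ?C) \<le> J 1" unfolding J_def Mt(2) c_def by (rule JJ_ge[OF M])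
    then show "c - rm_rate r m \<le> J 1 / ?N" unfolding log_card_rm_code by (simp add: field_simps)
    show "0 \<le> (1 - p) / c" using p1 c by simp
  qed
  ultimately have "((1 - p) / c) * (c - rm_rate r m) \<le> (8 * ln 2 / c) * ?\<Delta>" by linarith
  then have "c * (((1 - p) / c) * (c - rm_rate r m)) \<le> c * ((8 * ln 2 / c) * ?\<Delta>)" using c by (intro mult_left_mono) auto
  then show ?thesis using c unfolding p_def c_def by simp
qed

text \<open>Here the path runs from \<open>M\<close> to the noiseless channel.\<close>

lemma above_capacity:
  fixes r m :: nat
  assumes M: "sym_law M" and C0: "0 < cap M" and R: "cap M < rm_rate r m" "rm_rate r m \<le> 1" and m: "1 \<le> m"
  shows "mom (rm_code r m) (2 ^ m) M 0 * psi (1 - cap M) * psi (rm_rate r m - cap M) \<le> 8 * ln 2 * (rm_rate r m - rm_rate r (Suc m))"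
proof -
  let ?C = "rm_code r m" and ?C' = "rm_code r (Suc m)"
  let ?N = "2 ^ m :: nat" and ?N' = "2 ^ Suc m :: nat"
  let ?\<Delta> = "rm_rate r m - rm_rate r (Suc m)"
  have N: "0 < ?N" "0 < ?N'" by simp_all
  define p where "p = mom ?C ?N M 0"
  define c where "c = cap M"
  define R where "R = rm_rate r m"
  define V where "V = m2 M 0"
  define a1 where "a1 = kcoeff 0 * (1 - V)"
  note LM = sym_law_law[OF M]
  have c: "0 < c" "c < R" "R \<le> 1" unfolding c_def R_def using C0 R by auto
  obtain z1 where z1: "0 \<le> z1" "z1 \<le> 1" "kappa z1 = c" using kappa_inverse[of c] c by auto
  have z1': "0 < z1" "z1 < 1" using z1 c kappa_0 kappa_1 by (auto simp: less_le)
  obtain s1 where s1: "0 < s1" "\<And>z. \<bar>z\<bar> \<le> 1 \<Longrightarrow> kappa z1 + s1 * (z\<^sup>2 - z1\<^sup>2) \<le> kappa z"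
    using kappa_tangent[OF z1'] by blast
  \<comment> \<open>Jensen's inequality through the tangent: among symmetric laws of capacity
    \<open>c\<close> the one on plus and minus \<open>z1\<close> has the largest second moment.
    Hence the mean square error \<open>1 - V\<close> of a single use is at least
    \<open>psi (1 - c)\<close>.\<close>
  have Vz: "V \<le> z1\<^sup>2"
  proof -
    have b2: "bmeas BB (\<lambda>x. x\<^sup>2)" using bmeas_m2[of 1] by simp
    have "(\<integral>x. (c - s1 * z1\<^sup>2) + s1 * x\<^sup>2 \<partial>M) \<le> cap M"
      unfolding cap_def
    proof (rule law_integral_mono[OF LM bmeas_add[OF bmeas_const bmeas_cmult[OF b2]] bmeas_kappa])
      fix x assume "x \<in> space BB"
      then have "\<bar>x\<bar> \<le> 1" by (simp add: space_BB abs_le_iff)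
      from s1(2)[OF this] show "(c - s1 * z1\<^sup>2) + s1 * x\<^sup>2 \<le> kappa x" unfolding z1(3) by (simp add: algebra_simps)
    qed
    moreover have "(\<integral>x. (c - s1 * z1\<^sup>2) + s1 * x\<^sup>2 \<partial>M) = (c - s1 * z1\<^sup>2) + s1 * V"
      by (subst law_integral_add[OF LM bmeas_const bmeas_cmult[OF b2]]) (simp add: law_measure[OF LM] V_def m2_def)
    ultimately have "s1 * V \<le> s1 * z1\<^sup>2" unfolding c_def by simp
    then show ?thesis using s1(1) by simp
  qed
  have psi1: "psi (1 - c) = 1 - z1\<^sup>2" using psi_kappa[OF z1(1,2)] z1(3) by simp
  have V1: "psi (1 - c) \<le> 1 - V" "0 < psi (1 - c)" using Vz psi1 psi_pos[of "1 - c"] c by auto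
  then have a1: "0 < a1" unfolding a1_def using kcoeff_pos[of 0] by simp
  define u where "u = R - c"
  have u: "0 < u" "u < 1" unfolding u_def using c by auto
  \<comment> \<open>The bias of the binary symmetric channel whose conditional entropy equals the
    excess rate \<open>u\<close>.\<close>
  obtain z0 where z0: "0 \<le> z0" "z0 \<le> 1" "kappa z0 = 1 - u" using kappa_inverse[of "1 - u"] u by auto
  have z0': "0 < z0" "z0 < 1" using z0 u kappa_0 kappa_1 by (auto simp: less_le)
  obtain s where s: "0 < s" "\<And>z. \<bar>z\<bar> \<le> 1 \<Longrightarrow> kappa z0 + s * (z\<^sup>2 - z0\<^sup>2) \<le> kappa z"
    using kappa_tangent[OF z0'] by blast
  define v0 where "v0 = psi u"
  have v0: "v0 = 1 - z0\<^sup>2" unfolding v0_def using psi_kappa[OF z0(1,2)] z0(3) by simp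
  obtain Q where Q: "sym_law Q" "\<And>f. bmeas BB f \<Longrightarrow> (\<integral>x. f x \<partial>Q) = (f 1 + f (-1)) / 2" by (rule ex_revealed) blast
  obtain Mt where Mt: "Mt 0 = M" "Mt 1 = Q" "\<And>t. t \<in> {0..1} \<Longrightarrow> sym_law (Mt t)"
    "\<And>t f. t \<in> {0..1} \<Longrightarrow> bmeas BB f \<Longrightarrow> (\<integral>x. f x \<partial>Mt t) = (1 - t) * (\<integral>x. f x \<partial>M) + t * (\<integral>x. f x \<partial>Q)"
    by (rule ex_path[OF M Q(1)]) blast
  have m2Q: "m2 Q n = 1" for n unfolding m2_def using Q(2)[OF bmeas_m2, of "Suc n"] by simp
  have cx: "(\<integral>x. (ff ?C ?N (l(i := x)))\<^sup>2 * D0 ?C ?N (l(i := x)) \<partial>M) \<le> (\<integral>x. (ff ?C ?N (l(i := x)))\<^sup>2 * D0 ?C ?N (l(i := x)) \<partial>Q)"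
    if i: "i < ?N" and l: "l \<in> space (cube ?N)" for i l
  proof -
    define v where "v x = (ff ?C ?N (l(i := x)))\<^sup>2 * D0 ?C ?N (l(i := x))" for x
    have bv: "bmeas BB v" unfolding v_def using bmeas_cube_slice[OF _ i l] bmeas_mom[OF N(1), of ?C 1] by simp
    have "(\<integral>x. v x \<partial>M) \<le> (\<integral>x. (v 1 + v (-1)) / 2 + ((v 1 - v (-1)) / 2) * x \<partial>M)"
    proof (rule law_integral_mono[OF LM bv bmeas_add[OF bmeas_const bmeas_cmult[OF bmeas_BB_id]]])
      fix x assume "x \<in> space BB"
      then have "\<bar>x\<bar> \<le> 1" by (simp add: space_BB abs_le_iff)
      from mom_integrand_convex(2)[OF N(1) i l this, of ?C] have "v x \<le> (1 + x) / 2 * v 1 + (1 - x) / 2 * v (-1)" unfolding v_def .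
      also have "\<dots> = (v 1 + v (-1)) / 2 + ((v 1 - v (-1)) / 2) * x" by (simp add: field_simps)
      finally show "v x \<le> (v 1 + v (-1)) / 2 + ((v 1 - v (-1)) / 2) * x" .
    qed
    also have "\<dots> = (v 1 + v (-1)) / 2"
      by (subst law_integral_add[OF LM bmeas_const bmeas_cmult[OF bmeas_BB_id]]) (simp add: law_measure[OF LM] sym_law_mean[OF M])
    also have "\<dots> = (\<integral>x. v x \<partial>Q)" using Q(2)[OF bv] by simp
    finally show ?thesis unfolding v_def .
  qed
  have pt: "p \<le> mom ?C ?N (Mt t) 0" if "t \<in> {0..1}" for t
    using mom_path_mono[OF M Q(1) Mt(3,4) N(1) cx, of 0 t] that Mt(1) unfolding p_def by simp
  have p0: "0 \<le> p" unfolding p_def by (rule mom_bounds(1)[OF M lin_code_rm N(1)])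
  define J where "J t = JJ ?C ?N (Mt t)" for t
  define J' where "J' t = JJ ?C' ?N' (Mt t)" for t
  define G where "G t = gam ?C ?N (Mt t) Q - gam ?C ?N (Mt t) M" for t
  define G' where "G' t = gam ?C' ?N' (Mt t) Q - gam ?C' ?N' (Mt t) M" for t
  \<comment> \<open>The tangent at \<open>z0\<close> bounds \<open>1 - q\<close> from below by an
    affine function of \<open>G\<close>. Between the endpoints only the total increment
    \<open>(J 1 - J 0) / N\<close>, at most \<open>1 - R\<close>, then matters, and
    \<open>p * v0\<close> survives.\<close>
  define h where "h t = (4 / a1) * (J' t / ?N' - J t / ?N) - (p * (v0 + (1 - R) / s)) * t + (p / s) * (J t / ?N)" for t
  have dJ: "(J has_real_derivative ?N * G t) (at t within {0..1})" if "t \<in> {0..1}" for t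
    using JJ_derivative[OF M Q(1) Mt(3,4) that, of r m] unfolding J_def[abs_def] G_def by simp
  have dJ': "(J' has_real_derivative ?N' * G' t) (at t within {0..1})" if "t \<in> {0..1}" for t
    using JJ_derivative[OF M Q(1) Mt(3,4) that, of r "Suc m"] unfolding J'_def[abs_def] G'_def by simp
  have "h 0 \<le> h 1"
  proof (rule path_mono[where h=h and a=0 and b=1 and h'="\<lambda>t. (4 / a1) * (?N' * G' t / ?N' - ?N * G t / ?N) - (p * (v0 + (1 - R) / s)) * 1 + (p / s) * (?N * G t / ?N)"])
    fix t :: real assume t: "t \<in> {0..1}"
    show "(h has_real_derivative (4 / a1) * (?N' * G' t / ?N' - ?N * G t / ?N) - (p * (v0 + (1 - R) / s)) * 1 + (p / s) * (?N * G t / ?N)) (at t within {0..1})"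
      unfolding h_def[abs_def]
      by (intro DERIV_add DERIV_diff DERIV_cmult DERIV_cdivide DERIV_ident dJ[OF t] dJ'[OF t])
    define q where "q = mom ?C ?N (Mt t) 0"
    define q' where "q' = mom ?C' ?N' (Mt t) 0"
    have "a1 * (q' - q) \<le> G' t - G t"
      using gam_diff[OF M Q(1) Mt(3,4) t, of r m] m2_bounds(2)[OF LM]
      unfolding m2Q a1_def V_def q_def q'_def G_def G'_def by simp
    moreover have "q * (1 - q) / 4 \<le> q' - q" unfolding q_def q'_def by (rule two_look[OF Mt(3)[OF t] m])
    then have "a1 * (q * (1 - q) / 4) \<le> a1 * (q' - q)" using a1 by (intro mult_left_mono) auto
    ultimately have 1: "q * (1 - q) \<le> (4 / a1) * (G' t - G t)" using a1 by (simp add: field_simps)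
    have q: "p \<le> q" "q \<le> 1" unfolding q_def using mom_bounds(2)[OF Mt(3)[OF t] lin_code_rm N(1)] pt[OF t] by auto
    have gM: "gam ?C ?N (Mt t) M \<le> c"
    proof -
      have "gam ?C ?N (Mt t) M \<le> c * q" unfolding c_def q_def by (rule gam_le_cap[OF Mt(3)[OF t] M N(1)])
      also have "\<dots> \<le> c * 1" using c q by (intro mult_left_mono) auto
      finally show ?thesis by simp
    qed
    \<comment> \<open>For a fully revealed bit the functional is the mean of \<open>kappa\<close> of
      the extrinsic estimate, and the tangent turns it into a bound linear in the moment
      \<open>q\<close>.\<close>
    have gQ: "kappa z0 + s * (q - z0\<^sup>2) \<le> gam ?C ?N (Mt t) Q"
    proof -
      note LI = law_iid[OF sym_law_law[OF Mt(3)[OF t]], of ?N]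
      have kf: "(\<integral>x. kappa (x * ff ?C ?N l) \<partial>Q) = kappa (ff ?C ?N l)" if l: "l \<in> space (cube ?N)" for l
      proof -
        have f: "\<bar>ff ?C ?N l\<bar> \<le> 1" by (rule ff_abs_le[OF N(1) l])
        have "(\<lambda>x. x * ff ?C ?N l) \<in> measurable BB BB"
          unfolding BB_def
        proof (rule measurable_restrict_space3)
          show "(\<lambda>x. x * ff ?C ?N l) \<in> {-1..1} \<rightarrow> {-1..1}"
          proof
            fix x :: real assume "x \<in> {-1..1}"
            then have "\<bar>x * ff ?C ?N l\<bar> \<le> 1" using f by (auto simp: abs_mult intro!: mult_le_one)
            then show "x * ff ?C ?N l \<in> {-1..1}" by (simp add: abs_le_iff)
          qed
        qed simp
        from Q(2)[OF bmeas_compose[OF this bmeas_kappa]] show ?thesis by (simp add: kappa_minus)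
      qed
      have "(\<integral>l. (kappa z0 - s * z0\<^sup>2) * D0 ?C ?N l + s * ((ff ?C ?N l)\<^sup>2 ^ Suc 0 * D0 ?C ?N l) \<partial>iid ?N (Mt t)) \<le> (\<integral>l. D0 ?C ?N l * kappa (ff ?C ?N l) \<partial>iid ?N (Mt t))"
      proof (rule law_integral_mono[OF LI bmeas_add[OF bmeas_cmult[OF bmeas_D0[OF N(1)]] bmeas_cmult[OF bmeas_mom[OF N(1)]]]])
        have "ff ?C ?N \<in> measurable (cube ?N) BB"
          unfolding BB_def using bmeas_measurable[OF bmeas_ff[OF N(1)]] ff_abs_le[OF N(1)]
          by (intro measurable_restrict_space2) (auto simp: abs_le_iff)
        then show "bmeas (cube ?N) (\<lambda>l. D0 ?C ?N l * kappa (ff ?C ?N l))"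
          by (intro bmeas_mult bmeas_D0[OF N(1)] bmeas_compose[OF _ bmeas_kappa])
        fix l assume l: "l \<in> space (cube ?N)"
        have "D0 ?C ?N l * (kappa z0 + s * ((ff ?C ?N l)\<^sup>2 - z0\<^sup>2)) \<le> D0 ?C ?N l * kappa (ff ?C ?N l)"
          using s(2)[OF ff_abs_le[OF N(1) l]] D0_nonneg[OF N(1) l] by (intro mult_left_mono) auto
        then show "(kappa z0 - s * z0\<^sup>2) * D0 ?C ?N l + s * ((ff ?C ?N l)\<^sup>2 ^ Suc 0 * D0 ?C ?N l) \<le> D0 ?C ?N l * kappa (ff ?C ?N l)"
          by (simp add: algebra_simps)
      qed
      also have "\<dots> = gam ?C ?N (Mt t) Q"
        unfolding gam_def by (rule law_integral_cong[OF LI]) (simp only: kf)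
      finally have "(\<integral>l. (kappa z0 - s * z0\<^sup>2) * D0 ?C ?N l + s * ((ff ?C ?N l)\<^sup>2 ^ Suc 0 * D0 ?C ?N l) \<partial>iid ?N (Mt t)) \<le> gam ?C ?N (Mt t) Q" .
      moreover have "(\<integral>l. (kappa z0 - s * z0\<^sup>2) * D0 ?C ?N l + s * ((ff ?C ?N l)\<^sup>2 ^ Suc 0 * D0 ?C ?N l) \<partial>iid ?N (Mt t)) = (kappa z0 - s * z0\<^sup>2) * 1 + s * q"
        by (subst law_integral_add[OF LI bmeas_cmult[OF bmeas_D0[OF N(1)]] bmeas_cmult[OF bmeas_mom[OF N(1)]]])
          (simp only: integral_mult_right_zero mom_bounds(3)[OF Mt(3)[OF t] lin_code_rm N(1)] mom_def[symmetric] q_def)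
      ultimately show ?thesis by (simp add: algebra_simps)
    qed
    have "1 - R - G t \<le> s * ((1 - q) - v0)"
      using gM gQ unfolding G_def z0(3) v0 u_def by (simp add: algebra_simps)
    then have "(1 - R - G t) / s \<le> (1 - q) - v0" using s(1) by (simp add: pos_divide_le_eq mult.commute)
    then have "v0 + (1 - R - G t) / s \<le> 1 - q" by simp
    then have "p * (v0 + (1 - R - G t) / s) \<le> p * (1 - q)" using p0 by (intro mult_left_mono)
    also have "\<dots> \<le> q * (1 - q)" using q by (intro mult_right_mono) auto
    finally have 2: "p * (v0 + (1 - R) / s) - (p / s) * G t \<le> q * (1 - q)"
      by (simp add: algebra_simps diff_divide_distrib add_divide_distrib)
    have e: "real ?N' * G' t / real ?N' = G' t" "real ?N * G t / real ?N = G t" by simp_all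
    show "0 \<le> (4 / a1) * (?N' * G' t / ?N' - ?N * G t / ?N) - (p * (v0 + (1 - R) / s)) * 1 + (p / s) * (?N * G t / ?N)"
      unfolding e using 1 2 by linarith
  qed auto
  then have H: "p * (v0 + (1 - R) / s) + (p / s) * (J 0 / ?N) - (p / s) * (J 1 / ?N) \<le> (4 / a1) * ((J' 1 / ?N' - J 1 / ?N) - (J' 0 / ?N' - J 0 / ?N))"
    unfolding h_def by (simp add: algebra_simps)
  \<comment> \<open>The upper nesting bound is applied at the noiseless end and superadditivity at
    the given channel.\<close>
  have "(J' 1 / ?N' - J 1 / ?N) - (J' 0 / ?N' - J 0 / ?N) \<le> ?\<Delta>"
  proof -
    have "J' 1 / ?N' - J 1 / ?N \<le> ?\<Delta>"
      using JJ_level(2)[OF Q(1), of r m] unfolding J_def J'_def Mt(2) by (simp add: field_simps)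
    moreover have "0 \<le> J' 0 / ?N' - J 0 / ?N"
      using JJ_level(1)[OF M, of r m] unfolding J_def J'_def Mt(1) by (simp add: field_simps)
    ultimately show ?thesis by simp
  qed
  then have "(4 / a1) * ((J' 1 / ?N' - J 1 / ?N) - (J' 0 / ?N' - J 0 / ?N)) \<le> (4 / a1) * ?\<Delta>" using a1 by (intro mult_left_mono) auto
  moreover have "p * v0 \<le> p * (v0 + (1 - R) / s) + (p / s) * (J 0 / ?N) - (p / s) * (J 1 / ?N)"
  proof -
    interpret lin_code ?C ?N by (rule lin_code_rm)
    have "0 \<le> J 0" unfolding J_def Mt(1) by (rule JJ_nonneg[OF M])
    then have "0 \<le> J 0 / ?N" by simp
    moreover have "J 1 \<le> ?N - log 2 (card ?C)" unfolding J_def Mt(2)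
      by (rule JJ_le[OF Q(1)]) (use rm_code_support in auto)
    then have "J 1 / ?N \<le> 1 - R" unfolding log_card_rm_code R_def by (simp add: field_simps)
    ultimately have "0 \<le> (1 - R) + J 0 / ?N - J 1 / ?N" by linarith
    then have "0 \<le> (p / s) * ((1 - R) + J 0 / ?N - J 1 / ?N)" using p0 s(1) by (intro mult_nonneg_nonneg) auto
    then show ?thesis by (simp add: algebra_simps diff_divide_distrib)
  qed
  ultimately have "p * v0 \<le> (4 / a1) * ?\<Delta>" using H by linarith
  also have "4 / a1 = 8 * ln 2 / (1 - V)" unfolding a1_def kcoeff_0 by simp
  finally have "p * v0 * (1 - V) \<le> 8 * ln 2 * ?\<Delta>" using V1 by (simp add: field_simps)
  moreover have "p * v0 * psi (1 - c) \<le> p * v0 * (1 - V)"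
    using V1 p0 psi_pos[of u] u unfolding v0_def by (intro mult_left_mono) auto
  ultimately show ?thesis unfolding p_def c_def v0_def u_def R_def by (simp add: mult_ac)
qed

section \<open>Bit-error rates\<close>

text \<open>An estimate in [-1, 1] has absolute value at least its square, and by Jensen the bit's
  own observation, of mean zero, can only increase the mean absolute value. The right side is one
  minus twice the bit-error rate.\<close>

lemma mom_le_abs_Nb:
  assumes M: "sym_law M" and N: "0 < N"
  shows "mom C N M 0 \<le> (\<integral>l. \<bar>Nb C N 0 l\<bar> \<partial>iid N M)"
proof -
  note LM = sym_law_law[OF M] and LI = law_iid[OF sym_law_law[OF M], of N]
  have bA: "bmeas (cube N) (\<lambda>l. \<bar>Nb C N 0 l\<bar>)" by (intro bmeas_abs bmeas_Nb)
  have "mom C N M 0 \<le> (\<integral>l. (\<integral>x. \<bar>Nb C N 0 (l(0 := x))\<bar> \<partial>M) \<partial>iid N M)"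
    unfolding mom_def
  proof (rule law_integral_mono[OF LI bmeas_mom[OF N] bmeas_cube_partial[OF LM bA N]])
    fix l assume l: "l \<in> space (cube N)"
    have b: "bmeas BB (\<lambda>x. n0 C N l + D0 C N l * x)" by (intro bmeas_add bmeas_const bmeas_cmult bmeas_BB_id)
    have "(ff C N l)\<^sup>2 * D0 C N l = \<bar>ff C N l\<bar> * \<bar>n0 C N l\<bar>"
      unfolding ff_D0[OF N l, symmetric] using D0_nonneg[OF N l, of C] by (simp add: abs_mult power2_eq_square)
    also have "\<dots> \<le> 1 * \<bar>n0 C N l\<bar>" using ff_abs_le[OF N l] by (intro mult_right_mono) auto
    also have "\<dots> = \<bar>\<integral>x. n0 C N l + D0 C N l * x \<partial>M\<bar>"
      by (subst law_integral_add[OF LM bmeas_const bmeas_cmult[OF bmeas_BB_id]]) (simp add: law_measure[OF LM] sym_law_mean[OF M])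
    also have "\<dots> \<le> (\<integral>x. \<bar>n0 C N l + D0 C N l * x\<bar> \<partial>M)" by (rule integral_abs_bound)
    also have "\<dots> = (\<integral>x. \<bar>Nb C N 0 (l(0 := x))\<bar> \<partial>M)"
    proof -
      have "Nb C N 0 (l(0 := x)) = n0 C N l + D0 C N l * x" for x
        unfolding n0_def D0_def using Nb_upd[OF N, of C l x] by (simp only: mult.commute)
      then show ?thesis by simp
    qed
    finally show "(ff C N l)\<^sup>2 ^ Suc 0 * D0 C N l \<le> (\<integral>x. \<bar>Nb C N 0 (l(0 := x))\<bar> \<partial>M)" by simp
  qed
  then show ?thesis using iid_resample[OF LM bA N] by simp
qed

text \<open>By symmetry the average over the bit's own observation is that of max (|n|, d |x|). The
  bound d |x| from below corresponds to using this observation alone; the chord of this convex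
  function of |x| over [0, 1] bounds it from above. The weight of |n| is \<open>1 - e\<close>, and
  \<open>cap M\<close> is at most \<open>e\<close>.\<close>

lemma abs_Nb_sandwich:
  assumes M: "sym_law M" and C: "lin_code C" and N: "0 < N"
  defines "e \<equiv> (\<integral>x. \<bar>x\<bar> \<partial>M)" and "A \<equiv> (\<integral>l. \<bar>Nb C N 0 l\<bar> \<partial>iid N M)"
  shows "e \<le> A" and "A \<le> e + (1 - cap M) * sqrt (mom C N M 0)"
proof -
  interpret lin_code C N by (rule C)
  note LM = sym_law_law[OF M] and LI = law_iid[OF sym_law_law[OF M], of N]
  have bA: "bmeas (cube N) (\<lambda>l. \<bar>Nb C N 0 l\<bar>)" by (intro bmeas_abs bmeas_Nb)
  have ba: "bmeas BB (\<lambda>x. \<bar>x\<bar>)" by (intro bmeas_abs bmeas_BB_id)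
  define B where "B l = (\<integral>x. \<bar>Nb C N 0 (l(0 := x))\<bar> \<partial>M)" for l
  have bB: "bmeas (cube N) B" unfolding B_def by (rule bmeas_cube_partial[OF LM bA N])
  have AB: "A = (\<integral>l. B l \<partial>iid N M)" unfolding A_def B_def by (rule iid_resample[OF LM bA N])
  have e1: "e \<le> 1"
  proof -
    have "e \<le> (\<integral>x. 1 \<partial>M)" unfolding e_def by (rule law_integral_mono[OF LM ba bmeas_const]) (simp add: space_BB abs_le_iff)
    then show ?thesis by (simp add: law_measure[OF LM])
  qed
  have pt: "e * D0 C N l \<le> B l \<and> B l \<le> e * D0 C N l + (1 - e) * \<bar>n0 C N l\<bar>" if l: "l \<in> space (cube N)" for l
  proof -
    define n where "n = n0 C N l"
    define d where "d = D0 C N l"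
    have nd: "\<bar>n\<bar> \<le> d" unfolding n_def d_def by (rule n0_abs_le[OF N l])
    have b1: "bmeas BB (\<lambda>x. \<bar>n + d * x\<bar>)" by (intro bmeas_abs bmeas_add bmeas_const bmeas_cmult bmeas_BB_id)
    have b2: "bmeas BB (\<lambda>x. \<bar>n - d * x\<bar>)" by (intro bmeas_abs bmeas_diff bmeas_const bmeas_cmult bmeas_BB_id)
    have "Nb C N 0 (l(0 := x)) = n + d * x" for x
      unfolding n_def d_def n0_def D0_def using Nb_upd[OF N, of C l x] by (simp only: mult.commute)
    then have B: "B l = (\<integral>x. \<bar>n + d * x\<bar> \<partial>M)" unfolding B_def by simp
    have "(\<integral>x. \<bar>n - d * x\<bar> \<partial>M) = (\<integral>x. \<bar>n + d * x\<bar> \<partial>M)" using sym_law_integral[OF M b1] by simp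
    then have B2: "2 * B l = (\<integral>x. \<bar>n + d * x\<bar> + \<bar>n - d * x\<bar> \<partial>M)"
      unfolding B law_integral_add[OF LM b1 b2] by simp
    have "(\<integral>x. (2 * d) * \<bar>x\<bar> \<partial>M) \<le> 2 * B l"
      unfolding B2
    proof (rule law_integral_mono[OF LM bmeas_cmult[OF ba] bmeas_add[OF b1 b2]])
      fix x
      have "\<bar>(n + d * x) - (n - d * x)\<bar> \<le> \<bar>n + d * x\<bar> + \<bar>n - d * x\<bar>" by (rule abs_triangle_ineq4)
      moreover have "\<bar>(n + d * x) - (n - d * x)\<bar> = (2 * d) * \<bar>x\<bar>" using nd by (simp add: abs_mult)
      ultimately show "(2 * d) * \<bar>x\<bar> \<le> \<bar>n + d * x\<bar> + \<bar>n - d * x\<bar>" by simp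
    qed
    then have lo: "e * d \<le> B l" unfolding e_def by (simp add: mult.commute)
    have "2 * B l \<le> (\<integral>x. 2 * \<bar>n\<bar> + (2 * (d - \<bar>n\<bar>)) * \<bar>x\<bar> \<partial>M)"
      unfolding B2
    proof (rule law_integral_mono[OF LM bmeas_add[OF b1 b2] bmeas_add[OF bmeas_const bmeas_cmult[OF ba]]])
      fix x assume "x \<in> space BB"
      then have x: "\<bar>x\<bar> \<le> 1" by (simp add: space_BB abs_le_iff)
      have "\<bar>n + d * x\<bar> + \<bar>n - d * x\<bar> = 2 * max \<bar>n\<bar> \<bar>d * x\<bar>" by (auto simp: max_def abs_if)
      also have "\<bar>d * x\<bar> = d * \<bar>x\<bar>" using nd by (simp add: abs_mult)
      also have "max \<bar>n\<bar> (d * \<bar>x\<bar>) \<le> \<bar>n\<bar> + (d - \<bar>n\<bar>) * \<bar>x\<bar>"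
      proof -
        have "0 \<le> (d - \<bar>n\<bar>) * \<bar>x\<bar>" using nd by simp
        moreover have "0 \<le> \<bar>n\<bar> * (1 - \<bar>x\<bar>)" using x by simp
        ultimately show ?thesis by (intro max.boundedI) (simp_all add: algebra_simps)
      qed
      finally show "\<bar>n + d * x\<bar> + \<bar>n - d * x\<bar> \<le> 2 * \<bar>n\<bar> + (2 * (d - \<bar>n\<bar>)) * \<bar>x\<bar>" by (simp add: algebra_simps)
    qed
    also have "\<dots> = 2 * \<bar>n\<bar> + (2 * (d - \<bar>n\<bar>)) * e"
      by (subst law_integral_add[OF LM bmeas_const bmeas_cmult[OF ba]]) (simp add: law_measure[OF LM] e_def)
    finally show ?thesis using lo unfolding n_def d_def by (simp add: algebra_simps)
  qed
  have D1: "(\<integral>l. D0 C N l \<partial>iid N M) = 1" by (rule mom_bounds(3)[OF M C N])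
  have "(\<integral>l. e * D0 C N l \<partial>iid N M) \<le> A"
    unfolding AB using pt by (intro law_integral_mono[OF LI bmeas_cmult[OF bmeas_D0[OF N]] bB]) auto
  then show "e \<le> A" by (simp add: D1)
  define Z where "Z = (\<integral>l. \<bar>n0 C N l\<bar> \<partial>iid N M)"
  have bn: "bmeas (cube N) (\<lambda>l. \<bar>n0 C N l\<bar>)" by (intro bmeas_abs bmeas_n0 N)
  have "A \<le> (\<integral>l. e * D0 C N l + (1 - e) * \<bar>n0 C N l\<bar> \<partial>iid N M)"
    unfolding AB using pt by (intro law_integral_mono[OF LI bB bmeas_add[OF bmeas_cmult[OF bmeas_D0[OF N]] bmeas_cmult[OF bn]]]) auto
  also have "\<dots> = e + (1 - e) * Z"
    by (subst law_integral_add[OF LI bmeas_cmult[OF bmeas_D0[OF N]] bmeas_cmult[OF bn]]) (simp add: D1 Z_def)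
  finally have 1: "A \<le> e + (1 - e) * Z" .
  have Z0: "0 \<le> Z" unfolding Z_def by (rule law_integral_nonneg[OF LI]) simp
  have Zs: "Z \<le> sqrt (mom C N M 0)"
  proof -
    note bf = bmeas_abs[OF bmeas_ff[OF N, of C]]
    have "Z = (\<integral>l. \<bar>ff C N l\<bar> * D0 C N l \<partial>iid N M)"
      unfolding Z_def
    proof (rule law_integral_cong[OF LI])
      fix l assume l: "l \<in> space (cube N)"
      show "\<bar>n0 C N l\<bar> = \<bar>ff C N l\<bar> * D0 C N l"
        unfolding ff_D0[OF N l, symmetric] using D0_nonneg[OF N l, of C] by (simp add: abs_mult)
    qed
    also have "\<dots> = (\<integral>l. \<bar>ff C N l\<bar> * Du N (\<lambda>_. False) l \<partial>iid N M)"
      by (rule ext_even[OF M N bf]) (simp_all add: ff_upd ff_flip[OF N] abs_mult bpsk_abs)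
    also have "\<dots> = (\<integral>l. \<bar>ff C N l\<bar> \<partial>iid N (tilt M))" by (rule iid_tilt[OF M bf, symmetric])
    finally have "Z\<^sup>2 \<le> (\<integral>l. \<bar>ff C N l\<bar>\<^sup>2 \<partial>iid N (tilt M))"
      using law_square_mean_le[OF law_iid[OF law_tilt[OF M]] bf] by simp
    also have "\<dots> = mom C N M 0"
      using mom_zero_codeword(1)[OF M N, of 0] iid_tilt[OF M bmeas_power[OF bmeas_ff[OF N, of C], of 2]] by simp
    finally show ?thesis by (rule real_le_rsqrt)
  qed
  have "cap M \<le> e"
  proof -
    have "cap M \<le> m2 M 0" by (rule cap_le_m2[OF LM])
    also have "\<dots> \<le> e" unfolding m2_def e_def
    proof (rule law_integral_mono[OF LM bmeas_m2 ba])
      fix x :: real assume "x \<in> space BB"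
      then have "\<bar>x\<bar> \<le> 1" by (simp add: space_BB abs_le_iff)
      then have "\<bar>x\<bar> * \<bar>x\<bar> \<le> \<bar>x\<bar> * 1" by (intro mult_left_mono) auto
      then show "(x\<^sup>2) ^ Suc 0 \<le> \<bar>x\<bar>" by (simp add: power2_eq_square)
    qed
    finally show ?thesis .
  qed
  then have "(1 - e) * Z \<le> (1 - cap M) * sqrt (mom C N M 0)" using Zs Z0 e1 by (intro mult_mono) auto
  then show "A \<le> e + (1 - cap M) * sqrt (mom C N M 0)" using 1 by linarith
qed

lemma abs_Nb_translate:
  fixes r m :: nat
  assumes M: "sym_law M" and i: "i < 2 ^ m"
  shows "(\<integral>l. \<bar>Nb (rm_code r m) (2 ^ m) i l\<bar> \<partial>iid (2 ^ m) M) = (\<integral>l. \<bar>Nb (rm_code r m) (2 ^ m) 0 l\<bar> \<partial>iid (2 ^ m) M)"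
proof -
  let ?C = "rm_code r m" and ?N = "2 ^ m :: nat"
  define \<sigma> where "\<sigma> j = xor j i" for j
  have inv: "\<sigma> (\<sigma> j) = j" for j by (rule bit_eqI) (auto simp: \<sigma>_def bit_xor_iff)
  have dom: "\<sigma> j < ?N \<longleftrightarrow> j < ?N" for j unfolding \<sigma>_def by (rule xor_less_iff[OF i])
  have aut: "(\<lambda>j. u (\<sigma> j)) \<in> ?C" if "u \<in> ?C" for u using that i unfolding \<sigma>_def by (rule rm_code_translate)
  have z: "\<sigma> 0 = i" by (simp add: \<sigma>_def)
  have "Nb ?C ?N 0 (\<lambda>j. l (\<sigma> j)) = Nb ?C ?N (\<sigma> 0) l" for l by (rule Nb_reindex[OF inv dom aut])
  then show ?thesis
    using iid_reindex(1)[OF sym_law_law[OF M] bmeas_abs[OF bmeas_Nb] inv dom, of ?C 0] unfolding z by simp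
qed

text \<open>The MAP rule errs with the smaller of the two masses, which is half of their sum minus
  half of their distance.\<close>

lemma bit_map_sum:
  assumes "finite S" "\<And>x. x \<in> S \<Longrightarrow> g x = 1 \<or> g x = -1"
  shows "(\<Sum>x\<in>{x\<in>S. g x \<noteq> map_decision S p g y}. p x y) = ((\<Sum>x\<in>S. p x y) - \<bar>\<Sum>x\<in>S. g x * p x y\<bar>) / 2"
proof -
  let ?P = "{x\<in>S. g x = 1}" and ?M = "{x\<in>S. g x = -1}"
  have S: "S = ?P \<union> ?M" "?P \<inter> ?M = {}" using assms by auto
  have split: "(\<Sum>x\<in>S. F x) = (\<Sum>x\<in>?P. F x) + (\<Sum>x\<in>?M. F x)" for F :: "'a \<Rightarrow> real"
    using assms(1) S sum.union_disjoint[of ?P ?M F] by (metis (no_types, lifting) finite_Un)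
  have "(\<Sum>x\<in>?P. g x * p x y) = (\<Sum>x\<in>?P. p x y)" by (intro sum.cong) auto
  moreover have "(\<Sum>x\<in>?M. g x * p x y) = - (\<Sum>x\<in>?M. p x y)" by (subst sum_negf[symmetric], intro sum.cong) auto
  ultimately have d: "(\<Sum>x\<in>S. g x * p x y) = (\<Sum>x\<in>?P. p x y) - (\<Sum>x\<in>?M. p x y)" unfolding split[of "\<lambda>x. g x * p x y"] by simp
  show ?thesis
  proof (cases "(\<Sum>x\<in>?P. p x y) \<ge> (\<Sum>x\<in>?M. p x y)")
    case True
    then have "map_decision S p g y = 1" by (simp add: map_decision_def)
    moreover have "{x\<in>S. g x \<noteq> 1} = ?M" using assms(2) by auto
    ultimately show ?thesis unfolding d split[of "\<lambda>x. p x y"] using True by simp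
  next
    case False
    then have "map_decision S p g y = -1" by (simp add: map_decision_def)
    moreover have "{x\<in>S. g x \<noteq> -1} = ?P" using assms(2) by auto
    ultimately show ?thesis unfolding d split[of "\<lambda>x. p x y"] using False by simp
  qed
qed

section \<open>From the channel to the law of its soft bit\<close>

locale bms =
  fixes \<mu> :: "ereal measure" and W :: "real \<Rightarrow> ereal \<Rightarrow> real"
  assumes bms: "bms_channel \<mu> W"
begin

definition s where "s y = (W 1 y + W (-1) y) / 2"

text \<open>The posterior mean of a uniform input given \<open>y\<close>, with value 0 where both
  densities vanish. There \<open>s y = 0\<close> too, so the factorisation in \<open>W_eq\<close>
  holds for every output.\<close>

definition ll where "ll y = (W 1 y - W (-1) y) / (W 1 y + W (-1) y)"

definition M where "M = distr (density \<mu> (\<lambda>y. ennreal (s y))) BB ll"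

lemma W_nonneg: "0 \<le> W 1 y" "0 \<le> W (-1) y"
  and W_measurable: "W 1 \<in> borel_measurable borel" "W (-1) \<in> borel_measurable borel"
  and W_integrable: "integrable \<mu> (W 1)" "integrable \<mu> (W (-1))"
  and W_integral: "(\<integral>y. W 1 y \<partial>\<mu>) = 1" "(\<integral>y. W (-1) y \<partial>\<mu>) = 1"
  and W_sym: "W 1 y = W (-1) (- y)"
  and sets_mu: "sets \<mu> = sets borel"
  and sigma_finite_mu: "sigma_finite_measure \<mu>"
  and distr_mu: "distr \<mu> borel uminus = \<mu>"
proof -
  have b: "\<forall>x\<in>{1, -1}. W x \<in> borel_measurable borel \<and> (\<forall>y. 0 \<le> W x y) \<and> integrable \<mu> (W x) \<and> (\<integral>y. W x y \<partial>\<mu>) = 1"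
    "\<forall>y. W 1 y = W (-1) (- y)" "sets \<mu> = sets borel" "sigma_finite_measure \<mu>" "distr \<mu> borel uminus = \<mu>"
    using bms unfolding bms_channel_def by blast+
  have 1: "W x \<in> borel_measurable borel" "0 \<le> W x y" "integrable \<mu> (W x)" "(\<integral>y. W x y \<partial>\<mu>) = 1" if "x \<in> {1, -1}" for x y
    using bspec[OF b(1) that] by blast+
  show "0 \<le> W 1 y" "0 \<le> W (-1) y" "W 1 \<in> borel_measurable borel" "W (-1) \<in> borel_measurable borel"
    "integrable \<mu> (W 1)" "integrable \<mu> (W (-1))" "(\<integral>y. W 1 y \<partial>\<mu>) = 1" "(\<integral>y. W (-1) y \<partial>\<mu>) = 1"
    by (rule 1, simp)+
  show "W 1 y = W (-1) (- y)" using b(2) by (rule spec)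
qed (use bms[unfolded bms_channel_def] in blast)+

lemma W_eq: "x = 1 \<or> x = -1 \<Longrightarrow> W x y = s y * (1 + x * ll y)"
  using W_nonneg[of y] by (cases "W 1 y + W (-1) y = 0") (auto simp: s_def ll_def field_simps)

lemma ll_abs: "\<bar>ll y\<bar> \<le> 1"
  using W_nonneg[of y] unfolding ll_def by (cases "W 1 y + W (-1) y = 0") (auto simp: abs_le_iff pos_divide_le_eq pos_le_divide_eq)

lemma s_nonneg: "0 \<le> s y"
  using W_nonneg[of y] by (simp add: s_def)

lemma s_measurable: "s \<in> borel_measurable \<mu>"
proof -
  have "s \<in> borel_measurable borel" unfolding s_def[abs_def] using W_measurable by measurable
  then show ?thesis using measurable_cong_sets[OF sets_mu refl] by blast
qed

lemma s_integrable: "integrable \<mu> s" and s_integral: "(\<integral>y. s y \<partial>\<mu>) = 1"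
  unfolding s_def[abs_def] using W_integrable W_integral by simp_all

lemma ll_measurable: "ll \<in> measurable \<mu> BB"
proof -
  have "ll \<in> borel_measurable borel" unfolding ll_def[abs_def] using W_measurable by measurable
  then have "ll \<in> measurable borel BB"
    unfolding BB_def using ll_abs by (intro measurable_restrict_space2) (auto simp: abs_le_iff)
  then show ?thesis using measurable_cong_sets[OF sets_mu refl] by blast
qed

lemma law_M: "law BB M"
proof -
  have "emeasure (density \<mu> (\<lambda>y. ennreal (s y))) (space (density \<mu> (\<lambda>y. ennreal (s y)))) = (\<integral>\<^sup>+ y. ennreal (s y) \<partial>\<mu>)"
    using s_measurable by (simp add: emeasure_density cong: nn_integral_cong)
  also have "\<dots> = ennreal 1"
    using nn_integral_eq_integral[OF s_integrable] s_nonneg s_integral by simp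
  finally have "prob_space (density \<mu> (\<lambda>y. ennreal (s y)))" by (intro prob_spaceI) simp
  then have "prob_space M" unfolding M_def
    by (rule prob_space.prob_space_distr) (simp add: ll_measurable)
  then show ?thesis unfolding law_def by (simp add: M_def)
qed

lemma integral_M: "bmeas BB f \<Longrightarrow> (\<integral>x. f x \<partial>M) = (\<integral>y. s y * f (ll y) \<partial>\<mu>)"
proof -
  assume f: "bmeas BB f"
  have "(\<integral>x. f x \<partial>M) = (\<integral>y. f (ll y) \<partial>density \<mu> (\<lambda>y. ennreal (s y)))"
    unfolding M_def by (rule integral_distr) (use ll_measurable bmeas_measurable[OF f] in simp_all)
  also have "\<dots> = (\<integral>y. s y *\<^sub>R f (ll y) \<partial>\<mu>)"
    by (rule integral_density)
      (use measurable_compose[OF ll_measurable bmeas_measurable[OF f]] s_measurable s_nonneg in auto)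
  finally show ?thesis by simp
qed

lemma sym_law_M: "sym_law M"
  unfolding sym_law_def
proof (intro conjI allI impI law_M)
  fix f assume f: "bmeas BB f"
  have f': "bmeas BB (\<lambda>x. f (- x))" by (rule bmeas_compose[OF measurable_BB_uminus f])
  have W2: "W (-1) y = W 1 (- y)" for y using W_sym[of "- y"] by simp
  have sy: "s (- y) = s y" "ll (- y) = - ll y" for y
    using W_sym[of y] W2[of y] by (auto simp: s_def ll_def minus_divide_left add.commute)
  have m: "(\<lambda>y. s y * f (ll y)) \<in> borel_measurable borel"
    using borel_measurable_times[OF s_measurable measurable_compose[OF ll_measurable bmeas_measurable[OF f]]]
      measurable_cong_sets[OF sets_mu refl] by blast
  have "(\<integral>y. s y * f (ll y) \<partial>\<mu>) = (\<integral>y. s y * f (ll y) \<partial>distr \<mu> borel uminus)" by (simp only: distr_mu)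
  also have "\<dots> = (\<integral>y. s (- y) * f (ll (- y)) \<partial>\<mu>)"
  proof (rule integral_distr[OF _ m])
    have "(uminus :: ereal \<Rightarrow> ereal) \<in> measurable borel borel" by measurable
    then show "(uminus :: ereal \<Rightarrow> ereal) \<in> measurable \<mu> borel" using measurable_cong_sets[OF sets_mu refl] by blast
  qed
  finally show "(\<integral>x. f (- x) \<partial>M) = (\<integral>x. f x \<partial>M)" unfolding integral_M[OF f] integral_M[OF f'] sy by simp
qed

lemma capacity_eq: "capacity \<mu> W = cap M"
proof -
  have "(\<integral>y. W x y * log 2 (W x y / ((W 1 y + W (-1) y) / 2)) \<partial>\<mu>) = cap M" if x: "x = bpsk b" for x b
  proof -
    have x': "x = 1 \<or> x = -1" using bpsk_cases x by simp
    have "W x y * log 2 (W x y / ((W 1 y + W (-1) y) / 2)) = s y * ent (1 + x * ll y)" for y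
      unfolding W_eq[OF x'] s_def[symmetric] ent_def by (cases "s y = 0") auto
    then have "(\<integral>y. W x y * log 2 (W x y / ((W 1 y + W (-1) y) / 2)) \<partial>\<mu>) = (\<integral>y. s y * ent (1 + x * ll y) \<partial>\<mu>)" by simp
    also have "\<dots> = (\<integral>z. ent (1 + x * z) \<partial>M)"
      by (rule integral_M[symmetric]) (use x' bmeas_ent_BB in auto)
    also have "\<dots> = cap M" unfolding x by (rule integral_ent_cap[OF sym_law_M])
    finally show ?thesis .
  qed
  from this[of 1 False] this[of "-1" True] show ?thesis unfolding capacity_def by (simp add: bpsk_def)
qed

text \<open>The likelihood of a codeword is the product of the output densities \<open>s\<close>
  times \<open>Du\<close> of the soft bits. The first factor is the weight in the transfer of
  product measures, so the MAP error can be computed over the soft-bit laws.\<close>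

lemma ber_code_eq:
  "ber_code \<mu> W r m i = (1 - (\<integral>l. \<bar>Nb (rm_code r m) (2 ^ m) i l\<bar> \<partial>iid (2 ^ m) M)) / 2"
proof -
  let ?C = "rm_code r m" and ?N = "2 ^ m :: nat"
  let ?p = "\<lambda>u y. (\<Prod>j<?N. W (bpsk (u j)) (y j)) / real (card ?C)"
  interpret lin_code ?C ?N by (rule lin_code_rm)
  let ?F = "\<lambda>l. (Db ?C ?N l - \<bar>Nb ?C ?N i l\<bar>) * (1/2)"
  note LI = law_iid[OF law_M, of ?N]
  have bF: "bmeas (cube ?N) ?F" by (intro bmeas_mult bmeas_diff bmeas_Db bmeas_abs bmeas_Nb bmeas_const)
  have "ber_code \<mu> W r m i = (\<integral>y. (\<Prod>j\<in>{..<?N}. s (y j)) * ?F (\<lambda>j\<in>{..<?N}. ll (y j)) \<partial>PiM {..<?N} (\<lambda>_. \<mu>))"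
    unfolding ber_code_def bit_map_ber_def
  proof (rule Bochner_Integration.integral_cong[OF refl])
    fix y
    define l where "l = (\<lambda>j\<in>{..<?N}. ll (y j))"
    define q where "q = (\<Prod>j\<in>{..<?N}. s (y j))"
    have q: "0 \<le> q" unfolding q_def by (intro prod_nonneg s_nonneg)
    have p: "?p u y = q * Du ?N u l / card ?C" for u
    proof -
      have "(\<Prod>j<?N. W (bpsk (u j)) (y j)) = (\<Prod>j<?N. s (y j) * (1 + bpsk (u j) * l j))"
        by (rule prod.cong[OF refl]) (use W_eq[OF bpsk_cases] in \<open>simp add: l_def\<close>)
      then show ?thesis unfolding q_def Du_def by (simp add: prod.distrib)
    qed
    have 1: "(\<Sum>u\<in>?C. ?p u y) = q * Db ?C ?N l"
      unfolding p Db_def by (simp add: sum_distrib_left sum_divide_distrib)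
    have 2: "(\<Sum>u\<in>?C. bpsk (u i) * ?p u y) = q * Nb ?C ?N i l"
      unfolding p Nb_def by (simp add: sum_distrib_left sum_divide_distrib mult.left_commute)
    have "(\<Sum>u\<in>{u\<in>?C. bpsk (u i) \<noteq> map_decision ?C ?p (\<lambda>u. bpsk (u i)) y}. ?p u y)
        = ((\<Sum>u\<in>?C. ?p u y) - \<bar>\<Sum>u\<in>?C. bpsk (u i) * ?p u y\<bar>) / 2"
      by (rule bit_map_sum[OF finite_C bpsk_cases])
    also have "\<dots> = q * ?F l" unfolding 1 2 using q by (simp add: abs_mult right_diff_distrib)
    finally show "(\<Sum>u\<in>{u\<in>?C. bpsk (u i) \<noteq> map_decision ?C ?p (\<lambda>u. bpsk (u i)) y}. ?p u y) = (\<Prod>j\<in>{..<?N}. s (y j)) * ?F (\<lambda>j\<in>{..<?N}. ll (y j))"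
      unfolding q_def l_def .
  qed
  also have "\<dots> = (\<integral>l. ?F l \<partial>PiM {..<?N} (\<lambda>_. M))"
    by (rule integral_PiM_transfer[OF sigma_finite_mu s_integrable s_nonneg ll_measurable law_M integral_M, symmetric])
      (use bF in \<open>auto simp: cube_def\<close>)
  also have "\<dots> = (\<integral>l. Db ?C ?N l - \<bar>Nb ?C ?N i l\<bar> \<partial>iid ?N M) / 2" unfolding iid_def by simp
  also have "\<dots> = (1 - (\<integral>l. \<bar>Nb ?C ?N i l\<bar> \<partial>iid ?N M)) / 2"
    unfolding law_integral_diff[OF LI bmeas_Db bmeas_abs[OF bmeas_Nb]] iid_Db_one[OF sym_law_M] ..
  finally show ?thesis .
qed

lemma single_use_integral: "(\<integral>y. (s y - \<bar>s y * ll y\<bar>) / 2 \<partial>\<mu>) = (1 - (\<integral>x. \<bar>x\<bar> \<partial>M)) / 2"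
proof -
  have b: "bmeas BB (\<lambda>x. \<bar>x\<bar>)" by (intro bmeas_abs bmeas_BB_id)
  have "(\<integral>y. s y * (1 - \<bar>ll y\<bar>) \<partial>\<mu>) = (\<integral>x. 1 - \<bar>x\<bar> \<partial>M)"
    by (rule integral_M[symmetric]) (intro bmeas_diff bmeas_const b)
  also have "\<dots> = 1 - (\<integral>x. \<bar>x\<bar> \<partial>M)"
    by (subst law_integral_diff[OF law_M bmeas_const b]) (simp add: law_measure[OF law_M])
  finally show ?thesis using s_nonneg by (simp add: abs_mult right_diff_distrib)
qed

text \<open>The all-one word belongs to the code, and adding it flips bit \<open>i\<close>; the bit
  is therefore uniform, as for a single use of the channel.\<close>

lemma ber_code_single_eq:
  assumes i: "i < 2 ^ m"
  shows "ber_code_single \<mu> W r m i = (1 - (\<integral>x. \<bar>x\<bar> \<partial>M)) / 2"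
proof -
  let ?C = "rm_code r m" and ?c = "real (card (rm_code r m))"
  let ?p = "\<lambda>u y. W (bpsk (u i)) y / ?c"
  interpret lin_code ?C "2 ^ m" by (rule lin_code_rm)
  have bal: "(\<Sum>u\<in>?C. bpsk (u i)) = 0"
  proof -
    have "(\<Sum>u\<in>?C. bpsk (bxor u (\<lambda>i. i < 2 ^ m) i)) = (\<Sum>u\<in>?C. bpsk (u i))"
      by (rule sum_bxor[OF rm_code_one, of "\<lambda>u. bpsk (u i)"])
    moreover have "bpsk (bxor u (\<lambda>i. i < 2 ^ m) i) = - bpsk (u i)" for u using i by (simp add: bxor_def bpsk_def)
    ultimately show ?thesis by (simp add: sum_negf)
  qed
  have "(\<Sum>u\<in>{u\<in>?C. bpsk (u i) \<noteq> map_decision ?C ?p (\<lambda>u. bpsk (u i)) y}. ?p u y) = (s y - \<bar>s y * ll y\<bar>) / 2" for y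
  proof -
    have p: "?p u y = s y / ?c + bpsk (u i) * (s y * ll y / ?c)" for u
      unfolding W_eq[OF bpsk_cases] by (simp add: algebra_simps add_divide_distrib)
    have 1: "(\<Sum>u\<in>?C. ?p u y) = s y"
      unfolding p sum.distrib sum_distrib_right[symmetric] bal using card_pos by simp
    have "bpsk (u i) * ?p u y = bpsk (u i) * (s y / ?c) + s y * ll y / ?c" for u
      unfolding p using bpsk_sq[of "u i"] by (simp add: distrib_left mult.assoc[symmetric])
    then have 2: "(\<Sum>u\<in>?C. bpsk (u i) * ?p u y) = s y * ll y"
      by (simp only: sum.distrib sum_distrib_right[symmetric] bal) (use card_pos in simp)
    show ?thesis using bit_map_sum[OF finite_C, where g="\<lambda>u. bpsk (u i)" and p="?p" and y=y, OF bpsk_cases] unfolding 1 2 .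
  qed
  then show ?thesis unfolding ber_code_single_def bit_map_ber_def by (simp only: single_use_integral)
qed

lemma ber_channel_eq: "ber_channel \<mu> W = (1 - (\<integral>x. \<bar>x\<bar> \<partial>M)) / 2"
proof -
  let ?p = "\<lambda>x y. W x y / 2"
  have "(\<Sum>x\<in>{x\<in>{1,-1}. id x \<noteq> map_decision {1,-1} ?p id y}. ?p x y) = (s y - \<bar>s y * ll y\<bar>) / 2" for y
  proof -
    have 1: "(\<Sum>x\<in>{1,-1}. ?p x y) = s y" by (simp add: s_def)
    have 2: "(\<Sum>x\<in>{1,-1}. id x * ?p x y) = s y * ll y"
      using W_eq[of 1 y] W_eq[of "-1" y] by (simp add: field_simps)
    show ?thesis using bit_map_sum[of "{1,-1}" id ?p y] unfolding 1 2 by simp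
  qed
  then show ?thesis unfolding ber_channel_def bit_map_ber_def by (simp only: single_use_integral)
qed

end

section \<open>Rates of the codes and the function \<open>rho\<close>\<close>

lemma rm_rate_le_1: "r \<le> m \<Longrightarrow> rm_rate r m \<le> 1"
proof -
  assume "r \<le> m"
  then have "(\<Sum>i\<le>r. m choose i) \<le> (\<Sum>i\<le>m. m choose i)" by (intro sum_mono2) auto
  then have "(\<Sum>i\<le>r. m choose i) \<le> 2 ^ m" by (simp only: choose_row_sum)
  then have "real (\<Sum>i\<le>r. m choose i) \<le> 2 ^ m" by (metis of_nat_le_iff of_nat_numeral of_nat_power)
  then show ?thesis unfolding rm_rate_def by simp
qed

lemma rm_rate_full: "rm_rate m m = 1"
proof -
  have "real (\<Sum>i\<le>m. m choose i) = 2 ^ m" by (simp only: choose_row_sum of_nat_power of_nat_numeral)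
  then show ?thesis unfolding rm_rate_def by simp
qed

text \<open>The rate step is at most 1 / (2 sqrt m), so both multiples of it are at most 4 / sqrt m;
  the comparison with \<open>rho\<close> uses 4 <= 34 / 5 and that the logarithm is nonnegative from
  1 on.\<close>

lemma rho_bounds:
  assumes m: "1 \<le> m"
  shows "8 * ln 2 * (rm_rate r m - rm_rate r (Suc m)) \<le> rho m" "4 * (rm_rate r m - rm_rate r (Suc m)) \<le> rho m" "0 < rho m"
proof -
  let ?d = "rm_rate r m - rm_rate r (Suc m)"
  have sq: "0 < sqrt m" using m by simp
  have "?d = real (m choose r) / 2 ^ m / 2" unfolding rm_rate_diff by simp
  also have "\<dots> \<le> 1 / sqrt m / 2" using binomial_le_sqrt[OF m] by (intro divide_right_mono) auto
  finally have d: "?d \<le> 1 / (2 * sqrt m)" by simp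
  have d0: "0 \<le> ?d" unfolding rm_rate_diff by simp
  have "0 \<le> ln (real m)" using m by simp
  then have "34 / (5 * sqrt m) \<le> rho m" unfolding rho_def using sq by (intro divide_right_mono) auto
  moreover have "4 / sqrt m \<le> 34 / (5 * sqrt m)" using sq by (simp add: field_simps)
  ultimately have r: "4 / sqrt m \<le> rho m" by simp
  moreover have "0 < 4 / sqrt m" using sq by simp
  ultimately show "0 < rho m" by linarith
  have "8 * ln 2 * ?d \<le> 8 * 1 * ?d" using ln_2_less_1 d0 by (intro mult_right_mono) auto
  also have "\<dots> \<le> 8 * (1 / (2 * sqrt m))" using d by simp
  also have "\<dots> = 4 / sqrt m" by simp
  finally show 1: "8 * ln 2 * ?d \<le> rho m" using r by simp
  have "4 * ?d \<le> 8 * ?d" using d0 by simp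
  also have "\<dots> \<le> 8 * (1 / (2 * sqrt m))" using d by simp
  also have "\<dots> = 4 / sqrt m" by simp
  finally show "4 * ?d \<le> rho m" using r by simp
qed

lemma inv_sqrt_tendsto: "(\<lambda>m. 1 / sqrt (real m)) \<longlonglongrightarrow> 0"
  by (intro tendsto_divide_0[OF tendsto_const] filterlim_at_top_imp_at_infinity
      filterlim_compose[OF sqrt_at_top filterlim_real_sequentially])

lemma rho_tendsto: "rho \<longlonglongrightarrow> 0"
proof -
  have "(\<lambda>m. ln (real m) / real m powr (1/2)) \<longlonglongrightarrow> 0" by (rule lim_ln_over_power) simp
  then have "(\<lambda>m. ln (real m) / sqrt (real m)) \<longlonglongrightarrow> 0" by (simp add: powr_half_sqrt)
  then have "(\<lambda>m. 6 / 5 * (ln (real m) / sqrt (real m)) + 34 / 5 * (1 / sqrt (real m))) \<longlonglongrightarrow> 6 / 5 * 0 + 34 / 5 * 0"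
    by (intro tendsto_add tendsto_mult tendsto_const inv_sqrt_tendsto)
  moreover have "6 / 5 * (ln (real m) / sqrt (real m)) + 34 / 5 * (1 / sqrt (real m)) = rho m" for m
    unfolding rho_def by (simp add: add_divide_distrib)
  ultimately show ?thesis by simp
qed

text \<open>Consecutive orders differ in rate by one binomial term, at most 1 / sqrt k, so the least
  order whose rate reaches \<open>R\<close> overshoots by no more. At order 0 the rate itself is
  such a term.\<close>

lemma rate_approximation:
  assumes R: "0 \<le> R" "R \<le> 1"
  obtains rs :: "nat \<Rightarrow> nat" where "\<And>k. rs k \<le> k" "\<And>k. 1 \<le> k \<Longrightarrow> \<bar>rm_rate (rs k) k - R\<bar> \<le> 1 / sqrt k"
proof
  define rs where "rs k = (LEAST r. R \<le> rm_rate r k)" for k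
  have k: "R \<le> rm_rate k k" for k using R rm_rate_full[of k] by simp
  show "rs k \<le> k" for k unfolding rs_def by (rule Least_le[OF k])
  show "\<bar>rm_rate (rs k) k - R\<bar> \<le> 1 / sqrt k" if k1: "1 \<le> k" for k
  proof -
    have lo: "R \<le> rm_rate (rs k) k" unfolding rs_def by (rule LeastI[where P="\<lambda>r. R \<le> rm_rate r k", OF k])
    have "rm_rate (rs k) k \<le> R + 1 / sqrt k"
    proof (cases "rs k")
      case 0
      then show ?thesis using binomial_le_sqrt[OF k1, of 0] R by (simp add: rm_rate_def)
    next
      case (Suc r)
      have "\<not> R \<le> rm_rate r k" using not_less_Least[where P="\<lambda>r. R \<le> rm_rate r k", of r] Suc unfolding rs_def by simp
      moreover have "rm_rate (Suc r) k = rm_rate r k + real (k choose Suc r) / 2 ^ k"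
        unfolding rm_rate_def by (simp add: add_divide_distrib)
      ultimately show ?thesis using binomial_le_sqrt[OF k1, of "Suc r"] Suc by simp
    qed
    then show ?thesis using lo by simp
  qed
qed

section \<open>Bit-error bounds on either side of capacity\<close>

context bms
begin

lemma ber_below:
  assumes c: "0 < cap M" and m: "1 \<le> m" and R: "rm_rate r m < cap M" and i: "i < 2 ^ m"
  shows "ber_code \<mu> W r m i \<le> (rho m / 2) / (cap M - rm_rate r m)"
proof -
  let ?p = "mom (rm_code r m) (2 ^ m) M 0"
  have "ber_code \<mu> W r m i \<le> (1 - ?p) / 2"
    using mom_le_abs_Nb[OF sym_law_M, of "2 ^ m" "rm_code r m"]
    unfolding ber_code_eq abs_Nb_translate[OF sym_law_M i] by simp
  also have "(1 - ?p) / 2 \<le> (rho m / (cap M - rm_rate r m)) / 2"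
  proof (rule divide_right_mono)
    show "1 - ?p \<le> rho m / (cap M - rm_rate r m)"
      using below_capacity[OF sym_law_M c R m] rho_bounds(1)[OF m, of r] R by (simp add: pos_le_divide_eq)
  qed simp
  finally show ?thesis by (simp add: mult.commute)
qed

lemma ber_le_channel:
  assumes i: "i < 2 ^ m" shows "ber_code \<mu> W r m i \<le> ber_channel \<mu> W"
  using abs_Nb_sandwich(1)[OF sym_law_M lin_code_rm, of "2 ^ m" r m]
  unfolding ber_code_eq ber_channel_eq abs_Nb_translate[OF sym_law_M i] by simp

lemma ber_above:
  assumes c: "0 < cap M" "cap M < 1" and m: "1 \<le> m" and r: "r \<le> m" and R: "cap M < rm_rate r m" and i: "i < 2 ^ m"
  shows "ber_code \<mu> W r m i \<ge> ber_channel \<mu> W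
    - (1 - cap M) * sqrt (ln 2 * rho m / (2 * psi (1 - cap M) * Psi (rm_rate r m - cap M)))"
proof -
  let ?p = "mom (rm_code r m) (2 ^ m) M 0" and ?d = "rm_rate r m - rm_rate r (Suc m)"
  let ?a = "psi (1 - cap M)" and ?b = "psi (rm_rate r m - cap M)" and ?B = "Psi (rm_rate r m - cap M)"
  have R1: "rm_rate r m \<le> 1" by (rule rm_rate_le_1[OF r])
  have a: "0 < ?a" using c by (intro psi_pos) auto
  have B: "0 < ?B" "?B \<le> ?b" using Psi_pos[of "rm_rate r m - cap M"] Psi_le_psi[of "rm_rate r m - cap M"] R R1 c by auto
  have p0: "0 \<le> ?p" by (rule mom_bounds(1)[OF sym_law_M lin_code_rm]) simp
  have "?p * (?a * ?B) \<le> ?p * (?a * ?b)" using p0 a B by (intro mult_left_mono) auto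
  also have "\<dots> \<le> 8 * ln 2 * ?d" using above_capacity[OF sym_law_M c(1) R R1 m] by (simp add: mult.assoc)
  \<comment> \<open>A factor 4 is set aside for the comparison with \<open>rho m\<close>. The
    remaining 2 ln 2, divided by 4 because the error rate contains half of a square root, gives the
    constant ln 2 / 2 of the claim.\<close>
  also have "\<dots> = 2 * ln 2 * (4 * ?d)" by simp
  also have "\<dots> \<le> 2 * ln 2 * rho m" using rho_bounds(2)[OF m, of r] by (intro mult_left_mono) auto
  finally have "?p \<le> 2 * ln 2 * rho m / (?a * ?B)" using a B by (simp add: pos_le_divide_eq)
  then have "?p / 4 \<le> ln 2 * rho m / (2 * ?a * ?B)" by (simp add: mult_ac)
  then have "sqrt (?p / 4) \<le> sqrt (ln 2 * rho m / (2 * ?a * ?B))" by (rule real_sqrt_le_mono)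
  moreover have "sqrt (?p / 4) = sqrt ?p / 2" by (simp add: real_sqrt_divide)
  ultimately have "(1 - cap M) * (sqrt ?p / 2) \<le> (1 - cap M) * sqrt (ln 2 * rho m / (2 * ?a * ?B))"
    using c by (intro mult_left_mono) auto
  moreover have "ber_channel \<mu> W - (1 - cap M) * (sqrt ?p / 2) \<le> ber_code \<mu> W r m i"
    using abs_Nb_sandwich(2)[OF sym_law_M lin_code_rm, of "2 ^ m" r m]
    unfolding ber_code_eq ber_channel_eq abs_Nb_translate[OF sym_law_M i] by (simp add: field_simps)
  ultimately show ?thesis by linarith
qed

end

theorem theorem36:
  fixes \<mu> :: "ereal measure" and W :: "real \<Rightarrow> ereal \<Rightarrow> real"
  assumes "bms_channel \<mu> W"
    and "0 < capacity \<mu> W" and "capacity \<mu> W < 1"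
  shows "(\<forall>m r i. 1 \<le> m \<longrightarrow> r \<le> m \<longrightarrow> rm_rate r m < capacity \<mu> W \<longrightarrow> i < 2 ^ m \<longrightarrow>
            ber_code \<mu> W r m i \<le> (rho m / 2) / (capacity \<mu> W - rm_rate r m))
       \<and> (\<forall>R. 0 \<le> R \<and> R < capacity \<mu> W \<longrightarrow>
            (\<exists>rs ms. strict_mono ms \<and> (\<forall>k. rs k \<le> ms k) \<and>
               (\<lambda>k. rm_rate (rs k) (ms k)) \<longlonglongrightarrow> R \<and>
               (\<forall>e>0. eventually (\<lambda>k. \<forall>i<2 ^ ms k. ber_code \<mu> W (rs k) (ms k) i \<le> e) sequentially)))
       \<and> (\<forall>m r i. 1 \<le> m \<longrightarrow> r \<le> m \<longrightarrow> capacity \<mu> W < rm_rate r m \<longrightarrow> i < 2 ^ m \<longrightarrow>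
            ber_code \<mu> W r m i \<ge> ber_code_single \<mu> W r m i
              - (1 - capacity \<mu> W) * sqrt (ln 2 * rho m /
                   (2 * psi (1 - capacity \<mu> W) * Psi (rm_rate r m - capacity \<mu> W))))
       \<and> (\<forall>R rs ms. capacity \<mu> W < R \<and> R \<le> 1 \<and> strict_mono ms \<and> (\<forall>k. rs k \<le> ms k) \<and>
               (\<lambda>k. rm_rate (rs k) (ms k)) \<longlonglongrightarrow> R \<longrightarrow>
            (\<forall>e>0. eventually (\<lambda>k. \<forall>i<2 ^ ms k.
               \<bar>ber_code \<mu> W (rs k) (ms k) i - ber_channel \<mu> W\<bar> \<le> e) sequentially))"
proof -
  interpret bms \<mu> W by unfold_locales (rule assms(1))
  define c where "c = capacity \<mu> W"
  have cM: "c = cap M" unfolding c_def by (rule capacity_eq)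
  have c: "0 < c" "c < 1" unfolding c_def using assms by auto
  have below: "ber_code \<mu> W r m i \<le> (rho m / 2) / (c - rm_rate r m)"
    if "1 \<le> m" "rm_rate r m < c" "i < 2 ^ m" for m r i
    using ber_below[of m r i] that c unfolding cM by blast
  have above: "ber_channel \<mu> W - (1 - c) * sqrt (ln 2 * rho m / (2 * psi (1 - c) * Psi (rm_rate r m - c))) \<le> ber_code \<mu> W r m i"
    if "1 \<le> m" "r \<le> m" "c < rm_rate r m" "i < 2 ^ m" for m r i
    using ber_above[of m r i] that c unfolding cM by blast
  have second: "\<exists>rs ms. strict_mono ms \<and> (\<forall>k. rs k \<le> ms k) \<and> (\<lambda>k. rm_rate (rs k) (ms k)) \<longlonglongrightarrow> R \<and>
      (\<forall>e>0. eventually (\<lambda>k. \<forall>i<2 ^ ms k. ber_code \<mu> W (rs k) (ms k) i \<le> e) sequentially)"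
    if R: "0 \<le> R" "R < c" for R
  proof -
    \<comment> \<open>One code is chosen for every number of variables, so the lengths increase
      automatically.\<close>
    obtain rs :: "nat \<Rightarrow> nat" where rs: "\<And>k. rs k \<le> k" "\<And>k. 1 \<le> k \<Longrightarrow> \<bar>rm_rate (rs k) k - R\<bar> \<le> 1 / sqrt k"
      using rate_approximation[of R] R c by auto
    have "(\<lambda>k. rm_rate (rs k) k - R) \<longlonglongrightarrow> 0"
      by (rule Lim_null_comparison[OF _ inv_sqrt_tendsto]) (use rs(2) in \<open>auto simp: eventually_sequentially\<close>)
    then have lim: "(\<lambda>k. rm_rate (rs k) k) \<longlonglongrightarrow> R" by (simp add: LIM_zero_iff)
    have "eventually (\<lambda>k. \<forall>i<2 ^ k. ber_code \<mu> W (rs k) k i \<le> e) sequentially" if e: "0 < e" for e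
    proof -
      have "eventually (\<lambda>k. rm_rate (rs k) k < (R + c) / 2) sequentially"
        using order_tendstoD(2)[OF lim, of "(R + c) / 2"] R by simp
      moreover have "eventually (\<lambda>k. rho k < e * (c - R)) sequentially"
        using order_tendstoD(2)[OF rho_tendsto, of "e * (c - R)"] e R by simp
      moreover have "eventually (\<lambda>k::nat. 1 \<le> k) sequentially" by (rule eventually_ge_at_top)
      ultimately show ?thesis
      proof eventually_elim
        case (elim k)
        show ?case
        proof (intro allI impI)
          fix i :: nat assume i: "i < 2 ^ k"
          have d: "(c - R) / 2 \<le> c - rm_rate (rs k) k" "0 < (c - R) / 2" using elim R by auto
          have "ber_code \<mu> W (rs k) k i \<le> (rho k / 2) / (c - rm_rate (rs k) k)" using below[of k "rs k" i] elim R i by simp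
          also have "\<dots> \<le> (rho k / 2) / ((c - R) / 2)"
            using d rho_bounds(3)[of k] elim by (intro divide_left_mono mult_pos_pos) auto
          also have "\<dots> = rho k / (c - R)" using R by simp
          also have "\<dots> \<le> e" using elim R by (simp add: pos_divide_le_eq)
          finally show "ber_code \<mu> W (rs k) k i \<le> e" .
        qed
      qed
    qed
    then show ?thesis using rs(1) lim by (intro exI[of _ rs] exI[of _ "\<lambda>k. k"]) (auto simp: strict_mono_def)
  qed
  have fourth: "eventually (\<lambda>k. \<forall>i<2 ^ ms k. \<bar>ber_code \<mu> W (rs k) (ms k) i - ber_channel \<mu> W\<bar> \<le> e) sequentially"
    if R: "c < R" "R \<le> 1" and ms: "strict_mono ms" and rs: "\<And>k. rs k \<le> ms k"
      and lim: "(\<lambda>k. rm_rate (rs k) (ms k)) \<longlonglongrightarrow> R" and e: "0 < e" for R e :: real and rs ms :: "nat \<Rightarrow> nat"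
  proof -
    \<comment> \<open>Half of the gap serves as a margin: eventually the rates exceed
      \<open>c + u\<close>, and monotonicity of \<open>Psi\<close> then bounds the denominator below
      by the fixed constant \<open>K\<close>.\<close>
    define u where "u = (R - c) / 2"
    have u: "0 < u" "u \<le> 1" unfolding u_def using R c by auto
    define K where "K = 2 * psi (1 - c) * Psi u"
    have K: "0 < K" unfolding K_def using psi_pos[of "1 - c"] Psi_pos[of u] u c by simp
    have "(\<lambda>k. sqrt (ln 2 * rho (ms k) / K)) \<longlonglongrightarrow> sqrt (ln 2 * 0 / K)"
      by (intro tendsto_real_sqrt tendsto_divide tendsto_mult tendsto_const
          filterlim_compose[OF rho_tendsto filterlim_subseq[OF ms]]) (use K in auto)
    then have "eventually (\<lambda>k. sqrt (ln 2 * rho (ms k) / K) < e) sequentially"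
      using order_tendstoD(2)[of _ 0 sequentially e] e by simp
    moreover have "eventually (\<lambda>k. c + u < rm_rate (rs k) (ms k)) sequentially"
      by (rule order_tendstoD(1)[OF lim]) (use R in \<open>simp add: u_def field_simps\<close>)
    moreover have "eventually (\<lambda>k. 1 \<le> ms k) sequentially"
      using filterlim_subseq[OF ms] by (simp add: filterlim_at_top)
    ultimately show ?thesis
    proof eventually_elim
      case (elim k)
      let ?R = "rm_rate (rs k) (ms k)"
      have cR: "c < ?R" using elim u by linarith
      have P: "Psi u \<le> Psi (?R - c)" using Psi_mono[of u "?R - c"] elim u c rm_rate_le_1[OF rs[of k]] by simp
      have K': "K \<le> 2 * psi (1 - c) * Psi (?R - c)"
        unfolding K_def using P psi_pos[of "1 - c"] c by (intro mult_left_mono) auto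
      have "ln 2 * rho (ms k) / (2 * psi (1 - c) * Psi (?R - c)) \<le> ln 2 * rho (ms k) / K"
        using rho_bounds(3)[OF elim(3)]
        by (intro divide_left_mono[OF K' _ mult_pos_pos[OF less_le_trans[OF K K'] K]]) simp
      then have "sqrt (ln 2 * rho (ms k) / (2 * psi (1 - c) * Psi (?R - c))) \<le> e"
        using elim(1) by (meson less_imp_le order_trans real_sqrt_le_mono)
      moreover have "0 \<le> sqrt (ln 2 * rho (ms k) / (2 * psi (1 - c) * Psi (?R - c)))"
        using K K' rho_bounds(3)[OF elim(3)] by simp
      ultimately have "(1 - c) * sqrt (ln 2 * rho (ms k) / (2 * psi (1 - c) * Psi (?R - c))) \<le> 1 * e"
        using c by (intro mult_mono) auto
      \<comment> \<open>The bound above capacity gives one side; the other holds because further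
        observations never increase the error rate.\<close>
      then show ?case
        using above[OF elim(3) rs cR] ber_le_channel[of _ "ms k" "rs k"] by (fastforce simp: abs_le_iff)
    qed
  qed
  have single: "ber_code_single \<mu> W r m i = ber_channel \<mu> W" if "i < 2 ^ m" for r m i
    unfolding ber_code_single_eq[OF that] ber_channel_eq ..
  show ?thesis
    unfolding c_def[symmetric]
  proof (intro conjI allI impI)
    fix m r i :: nat assume a: "1 \<le> m" "r \<le> m" "i < 2 ^ m"
    show "ber_code \<mu> W r m i \<le> (rho m / 2) / (c - rm_rate r m)" if "rm_rate r m < c"
      using below a that by blast
    show "ber_code_single \<mu> W r m i - (1 - c) * sqrt (ln 2 * rho m / (2 * psi (1 - c) * Psi (rm_rate r m - c))) \<le> ber_code \<mu> W r m i"
      if "c < rm_rate r m"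
      unfolding single[OF a(3)] using above a that by blast
  next
    fix R :: real assume "0 \<le> R \<and> R < c"
    then show "\<exists>rs ms. strict_mono ms \<and> (\<forall>k. rs k \<le> ms k) \<and> (\<lambda>k. rm_rate (rs k) (ms k)) \<longlonglongrightarrow> R \<and>
        (\<forall>e>0. eventually (\<lambda>k. \<forall>i<2 ^ ms k. ber_code \<mu> W (rs k) (ms k) i \<le> e) sequentially)"
      by (intro second) auto
  next
    fix R e :: real and rs ms :: "nat \<Rightarrow> nat"
    assume "c < R \<and> R \<le> 1 \<and> strict_mono ms \<and> (\<forall>k. rs k \<le> ms k) \<and> (\<lambda>k. rm_rate (rs k) (ms k)) \<longlonglongrightarrow> R" "0 < e"
    then show "eventually (\<lambda>k. \<forall>i<2 ^ ms k. \<bar>ber_code \<mu> W (rs k) (ms k) i - ber_channel \<mu> W\<bar> \<le> e) sequentially"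
      by (intro fourth) auto
  qed
qed

end
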